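(* Let $f:X\to\mathcal{E}^{1,2}$ be a quasi-umbilical timelike immersion. Then the conformal Gauss map $\mathcal{N}_f:X\to S^{2,2}$ of $f$ is harmonic. Moreover, if $f$ is regular, then $f$ is isothermic and its infinitesimal deformations depend on one arbitrary function in one variable.
   Context: Ambient spaces. $\mathbb{R}^{2,3}$ is $\mathbb{R}^5$ with the scalar product $\langle X,Y\rangle=-(X^0Y^4+X^4Y^0)-X^1Y^1+X^2Y^2+X^3Y^3$. $G=\mathrm{O}^{\uparrow}_+(2,3)$ is the identity component of its isometry group and $\mathfrak{o}(2,3)$ its Lie algebra. For $X\ne0$, $[X]$ is the ray (oriented line) spanned by $X$. The Einstein universe $\mathcal{E}^{1,2}$ is the manifold of null rays of $\mathbb{R}^{2,3}$. Let $(E_0,\dots,E_4)$ be the standard basis, $P_0=(E_0+E_4)/\sqrt2$, $P_i=E_i$ ($i=1,2,3$), $P_4=(E_4-E_0)/\sqrt2$. Each null ray meets $S^1_-\times S^2_+$ (product of the unit circle of $\mathrm{span}(P_0,P_1)$ and the unit sphere of $\mathrm{span}(P_2,P_3,P_4)$) in one point; the Lorentzian metric $g_{\mathcal{E}}$ on $\mathcal{E}^{1,2}$ is the one induced on $S^1_-\times S^2_+$ by $\langle\cdot,\cdot\rangle$. $S^{2,2}=\{V\in\mathbb{R}^{2,3}:\langle V,V\rangle=1\}$ with the induced metric of signature $(2,2)$. $G$ acts on $\mathcal{E}^{1,2}$ by $F\cdot[X]=[FX]$. Frames. $X$ is a connected oriented smooth surface. An immersion $f:X\to\mathcal{E}^{1,2}$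 is timelike if $f^*g_{\mathcal{E}}$ is Lorentzian. A conformal frame field along $f$ is a smooth map $F:U\to G$, $U\subset X$ open, with columns $F_0,\dots,F_4$, such that $f=[F_0]$; write $F^{-1}dF=(\phi^i_j)$, i.e. $dF_k=\sum_j\phi^j_kF_j$. It is of first order if $\phi^3_0=0$ and $\phi^1_0\wedge\phi^2_0>0$, and of second order if moreover $\phi^3_1\wedge\phi^2_0+\phi^3_2\wedge\phi^1_0=0$. Second order frame fields exist locally, and $F_3$ is the same for all of them; the conformal Gauss map $\mathcal{N}_f:X\to S^{2,2}$ is defined by $\mathcal{N}_f=F_3$ for any second order $F$. One has $\langle d\mathcal{N}_f,d\mathcal{N}_f\rangle=\varrho_f\,f^*g_{\mathcal{E}}$ for a smooth function $\varrho_f$. Harmonicity of $\mathcal{N}_f$ refers to the conformal class on $X$ of the Lorentzian metric induced by $f$ and to the neutral metric of $S^{2,2}$ (since $X$ is 2-dimensional, only the conformal class on $X$ matters). Quasi-umbilical. $f$ is quasi-umbilical if at every $x\in X$ one has $\varrho_f(x)=0$ and $f(x)\wedge d\mathcal{N}_f|_x\neq0$ ($f$ denoting also a lift to $\mathbb{R}^{2,3}$). For such $f$, $\mathcal{N}_f$ has rank 1. $f$ is regular if the leaf space $\Lambda$ of the distribution $\ker d\mathcal{N}_f$ is Hausdorff with respect to the quotient topology; then $\Lambda$ is a connected 1-dimensional manifold and the projection $\pi:X\to\Lambda$ is a smooth submersion with connected fibers. Isothermic. For $x\in X$ let $\mathfrak{h}_x\subset\mathfrak{o}(2,3)$ be the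 Lie algebra of the stabilizer of $f(x)$ in $G$ and $\mathfrak{h}_x^\perp$ its polar space with respect to the Killing form. An infinitesimal deformation of $f$ is a nonzero $\mathfrak{o}(2,3)$-valued smooth 1-form $\delta$ on $X$ which is closed ($d\delta=0$) and satisfies $\delta_x(v)\in\mathfrak{h}_x^\perp$ for all $x\in X$, $v\in T_xX$. A timelike immersion $f$ is isothermic if it admits an infinitesimal deformation. *)

theory Defs
  imports "HOL-Analysis.Analysis"
begin

section \<open>Smooth manifolds given by atlases\<close>

text \<open>\<open>smooth_on\<close> means $C^\infty$; it is only used on open sets.\<close>

fun Ck_on :: "nat \<Rightarrow> 'a::real_normed_vector set \<Rightarrow> ('a \<Rightarrow> 'b::real_normed_vector) \<Rightarrow> bool" where
  "Ck_on 0 S h \<longleftrightarrow> continuous_on S h"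
| "Ck_on (Suc k) S h \<longleftrightarrow> (\<forall>p\<in>S. h differentiable (at p)) \<and>
     (\<forall>v. Ck_on k S (\<lambda>p. frechet_derivative h (at p) v))"

definition smooth_on :: "'a::real_normed_vector set \<Rightarrow> ('a \<Rightarrow> 'b::real_normed_vector) \<Rightarrow> bool" where
  "smooth_on S h \<longleftrightarrow> (\<forall>k. Ck_on k S h)"

text \<open>A chart is a pair of its domain and the coordinate map; the values of the coordinate map
  outside the domain are irrelevant.\<close>

type_synonym ('a, 'e) chart = "'a set \<times> ('a \<Rightarrow> 'e)"

definition chart_image :: "('a, 'e) chart \<Rightarrow> 'e set" where
  "chart_image c = snd c ` fst c"

definition chart_inv :: "('a, 'e) chart \<Rightarrow> 'e \<Rightarrow> 'a" where
  "chart_inv c = inv_into (fst c) (snd c)"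

definition is_chart :: "'a topology \<Rightarrow> ('a, 'e::euclidean_space) chart \<Rightarrow> bool" where
  "is_chart T c \<longleftrightarrow> openin T (fst c) \<and> open (chart_image c) \<and>
     homeomorphic_map (subtopology T (fst c)) (top_of_set (chart_image c)) (snd c)"

definition transition :: "('a, 'e) chart \<Rightarrow> ('a, 'e) chart \<Rightarrow> 'e \<Rightarrow> 'e" where
  "transition c c' = snd c' \<circ> chart_inv c"

definition smooth_atlas :: "'a topology \<Rightarrow> ('a, 'e::euclidean_space) chart set \<Rightarrow> bool" where
  "smooth_atlas T A \<longleftrightarrow> (\<forall>c\<in>A. is_chart T c) \<and> (\<Union>c\<in>A. fst c) = topspace T \<and>
     (\<forall>c\<in>A. \<forall>c'\<in>A. smooth_on (snd c ` (fst c \<inter> fst c')) (transition c c'))"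

definition smooth_manifold :: "'a topology \<Rightarrow> ('a, 'e::euclidean_space) chart set \<Rightarrow> bool" where
  "smooth_manifold T A \<longleftrightarrow> Hausdorff_space T \<and> second_countable T \<and> smooth_atlas T A"

definition smooth_map ::
  "('a, 'e::euclidean_space) chart set \<Rightarrow> 'a set \<Rightarrow> ('a \<Rightarrow> 'b::real_normed_vector) \<Rightarrow> bool" where
  "smooth_map A U h \<longleftrightarrow> (\<forall>c\<in>A. smooth_on (snd c ` (fst c \<inter> U)) (h \<circ> chart_inv c))"

text \<open>The differential at \<open>x\<close>, tangent vectors at \<open>x\<close> being represented by their coordinates in
  the chart \<open>c\<close> around \<open>x\<close>.\<close>

definition differential ::
  "('a, 'e::euclidean_space) chart \<Rightarrow> ('a \<Rightarrow> 'b::real_normed_vector) \<Rightarrow> 'a \<Rightarrow> 'e \<Rightarrow> 'b" where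
  "differential c h x = frechet_derivative (h \<circ> chart_inv c) (at (snd c x))"

text \<open>Surfaces have the underlying point set \<open>UNIV\<close>. The orientation is the one for which all
  charts of the atlas are positively oriented.\<close>

definition connected_oriented_surface :: "('x::topological_space, real^2) chart set \<Rightarrow> bool" where
  "connected_oriented_surface A \<longleftrightarrow> smooth_manifold euclidean A \<and> connected (UNIV :: 'x set) \<and>
     (\<forall>c\<in>A. \<forall>c'\<in>A. \<forall>p \<in> snd c ` (fst c \<inter> fst c').
        det (matrix (frechet_derivative (transition c c') (at p))) > 0)"


section \<open>The pseudo-Euclidean space and its isometry group\<close>

text \<open>The coordinates of \<open>real^5\<close> are indexed by \<open>0, 1, 2, 3, 4\<close>.\<close>

definition scal :: "real^5 \<Rightarrow> real^5 \<Rightarrow> real" where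
  "scal X Y = - (X$0 * Y$4 + X$4 * Y$0) - X$1 * Y$1 + X$2 * Y$2 + X$3 * Y$3"

definition isometries :: "(real^5^5) set" where
  "isometries = {F. \<forall>X Y. scal (F *v X) (F *v Y) = scal X Y}"

definition G_group :: "(real^5^5) set" where
  "G_group = connected_component_set isometries (mat 1)"

text \<open>The Lie algebra of a closed matrix group \<open>H\<close>, as the tangent space to \<open>H\<close> at the identity.\<close>

definition lie_algebra :: "(real^'n^'n) set \<Rightarrow> (real^'n^'n) set" where
  "lie_algebra H = {M. \<exists>\<gamma> \<epsilon>. \<epsilon> > 0 \<and> smooth_on {-\<epsilon><..<\<epsilon>} \<gamma> \<and> (\<forall>t. \<bar>t\<bar> < \<epsilon> \<longrightarrow> \<gamma> t \<in> H) \<and>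
     \<gamma> 0 = mat 1 \<and> (\<gamma> has_vector_derivative M) (at 0)}"

definition o23 :: "(real^5^5) set" where
  "o23 = lie_algebra G_group"

definition lie_bracket :: "real^'n^'n \<Rightarrow> real^'n^'n \<Rightarrow> real^'n^'n" where
  "lie_bracket M N = M ** N - N ** M"

text \<open>Trace of an endomorphism of a finite-dimensional subspace \<open>S\<close>; it does not depend on the
  basis chosen.\<close>

definition trace_on :: "'v::euclidean_space set \<Rightarrow> ('v \<Rightarrow> 'v) \<Rightarrow> real" where
  "trace_on S T = (let B = (SOME B. B \<subseteq> S \<and> independent B \<and> S \<subseteq> span B)
     in \<Sum>b\<in>B. representation B (T b) b)"

definition killing :: "(real^'n^'n) set \<Rightarrow> real^'n^'n \<Rightarrow> real^'n^'n \<Rightarrow> real" where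
  "killing \<gg> M N = trace_on \<gg> (\<lambda>Z. lie_bracket M (lie_bracket N Z))"

definition polar :: "(real^'n^'n) set \<Rightarrow> (real^'n^'n) set \<Rightarrow> (real^'n^'n) set" where
  "polar \<gg> \<hh> = {M \<in> \<gg>. \<forall>N\<in>\<hh>. killing \<gg> M N = 0}"


section \<open>The Einstein universe and the neutral pseudosphere\<close>

definition ray :: "real^5 \<Rightarrow> (real^5) set" where
  "ray X = {t *\<^sub>R X | t. t > 0}"

definition einstein_universe :: "(real^5) set set" where
  "einstein_universe = {ray X | X. X \<noteq> 0 \<and> scal X X = 0}"

abbreviation E_vec :: "5 \<Rightarrow> real^5" where
  "E_vec i \<equiv> axis i 1"

definition P0 :: "real^5" where "P0 = (1 / sqrt 2) *\<^sub>R (E_vec 0 + E_vec 4)"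
definition P1 :: "real^5" where "P1 = E_vec 1"
definition P2 :: "real^5" where "P2 = E_vec 2"
definition P3 :: "real^5" where "P3 = E_vec 3"
definition P4 :: "real^5" where "P4 = (1 / sqrt 2) *\<^sub>R (E_vec 4 - E_vec 0)"

definition S1_times_S2 :: "(real^5) set" where
  "S1_times_S2 = {V + W | V W. V \<in> span {P0, P1} \<and> scal V V = -1 \<and>
     W \<in> span {P2, P3, P4} \<and> scal W W = 1}"

text \<open>The identification of null rays with points of the submanifold \<open>S1_times_S2\<close>. It
  carries the manifold structure and the Lorentzian metric of the Einstein universe, and it
  provides a lift of each map into the Einstein universe.\<close>

definition normal_rep :: "(real^5) set \<Rightarrow> real^5" where
  "normal_rep R = (THE V. V \<in> R \<and> V \<in> S1_times_S2)"

definition S22 :: "(real^5) set" where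
  "S22 = {V. scal V V = 1}"

definition group_action :: "real^5^5 \<Rightarrow> (real^5) set \<Rightarrow> (real^5) set" where
  "group_action F R = (\<lambda>X. F *v X) ` R"

definition stabilizer :: "(real^5) set \<Rightarrow> (real^5^5) set" where
  "stabilizer R = {F \<in> G_group. group_action F R = R}"


section \<open>Timelike immersions\<close>

definition lift :: "('x \<Rightarrow> (real^5) set) \<Rightarrow> 'x \<Rightarrow> real^5" where
  "lift f x = normal_rep (f x)"

text \<open>The pullback of the metric of the Einstein universe, in a chart.\<close>

definition induced_metric ::
  "('x \<Rightarrow> (real^5) set) \<Rightarrow> ('x, real^2) chart \<Rightarrow> 'x \<Rightarrow> real^2 \<Rightarrow> real^2 \<Rightarrow> real" where
  "induced_metric f c x v w = scal (differential c (lift f) x v) (differential c (lift f) x w)"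

text \<open>Signature \<open>(1,1)\<close> of a symmetric bilinear form on the plane.\<close>

definition lorentzian :: "(real^2 \<Rightarrow> real^2 \<Rightarrow> real) \<Rightarrow> bool" where
  "lorentzian b \<longleftrightarrow> (\<exists>e1 e2. b e1 e1 = -1 \<and> b e2 e2 = 1 \<and> b e1 e2 = 0)"

definition timelike_immersion ::
  "('x, real^2) chart set \<Rightarrow> ('x \<Rightarrow> (real^5) set) \<Rightarrow> bool" where
  "timelike_immersion A f \<longleftrightarrow> (\<forall>x. f x \<in> einstein_universe) \<and> smooth_map A UNIV (lift f) \<and>
     (\<forall>c\<in>A. \<forall>x\<in>fst c. inj (differential c (lift f) x) \<and> lorentzian (induced_metric f c x))"


section \<open>Conformal frame fields and the conformal Gauss map\<close>

text \<open>\<open>mc_form c F x i j\<close> is the entry in row \<open>i\<close> and column \<open>j\<close> of \<open>F\<^sup>-\<^sup>1 dF\<close>.\<close>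

definition mc_form ::
  "('x, real^2) chart \<Rightarrow> ('x \<Rightarrow> real^5^5) \<Rightarrow> 'x \<Rightarrow> 5 \<Rightarrow> 5 \<Rightarrow> real^2 \<Rightarrow> real" where
  "mc_form c F x i j v = (matrix_inv (F x) ** differential c F x v) $ i $ j"

text \<open>The value of the exterior product of two covectors on the coordinate basis; its sign is
  the sign with respect to the orientation.\<close>

definition wedge :: "(real^2 \<Rightarrow> real) \<Rightarrow> (real^2 \<Rightarrow> real) \<Rightarrow> real" where
  "wedge \<alpha> \<beta> = \<alpha> (axis 1 1) * \<beta> (axis 2 1) - \<alpha> (axis 2 1) * \<beta> (axis 1 1)"

definition conformal_frame ::
  "('x::topological_space, real^2) chart set \<Rightarrow> ('x \<Rightarrow> (real^5) set) \<Rightarrow> 'x set \<Rightarrow>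
   ('x \<Rightarrow> real^5^5) \<Rightarrow> bool" where
  "conformal_frame A f U F \<longleftrightarrow> open U \<and> smooth_map A U F \<and>
     (\<forall>x\<in>U. F x \<in> G_group \<and> f x = ray (column 0 (F x)))"

definition first_order_frame ::
  "('x::topological_space, real^2) chart set \<Rightarrow> ('x \<Rightarrow> (real^5) set) \<Rightarrow> 'x set \<Rightarrow>
   ('x \<Rightarrow> real^5^5) \<Rightarrow> bool" where
  "first_order_frame A f U F \<longleftrightarrow> conformal_frame A f U F \<and>
     (\<forall>c\<in>A. \<forall>x \<in> U \<inter> fst c. (\<forall>v. mc_form c F x 3 0 v = 0) \<and>
        wedge (mc_form c F x 1 0) (mc_form c F x 2 0) > 0)"

definition second_order_frame ::
  "('x::topological_space, real^2) chart set \<Rightarrow> ('x \<Rightarrow> (real^5) set) \<Rightarrow> 'x set \<Rightarrow>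
   ('x \<Rightarrow> real^5^5) \<Rightarrow> bool" where
  "second_order_frame A f U F \<longleftrightarrow> first_order_frame A f U F \<and>
     (\<forall>c\<in>A. \<forall>x \<in> U \<inter> fst c.
        wedge (mc_form c F x 3 1) (mc_form c F x 2 0) +
        wedge (mc_form c F x 3 2) (mc_form c F x 1 0) = 0)"

definition conformal_gauss_map ::
  "('x::topological_space, real^2) chart set \<Rightarrow> ('x \<Rightarrow> (real^5) set) \<Rightarrow> 'x \<Rightarrow> real^5" where
  "conformal_gauss_map A f x =
     (THE n. \<exists>U F. second_order_frame A f U F \<and> x \<in> U \<and> n = column 3 (F x))"

text \<open>The function \<open>\<rho>\<close> with \<open>\<langle>dN, dN\<rangle> = \<rho> f\<^sup>*g\<close>, where \<open>N\<close> is the conformal Gauss map.\<close>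

definition gauss_factor ::
  "('x::topological_space, real^2) chart set \<Rightarrow> ('x \<Rightarrow> (real^5) set) \<Rightarrow> 'x \<Rightarrow> real" where
  "gauss_factor A f x = (THE \<rho>. \<forall>c\<in>A. x \<in> fst c \<longrightarrow> (\<forall>v w.
     scal (differential c (conformal_gauss_map A f) x v)
          (differential c (conformal_gauss_map A f) x w) = \<rho> * induced_metric f c x v w))"

definition bivector :: "real^5 \<Rightarrow> real^5 \<Rightarrow> real^5^5" where
  "bivector V W = (\<chi> i j. V$i * W$j - V$j * W$i)"

definition quasi_umbilical ::
  "('x::topological_space, real^2) chart set \<Rightarrow> ('x \<Rightarrow> (real^5) set) \<Rightarrow> bool" where
  "quasi_umbilical A f \<longleftrightarrow> (\<forall>x. gauss_factor A f x = 0 \<and>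
     (\<forall>c\<in>A. x \<in> fst c \<longrightarrow>
        (\<exists>v. bivector (lift f x) (differential c (conformal_gauss_map A f) x v) \<noteq> 0)))"


section \<open>Harmonic maps into the neutral pseudosphere\<close>

definition pd :: "2 \<Rightarrow> (real^2 \<Rightarrow> 'b::real_normed_vector) \<Rightarrow> real^2 \<Rightarrow> 'b" where
  "pd i h p = frechet_derivative h (at p) (axis i 1)"

definition christoffel :: "(real^2 \<Rightarrow> real^2^2) \<Rightarrow> 2 \<Rightarrow> 2 \<Rightarrow> 2 \<Rightarrow> real^2 \<Rightarrow> real" where
  "christoffel m k i j p = (1/2) * (\<Sum>l\<in>UNIV. matrix_inv (m p) $ k $ l *
     (pd i (\<lambda>q. m q $ j $ l) p + pd j (\<lambda>q. m q $ i $ l) p - pd l (\<lambda>q. m q $ i $ j) p))"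

text \<open>The tension field of a map \<open>N\<close> from a plane domain with metric \<open>m\<close> into \<open>S22\<close>. The
  Levi-Civita connection of \<open>S22\<close> is the tangential part of the flat connection of the ambient
  space, the projection to the tangent space at \<open>N\<close> being \<open>W - \<langle>W, N\<rangle> N\<close>.\<close>

definition tangential_part :: "real^5 \<Rightarrow> real^5 \<Rightarrow> real^5" where
  "tangential_part n W = W - scal W n *\<^sub>R n"

definition tension :: "(real^2 \<Rightarrow> real^2^2) \<Rightarrow> (real^2 \<Rightarrow> real^5) \<Rightarrow> real^2 \<Rightarrow> real^5" where
  "tension m N p = (\<Sum>i\<in>UNIV. \<Sum>j\<in>UNIV. matrix_inv (m p) $ i $ j *\<^sub>R
     (tangential_part (N p) (pd i (pd j N) p) - (\<Sum>k\<in>UNIV. christoffel m k i j p *\<^sub>R pd k N p)))"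

text \<open>Harmonicity with respect to the metric induced by \<open>f\<close>; in dimension two it depends on the
  conformal class of this metric only.\<close>

definition harmonic_wrt ::
  "('x, real^2) chart set \<Rightarrow> ('x \<Rightarrow> (real^5) set) \<Rightarrow> ('x \<Rightarrow> real^5) \<Rightarrow> bool" where
  "harmonic_wrt A f N \<longleftrightarrow> (\<forall>x. N x \<in> S22) \<and> smooth_map A UNIV N \<and>
     (\<forall>c\<in>A. \<forall>p\<in>chart_image c.
        tension (\<lambda>q. \<chi> i j. induced_metric f c (chart_inv c q) (axis i 1) (axis j 1))
          (N \<circ> chart_inv c) p = 0)"


section \<open>The leaf space\<close>

text \<open>Smooth curves, defined on an open set \<open>J\<close> of parameters, that are tangent to the
  distribution \<open>ker dN\<close>.\<close>

definition tangent_curve ::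
  "('x::topological_space, real^2) chart set \<Rightarrow> ('x \<Rightarrow> real^5) \<Rightarrow> real set \<Rightarrow> (real \<Rightarrow> 'x) \<Rightarrow> bool" where
  "tangent_curve A N J \<gamma> \<longleftrightarrow> continuous_on J \<gamma> \<and>
     (\<forall>c\<in>A. smooth_on (J \<inter> \<gamma> -` fst c) (snd c \<circ> \<gamma>) \<and>
        (\<forall>t \<in> J \<inter> \<gamma> -` fst c.
           differential c N (\<gamma> t) (vector_derivative (snd c \<circ> \<gamma>) (at t)) = 0))"

text \<open>Two points lie on the same leaf iff they can be joined by a piecewise smooth curve tangent
  to the distribution.\<close>

definition leaf_rel ::
  "('x::topological_space, real^2) chart set \<Rightarrow> ('x \<Rightarrow> real^5) \<Rightarrow> ('x \<times> 'x) set" where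
  "leaf_rel A N = {(x, y). \<exists>\<gamma> a b. a < 0 \<and> 1 < b \<and> tangent_curve A N {a<..<b} \<gamma> \<and>
     \<gamma> 0 = x \<and> \<gamma> 1 = y}\<^sup>*"

definition leaf_of ::
  "('x::topological_space, real^2) chart set \<Rightarrow> ('x \<Rightarrow> real^5) \<Rightarrow> 'x \<Rightarrow> 'x set" where
  "leaf_of A N x = leaf_rel A N `` {x}"

definition leaf_space ::
  "('x::topological_space, real^2) chart set \<Rightarrow> ('x \<Rightarrow> real^5) \<Rightarrow> 'x set set" where
  "leaf_space A N = range (leaf_of A N)"

definition leaf_topology ::
  "('x::topological_space, real^2) chart set \<Rightarrow> ('x \<Rightarrow> real^5) \<Rightarrow> 'x set topology" where
  "leaf_topology A N = topology (\<lambda>S. S \<subseteq> leaf_space A N \<and> open (leaf_of A N -` S))"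

lemma openin_leaf_topology:
  "openin (leaf_topology A N) S \<longleftrightarrow> S \<subseteq> leaf_space A N \<and> open (leaf_of A N -` S)"
proof -
  have "istopology (\<lambda>S. S \<subseteq> leaf_space A N \<and> open (leaf_of A N -` S))"
    unfolding istopology_def vimage_Int vimage_Union by (blast intro: open_Int open_UN)
  then show ?thesis
    unfolding leaf_topology_def by (simp only: topology_inverse')
qed

lemma quotient_map_leaf_of:
  "quotient_map euclidean (leaf_topology A N) (leaf_of A N)"
proof -
  have "leaf_of A N -` leaf_space A N = UNIV"
    unfolding leaf_space_def by blast
  then have "open (leaf_of A N -` leaf_space A N)"
    by (simp only: open_UNIV)
  then have "topspace (leaf_topology A N) = leaf_space A N"
    unfolding topspace_def openin_leaf_topology by blast
  then show ?thesis
    unfolding quotient_map_def openin_leaf_topology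
    by (simp add: leaf_space_def vimage_def)
qed

text \<open>The smooth structure of the leaf space for which the projection is a submersion, given as
  the maximal atlas.\<close>

definition leaf_charts ::
  "('x::topological_space, real^2) chart set \<Rightarrow> ('x \<Rightarrow> real^5) \<Rightarrow> ('x set, real) chart set" where
  "leaf_charts A N = {(V, \<psi>). is_chart (leaf_topology A N) (V, \<psi>) \<and>
     smooth_map A (leaf_of A N -` V) (\<psi> \<circ> leaf_of A N) \<and>
     (\<forall>c\<in>A. \<forall>x \<in> fst c \<inter> leaf_of A N -` V. \<exists>v. differential c (\<psi> \<circ> leaf_of A N) x v \<noteq> 0)}"

definition regular ::
  "('x::topological_space, real^2) chart set \<Rightarrow> ('x \<Rightarrow> (real^5) set) \<Rightarrow> bool" where
  "regular A f \<longleftrightarrow> Hausdorff_space (leaf_topology A (conformal_gauss_map A f))"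


section \<open>Infinitesimal deformations\<close>

text \<open>A 1-form with values in a vector space, given by its coordinate expressions: \<open>\<delta> c x v\<close> is its
  value at \<open>x\<close> on the tangent vector with coordinates \<open>v\<close> in the chart \<open>c\<close>. The last condition
  makes equality of 1-forms coincide with equality of functions.\<close>

type_synonym ('x, 'v) form = "('x, real^2) chart \<Rightarrow> 'x \<Rightarrow> real^2 \<Rightarrow> 'v"

definition smooth_one_form ::
  "('x, real^2) chart set \<Rightarrow> ('x, 'v::real_normed_vector) form \<Rightarrow> bool" where
  "smooth_one_form A \<delta> \<longleftrightarrow>
     (\<forall>c\<in>A. \<forall>x\<in>fst c. linear (\<delta> c x)) \<and>
     (\<forall>c\<in>A. \<forall>v. smooth_on (chart_image c) (\<lambda>p. \<delta> c (chart_inv c p) v)) \<and>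
     (\<forall>c\<in>A. \<forall>c'\<in>A. \<forall>x \<in> fst c \<inter> fst c'. \<forall>v.
        \<delta> c' x (frechet_derivative (transition c c') (at (snd c x)) v) = \<delta> c x v) \<and>
     (\<forall>c x v. \<not> (c \<in> A \<and> x \<in> fst c) \<longrightarrow> \<delta> c x v = 0)"

definition closed_one_form ::
  "('x, real^2) chart set \<Rightarrow> ('x, 'v::real_normed_vector) form \<Rightarrow> bool" where
  "closed_one_form A \<delta> \<longleftrightarrow> (\<forall>c\<in>A. \<forall>p\<in>chart_image c.
     pd 1 (\<lambda>q. \<delta> c (chart_inv c q) (axis 2 1)) p - pd 2 (\<lambda>q. \<delta> c (chart_inv c q) (axis 1 1)) p = 0)"

definition infinitesimal_deformation ::
  "('x, real^2) chart set \<Rightarrow> ('x \<Rightarrow> (real^5) set) \<Rightarrow> ('x, real^5^5) form \<Rightarrow> bool" where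
  "infinitesimal_deformation A f \<delta> \<longleftrightarrow> smooth_one_form A \<delta> \<and> closed_one_form A \<delta> \<and>
     (\<exists>c x v. \<delta> c x v \<noteq> 0) \<and>
     (\<forall>c\<in>A. \<forall>x\<in>fst c. \<forall>v. \<delta> c x v \<in> o23 \<and>
        \<delta> c x v \<in> polar o23 (lie_algebra (stabilizer (f x))))"

definition isothermic ::
  "('x, real^2) chart set \<Rightarrow> ('x \<Rightarrow> (real^5) set) \<Rightarrow> bool" where
  "isothermic A f \<longleftrightarrow> (\<exists>\<delta>. infinitesimal_deformation A f \<delta>)"

text \<open>Smooth functions on the leaf space that do not vanish identically.\<close>

definition nonzero_leaf_functions ::
  "('x::topological_space, real^2) chart set \<Rightarrow> ('x \<Rightarrow> real^5) \<Rightarrow> ('x set \<Rightarrow> real) set" where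
  "nonzero_leaf_functions A N = {r \<in> extensional (leaf_space A N).
     smooth_map (leaf_charts A N) (leaf_space A N) r \<and> (\<exists>L\<in>leaf_space A N. r L \<noteq> 0)}"

text \<open>The leaf space is a 1-dimensional manifold, and multiplication of a fixed 1-form \<open>\<delta>0\<close> by the
  pullbacks of arbitrary smooth functions of the leaf yields each infinitesimal deformation
  exactly once.\<close>

definition deformations_depend_on_one_function ::
  "('x::topological_space, real^2) chart set \<Rightarrow> ('x \<Rightarrow> (real^5) set) \<Rightarrow> bool" where
  "deformations_depend_on_one_function A f \<longleftrightarrow>
     (let N = conformal_gauss_map A f in
       smooth_manifold (leaf_topology A N) (leaf_charts A N) \<and> connected_space (leaf_topology A N) \<and>
       (\<exists>\<delta>0 :: ('x, real^5^5) form.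
          bij_betw (\<lambda>r c x v. r (leaf_of A N x) *\<^sub>R \<delta>0 c x v)
            (nonzero_leaf_functions A N) {\<delta>. infinitesimal_deformation A f \<delta>}))"

end

theory Submission
  imports Defs
begin

text \<open>Let \<open>y\<close> be the lift of \<open>f\<close> to the light cone and \<open>n\<close> the conformal Gauss map. A second order
  frame exists locally by orthonormalisation, and its third column is the unit normal, with the sign
  given by the orientation, for which the second fundamental form \<open>\<langle>dn(v), dy(w)\<rangle>\<close> has trace zero
  (\<open>gauss_normal\<close>). These conditions determine it, so that \<open>n\<close> is well defined and smooth. The
  existence of frames in the identity component needs the components of the isometry group, which
  are found by factorisation into reflections.

  Modulo \<open>y\<close>, \<open>dn\<close> is a symmetric endomorphism of the tangent plane with trace zero, and
  quasi-umbilicity says that it is nonzero with square zero. Therefore its kernel is a null line,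
  and \<open>dn\<close> maps the kernel to multiples of \<open>y\<close>. By differentiating once more, the multiples are seen
  to be zero (\<open>kernel_field\<close>, \<open>rank_one\<close>). Hence \<open>dn = M du\<close> locally, where \<open>u\<close> is a component of
  \<open>n\<close>. As the kernel of \<open>du\<close> is null, so is the gradient of \<open>u\<close>; a function with null gradient on a
  Lorentzian surface has vanishing Laplacian, and the tension field of \<open>n\<close>, which is \<open>(Laplacian of
  u) M + |grad u|\<^sup>2 dM/du\<close>, vanishes (\<open>tension_zero\<close>).

  The polar space of the stabilizer algebra of \<open>f(x)\<close> consists of the endomorphisms \<open>y \<and> w\<close> with
  \<open>w\<close> orthogonal to \<open>y\<close> (\<open>polar_stabilizer\<close>, which uses that the Killing form is a multiple of the
  trace form). Let \<open>W\<close> be the image under \<open>dy\<close> of a field that spans the kernel of \<open>dn\<close>. Along the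
  leaves the plane spanned by \<open>y\<close> and \<open>W\<close> is constant, so that a suitable multiple \<open>\<Psi>\<close> of \<open>y \<and> W\<close> is
  constant along them; then \<open>\<Psi> du\<close> is closed and is an infinitesimal deformation. The multiple can
  be chosen such that \<open>\<Psi> du\<close> does not depend on the coordinates and on \<open>u\<close>, which gives a form on
  the whole surface (\<open>fundamental_form\<close>). Conversely, comparing coefficients in the equation \<open>d\<delta> =
  0\<close> shows that each closed form \<open>\<delta>\<close> with values in the polar spaces is \<open>h \<Psi> du\<close> for a function \<open>h\<close>
  (\<open>closed_form_multiple\<close>), and such a form is closed if and only if \<open>h\<close> is constant along the
  leaves (\<open>curl_multiple\<close>).

  It remains to identify the functions that are constant on the leaves with those on the leaf
  space. Near each point a component of \<open>n\<close> is a transversal coordinate of a flow box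
  (\<open>flow_box_exists\<close>). It follows that the saturation of an open set is open and that the components
  of \<open>n\<close> are charts of the leaf space (\<open>leaf_chart\<close>), in which smoothness can be tested along
  transversal curves (\<open>leaf_function_smooth\<close>).\<close>

section \<open>Smooth maps between Euclidean spaces\<close>

lemma Ck_on_subset: "Ck_on k S h \<Longrightarrow> T \<subseteq> S \<Longrightarrow> Ck_on k T h"
  by (induction k arbitrary: h) (auto intro: continuous_on_subset)

lemma Ck_on_Suc_imp: "Ck_on (Suc k) S h \<Longrightarrow> Ck_on k S h"
proof (induction k arbitrary: h)
  case 0
  then show ?case
    by (auto intro!: continuous_at_imp_continuous_on differentiable_imp_continuous_within)
next
  case (Suc k)
  then show ?case by simp
qed

lemma Ck_on_continuous: "Ck_on k S h \<Longrightarrow> continuous_on S h"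
  by (induction k) (simp, metis Ck_on_Suc_imp)

lemma Ck_on_cong:
  assumes "open S" and "Ck_on k S h" and "\<And>x. x \<in> S \<Longrightarrow> h x = g x"
  shows "Ck_on k S g"
  using assms(2,3)
proof (induction k arbitrary: h g)
  case 0
  then show ?case by (simp cong: continuous_on_cong)
next
  case (Suc k)
  have d: "(g has_derivative frechet_derivative h (at p)) (at p)" if "p \<in> S" for p
    using Suc.prems that assms(1)
    by (intro has_derivative_transform_within_open[of h _ p UNIV S g])
       (auto simp: frechet_derivative_works)
  have eq: "frechet_derivative h (at p) = frechet_derivative g (at p)" if "p \<in> S" for p
    using frechet_derivative_at[OF d[OF that]] .
  show ?case
    unfolding Ck_on.simps
  proof (intro conjI ballI allI)
    show "g differentiable at p" if "p \<in> S" for p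
      using d[OF that] by (auto simp: differentiable_def)
    show "Ck_on k S (\<lambda>p. frechet_derivative g (at p) v)" for v
      by (rule Suc.IH[of "\<lambda>p. frechet_derivative h (at p) v"]) (use Suc.prems eq in auto)
  qed
qed

lemma Ck_on_local:
  assumes "\<And>x. x \<in> S \<Longrightarrow> \<exists>T. open T \<and> x \<in> T \<and> Ck_on k T h"
  shows "Ck_on k S h"
  using assms
proof (induction k arbitrary: h)
  case 0
  show ?case
    unfolding Ck_on.simps
  proof (intro continuous_at_imp_continuous_on ballI)
    fix x assume "x \<in> S"
    then obtain T where "open T" "x \<in> T" "Ck_on 0 T h" using 0 by blast
    then show "isCont h x" by (simp add: continuous_on_eq_continuous_at)
  qed
next
  case (Suc k)
  show ?case
    unfolding Ck_on.simps
  proof (intro conjI ballI allI)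
    fix p assume "p \<in> S" then show "h differentiable at p" using Suc.prems by force
  next
    fix v show "Ck_on k S (\<lambda>p. frechet_derivative h (at p) v)"
      using Suc.prems by (intro Suc.IH) force
  qed
qed

lemma Ck_on_const: "Ck_on k S (\<lambda>x. c)"
  by (induction k arbitrary: c) (auto)

lemma Ck_on_bounded_linear: "bounded_linear h \<Longrightarrow> Ck_on k S h"
proof (cases k)
  case (Suc l)
  assume h: "bounded_linear h"
  have "frechet_derivative h (at p) = h" for p
    using frechet_derivative_at[OF bounded_linear_imp_has_derivative[OF h]] by metis
  then show ?thesis using h Suc by (auto simp: Ck_on_const bounded_linear_imp_differentiable)
qed (auto intro: linear_continuous_on)


text \<open>The recursion in \<open>Ck_on\<close> asks for the derivatives as computed by the choice operator; this
  form allows them to be exhibited.\<close>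

lemma Ck_on_SucI:
  assumes "open S" "\<And>p. p \<in> S \<Longrightarrow> (h has_derivative h' p) (at p)"
    and "\<And>v. Ck_on k S (\<lambda>p. h' p v)"
  shows "Ck_on (Suc k) S h"
proof -
  have d: "h' p = frechet_derivative h (at p)" if "p \<in> S" for p
    using assms(2)[OF that] by (rule frechet_derivative_at)
  have "Ck_on k S (\<lambda>p. frechet_derivative h (at p) v)" for v
    using assms(1) assms(3)[of v] by (rule Ck_on_cong) (simp add: d)
  then show ?thesis using assms(2) by (auto simp: differentiable_def)
qed

lemma Ck_on_SucD:
  assumes "Ck_on (Suc k) S h" "p \<in> S"
  shows "(h has_derivative frechet_derivative h (at p)) (at p)"
  using assms by (auto simp: frechet_derivative_works)

lemma Ck_on_add:
  assumes "open S"
  shows "Ck_on k S h \<Longrightarrow> Ck_on k S g \<Longrightarrow> Ck_on k S (\<lambda>x. h x + g x)"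
proof (induction k arbitrary: h g)
  case 0
  then show ?case by (auto intro: continuous_on_add)
next
  case (Suc k)
  show ?case
    by (rule Ck_on_SucI[OF assms has_derivative_add[OF Ck_on_SucD[OF Suc.prems(1)]
          Ck_on_SucD[OF Suc.prems(2)]]]) (use Suc.prems in \<open>auto intro: Suc.IH\<close>)
qed

lemma Ck_on_bilinear:
  assumes "bounded_bilinear B" "open S"
  shows "Ck_on k S h \<Longrightarrow> Ck_on k S g \<Longrightarrow> Ck_on k S (\<lambda>x. B (h x) (g x))"
proof (induction k arbitrary: h g)
  case 0
  then show ?case by (auto intro: bounded_bilinear.continuous_on[OF assms(1)])
next
  case (Suc k)
  show ?case
    by (rule Ck_on_SucI[OF assms(2) bounded_bilinear.FDERIV[OF assms(1) Ck_on_SucD[OF Suc.prems(1)]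
          Ck_on_SucD[OF Suc.prems(2)]]])
       (use Suc.prems Ck_on_Suc_imp[OF Suc.prems(1)] Ck_on_Suc_imp[OF Suc.prems(2)]
         in \<open>auto intro!: Ck_on_add[OF assms(2)] Suc.IH\<close>)
qed

lemma Ck_on_sum:
  assumes "open S" "\<And>i. i \<in> I \<Longrightarrow> Ck_on k S (h i)"
  shows "Ck_on k S (\<lambda>x. \<Sum>i\<in>I. h i x)"
  using assms(2) by (induction I rule: infinite_finite_induct)
    (auto intro: Ck_on_const Ck_on_add[OF assms(1)])

lemma Ck_on_linear_compose:
  assumes "bounded_linear L" "open S"
  shows "Ck_on k S h \<Longrightarrow> Ck_on k S (\<lambda>x. L (h x))"
proof (induction k arbitrary: h)
  case 0
  then show ?case by (auto intro: bounded_linear.continuous_on[OF assms(1)])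
next
  case (Suc k)
  show ?case
    by (rule Ck_on_SucI[OF assms(2) bounded_linear.has_derivative[OF assms(1) Ck_on_SucD[OF Suc.prems(1)]]])
       (use Suc.prems in \<open>auto intro: Suc.IH\<close>)
qed

text \<open>The derivative of \<open>g\<close> at the moving point \<open>h p\<close> in the moving direction \<open>h' p v\<close> is
  expanded in a basis, so that it becomes a sum of products of functions to which the induction
  hypothesis applies.\<close>

lemma Ck_on_compose:
  fixes g :: "'b::euclidean_space \<Rightarrow> 'c::real_normed_vector"
  assumes "open S"
  shows "Ck_on k T g \<Longrightarrow> Ck_on k S h \<Longrightarrow> h ` S \<subseteq> T \<Longrightarrow> Ck_on k S (\<lambda>x. g (h x))"
proof (induction k arbitrary: g h)
  case 0
  then show ?case using continuous_on_compose2 by auto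
next
  case (Suc k)
  let ?h' = "\<lambda>p. frechet_derivative h (at p)" and ?g' = "\<lambda>q. frechet_derivative g (at q)"
  have g: "(g has_derivative ?g' (h p)) (at (h p))" if "p \<in> S" for p
    using Suc.prems that by (intro Ck_on_SucD) auto
  have "Ck_on k S (\<lambda>p. \<Sum>b\<in>Basis. (?h' p v \<bullet> b) *\<^sub>R ?g' (h p) b)" for v
    using Suc.prems(1,2,3) Ck_on_Suc_imp[OF Suc.prems(2)]
    by (intro Ck_on_sum[OF assms] Ck_on_bilinear[OF bounded_bilinear_scaleR assms] Suc.IH
        Ck_on_linear_compose[OF bounded_linear_inner_left assms]) auto
  moreover have "?g' (h p) (?h' p v) = (\<Sum>b\<in>Basis. (?h' p v \<bullet> b) *\<^sub>R ?g' (h p) b)"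
    if "p \<in> S" for p v
  proof -
    interpret linear "?g' (h p)"
      using g[OF that] by (rule has_derivative_linear)
    have "?g' (h p) (?h' p v) = ?g' (h p) (\<Sum>b\<in>Basis. (?h' p v \<bullet> b) *\<^sub>R b)"
      by (simp only: euclidean_representation)
    then show ?thesis by (simp only: sum scale)
  qed
  ultimately have "Ck_on k S (\<lambda>p. ?g' (h p) (?h' p v))" for v
    by (rule_tac Ck_on_cong[OF assms, of _ "\<lambda>p. \<Sum>b\<in>Basis. (?h' p v \<bullet> b) *\<^sub>R ?g' (h p) b"]) auto
  then show ?case
    by (intro Ck_on_SucI[OF assms has_derivative_compose[OF Ck_on_SucD[OF Suc.prems(2)] g]]) auto
qed

lemma Ck_on_inverse: "Ck_on k {x::real. x \<noteq> 0} inverse"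
proof (induction k)
  case 0
  then show ?case by (auto intro!: continuous_intros)
next
  case (Suc k)
  have o: "open {x::real. x \<noteq> 0}" by (simp add: open_Collect_neq)
  have "Ck_on k {x::real. x \<noteq> 0} (\<lambda>p. - (inverse p * v * inverse p))" for v
    by (intro Ck_on_linear_compose[OF bounded_linear_minus[OF bounded_linear_ident] o]
        Ck_on_bilinear[OF bounded_bilinear_mult o] Suc Ck_on_const)
  then show ?case
    by (rule_tac Ck_on_SucI[OF o has_derivative_inverse']) auto
qed

lemma Ck_on_sqrt: "Ck_on k {x::real. x > 0} sqrt"
proof (induction k)
  case 0
  then show ?case by (auto intro!: continuous_intros)
next
  case (Suc k)
  have o: "open {x::real. x > 0}" by (simp add: open_Collect_less)
  have "Ck_on k {x::real. x > 0} (\<lambda>p. (inverse (sqrt p) / 2) * v)" for v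
    by (intro Ck_on_linear_compose[OF bounded_linear_divide o]
        Ck_on_bilinear[OF bounded_bilinear_mult o] Ck_on_const
        Ck_on_compose[OF o Ck_on_inverse] Suc) auto
  then show ?case
    by (rule_tac Ck_on_SucI[OF o])
       (auto intro!: DERIV_real_sqrt[unfolded has_field_derivative_def])
qed

lemma smooth_on_subset: "smooth_on S h \<Longrightarrow> T \<subseteq> S \<Longrightarrow> smooth_on T h"
  by (auto simp: smooth_on_def intro: Ck_on_subset)

lemma smooth_on_cong:
  assumes "open S" "smooth_on S h" "\<And>x. x \<in> S \<Longrightarrow> h x = g x"
  shows "smooth_on S g"
  using assms by (auto simp: smooth_on_def intro: Ck_on_cong)

lemma smooth_on_local:
  assumes "\<And>x. x \<in> S \<Longrightarrow> \<exists>T. open T \<and> x \<in> T \<and> smooth_on T h"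
  shows "smooth_on S h"
  using assms unfolding smooth_on_def by (meson Ck_on_local)

lemma smooth_on_continuous: "smooth_on S h \<Longrightarrow> continuous_on S h"
  using Ck_on_continuous by (auto simp: smooth_on_def)

lemma smooth_on_differentiable: "smooth_on S h \<Longrightarrow> p \<in> S \<Longrightarrow> h differentiable (at p)"
  unfolding smooth_on_def by (metis Ck_on.simps(2))

lemma smooth_on_has_derivative:
  "smooth_on S h \<Longrightarrow> p \<in> S \<Longrightarrow> (h has_derivative frechet_derivative h (at p)) (at p)"
  using smooth_on_differentiable frechet_derivative_works by blast

lemma smooth_on_frechet: "smooth_on S h \<Longrightarrow> smooth_on S (\<lambda>p. frechet_derivative h (at p) v)"
  unfolding smooth_on_def by (metis Ck_on.simps(2))

lemma smooth_on_const: "smooth_on S (\<lambda>x. c)"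
  by (simp add: smooth_on_def Ck_on_const)

lemma smooth_on_bounded_linear: "bounded_linear h \<Longrightarrow> smooth_on S h"
  by (simp add: smooth_on_def Ck_on_bounded_linear)

lemmas smooth_on_ident = smooth_on_bounded_linear[OF bounded_linear_ident]

lemma smooth_on_add:
  "open S \<Longrightarrow> smooth_on S h \<Longrightarrow> smooth_on S g \<Longrightarrow> smooth_on S (\<lambda>x. h x + g x)"
  by (simp add: smooth_on_def Ck_on_add)

lemma smooth_on_linear_compose:
  "bounded_linear L \<Longrightarrow> open S \<Longrightarrow> smooth_on S h \<Longrightarrow> smooth_on S (\<lambda>x. L (h x))"
  by (simp add: smooth_on_def Ck_on_linear_compose)

lemmas smooth_on_minus = smooth_on_linear_compose[OF bounded_linear_minus[OF bounded_linear_ident]]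
lemmas smooth_on_nth = smooth_on_linear_compose[OF bounded_linear_vec_nth]

lemma smooth_on_diff:
  "open S \<Longrightarrow> smooth_on S h \<Longrightarrow> smooth_on S g \<Longrightarrow> smooth_on S (\<lambda>x. h x - g x)"
  using smooth_on_add[OF _ _ smooth_on_minus, of S h g] by simp

lemma smooth_on_bilinear:
  "bounded_bilinear B \<Longrightarrow> open S \<Longrightarrow> smooth_on S h \<Longrightarrow> smooth_on S g \<Longrightarrow>
    smooth_on S (\<lambda>x. B (h x) (g x))"
  by (simp add: smooth_on_def Ck_on_bilinear)

lemmas smooth_on_scaleR = smooth_on_bilinear[OF bounded_bilinear_scaleR]
lemmas smooth_on_mult = smooth_on_bilinear[OF bounded_bilinear_mult]
lemmas smooth_on_inner = smooth_on_bilinear[OF bounded_bilinear_inner]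

lemma smooth_on_sum:
  "open S \<Longrightarrow> (\<And>i. i \<in> I \<Longrightarrow> smooth_on S (h i)) \<Longrightarrow> smooth_on S (\<lambda>x. \<Sum>i\<in>I. h i x)"
  by (simp add: smooth_on_def Ck_on_sum)

lemma smooth_on_prod:
  fixes h :: "'i \<Rightarrow> 'a::real_normed_vector \<Rightarrow> real"
  assumes "open S" "\<And>i. i \<in> I \<Longrightarrow> smooth_on S (h i)"
  shows "smooth_on S (\<lambda>x. \<Prod>i\<in>I. h i x)"
  using assms(2) by (induction I rule: infinite_finite_induct)
    (auto intro: smooth_on_const smooth_on_mult[OF assms(1)])

lemma smooth_on_compose:
  fixes g :: "'b::euclidean_space \<Rightarrow> 'c::real_normed_vector"
  assumes "open S" "smooth_on T g" "smooth_on S h" "\<And>x. x \<in> S \<Longrightarrow> h x \<in> T"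
  shows "smooth_on S (\<lambda>x. g (h x))"
  unfolding smooth_on_def
proof
  fix k show "Ck_on k S (\<lambda>x. g (h x))"
    by (rule Ck_on_compose[OF assms(1), where T=T]) (use assms in \<open>auto simp: smooth_on_def\<close>)
qed

lemma smooth_on_inverse:
  fixes h :: "'a::real_normed_vector \<Rightarrow> real"
  assumes "open S" "smooth_on S h" "\<And>x. x \<in> S \<Longrightarrow> h x \<noteq> 0"
  shows "smooth_on S (\<lambda>x. inverse (h x))"
  by (rule smooth_on_compose[OF assms(1) _ assms(2), where T="{x. x \<noteq> 0}"])
     (simp_all add: smooth_on_def Ck_on_inverse assms(3))

lemma smooth_on_divide:
  fixes h g :: "'a::real_normed_vector \<Rightarrow> real"
  assumes "open S" "smooth_on S g" "smooth_on S h" "\<And>x. x \<in> S \<Longrightarrow> h x \<noteq> 0"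
  shows "smooth_on S (\<lambda>x. g x / h x)"
  unfolding divide_inverse by (intro smooth_on_mult smooth_on_inverse assms)

lemma smooth_on_sqrt:
  fixes h :: "'a::real_normed_vector \<Rightarrow> real"
  assumes "open S" "smooth_on S h" "\<And>x. x \<in> S \<Longrightarrow> h x > 0"
  shows "smooth_on S (\<lambda>x. sqrt (h x))"
  by (rule smooth_on_compose[OF assms(1) _ assms(2), where T="{x. x > 0}"])
     (simp_all add: smooth_on_def Ck_on_sqrt assms(3))

lemma smooth_on_vec:
  fixes h :: "'a::real_normed_vector \<Rightarrow> ('b::real_normed_vector)^'n::finite"
  assumes "open S" "\<And>i. smooth_on S (\<lambda>x. h x $ i)"
  shows "smooth_on S h"
proof -
  have bl: "bounded_linear (\<lambda>b::'b. axis i b :: 'b^'n)" for i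
  proof (rule bounded_linear_intro[where K=1])
    show "norm (axis i x :: 'b^'n) \<le> norm x * 1" for x :: 'b
    proof -
      have "(\<Sum>j\<in>UNIV. (norm ((axis i x :: 'b^'n) $ j))\<^sup>2) = (\<Sum>j\<in>UNIV. if j = i then (norm x)\<^sup>2 else 0)"
        by (rule sum.cong) (auto simp: axis_def)
      then show ?thesis by (simp add: norm_vec_def L2_set_def)
    qed
  qed (auto simp: axis_def vec_eq_iff)
  have "smooth_on S (\<lambda>x. \<Sum>i\<in>UNIV. axis i (h x $ i))"
    by (intro smooth_on_sum assms smooth_on_linear_compose[OF bl])
  moreover have "(\<Sum>i\<in>UNIV. axis i (v $ i)) = v" for v :: "'b^'n"
    by (simp add: vec_eq_iff axis_def if_distrib[where f="\<lambda>f. f _"] cong: if_cong)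
  ultimately show ?thesis by simp
qed

lemma smooth_on_det:
  assumes "open S" "\<And>i j. smooth_on S (\<lambda>x. h x $ i $ j)"
  shows "smooth_on S (\<lambda>x. det (h x :: real^'n^'n))"
  unfolding det_def
  by (intro smooth_on_sum smooth_on_mult smooth_on_const smooth_on_prod assms)

lemmas smooth_intros = smooth_on_const smooth_on_ident smooth_on_add smooth_on_diff smooth_on_minus
  smooth_on_scaleR smooth_on_mult smooth_on_inner smooth_on_sum smooth_on_nth smooth_on_frechet
  smooth_on_inverse smooth_on_divide smooth_on_sqrt smooth_on_det

lemma matrix_inv_inverse:
  assumes "det (M :: real^'n^'n) \<noteq> 0"
  shows "M ** matrix_inv M = mat 1" "matrix_inv M ** M = mat 1"
proof -
  have "\<exists>N. M ** N = mat 1 \<and> N ** M = mat 1"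
    using assms invertible_det_nz[of M] by (auto simp: invertible_def)
  from someI_ex[OF this] show "M ** matrix_inv M = mat 1" "matrix_inv M ** M = mat 1"
    by (simp_all add: matrix_inv_def)
qed

text \<open>By Cramer's rule the entries of the inverse are quotients of determinants.\<close>

lemma smooth_on_matrix_inv:
  fixes h :: "'a::real_normed_vector \<Rightarrow> real^'n^'n"
  assumes "open S" "smooth_on S h" "\<And>x. x \<in> S \<Longrightarrow> det (h x) \<noteq> 0"
  shows "smooth_on S (\<lambda>x. matrix_inv (h x))"
proof (rule smooth_on_vec[OF assms(1)], rule smooth_on_vec[OF assms(1)])
  fix i j
  let ?D = "\<lambda>x. det (\<chi> r s. if s = i then axis j (1::real) $ r else h x $ r $ s)"
  have "smooth_on S (\<lambda>x. if s = i then c else h x $ r $ s)" for r s c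
    by (cases "s = i") (auto intro!: smooth_on_const smooth_on_nth assms)
  then have "smooth_on S (\<lambda>x. ?D x / det (h x))"
    by (intro smooth_on_divide smooth_on_det assms) (simp_all add: smooth_on_nth assms)
  moreover have "?D x / det (h x) = matrix_inv (h x) $ i $ j" if "x \<in> S" for x
  proof -
    have inv: "h x ** matrix_inv (h x) = mat 1"
      using assms(3)[OF that] by (rule matrix_inv_inverse)
    have "h x *v column j (matrix_inv (h x)) = axis j 1"
    proof -
      have "h x *v column j (matrix_inv (h x)) = column j (h x ** matrix_inv (h x))"
        by (simp add: column_def matrix_vector_mult_def matrix_matrix_mult_def vec_eq_iff)
      then show ?thesis by (simp add: inv column_def mat_def axis_def vec_eq_iff)
    qed
    then have "column j (matrix_inv (h x)) = (\<chi> k. det (\<chi> r s. if s = k then axis j 1 $ r else h x $ r $ s) / det (h x))"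
      using cramer[OF assms(3)[OF that]] by blast
    then show ?thesis by (simp add: column_def vec_eq_iff)
  qed
  ultimately show "smooth_on S (\<lambda>x. matrix_inv (h x) $ i $ j)"
    by (rule smooth_on_cong[OF assms(1)])
qed

text \<open>Both mixed derivatives are the limit of the second difference quotient, by applying the mean
  value theorem twice in either order.\<close>

lemma symmetric_second_derivative:
  fixes h :: "'a::real_normed_vector \<Rightarrow> 'b::euclidean_space"
  assumes "open S" "smooth_on S h" "p \<in> S"
  shows "frechet_derivative (\<lambda>q. frechet_derivative h (at q) v) (at p) w
       = frechet_derivative (\<lambda>q. frechet_derivative h (at q) w) (at p) v"
proof -
  have main: "frechet_derivative (\<lambda>q. frechet_derivative g (at q) v) (at p) w
       = frechet_derivative (\<lambda>q. frechet_derivative g (at q) w) (at p) v"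
    if g: "smooth_on S g" for g :: "'a \<Rightarrow> real"
  proof -
    define G where "G a q = frechet_derivative g (at q) a" for a q
    define H where "H a b q = frechet_derivative (G a) (at q) b" for a b q
    have sG: "smooth_on S (G a)" for a
      unfolding G_def by (rule smooth_on_frechet[OF g])
    have sH: "smooth_on S (H a b)" for a b
      unfolding H_def by (rule smooth_on_frechet[OF sG])
    have line: "((\<lambda>s. k (q + s *\<^sub>R a)) has_field_derivative frechet_derivative k (at (q + s *\<^sub>R a)) a) (at s)"
      if k: "smooth_on S k" and q: "q + s *\<^sub>R a \<in> S" for k :: "'a \<Rightarrow> real" and q a s
    proof -
      have "((\<lambda>s. k (q + s *\<^sub>R a)) has_derivative (\<lambda>t. frechet_derivative k (at (q + s *\<^sub>R a)) (t *\<^sub>R a))) (at s)"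
        by (rule has_derivative_compose[where f="\<lambda>s. q + s *\<^sub>R a", OF _ smooth_on_has_derivative[OF k q]])
           (auto intro!: derivative_eq_intros)
      then show ?thesis
        unfolding has_field_derivative_def
        by (rule has_derivative_eq_rhs)
           (use linear_cmul[OF has_derivative_linear[OF smooth_on_has_derivative[OF k q]]] in
             \<open>auto simp: fun_eq_iff\<close>)
    qed
    have G: "((\<lambda>s. g (q + s *\<^sub>R a)) has_field_derivative G a (q + s *\<^sub>R a)) (at s)"
      if "q + s *\<^sub>R a \<in> S" for q a and s :: real
      unfolding G_def using g that by (rule line)
    have H: "((\<lambda>s. G b (q + s *\<^sub>R a)) has_field_derivative H b a (q + s *\<^sub>R a)) (at s)"
      if "q + s *\<^sub>R a \<in> S" for q a b and s :: real
      unfolding H_def using sG that by (rule line)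
    \<comment> \<open>The second difference in the directions \<open>a\<close> and \<open>b\<close>.\<close>
    have diff: "\<exists>r s. 0 < r \<and> r < t \<and> 0 < s \<and> s < t \<and>
        g (p + t *\<^sub>R a + t *\<^sub>R b) - g (p + t *\<^sub>R a) - g (p + t *\<^sub>R b) + g p
          = t * t * H a b (p + r *\<^sub>R a + s *\<^sub>R b)"
      if t: "t > 0" and in_S: "\<And>r s. 0 \<le> r \<Longrightarrow> r \<le> t \<Longrightarrow> 0 \<le> s \<Longrightarrow> s \<le> t \<Longrightarrow> p + r *\<^sub>R a + s *\<^sub>R b \<in> S"
      for t a b
    proof -
      let ?\<phi> = "\<lambda>r. g (p + t *\<^sub>R b + r *\<^sub>R a) - g (p + r *\<^sub>R a)"
      have "\<exists>r>0. r < t \<and> ?\<phi> t - ?\<phi> 0 = (t - 0) * (G a (p + t *\<^sub>R b + r *\<^sub>R a) - G a (p + r *\<^sub>R a))"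
      proof (rule MVT2[OF t])
        fix r assume "0 \<le> r" "r \<le> t"
        then show "(?\<phi> has_real_derivative G a (p + t *\<^sub>R b + r *\<^sub>R a) - G a (p + r *\<^sub>R a)) (at r)"
          using in_S[of r t] in_S[of r 0] t
          by (intro DERIV_diff G) (auto simp: add_ac)
      qed
      then obtain r where r: "0 < r" "r < t"
        "?\<phi> t - ?\<phi> 0 = t * (G a (p + t *\<^sub>R b + r *\<^sub>R a) - G a (p + r *\<^sub>R a))" by auto
      have "\<exists>s>0. s < t \<and> G a (p + r *\<^sub>R a + t *\<^sub>R b) - G a (p + r *\<^sub>R a + 0 *\<^sub>R b)
          = (t - 0) * H a b (p + r *\<^sub>R a + s *\<^sub>R b)"
        using in_S r by (intro MVT2[OF t] H) auto
      then obtain s where s: "0 < s" "s < t"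
        "G a (p + r *\<^sub>R a + t *\<^sub>R b) - G a (p + r *\<^sub>R a) = t * H a b (p + r *\<^sub>R a + s *\<^sub>R b)" by auto
      show ?thesis
        by (rule exI[of _ r], rule exI[of _ s]) (use r s in \<open>simp add: add_ac\<close>)
    qed
    obtain e where e: "e > 0" "ball p e \<subseteq> S"
      using assms openE by blast
    define K where "K = norm v + norm w + 1"
    have K: "K > 0" unfolding K_def by (smt (verit) norm_ge_zero)
    have near: "norm (r *\<^sub>R a + s *\<^sub>R b) < d"
      if "0 \<le> r" "r \<le> t" "0 \<le> s" "s \<le> t" "t < d / K" "a = v \<and> b = w \<or> a = w \<and> b = v" for r s t a b d
    proof -
      have "norm (r *\<^sub>R a + s *\<^sub>R b) \<le> r * norm a + s * norm b"
        using norm_triangle_ineq[of "r *\<^sub>R a" "s *\<^sub>R b"] that by simp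
      also have "\<dots> \<le> t * norm a + t * norm b"
        using that by (intro add_mono mult_right_mono) auto
      also have "\<dots> \<le> t * K" using that unfolding K_def by (auto simp: distrib_left)
      also have "\<dots> < d" using that K by (simp add: pos_less_divide_eq)
      finally show ?thesis .
    qed
    have "\<bar>H v w p - H w v p\<bar> \<le> \<epsilon>" if "\<epsilon> > 0" for \<epsilon>
    proof -
      have "\<exists>d>0. \<forall>q. dist q p < d \<longrightarrow> dist (H a b q) (H a b p) < \<epsilon> / 2" for a b
        using smooth_on_continuous[OF sH] assms(1,3) that
        unfolding continuous_on_eq_continuous_at[OF assms(1)] continuous_at_eps_delta
        by (metis half_gt_zero)
      then obtain d1 d2 where d: "d1 > 0" "d2 > 0"
        "\<And>q. dist q p < d1 \<Longrightarrow> dist (H v w q) (H v w p) < \<epsilon> / 2"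
        "\<And>q. dist q p < d2 \<Longrightarrow> dist (H w v q) (H w v p) < \<epsilon> / 2"
        by metis
      define t where "t = min e (min d1 d2) / K / 2"
      have t: "t > 0" "t < e / K" "t < d1 / K" "t < d2 / K"
        using K e d unfolding t_def by (auto simp: field_simps min_def)
      have inS: "p + r *\<^sub>R a + s *\<^sub>R b \<in> S"
        if "0 \<le> r" "r \<le> t" "0 \<le> s" "s \<le> t" "a = v \<and> b = w \<or> a = w \<and> b = v" for r s a b
        using near[OF that(1-4) t(2) that(5)] e(2) by (auto simp: dist_norm add.assoc subset_iff norm_minus_commute)
      obtain r s where rs: "0 < r" "r < t" "0 < s" "s < t"
        "g (p + t *\<^sub>R v + t *\<^sub>R w) - g (p + t *\<^sub>R v) - g (p + t *\<^sub>R w) + g p = t * t * H v w (p + r *\<^sub>R v + s *\<^sub>R w)"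
        using diff[OF t(1) inS] by blast
      obtain r' s' where rs': "0 < r'" "r' < t" "0 < s'" "s' < t"
        "g (p + t *\<^sub>R w + t *\<^sub>R v) - g (p + t *\<^sub>R w) - g (p + t *\<^sub>R v) + g p = t * t * H w v (p + r' *\<^sub>R w + s' *\<^sub>R v)"
        using diff[OF t(1) inS, of w v] by blast
      have "t * t * H v w (p + r *\<^sub>R v + s *\<^sub>R w) = t * t * H w v (p + r' *\<^sub>R w + s' *\<^sub>R v)"
      proof -
        have "g (p + t *\<^sub>R w + t *\<^sub>R v) = g (p + t *\<^sub>R v + t *\<^sub>R w)" by (simp add: algebra_simps)
        then show ?thesis using rs(5) rs'(5) by linarith
      qed
      then have "H v w (p + r *\<^sub>R v + s *\<^sub>R w) = H w v (p + r' *\<^sub>R w + s' *\<^sub>R v)"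
        using t(1) by simp
      moreover have "dist (H v w (p + r *\<^sub>R v + s *\<^sub>R w)) (H v w p) < \<epsilon> / 2"
        using near[of r t s d1 v w] rs t by (intro d) (auto simp: dist_norm add.assoc)
      moreover have "dist (H w v (p + r' *\<^sub>R w + s' *\<^sub>R v)) (H w v p) < \<epsilon> / 2"
        using near[of r' t s' d2 w v] rs' t by (intro d) (auto simp: dist_norm add.assoc)
      ultimately show ?thesis unfolding dist_real_def by linarith
    qed
    then have "\<bar>H v w p - H w v p\<bar> \<le> 0"
      by (rule field_le_epsilon[of _ 0, simplified]) 
    then show ?thesis by (simp add: H_def G_def[abs_def])
  qed
  show ?thesis
  proof (rule euclidean_eqI)
    fix b :: 'b assume "b \<in> Basis"
    have inner: "frechet_derivative (\<lambda>q. k q \<bullet> b) (at q) a = frechet_derivative k (at q) a \<bullet> b"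
      if "smooth_on S k" "q \<in> S" for k :: "'a \<Rightarrow> 'b" and q a
      using frechet_derivative_at[OF has_derivative_inner_left[OF smooth_on_has_derivative[OF that]]]
      by metis
    have *: "frechet_derivative (\<lambda>q. frechet_derivative (\<lambda>q. h q \<bullet> b) (at q) a) (at p) c
       = frechet_derivative (\<lambda>q. frechet_derivative h (at q) a) (at p) c \<bullet> b" for a c
    proof -
      have "frechet_derivative (\<lambda>q. frechet_derivative (\<lambda>q. h q \<bullet> b) (at q) a) (at p)
          = frechet_derivative (\<lambda>q. frechet_derivative h (at q) a \<bullet> b) (at p)"
        using inner[OF assms(2)] assms(1,3)
        by (intro frechet_derivative_transform_within_open[of _ _ S, symmetric])
           (auto intro!: smooth_on_differentiable[of S] smooth_on_inner smooth_on_frechet smooth_on_const assms)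
      then show ?thesis using inner[OF smooth_on_frechet[OF assms(2)] assms(3)] by simp
    qed
    show "frechet_derivative (\<lambda>q. frechet_derivative h (at q) v) (at p) w \<bullet> b
       = frechet_derivative (\<lambda>q. frechet_derivative h (at q) w) (at p) v \<bullet> b"
      using main[of "\<lambda>q. h q \<bullet> b"] unfolding *
      by (simp add: smooth_on_inner smooth_on_const assms)
  qed
qed

text \<open>A differentiable map whose derivative is a smooth function of its own values is smooth; this
  is how the smoothness of inverse maps is obtained.\<close>

lemma smooth_on_bootstrap:
  fixes g :: "'a::real_normed_vector \<Rightarrow> 'b::euclidean_space"
  assumes "open V" "\<And>q. q \<in> V \<Longrightarrow> (g has_derivative (\<lambda>v. L v (g q))) (at q)"
    and "\<And>v. smooth_on U (L v)" "g ` V \<subseteq> U"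
  shows "smooth_on V g"
  unfolding smooth_on_def
proof
  fix k show "Ck_on k V g"
  proof (induction k)
    case 0
    show ?case
      using assms(2) by (auto intro!: continuous_at_imp_continuous_on has_derivative_continuous)
  next
    case (Suc k)
    show ?case
      by (rule Ck_on_SucI[OF assms(1,2)], assumption, rule Ck_on_compose[OF assms(1) _ Suc assms(4)])
         (use assms(3) in \<open>simp add: smooth_on_def\<close>)
  qed
qed

text \<open>The inverse function theorem, with smoothness of the inverse \<open>g\<close>: the derivative of \<open>g\<close> at \<open>q\<close>
  is the field \<open>L\<close> of inverse derivatives, evaluated at \<open>g q\<close>. In each dimension it remains to
  exhibit \<open>L\<close> by a formula from which its smoothness can be read off.\<close>

lemma smooth_local_inverse:
  fixes h :: "'a::euclidean_space \<Rightarrow> 'a"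
  assumes "open S" "smooth_on S h" "p \<in> S" "inj (frechet_derivative h (at p))"
    and L: "\<And>v. smooth_on T (L v)" "\<And>q v. q \<in> S \<Longrightarrow> inj (frechet_derivative h (at q)) \<Longrightarrow>
        q \<in> T \<and> frechet_derivative h (at q) (L v q) = v"
  obtains U V g where "open U" "p \<in> U" "U \<subseteq> S" "open V" "homeomorphism U V h g" "smooth_on V g"
proof -
  let ?h' = "\<lambda>q. Blinfun (frechet_derivative h (at q))"
  have bl: "bounded_linear (frechet_derivative h (at q))" if "q \<in> S" for q
    using smooth_on_has_derivative[OF assms(2) that] by (rule has_derivative_bounded_linear)
  then have app: "blinfun_apply (?h' q) = frechet_derivative h (at q)" if "q \<in> S" for q
    using that bounded_linear_Blinfun_apply by blast
  have "continuous_on S ?h'"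
  proof (rule continuous_on_blinfun_componentwise)
    fix b :: 'a
    show "continuous_on S (\<lambda>q. blinfun_apply (?h' q) b)"
      using smooth_on_continuous[OF smooth_on_frechet[OF assms(2), of b]] app
      by (simp cong: continuous_on_cong)
  qed
  moreover obtain k where k: "linear k" "k \<circ> frechet_derivative h (at p) = id"
    using linear_injective_left_inverse[OF bounded_linear.linear[OF bl[OF assms(3)]] assms(4)] by blast
  have "Blinfun k o\<^sub>L ?h' p = id_blinfun"
    using k app[OF assms(3)] bounded_linear_Blinfun_apply[of k]
    by (intro blinfun_eqI) (auto simp: linear_conv_bounded_linear fun_eq_iff)
  ultimately obtain U V g g' where g: "open U" "U \<subseteq> S" "p \<in> U" "open V" "homeomorphism U V h g"
      "\<And>y. y \<in> V \<Longrightarrow> (g has_derivative (g' y)) (at y)"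
      "\<And>y. y \<in> V \<Longrightarrow> g' y = inv (blinfun_apply (?h' (g y)))"
      "\<And>y. y \<in> V \<Longrightarrow> bij (blinfun_apply (?h' (g y)))"
    using inverse_function_theorem[of S h ?h' p "Blinfun k"] assms(1,3)
      smooth_on_has_derivative[OF assms(2)] app by metis
  have gU: "g y \<in> U" if "y \<in> V" for y
    using g(5) that by (auto simp: homeomorphism_def)
  have gL: "g y \<in> T \<and> g' y = (\<lambda>v. L v (g y))" if "y \<in> V" for y
  proof -
    have S: "g y \<in> S" using gU[OF that] g(2) by blast
    have bij: "bij (frechet_derivative h (at (g y)))"
      using g(8)[OF that] app[OF S] by simp
    then show ?thesis
      using L(2)[OF S bij_is_inj[OF bij]] g(7)[OF that] app[OF S]
      by (auto simp: fun_eq_iff bij_is_inj inv_f_eq)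
  qed
  have "smooth_on V g"
    by (rule smooth_on_bootstrap[OF g(4) _ L(1)]) (use g(6) gL in auto)
  then show ?thesis using that g by blast
qed

lemma smooth_local_inverse_real:
  fixes h :: "real \<Rightarrow> real"
  assumes "open S" "smooth_on S h" "p \<in> S" "frechet_derivative h (at p) 1 \<noteq> 0"
  obtains U V g where "open U" "p \<in> U" "U \<subseteq> S" "open V" "homeomorphism U V h g" "smooth_on V g"
proof -
  let ?D = "\<lambda>q. frechet_derivative h (at q) 1"
  have D: "frechet_derivative h (at q) v = v * ?D q" if "q \<in> S" for q v
    using linear_cmul[OF has_derivative_linear[OF smooth_on_has_derivative[OF assms(2) that]], of v 1]
    by simp
  define T where "T = {q \<in> S. ?D q \<noteq> 0}"
  have "T = S \<inter> ?D -` (- {0})" by (auto simp: T_def)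
  then have "open T"
    using continuous_open_preimage[OF smooth_on_continuous[OF smooth_on_frechet[OF assms(2)]] assms(1)]
    by (metis open_Compl closed_singleton)
  then have "smooth_on T (\<lambda>q. v / ?D q)" for v
    by (intro smooth_intros smooth_on_subset[OF assms(2)]) (auto simp: T_def)
  moreover have "q \<in> T \<and> frechet_derivative h (at q) (v / ?D q) = v"
    if "q \<in> S" "inj (frechet_derivative h (at q))" for q v
  proof -
    have "?D q \<noteq> 0"
      using that D[OF that(1)] inj_eq[OF that(2), of 1 0] by (metis mult_zero_left zero_neq_one)
    then show ?thesis using that D[OF that(1), of "v / ?D q"] by (simp add: T_def)
  qed
  moreover have "inj (frechet_derivative h (at p))"
    by (rule injI) (metis D[OF assms(3)] assms(4) mult_right_cancel)
  ultimately show ?thesis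
    using smooth_local_inverse[OF assms(1-3), of T "\<lambda>v q. v / ?D q"] that by blast
qed

lemma smooth_local_inverse_plane:
  fixes h :: "real^2 \<Rightarrow> real^2"
  assumes "open S" "smooth_on S h" "p \<in> S" "det (matrix (frechet_derivative h (at p))) \<noteq> 0"
  obtains U V g where "open U" "p \<in> U" "U \<subseteq> S" "open V" "homeomorphism U V h g" "smooth_on V g"
proof -
  let ?D = "\<lambda>q. matrix (frechet_derivative h (at q))"
  have lin: "linear (frechet_derivative h (at q))" if "q \<in> S" for q
    using has_derivative_linear[OF smooth_on_has_derivative[OF assms(2) that]] .
  have D: "frechet_derivative h (at q) v = ?D q *v v" if "q \<in> S" for q v
    using lin[OF that] by simp
  define T where "T = {q \<in> S. det (?D q) \<noteq> 0}"
  have "smooth_on S (\<lambda>q. ?D q $ i $ j)" for i j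
    unfolding matrix_def by (simp add: smooth_on_nth assms smooth_on_frechet)
  then have sD: "smooth_on S ?D"
    by (intro smooth_on_vec assms)
  have "T = S \<inter> (\<lambda>q. det (?D q)) -` (- {0})" by (auto simp: T_def)
  moreover have "continuous_on S (\<lambda>q. det (?D q))"
    by (intro smooth_on_continuous smooth_on_det smooth_on_nth assms sD)
  ultimately have "open T"
    using continuous_open_preimage assms(1) by (metis open_Compl closed_singleton)
  then have "smooth_on T (\<lambda>q. matrix_inv (?D q) *v v)" for v
    unfolding matrix_vector_mult_def
    by (intro smooth_on_vec) (simp_all, intro smooth_on_sum smooth_on_mult smooth_on_const smooth_on_nth
        smooth_on_matrix_inv smooth_on_subset[OF sD], auto simp: T_def)
  moreover have "q \<in> T \<and> frechet_derivative h (at q) (matrix_inv (?D q) *v v) = v"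
    if "q \<in> S" "inj (frechet_derivative h (at q))" for q v
  proof -
    have "det (?D q) \<noteq> 0"
      using that lin[OF that(1)] det_nz_iff_inj by blast
    then show ?thesis using that D[OF that(1), of "matrix_inv (?D q) *v v"]
      by (simp add: T_def matrix_vector_mul_assoc matrix_inv_inverse)
  qed
  moreover have "inj (frechet_derivative h (at p))"
    using lin[OF assms(3)] det_nz_iff_inj assms(4) by blast
  ultimately show ?thesis
    using smooth_local_inverse[OF assms(1-3), of T "\<lambda>v q. matrix_inv (?D q) *v v"] that by blast
qed

section \<open>The scalar product of signature (2,3) and its isometries\<close>

lemma exhaust_5: fixes x :: 5 shows "x = 0 \<or> x = 1 \<or> x = 2 \<or> x = 3 \<or> x = 4"
proof (induct x)
  case (of_int z)
  then have "0 \<le> z" "z < 5" by simp_all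
  then have "z = 0 \<or> z = 1 \<or> z = 2 \<or> z = 3 \<or> z = 4" by arith
  then show ?case by auto
qed

lemma forall_5: "(\<forall>i::5. P i) \<longleftrightarrow> P 0 \<and> P 1 \<and> P 2 \<and> P 3 \<and> P 4"
  by (metis exhaust_5)

lemma UNIV_5: "(UNIV :: 5 set) = {0, 1, 2, 3, 4}"
  using exhaust_5 by auto

lemma sum_5: "sum f (UNIV :: 5 set) = f 0 + f 1 + f 2 + f 3 + f 4"
  unfolding UNIV_5 by (simp add: add.assoc)

lemma scal_commute: "scal X Y = scal Y X"
  by (simp add: scal_def algebra_simps)

definition flip :: "real^5 \<Rightarrow> real^5" where
  "flip X = (\<chi> i. if i = 0 then - X$4 else if i = 4 then - X$0 else if i = 1 then - X$1 else X$i)"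

lemma scal_flip: "scal X Y = flip X \<bullet> Y"
  by (simp add: scal_def flip_def inner_vec_def sum_5)

lemma flip_flip [simp]: "flip (flip X) = X"
  by (simp add: flip_def vec_eq_iff forall_5)

lemma linear_flip: "linear flip"
  by (rule linearI) (simp_all add: flip_def vec_eq_iff forall_5)

lemma bounded_bilinear_scal: "bounded_bilinear scal"
proof -
  interpret f: bounded_linear flip
    using linear_flip linear_conv_bounded_linear by blast
  show ?thesis
    unfolding scal_flip[abs_def] by (rule bounded_bilinear.comp1[OF bounded_bilinear_inner f.bounded_linear_axioms])
qed

interpretation scal: bounded_bilinear scal
  by (rule bounded_bilinear_scal)

lemmas scal_simps = scal.add_left scal.add_right scal.diff_left scal.diff_right scal.scaleR_left
  scal.scaleR_right scal.minus_left scal.minus_right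

lemma scal_nondegenerate: "(\<And>Y. scal X Y = 0) \<Longrightarrow> X = 0"
  by (metis scal_flip flip_flip inner_eq_zero_iff linear_0 linear_flip)

lemma scal_eqI: "(\<And>Y. scal X Y = scal X' Y) \<Longrightarrow> X = X'"
  using scal_nondegenerate[of "X - X'"] by (simp add: scal_simps)

definition Jm :: "real^5^5" where "Jm = matrix flip"

lemma Jm_mult [simp]: "Jm *v X = flip X"
  unfolding Jm_def using linear_flip by simp

lemma Jm_square: "Jm ** Jm = mat 1"
  by (simp add: matrix_eq matrix_vector_mul_assoc[symmetric])

lemma transpose_Jm: "transpose Jm = Jm"
proof -
  have "(transpose Jm *v X) \<bullet> Y = (Jm *v X) \<bullet> Y" for X Y
  proof -
    have "(transpose Jm *v X) \<bullet> Y = X \<bullet> flip Y"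
      by (simp add: transpose_matrix_vector dot_lmul_matrix)
    then show ?thesis using scal_commute[of X Y] by (simp add: scal_flip inner_commute)
  qed
  then have "transpose Jm *v X = Jm *v X" for X
    using vector_eq_rdot by blast
  then show ?thesis using matrix_eq by blast
qed

text \<open>The adjoint with respect to the scalar product.\<close>

definition adj :: "real^5^5 \<Rightarrow> real^5^5" where
  "adj M = Jm ** transpose M ** Jm"

lemma scal_adj: "scal (M *v X) Y = scal X (adj M *v Y)"
proof -
  have "scal X (adj M *v Y) = flip (adj M *v Y) \<bullet> X"
    by (metis scal_commute scal_flip)
  also have "\<dots> = (transpose M *v flip Y) \<bullet> X"
    by (simp add: adj_def matrix_vector_mul_assoc[symmetric])
  also have "\<dots> = flip Y \<bullet> (M *v X)"
    by (simp add: transpose_matrix_vector dot_lmul_matrix)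
  finally show ?thesis by (metis scal_commute scal_flip)
qed

lemma adj_unique: "(\<And>X Y. scal (M *v X) Y = scal X (N *v Y)) \<Longrightarrow> N = adj M"
  by (simp add: matrix_eq) (metis scal_adj scal_commute scal_eqI)

lemma adj_mult: "adj (M ** N) = adj N ** adj M"
  by (rule adj_unique[symmetric]) (simp add: matrix_vector_mul_assoc[symmetric] scal_adj)

lemma adj_adj: "adj (adj M) = M"
  by (rule adj_unique[symmetric]) (metis scal_adj scal_commute)

lemma linear_adj: "linear adj"
  by (rule linearI; rule adj_unique[symmetric])
     (simp_all add: matrix_vector_mult_add_rdistrib scaleR_matrix_vector_assoc[symmetric] scal_simps scal_adj)

lemma det_Jm_square: "det Jm * det Jm = 1"
  using det_mul[of Jm Jm] Jm_square by (simp add: det_I)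

lemma det_adj: "det (adj M) = det M"
  using det_Jm_square by (simp add: adj_def det_mul det_transpose algebra_simps)

lemma isometries_iff: "F \<in> isometries \<longleftrightarrow> adj F ** F = mat 1"
  unfolding isometries_def mem_Collect_eq
proof
  assume F: "\<forall>X Y. scal (F *v X) (F *v Y) = scal X Y"
  have "(adj F ** F) *v Y = Y" for Y
    by (rule scal_eqI) (metis F scal_adj scal_commute matrix_vector_mul_assoc)
  then show "adj F ** F = mat 1" by (simp add: matrix_eq)
qed (simp add: scal_adj matrix_vector_mul_assoc)

lemma isometry_scal: "F \<in> isometries \<Longrightarrow> scal (F *v X) (F *v Y) = scal X Y"
  by (simp add: isometries_def)

lemma isometry_det:
  assumes "F \<in> isometries" shows "det F * det F = 1"
  using assms det_mul[of "adj F" F] by (simp add: isometries_iff det_adj det_I)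

lemma isometries_mat_1: "mat 1 \<in> isometries"
  by (simp add: isometries_def)

lemma isometries_mult: "F \<in> isometries \<Longrightarrow> F' \<in> isometries \<Longrightarrow> F ** F' \<in> isometries"
  by (simp add: isometries_def matrix_vector_mul_assoc[symmetric])

lemma G_group_isometries: "G_group \<subseteq> isometries"
  unfolding G_group_def by (rule connected_component_subset)

lemma column_mult: "column j (M ** N) = M *v column j N"
  by (simp add: column_def matrix_vector_mult_def matrix_matrix_mult_def vec_eq_iff)

lemma column_eq_mult_axis: "column j M = M *v axis j 1"
  by (simp add: column_def matrix_vector_mult_def axis_def vec_eq_iff if_distrib cong: if_cong)

lemma scal_axis: "scal (axis i 1) (axis j 1) =
    (if i = 0 \<and> j = 4 \<or> i = 4 \<and> j = 0 \<or> i = 1 \<and> j = 1 then -1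
     else if i = 2 \<and> j = 2 \<or> i = 3 \<and> j = 3 then 1 else 0)"
proof -
  have "\<forall>i j::5. scal (axis i 1) (axis j 1) =
    (if i = 0 \<and> j = 4 \<or> i = 4 \<and> j = 0 \<or> i = 1 \<and> j = 1 then -1
     else if i = 2 \<and> j = 2 \<or> i = 3 \<and> j = 3 then 1 else 0)"
    unfolding forall_5 by (simp add: scal_def axis_def)
  then show ?thesis by blast
qed

lemma isometry_column_scal:
  "F \<in> isometries \<Longrightarrow> scal (column i F) (column j F) =
    (if i = 0 \<and> j = 4 \<or> i = 4 \<and> j = 0 \<or> i = 1 \<and> j = 1 then -1
     else if i = 2 \<and> j = 2 \<or> i = 3 \<and> j = 3 then 1 else 0)"
  unfolding column_eq_mult_axis isometry_scal scal_axis ..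

lemma isometryI:
  assumes "\<And>i j. scal (column i F) (column j F) = scal (axis i 1) (axis j 1)"
  shows "F \<in> isometries"
proof -
  have exp: "X = (\<Sum>i\<in>UNIV. X $ i *\<^sub>R axis i 1)" for X :: "real^5"
    using basis_expansion[of X] by (simp add: scalar_mult_eq_scaleR)
  have "scal (F *v X) (F *v Y) = scal X Y" for X Y
  proof -
    have F: "F *v X = (\<Sum>i\<in>UNIV. X $ i *\<^sub>R column i F)" for X
      by (simp add: matrix_mult_sum scalar_mult_eq_scaleR)
    have "scal (F *v X) (F *v Y) = (\<Sum>i\<in>UNIV. \<Sum>j\<in>UNIV. Y $ i * (X $ j * scal (axis j 1) (axis i 1)))"
      unfolding F scal.sum_left scal.sum_right by (simp add: scal_simps assms)
    also have "\<dots> = scal (\<Sum>i\<in>UNIV. X $ i *\<^sub>R axis i 1) (\<Sum>i\<in>UNIV. Y $ i *\<^sub>R axis i 1)"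
      unfolding scal.sum_left scal.sum_right by (simp add: scal_simps)
    finally show ?thesis using exp by metis
  qed
  then show ?thesis by (simp add: isometries_def)
qed

subsection \<open>The volume form\<close>

definition rows5 :: "real^5 \<Rightarrow> real^5 \<Rightarrow> real^5 \<Rightarrow> real^5 \<Rightarrow> real^5 \<Rightarrow> real^5^5" where
  "rows5 a b c d e = (\<chi> i. if i = 0 then a else if i = 1 then b else if i = 2 then c
     else if i = 3 then d else e)"

lemma rows5_nth [simp]: "rows5 a b c d e $ 0 = a" "rows5 a b c d e $ 1 = b"
  "rows5 a b c d e $ 2 = c" "rows5 a b c d e $ 3 = d" "rows5 a b c d e $ 4 = e"
  by (simp_all add: rows5_def)

definition vol :: "real^5 \<Rightarrow> real^5 \<Rightarrow> real^5 \<Rightarrow> real^5 \<Rightarrow> real^5 \<Rightarrow> real" where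
  "vol a b c d e = det (rows5 a b c d e)"

lemma linear_det_row:
  fixes C :: "'n::finite \<Rightarrow> real^'n"
  shows "linear (\<lambda>x. det (\<chi> i. if i = k then x else C i))"
proof (rule linearI)
  show "det (\<chi> i. if i = k then x + y else C i) = det (\<chi> i. if i = k then x else C i) + det (\<chi> i. if i = k then y else C i)" for x y
    using det_row_add[of k "\<lambda>_. x" "\<lambda>_. y" C] .
  show "det (\<chi> i. if i = k then r *\<^sub>R x else C i) = r *\<^sub>R det (\<chi> i. if i = k then x else C i)" for r x
  proof -
    have "r *\<^sub>R x = r *s x" by (simp add: vec_eq_iff)
    then show ?thesis using det_row_mul[of k r "\<lambda>_. x" C] by (simp only: real_scaleR_def)
  qed
qed

lemma linear_vol:
  "linear (\<lambda>x. vol x b c d e)" "linear (\<lambda>x. vol a x c d e)" "linear (\<lambda>x. vol a b x d e)"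
  "linear (\<lambda>x. vol a b c x e)" "linear (\<lambda>x. vol a b c d x)"
proof -
  have *: "rows5 x b c d e = (\<chi> i. if i = 0 then x else rows5 x b c d e $ i)"
    "rows5 a x c d e = (\<chi> i. if i = 1 then x else rows5 a x c d e $ i)"
    "rows5 a b x d e = (\<chi> i. if i = 2 then x else rows5 a b x d e $ i)"
    "rows5 a b c x e = (\<chi> i. if i = 3 then x else rows5 a b c x e $ i)"
    "rows5 a b c d x = (\<chi> i. if i = 4 then x else rows5 a b c d x $ i)" for x
    by (simp_all add: vec_eq_iff forall_5)
  have **: "(\<lambda>x. vol x b c d e) = (\<lambda>x. det (\<chi> i. if i = 0 then x else rows5 0 b c d e $ i))"
    "(\<lambda>x. vol a x c d e) = (\<lambda>x. det (\<chi> i. if i = 1 then x else rows5 a 0 c d e $ i))"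
    "(\<lambda>x. vol a b x d e) = (\<lambda>x. det (\<chi> i. if i = 2 then x else rows5 a b 0 d e $ i))"
    "(\<lambda>x. vol a b c x e) = (\<lambda>x. det (\<chi> i. if i = 3 then x else rows5 a b c 0 e $ i))"
    "(\<lambda>x. vol a b c d x) = (\<lambda>x. det (\<chi> i. if i = 4 then x else rows5 a b c d 0 $ i))"
    unfolding vol_def by (intro ext arg_cong[of _ _ det]; simp add: vec_eq_iff forall_5)+
  show "linear (\<lambda>x. vol x b c d e)" "linear (\<lambda>x. vol a x c d e)" "linear (\<lambda>x. vol a b x d e)"
    "linear (\<lambda>x. vol a b c x e)" "linear (\<lambda>x. vol a b c d x)"
    unfolding ** by (rule linear_det_row)+
qed

lemmas vol_linear = linear_vol[THEN linear_add] linear_vol[THEN linear_cmul]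
  linear_vol[THEN linear_diff] linear_vol[THEN linear_0] linear_vol[THEN linear_neg]

lemma vol_alternating [simp]:
  "vol a a c d e = 0" "vol a b a d e = 0" "vol a b c a e = 0" "vol a b c d a = 0"
  "vol a b b d e = 0" "vol a b c b e = 0" "vol a b c d b = 0"
  "vol a b c c e = 0" "vol a b c d c = 0" "vol a b c d d = 0"
  unfolding vol_def
  by (rule det_identical_rows[of 0 1] det_identical_rows[of 0 2] det_identical_rows[of 0 3]
      det_identical_rows[of 0 4] det_identical_rows[of 1 2] det_identical_rows[of 1 3]
      det_identical_rows[of 1 4] det_identical_rows[of 2 3] det_identical_rows[of 2 4]
      det_identical_rows[of 3 4]; simp add: row_def; fail)+

lemma vol_swap: "vol a c b d e = - vol a b c d e"
  using vol_alternating(5)[of a "b + c" d e] unfolding vol_linear by simp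

lemma smooth_on_vol:
  assumes "open S" "smooth_on S a" "smooth_on S b" "smooth_on S c" "smooth_on S d" "smooth_on S e"
  shows "smooth_on S (\<lambda>x. vol (a x) (b x) (c x) (d x) (e x))"
  unfolding vol_def
proof (rule smooth_on_det[OF assms(1)])
  fix i j :: 5
  show "smooth_on S (\<lambda>x. rows5 (a x) (b x) (c x) (d x) (e x) $ i $ j)"
    using exhaust_5[of i] by (elim disjE) (simp_all add: smooth_on_nth assms)
qed

text \<open>A nonzero volume means that the five vectors span, so that no nonzero vector is orthogonal
  to all of them.\<close>

lemma vol_nonzero_orthogonal:
  assumes "vol a b c d e \<noteq> 0"
    and "scal X a = 0" "scal X b = 0" "scal X c = 0" "scal X d = 0" "scal X e = 0"
  shows "X = 0"
proof -
  let ?M = "rows5 a b c d e"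
  have "?M *v flip X = 0"
    using assms(2-) by (simp add: vec_eq_iff forall_5 matrix_vector_mul_component scal_flip inner_commute)
  then have "flip X = 0"
    using assms(1) unfolding vol_def
    by (metis matrix_inv_inverse(2) matrix_vector_mul_assoc matrix_vector_mul_lid matrix_vector_mult_0_right)
  then show ?thesis by (metis flip_flip linear_0 linear_flip)
qed

text \<open>Four independent vectors do not span the space; they are completed by any vector outside their
  span.\<close>

lemma vol_nonzero_exists:
  assumes "\<And>p q r s. p *\<^sub>R a + q *\<^sub>R b + r *\<^sub>R c + s *\<^sub>R e = 0 \<Longrightarrow> p = 0 \<and> q = 0 \<and> r = 0 \<and> s = 0"
  shows "\<exists>X. vol a b c X e \<noteq> 0"
proof -
  have "dim (span {a, b, c, e}) \<le> card {a, b, c, e}"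
    by (simp add: dim_le_card')
  also have "\<dots> \<le> 4" by (simp add: card_insert_if)
  finally have "dim (span {a, b, c, e}) < DIM(real^5)" by simp
  then have "span {a, b, c, e} \<noteq> (UNIV :: (real^5) set)"
    using dim_UNIV[where 'a="real^5"] by (metis dim_span less_irrefl)
  then obtain X where X: "X \<notin> span {a, b, c, e}" by blast
  let ?M = "transpose (rows5 a b c X e)"
  have M: "?M *v v = v$0 *\<^sub>R a + v$1 *\<^sub>R b + v$2 *\<^sub>R c + v$3 *\<^sub>R X + v$4 *\<^sub>R e" for v
    unfolding matrix_mult_sum sum_5 by (simp add: scalar_mult_eq_scaleR row_def)
  have "v = 0" if "?M *v v = 0" for v
  proof -
    have "v$3 = 0"
    proof (rule ccontr)
      assume v: "v$3 \<noteq> 0"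
      have "v$3 *\<^sub>R X = - (v$0 *\<^sub>R a + v$1 *\<^sub>R b + v$2 *\<^sub>R c + v$4 *\<^sub>R e)"
        using that unfolding M by (simp add: eq_neg_iff_add_eq_0 algebra_simps)
      also have "\<dots> \<in> span {a, b, c, e}"
        by (intro span_neg span_add span_scale) (auto intro: span_base)
      finally have "(1 / v$3) *\<^sub>R v$3 *\<^sub>R X \<in> span {a, b, c, e}" by (rule span_scale)
      then show False using v X by simp
    qed
    then show ?thesis
      using that assms[of "v$0" "v$1" "v$2" "v$4"] unfolding M by (simp add: vec_eq_iff forall_5)
  qed
  then have "invertible ?M"
    using matrix_left_invertible_ker[of ?M] invertible_left_inverse by blast
  then have "det ?M \<noteq> 0" by (simp add: invertible_det_nz)
  then show ?thesis unfolding vol_def det_transpose by blast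
qed

subsection \<open>The identity component\<close>

definition reflection :: "real^5 \<Rightarrow> real^5^5" where
  "reflection v = (\<chi> i j. (if i = j then 1 else 0) - (2 / scal v v) * v $ i * flip v $ j)"

lemma reflection_mult: "reflection v *v X = X - (2 * scal v X / scal v v) *\<^sub>R v"
proof -
  have "(\<Sum>j\<in>UNIV. ((if i = j then 1 else 0) - (2 / scal v v) * v $ i * flip v $ j) * X $ j)
      = X $ i - (2 / scal v v) * v $ i * (flip v \<bullet> X)" for i
    by (simp add: left_diff_distrib sum_subtractf inner_vec_def sum_distrib_left sum.delta' mult.assoc
        if_distrib[of "\<lambda>u. u * _"] cong: if_cong)
  then show ?thesis
    by (simp add: vec_eq_iff reflection_def matrix_vector_mult_def scal_flip)
qed

lemma reflection_isometry:
  assumes "scal v v \<noteq> 0" shows "reflection v \<in> isometries"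
  using assms unfolding isometries_def mem_Collect_eq reflection_mult
  by (auto simp: scal_simps scal_commute field_simps)

lemma reflection_square:
  assumes "scal v v \<noteq> 0" shows "reflection v ** reflection v = mat 1"
  using assms
  by (simp add: matrix_eq matrix_vector_mul_assoc[symmetric] reflection_mult scal_simps)

lemma reflection_minus: "reflection (- v) = reflection v"
  by (simp add: matrix_eq reflection_mult scal_simps)

abbreviation joined :: "real^5^5 \<Rightarrow> real^5^5 \<Rightarrow> bool" where
  "joined \<equiv> connected_component isometries"

lemma continuous_on_matrix_mult:
  "continuous_on S h \<Longrightarrow> continuous_on S g \<Longrightarrow> continuous_on S (\<lambda>x. (h x :: real^'n^'m) ** (g x :: real^'k^'n))"
  unfolding matrix_matrix_mult_def by (intro continuous_intros)

lemma joined_mult_left: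
  assumes "joined F F'" "H \<in> isometries" shows "joined (H ** F) (H ** F')"
proof -
  obtain T where T: "connected T" "T \<subseteq> isometries" "F \<in> T" "F' \<in> T"
    using assms(1) by (auto simp: connected_component_def)
  have "connected ((**) H ` T)"
    by (intro connected_continuous_image T continuous_on_matrix_mult continuous_intros)
  moreover have "(**) H ` T \<subseteq> isometries" using T assms(2) isometries_mult by blast
  ultimately show ?thesis using T unfolding connected_component_def by blast
qed

lemma joined_mult_right:
  assumes "joined F F'" "H \<in> isometries" shows "joined (F ** H) (F' ** H)"
proof -
  obtain T where T: "connected T" "T \<subseteq> isometries" "F \<in> T" "F' \<in> T"
    using assms(1) by (auto simp: connected_component_def)
  have "connected ((\<lambda>F. F ** H) ` T)"
    by (intro connected_continuous_image T continuous_on_matrix_mult continuous_intros)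
  moreover have "(\<lambda>F. F ** H) ` T \<subseteq> isometries" using T assms(2) isometries_mult by blast
  ultimately show ?thesis using T unfolding connected_component_def by blast
qed

lemma joined_det:
  assumes "joined F F'" shows "det F = det F'"
proof -
  obtain T where T: "connected T" "T \<subseteq> isometries" "F \<in> T" "F' \<in> T"
    using assms(1) by (auto simp: connected_component_def)
  have "det H = 1 \<or> det H = -1" if "H \<in> T" for H
    using isometry_det[of H] T(2) that by (metis power2_eq_1_iff power2_eq_square subsetD)
  then have fin: "finite (det ` T)"
    by (intro finite_subset[of "det ` T" "{1, -1}"]) auto
  have "continuous_on T det"
    unfolding det_def by (intro continuous_intros)
  then have "connected (det ` T)"
    using T(1) connected_continuous_image by blast
  then have "\<exists>c. det ` T \<subseteq> {c}"
    using fin by (metis connected_finite_iff_sing empty_subsetI order_refl)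
  then show ?thesis using T by blast
qed

text \<open>A vector \<open>v\<close> whose square has the same sign as that of \<open>e\<close> is joined to \<open>e\<close> by a straight
  segment of vectors with this property as soon as \<open>scal v e\<close> does not have the opposite sign. One
  of \<open>v\<close>, \<open>- v\<close> satisfies this, and both define the same reflection.\<close>

lemma joined_reflection:
  assumes e: "scal e e = 1 \<or> scal e e = -1" and v: "scal v v * scal e e > 0"
  shows "joined (reflection v) (reflection e)"
proof -
  have main: "joined (reflection v) (reflection e)"
    if v: "scal v v * scal e e > 0" and ve: "scal v e * scal e e \<ge> 0" for v
  proof -
    define g where "g t = (1 - t) *\<^sub>R v + t *\<^sub>R e" for t :: real
    have ee: "scal e e * scal e e = 1" using e by auto
    have pos: "scal (g t) (g t) * scal e e > 0" if t: "t \<in> {0..1}" for t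
    proof -
      have "scal (g t) (g t) * scal e e = (1 - t) * (1 - t) * (scal v v * scal e e)
          + 2 * (t * (1 - t)) * (scal v e * scal e e) + t * t * (scal e e * scal e e)"
        unfolding g_def by (simp add: scal_simps scal_commute[of e v] algebra_simps)
      moreover have "t * (1 - t) \<ge> 0" using t by auto
      moreover have "(1 - t) * (1 - t) * (scal v v * scal e e) + t * t > 0"
      proof (cases "t = 0")
        case False
        then have "0 < t * t" by (auto simp: zero_less_mult_iff)
        then show ?thesis using v by (intro add_nonneg_pos mult_nonneg_nonneg[of "_ * _"]) auto
      qed (use v in simp)
      ultimately show ?thesis using ve ee
        by (smt (verit) mult_cancel_left1 mult_nonneg_nonneg)
    qed
    have "continuous_on {0..1} (\<lambda>t. flip (g t))"
      unfolding g_def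
      by (intro linear_continuous_on_compose[OF _ linear_flip]) (intro continuous_intros)
    moreover have "continuous_on {0..1} g"
      unfolding g_def by (intro continuous_intros)
    moreover have "continuous_on {0..1} (\<lambda>t. scal (g t) (g t))"
      unfolding g_def by (intro scal.continuous_on continuous_intros)
    moreover have "scal (g t) (g t) \<noteq> 0" if "t \<in> {0..1}" for t
      using pos[OF that] by auto
    ultimately have "continuous_on {0..1} (\<lambda>t. reflection (g t))"
      unfolding reflection_def by (intro continuous_intros) auto
    then have "connected ((\<lambda>t. reflection (g t)) ` {0..1})"
      by (intro connected_continuous_image) auto
    moreover have "(\<lambda>t. reflection (g t)) ` {0..1} \<subseteq> isometries"
      using pos by (force intro!: reflection_isometry)
    moreover have "reflection v \<in> (\<lambda>t. reflection (g t)) ` {0..1}"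
      by (rule image_eqI[of _ _ 0]) (auto simp: g_def)
    moreover have "reflection e \<in> (\<lambda>t. reflection (g t)) ` {0..1}"
      by (rule image_eqI[of _ _ 1]) (auto simp: g_def)
    ultimately show ?thesis unfolding connected_component_def by blast
  qed
  show ?thesis
  proof (cases "scal v e * scal e e \<ge> 0")
    case True
    then show ?thesis using main[OF v] by blast
  next
    case False
    then have "joined (reflection (- v)) (reflection e)"
      using v by (intro main) (auto simp: scal_simps)
    then show ?thesis by (simp add: reflection_minus)
  qed
qed

definition R1 :: "real^5^5" where "R1 = reflection (axis 1 1)"
definition R2 :: "real^5^5" where "R2 = reflection (axis 2 1)"

lemma R1_R2:
  "R1 \<in> isometries" "R2 \<in> isometries" "R1 ** R1 = mat 1" "R2 ** R2 = mat 1" "R1 ** R2 = R2 ** R1"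
  unfolding R1_def R2_def
  by (simp_all add: reflection_isometry reflection_square scal_axis matrix_eq
      matrix_vector_mul_assoc[symmetric] reflection_mult scal_simps algebra_simps)

lemma det_R: "det R1 = -1" "det R2 = -1"
proof -
  have R: "R1 = (\<chi> i j. if i = j then if i = 1 then - 1 else 1 else 0)"
    "R2 = (\<chi> i j. if i = j then if i = 2 then - 1 else 1 else 0)"
    by (simp_all add: R1_def R2_def reflection_def vec_eq_iff forall_5 flip_def axis_def scal_def)
  have d: "det ((\<chi> i j. if i = j then if i = k then - 1 else 1 else 0) :: real^5^5) = -1" for k
    by (subst det_diagonal) simp_all
  show "det R1 = -1" "det R2 = -1" by (simp_all only: R d)
qed

text \<open>The isometries in the components of four standard ones. These turn out to be all isometries.\<close>

definition component_reps :: "(real^5^5) set" where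
  "component_reps = {F \<in> isometries. \<exists>K \<in> {mat 1, R1, R2, R1 ** R2}. joined F K}"

lemma component_reps_reflection:
  assumes "F \<in> component_reps" "scal v v \<noteq> 0"
  shows "reflection v ** F \<in> component_reps"
proof -
  obtain K where K: "K \<in> {mat 1, R1, R2, R1 ** R2}" "joined F K" and F: "F \<in> isometries"
    using assms(1) by (auto simp: component_reps_def)
  have "\<exists>R\<in>{R1, R2}. joined (reflection v) R"
  proof (cases "scal v v > 0")
    case True
    then show ?thesis
      using joined_reflection[of "axis 2 1" v] by (auto simp: scal_axis R2_def)
  next
    case False
    then show ?thesis
      using joined_reflection[of "axis 1 1" v] assms(2) by (auto simp: scal_axis R1_def)
  qed
  then obtain R where R: "R \<in> {R1, R2}" "joined (reflection v) R" by blast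
  have iso: "R \<in> isometries" using R R1_R2 by blast
  have "joined (reflection v ** F) (R ** K)"
    using joined_mult_right[OF R(2) F] joined_mult_left[OF K(2) iso] connected_component_trans by blast
  moreover have "R ** K \<in> {mat 1, R1, R2, R1 ** R2}"
    using R(1) K(1) R1_R2 by (auto simp: matrix_mul_assoc) (metis matrix_mul_assoc matrix_mul_lid matrix_mul_rid)+
  moreover have "reflection v ** F \<in> isometries"
    using F assms(2) reflection_isometry isometries_mult by blast
  ultimately show ?thesis unfolding component_reps_def by blast
qed

lemma component_reps_cancel:
  assumes "reflection v ** F \<in> component_reps" "scal v v \<noteq> 0"
  shows "F \<in> component_reps"
proof -
  have "reflection v ** (reflection v ** F) \<in> component_reps"
    by (rule component_reps_reflection[OF assms])
  then show ?thesis by (simp add: matrix_mul_assoc reflection_square[OF assms(2)])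
qed

text \<open>If \<open>F\<close> moves \<open>e\<close>, one or two reflections bring \<open>F e\<close> back to \<open>e\<close>; they fix the vectors
  orthogonal to \<open>e\<close> that \<open>F\<close> fixes.\<close>

lemma component_reps_step:
  assumes IH: "\<And>F. F \<in> isometries \<Longrightarrow> (\<forall>q\<in>insert e Q. F *v q = q) \<Longrightarrow> F \<in> component_reps"
    and e: "scal e e \<noteq> 0" "\<forall>q\<in>Q. scal e q = 0"
    and F: "F \<in> isometries" "\<forall>q\<in>Q. F *v q = q"
  shows "F \<in> component_reps"
proof -
  let ?v = "F *v e"
  have vv: "scal ?v ?v = scal e e" using isometry_scal[OF F(1)] by simp
  have vq: "scal ?v q = 0" if "q \<in> Q" for q
    using isometry_scal[OF F(1), of e q] F(2) e(2) that by simp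
  show ?thesis
  proof (cases "scal (?v - e) (?v - e) = 0")
    case False
    have "reflection (?v - e) *v ?v = e"
    proof -
      have "2 * scal (?v - e) ?v = scal (?v - e) (?v - e)"
        using vv by (simp add: scal_simps scal_commute)
      then show ?thesis using False by (simp add: reflection_mult)
    qed
    moreover have "reflection (?v - e) *v q = q" if "q \<in> Q" for q
      using vq that e(2) by (simp add: reflection_mult scal_simps)
    ultimately have "reflection (?v - e) ** F \<in> component_reps"
      using F reflection_isometry[OF False]
      by (intro IH isometries_mult) (auto simp: matrix_vector_mul_assoc[symmetric])
    then show ?thesis using False component_reps_cancel by blast
  next
    case True
    have "scal (?v - e) (?v - e) + scal (?v + e) (?v + e) = 4 * scal e e"
      using vv by (simp add: scal_simps scal_commute)
    then have nz: "scal (?v + e) (?v + e) \<noteq> 0" using True e by simp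
    have "reflection (?v + e) *v ?v = - e"
    proof -
      have "2 * scal (?v + e) ?v = scal (?v + e) (?v + e)"
        using vv by (simp add: scal_simps scal_commute)
      then show ?thesis using nz by (simp add: reflection_mult)
    qed
    moreover have "reflection e *v (- e) = e"
      using e(1) by (simp add: reflection_mult scal_simps vec_eq_iff)
    moreover have "reflection (?v + e) *v q = q" "reflection e *v q = q" if "q \<in> Q" for q
      using vq that e(2) by (simp_all add: reflection_mult scal_simps)
    ultimately have "reflection e ** (reflection (?v + e) ** F) \<in> component_reps"
      using F reflection_isometry[OF nz] reflection_isometry[OF e(1)]
      by (intro IH isometries_mult) (auto simp: matrix_vector_mul_assoc[symmetric])
    then show ?thesis using component_reps_cancel e(1) nz by blast
  qed
qed

text \<open>The argument of Cartan and Dieudonne: composition with reflections makes an isometry fix the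
  vectors of an orthogonal basis one after the other, and each reflection is joined to \<open>R1\<close> or \<open>R2\<close>.\<close>

lemma isometries_component_reps: "isometries \<subseteq> component_reps"
proof -
  let ?q0 = "axis 0 1 + axis 4 1 :: real^5" and ?q4 = "axis 4 1 - axis 0 1 :: real^5"
  let ?q1 = "axis 1 1 :: real^5" and ?q2 = "axis 2 1 :: real^5" and ?q3 = "axis 3 1 :: real^5"
  have base: "F \<in> component_reps"
    if F: "F \<in> isometries" "\<forall>q\<in>{?q4, ?q3, ?q2, ?q1, ?q0}. F *v q = q" for F
  proof -
    have s: "F *v axis 0 1 + F *v axis 4 1 = axis 0 1 + axis 4 1"
        "F *v axis 4 1 - F *v axis 0 1 = axis 4 1 - axis 0 1"
      using F(2) by (simp_all add: matrix_vector_right_distrib matrix_vector_mult_diff_distrib)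
    have "2 *\<^sub>R (F *v axis 0 1) = 2 *\<^sub>R axis 0 1" "2 *\<^sub>R (F *v axis 4 1) = 2 *\<^sub>R axis 4 1"
      using arg_cong2[OF s, of "(-)"] arg_cong2[OF s, of "(+)"] by (simp_all add: scaleR_2)
    then have "F *v axis 0 1 = axis 0 1" "F *v axis 4 1 = axis 4 1" by simp_all
    then have "\<forall>j. column j F = axis j 1"
      unfolding forall_5 column_eq_mult_axis using F(2) by simp
    then have "F = mat 1"
      by (simp add: vec_eq_iff column_def mat_def axis_def)
    moreover have "mat 1 \<in> component_reps"
      by (simp add: component_reps_def isometries_mat_1 connected_component_refl)
    ultimately show ?thesis by simp
  qed
  have s: "scal ?q0 ?q0 \<noteq> 0" "scal ?q1 ?q1 \<noteq> 0" "scal ?q2 ?q2 \<noteq> 0" "scal ?q3 ?q3 \<noteq> 0" "scal ?q4 ?q4 \<noteq> 0"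
    "scal ?q1 ?q0 = 0" "scal ?q2 ?q0 = 0" "scal ?q3 ?q0 = 0" "scal ?q4 ?q0 = 0"
    "scal ?q2 ?q1 = 0" "scal ?q3 ?q1 = 0" "scal ?q4 ?q1 = 0" "scal ?q3 ?q2 = 0" "scal ?q4 ?q2 = 0"
    "scal ?q4 ?q3 = 0"
    by (simp_all add: scal_simps scal_axis)
  have 4: "F \<in> component_reps" if "F \<in> isometries" "\<forall>q\<in>{?q3, ?q2, ?q1, ?q0}. F *v q = q" for F
    by (rule component_reps_step[OF base _ _ that]) (use s in auto)
  have 3: "F \<in> component_reps" if "F \<in> isometries" "\<forall>q\<in>{?q2, ?q1, ?q0}. F *v q = q" for F
    by (rule component_reps_step[OF 4 _ _ that]) (use s in auto)
  have 2: "F \<in> component_reps" if "F \<in> isometries" "\<forall>q\<in>{?q1, ?q0}. F *v q = q" for F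
    by (rule component_reps_step[OF 3 _ _ that]) (use s in auto)
  have 1: "F \<in> component_reps" if "F \<in> isometries" "\<forall>q\<in>{?q0}. F *v q = q" for F
    by (rule component_reps_step[OF 2 _ _ that]) (use s in auto)
  have 0: "F \<in> component_reps" if "F \<in> isometries" for F
    by (rule component_reps_step[OF 1 _ _ that, of ?q0 "{}"]) (use s in auto)
  show ?thesis using 0 by blast
qed

text \<open>Among the representatives of the components only \<open>mat 1\<close> and \<open>R1 ** R2\<close> have determinant 1.\<close>

lemma det_1_in_G_group:
  assumes "F \<in> isometries" "det F = 1"
  shows "F \<in> G_group \<or> F ** (R1 ** R2) \<in> G_group"
proof -
  obtain K where K: "K \<in> {mat 1, R1, R2, R1 ** R2}" "joined F K"
    using assms isometries_component_reps by (auto simp: component_reps_def)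
  have dR: "det R1 = -1" "det R2 = -1"
    by (simp_all add: det_R)
  have "det K = 1" using joined_det[OF K(2)] assms(2) by simp
  then have "K = mat 1 \<or> K = R1 ** R2" using K(1) dR by auto
  then show ?thesis
  proof
    assume "K = mat 1"
    then show ?thesis using K(2) by (simp add: G_group_def connected_component_sym)
  next
    assume "K = R1 ** R2"
    then have "joined (F ** (R1 ** R2)) (R1 ** R2 ** (R1 ** R2))"
      using joined_mult_right[OF K(2)] R1_R2 isometries_mult by blast
    moreover have "R1 ** R2 ** (R1 ** R2) = mat 1"
      by (metis R1_R2(3-5) matrix_mul_assoc matrix_mul_lid)
    ultimately show ?thesis by (simp add: G_group_def connected_component_sym)
  qed
qed

subsection \<open>The Lie algebra and its Killing form\<close>

lemma matrix_vector_mult_minus: "(- M) *v X = - (M *v (X :: real^'n))"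
  by (simp add: vec_eq_iff matrix_vector_mult_def sum_negf)

text \<open>The Cayley transform of \<open>t M / 2\<close> is a curve of isometries through the identity with velocity
  \<open>M\<close>, which is smooth by Cramer's rule.\<close>

definition cayley :: "real^5^5 \<Rightarrow> real \<Rightarrow> real^5^5" where
  "cayley M t = matrix_inv (mat 1 - (t / 2) *\<^sub>R M) ** (mat 1 + (t / 2) *\<^sub>R M)"

lemma smooth_on_matrix_mult:
  fixes h :: "'a::real_normed_vector \<Rightarrow> real^'n^'m" and g :: "'a \<Rightarrow> real^'k^'n"
  assumes "open S" "smooth_on S h" "smooth_on S g"
  shows "smooth_on S (\<lambda>x. h x ** g x)"
  unfolding matrix_matrix_mult_def
  by (rule smooth_on_vec[OF assms(1)], rule smooth_on_vec[OF assms(1)])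
     (simp, intro smooth_on_sum smooth_on_mult smooth_on_nth assms)

lemma matrix_mult_scaleR: "(c *\<^sub>R M) *v X = c *\<^sub>R (M *v (X :: real^'n))"
  by (rule scaleR_matrix_vector_assoc[symmetric])

lemmas matrix_mult_simps = matrix_vector_mult_add_rdistrib matrix_vector_mult_diff_rdistrib
  matrix_vector_mul_assoc[symmetric] matrix_mult_scaleR

lemma cayley_isometry:
  assumes M: "adj M = - M" and d: "det (mat 1 - (t / 2) *\<^sub>R M) \<noteq> 0"
  shows "cayley M t \<in> isometries"
proof -
  let ?A = "mat 1 - (t / 2) *\<^sub>R M" and ?B = "mat 1 + (t / 2) *\<^sub>R M"
  have comm: "?A *v (?B *v X) = ?B *v (?A *v X)" for X
    by (simp add: matrix_mult_simps matrix_vector_right_distrib matrix_vector_mult_diff_distrib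
        matrix_vector_mult_scaleR algebra_simps)
  note inv = matrix_inv_inverse[OF d]
  have C: "cayley M t *v (?A *v X) = ?B *v X" for X
  proof -
    have "cayley M t *v (?A *v X) = matrix_inv ?A *v (?A *v (?B *v X))"
      by (simp only: cayley_def matrix_vector_mul_assoc[symmetric] comm)
    also have "\<dots> = (matrix_inv ?A ** ?A) *v (?B *v X)" by (simp only: matrix_vector_mul_assoc matrix_mul_assoc)
    finally show ?thesis by (simp only: inv matrix_vector_mul_lid)
  qed
  have skew: "scal (M *v X) Y = - scal X (M *v Y)" for X Y
    using scal_adj[of M X Y] M by (simp add: matrix_vector_mult_minus scal_simps)
  have AB: "scal (?A *v X) (?A *v Y) = scal (?B *v X) (?B *v Y)" for X Y
    by (simp add: matrix_mult_simps scal_simps skew algebra_simps)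
  have "scal (cayley M t *v X) (cayley M t *v Y) = scal X Y" for X Y
  proof -
    have "X = ?A *v (matrix_inv ?A *v X)" "Y = ?A *v (matrix_inv ?A *v Y)"
      using inv by (simp_all only: matrix_vector_mul_assoc matrix_vector_mul_lid)
    then show ?thesis using C AB by metis
  qed
  then show ?thesis by (simp add: isometries_def)
qed

lemma cayley_curve:
  assumes "adj M = - M"
  obtains e where "e > 0" "smooth_on {-e<..<e} (cayley M)" "cayley M 0 = mat 1"
    "(cayley M has_vector_derivative M) (at 0)" "\<And>t. \<bar>t\<bar> < e \<Longrightarrow> cayley M t \<in> G_group"
    "\<And>t. \<bar>t\<bar> < e \<Longrightarrow> det (mat 1 - (t / 2) *\<^sub>R M) \<noteq> 0"
proof -
  let ?A = "\<lambda>t. mat 1 - (t / 2) *\<^sub>R M"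
  have sA: "smooth_on S ?A" "smooth_on S (\<lambda>t. mat 1 + (t / 2) *\<^sub>R M)" if "open S" for S
    by (intro smooth_on_diff smooth_on_add smooth_on_scaleR smooth_on_const that
        smooth_on_bounded_linear bounded_linear_divide)+
  have "continuous_on UNIV (\<lambda>t. det (?A t))"
    by (intro smooth_on_continuous smooth_on_det smooth_on_nth sA) auto
  then have "isCont (\<lambda>t. det (?A t)) 0"
    by (simp add: continuous_on_eq_continuous_at)
  moreover have "det (?A 0) = 1" by (simp add: det_I)
  ultimately obtain e where e: "e > 0" "\<And>t. dist t 0 < e \<Longrightarrow> dist (det (?A t)) 1 < 1"
    unfolding continuous_at_eps_delta by (metis zero_less_one)
  have d: "det (?A t) \<noteq> 0" if "\<bar>t\<bar> < e" for t
    using e(2)[of t] that by (auto simp: dist_real_def)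
  have sm: "smooth_on {-e<..<e} (cayley M)"
    unfolding cayley_def[abs_def]
    by (intro smooth_on_matrix_mult smooth_on_matrix_inv sA) (auto intro!: d)
  have C0: "cayley M 0 = mat 1"
    using matrix_inv_inverse(2)[of "mat 1 :: real^5^5"] by (simp add: cayley_def det_I)
  define D where "D = vector_derivative (cayley M) (at 0)"
  have "cayley M differentiable (at 0)"
    using smooth_on_differentiable[OF sm] e(1) by simp
  then have D: "(cayley M has_vector_derivative D) (at 0)"
    unfolding D_def using vector_derivative_works by blast
  \<comment> \<open>Differentiate \<open>(1 - t M / 2) cayley M t = 1 + t M / 2\<close>.\<close>
  have bil: "bounded_bilinear (\<lambda>M N. (M :: real^5^5) ** (N :: real^5^5))"
  proof -
    have "bilinear (\<lambda>M N. (M :: real^5^5) ** (N :: real^5^5))"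
      unfolding bilinear_def
      by (auto intro!: linearI
          simp: matrix_matrix_mult_def vec_eq_iff sum.distrib algebra_simps sum_distrib_left)
    then show ?thesis using bilinear_conv_bounded_bilinear by blast
  qed
  have A': "(?A has_vector_derivative - (1 / 2) *\<^sub>R M) (at 0)"
    by (auto intro!: derivative_eq_intros simp: has_vector_derivative_def)
  have der: "((\<lambda>t. ?A t ** cayley M t) has_vector_derivative
      (?A 0 ** D + (- (1 / 2) *\<^sub>R M) ** cayley M 0)) (at 0)"
    using bounded_bilinear.has_vector_derivative[OF bil A' D] .
  have AC: "?A t ** cayley M t = mat 1 + (t / 2) *\<^sub>R M" if "t \<in> {-e<..<e}" for t
    using matrix_inv_inverse(1)[OF d, of t] that by (auto simp: cayley_def matrix_mul_assoc)
  have "((\<lambda>t. mat 1 + (t / 2) *\<^sub>R M) has_vector_derivative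
      (?A 0 ** D + (- (1 / 2) *\<^sub>R M) ** cayley M 0)) (at 0)"
    by (rule has_vector_derivative_transform_within_open[OF der open_greaterThanLessThan[of "-e" e] _ AC])
       (use e(1) in simp_all)
  moreover have "((\<lambda>t. mat 1 + (t / 2) *\<^sub>R M) has_vector_derivative (1 / 2) *\<^sub>R M) (at 0)"
    by (auto intro!: derivative_eq_intros simp: has_vector_derivative_def)
  ultimately have "?A 0 ** D + (- (1 / 2) *\<^sub>R M) ** cayley M 0 = (1 / 2) *\<^sub>R M"
    by (rule vector_derivative_unique_at)
  then have "D - (1 / 2) *\<^sub>R M = (1 / 2) *\<^sub>R M" using C0 by simp
  then have DM: "D = M"
    by (metis add_diff_cancel_right' diff_add_cancel scaleR_half_double scaleR_left_distrib scaleR_add_right)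
  have G: "cayley M t \<in> G_group" if "\<bar>t\<bar> < e" for t
  proof -
    have "connected (cayley M ` {-e<..<e})"
      by (intro connected_continuous_image smooth_on_continuous sm) auto
    moreover have "cayley M ` {-e<..<e} \<subseteq> isometries"
      using d by (auto intro!: cayley_isometry assms)
    moreover have "mat 1 \<in> cayley M ` {-e<..<e}"
      by (rule image_eqI[of _ _ 0]) (use C0 e(1) in auto)
    moreover have "cayley M t \<in> cayley M ` {-e<..<e}" using that by (intro imageI) auto
    ultimately show ?thesis
      unfolding G_group_def connected_component_def mem_Collect_eq by blast
  qed
  show ?thesis using that[OF e(1) sm C0] D DM G d by blast
qed

lemma constant_vector_derivative:
  assumes "e > 0" "\<And>t. \<bar>t\<bar> < e \<Longrightarrow> h t = h 0" "(h has_vector_derivative D) (at 0)"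
  shows "D = 0"
proof -
  have "((\<lambda>t. h 0) has_vector_derivative D) (at 0)"
  proof (rule has_vector_derivative_transform_within_open[OF assms(3), where S="{-e<..<e}"])
    show "h t = h 0" if "t \<in> {-e<..<e}" for t
      using assms(2)[of t] that by (simp add: abs_less_iff)
  qed (use assms(1) in auto)
  then show ?thesis using vector_derivative_unique_at[OF _ has_vector_derivative_const] by blast
qed

lemma has_vector_derivative_mult_vec:
  "(\<gamma> has_vector_derivative M) (at t) \<Longrightarrow>
    ((\<lambda>t. (\<gamma> t :: real^'n^'m) *v X) has_vector_derivative M *v X) (at t)"
  by (rule bounded_linear.has_vector_derivative)
     (auto intro!: linear_conv_bounded_linear[THEN iffD1] linearI
       simp: matrix_vector_mult_add_rdistrib matrix_mult_scaleR)

text \<open>Differentiation of \<open>adj F ** F = mat 1\<close> along a curve gives one inclusion, the Cayley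
  transform the other.\<close>

lemma o23_eq: "o23 = {M. adj M = - M}"
proof (intro equalityI subsetI)
  fix M assume "M \<in> o23"
  then obtain \<gamma> e where g: "e > 0" "\<And>t. \<bar>t\<bar> < e \<Longrightarrow> \<gamma> t \<in> G_group" "\<gamma> 0 = mat 1"
      "(\<gamma> has_vector_derivative M) (at 0)"
    by (auto simp: o23_def lie_algebra_def)
  have "scal (M *v X) Y = scal X ((- M) *v Y)" for X Y
  proof -
    have d: "((\<lambda>t. scal (\<gamma> t *v X) (\<gamma> t *v Y)) has_vector_derivative
        (scal (\<gamma> 0 *v X) (M *v Y) + scal (M *v X) (\<gamma> 0 *v Y))) (at 0)"
      by (intro scal.has_vector_derivative has_vector_derivative_mult_vec g)
    have c: "scal (\<gamma> t *v X) (\<gamma> t *v Y) = scal (\<gamma> 0 *v X) (\<gamma> 0 *v Y)" if "\<bar>t\<bar> < e" for t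
      using g(2)[OF that] G_group_isometries g(3) by (auto simp: isometry_scal)
    have "scal (\<gamma> 0 *v X) (M *v Y) + scal (M *v X) (\<gamma> 0 *v Y) = 0"
      by (rule constant_vector_derivative[OF g(1) c d])
    then show ?thesis using g(3) by (simp add: matrix_vector_mult_minus scal_simps)
  qed
  then show "M \<in> {M. adj M = - M}" using adj_unique by auto
next
  fix M assume "M \<in> {M. adj M = - M}"
  then have "adj M = - M" by simp
  then show "M \<in> o23"
    by (rule cayley_curve) (auto simp: o23_def lie_algebra_def)
qed

lemma ray_nonempty: "y \<in> ray y"
  unfolding ray_def by (auto intro!: exI[of _ 1])

lemma group_action_ray: "group_action F (ray y) = ray (F *v y)"
  unfolding group_action_def ray_def
  by (auto simp: matrix_vector_mult_scaleR)
     (metis (mono_tags, lifting) image_eqI matrix_vector_mult_scaleR mem_Collect_eq)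

lemma ray_scaleR: "c > 0 \<Longrightarrow> ray (c *\<^sub>R y) = ray y"
proof (intro equalityI subsetI)
  fix X assume "c > 0" "X \<in> ray y"
  then obtain t where t: "X = t *\<^sub>R y" "t > 0" by (auto simp: ray_def)
  have "X = (t / c) *\<^sub>R c *\<^sub>R y" "t / c > 0" using \<open>c > 0\<close> t by auto
  then show "X \<in> ray (c *\<^sub>R y)" unfolding ray_def by blast
next
  fix X assume c: "c > 0" "X \<in> ray (c *\<^sub>R y)"
  then obtain t where t: "X = (t * c) *\<^sub>R y" "t > 0" by (auto simp: ray_def)
  then have "t * c > 0" using c by simp
  then show "X \<in> ray y" unfolding ray_def t(1) by blast
qed

text \<open>An eigenvector of \<open>M\<close> is an eigenvector of its Cayley transforms, and for small parameters the
  eigenvalue is positive, so that the ray is preserved.\<close>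

lemma stabilizer_algebra_intro:
  assumes M: "adj M = - M" and y: "M *v y = c *\<^sub>R y"
  shows "M \<in> lie_algebra (stabilizer (ray y))"
proof -
  obtain e where e: "e > 0" "smooth_on {-e<..<e} (cayley M)" "cayley M 0 = mat 1"
    "(cayley M has_vector_derivative M) (at 0)" "\<And>t. \<bar>t\<bar> < e \<Longrightarrow> cayley M t \<in> G_group"
    "\<And>t. \<bar>t\<bar> < e \<Longrightarrow> det (mat 1 - (t / 2) *\<^sub>R M) \<noteq> 0"
    using cayley_curve[OF M] by blast
  define e' where "e' = min e (1 / (\<bar>c\<bar> + 1))"
  have e': "e' > 0" "e' \<le> e" using e(1) by (auto simp: e'_def)
  have pos: "1 - t / 2 * c > 0" "1 + t / 2 * c > 0" if "\<bar>t\<bar> < e'" for t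
  proof -
    have "\<bar>t\<bar> * (\<bar>c\<bar> + 1) < 1"
      using that by (auto simp: e'_def pos_less_divide_eq)
    then have "\<bar>t * c\<bar> < 1" unfolding abs_mult distrib_left by linarith
    then show "1 - t / 2 * c > 0" "1 + t / 2 * c > 0" by auto
  qed
  have "cayley M t \<in> stabilizer (ray y)" if t: "\<bar>t\<bar> < e'" for t
  proof -
    let ?A = "mat 1 - (t / 2) *\<^sub>R M"
    have Ay: "?A *v y = (1 - t / 2 * c) *\<^sub>R y" and By: "(mat 1 + (t / 2) *\<^sub>R M) *v y = (1 + t / 2 * c) *\<^sub>R y"
      by (simp_all add: matrix_mult_simps y algebra_simps)
    have "matrix_inv ?A *v (?A *v y) = y"
      using matrix_inv_inverse(2)[OF e(6)[of t]] t e'(2) by (simp add: matrix_vector_mul_assoc)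
    then have "(1 - t / 2 * c) *\<^sub>R (matrix_inv ?A *v y) = y"
      unfolding Ay by (simp add: matrix_vector_mult_scaleR)
    then have "matrix_inv ?A *v y = (1 / (1 - t / 2 * c)) *\<^sub>R y"
      using pos(1)[OF t] by (metis divideR_right less_irrefl divide_inverse mult_1 )
    then have "cayley M t *v y = ((1 + t / 2 * c) * (1 / (1 - t / 2 * c))) *\<^sub>R y"
      unfolding cayley_def matrix_vector_mul_assoc[symmetric] By by (simp add: matrix_vector_mult_scaleR)
    moreover have "(1 + t / 2 * c) * (1 / (1 - t / 2 * c)) > 0"
      using pos[OF t] by simp
    ultimately show ?thesis
      using e(5)[of t] t e'(2) ray_scaleR by (simp add: stabilizer_def group_action_ray)
  qed
  moreover have "smooth_on {-e'<..<e'} (cayley M)"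
    by (rule smooth_on_subset[OF e(2)]) (use e'(2) in auto)
  ultimately show ?thesis
    unfolding lie_algebra_def mem_Collect_eq using e(3,4) e'(1)
    by (intro exI[of _ "cayley M"] exI[of _ e']) simp
qed

text \<open>Along a curve in the stabilizer the image of \<open>y\<close> moves on a ray and stays orthogonal to \<open>b\<close>.\<close>

lemma stabilizer_algebra_dest:
  assumes "N \<in> lie_algebra (stabilizer (ray y))"
  shows "adj N = - N" and "scal y b = 0 \<Longrightarrow> scal (N *v y) b = 0"
proof -
  obtain \<gamma> e where g: "e > 0" "smooth_on {-e<..<e} \<gamma>" "\<And>t. \<bar>t\<bar> < e \<Longrightarrow> \<gamma> t \<in> stabilizer (ray y)" "\<gamma> 0 = mat 1"
      "(\<gamma> has_vector_derivative N) (at 0)"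
    using assms by (auto simp: lie_algebra_def)
  have "N \<in> o23"
    unfolding o23_def lie_algebra_def mem_Collect_eq using g by (auto simp: stabilizer_def)
  then show "adj N = - N" by (simp add: o23_eq)
  assume b: "scal y b = 0"
  have "scal (\<gamma> t *v y) b = 0" if "\<bar>t\<bar> < e" for t
  proof -
    have "\<gamma> t *v y \<in> ray y"
      using g(3)[OF that] ray_nonempty group_action_ray by (auto simp: stabilizer_def)
    then show ?thesis using b by (auto simp: ray_def scal_simps)
  qed
  moreover have "((\<lambda>t. scal (\<gamma> t *v y) b) has_vector_derivative (scal (\<gamma> 0 *v y) 0 + scal (N *v y) b)) (at 0)"
    by (intro scal.has_vector_derivative has_vector_derivative_mult_vec g has_vector_derivative_const)
  ultimately have "scal (\<gamma> 0 *v y) 0 + scal (N *v y) b = 0"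
    using g(1) by (intro constant_vector_derivative[OF g(1)]) auto
  then show "scal (N *v y) b = 0" by (simp add: scal.zero_right)
qed

text \<open>A projection \<open>P\<close> onto \<open>S\<close> turns the trace on \<open>S\<close>, which is defined by an arbitrary basis of
  \<open>S\<close>, into a sum over the standard basis of the ambient space.\<close>

lemma trace_on_projection:
  fixes S :: "'v::euclidean_space set"
  assumes S: "subspace S" and P: "linear P" "\<And>x. P x \<in> S" "\<And>x. x \<in> S \<Longrightarrow> P x = x"
    and T: "linear T" "\<And>x. x \<in> S \<Longrightarrow> T x \<in> S"
  shows "trace_on S T = (\<Sum>e\<in>Basis. T (P e) \<bullet> e)"
proof -
  define B where "B = (SOME B. B \<subseteq> S \<and> independent B \<and> S \<subseteq> span B)"
  have B: "B \<subseteq> S \<and> independent B \<and> S \<subseteq> span B"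
    unfolding B_def using basis_exists[of S] by (rule_tac someI_ex) metis
  then have fin: "finite B" using independent_imp_finite by blast
  have spB: "x \<in> span B" if "x \<in> S" for x using B that by blast
  define d where "d b x = representation B (P x) b" for b x
  have lin: "linear (d b)" for b
    unfolding d_def
    by (rule linearI) (use B spB P in \<open>simp_all add: linear_add linear_cmul representation_add representation_scale\<close>)
  have Px: "P x = (\<Sum>b\<in>B. d b x *\<^sub>R b)" for x
    unfolding d_def using B spB[OF P(2)] fin
    by (simp add: sum_representation_eq)
  have "(\<Sum>e\<in>Basis. T (P e) \<bullet> e) = (\<Sum>e\<in>Basis. \<Sum>b\<in>B. (T b \<bullet> e) * d b e)"
    unfolding Px by (simp add: linear_sum[OF T(1)] linear_cmul[OF T(1)] inner_sum_left mult.commute)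
  also have "\<dots> = (\<Sum>b\<in>B. \<Sum>e\<in>Basis. (T b \<bullet> e) * d b e)"
    by (rule sum.swap)
  also have "\<dots> = (\<Sum>b\<in>B. d b (T b))"
  proof (rule sum.cong[OF refl])
    fix b
    have "d b (T b) = d b (\<Sum>e\<in>Basis. (T b \<bullet> e) *\<^sub>R e)" by (simp only: euclidean_representation)
    then show "(\<Sum>e\<in>Basis. (T b \<bullet> e) * d b e) = d b (T b)"
      by (simp only: linear_sum[OF lin] linear_cmul[OF lin] real_scaleR_def)
  qed
  also have "\<dots> = (\<Sum>b\<in>B. representation B (T b) b)"
    using B T(2) P(3) by (intro sum.cong) (auto simp: d_def subset_iff)
  finally show ?thesis
    unfolding trace_on_def Let_def B_def[symmetric] by simp
qed

lemma sum_Basis_matrix: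
  fixes g :: "real^'n^'m \<Rightarrow> real"
  shows "(\<Sum>e\<in>Basis. g e) = (\<Sum>i\<in>UNIV. \<Sum>j\<in>UNIV. g (axis i (axis j 1)))"
proof -
  have "(Basis :: (real^'n^'m) set) = (\<lambda>(i, j). axis i (axis j 1)) ` UNIV"
    by (auto simp: Basis_vec_def image_iff)
  moreover have "inj (\<lambda>(i, j). axis i (axis j 1) :: real^'n^'m)"
    by (auto simp: inj_def axis_eq_axis)
  ultimately have "(\<Sum>e\<in>Basis. g e) = (\<Sum>(i, j)\<in>UNIV. g (axis i (axis j 1)))"
    by (metis (mono_tags, lifting) sum.reindex_cong case_prod_unfold)
  then show ?thesis by (simp add: sum.cartesian_product UNIV_Times_UNIV[symmetric] del: UNIV_Times_UNIV)
qed

lemma matrix_unit_sandwich: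
  "(M ** axis i (axis j 1) ** N) $ k $ l = M $ k $ i * (N :: real^'n^'n) $ j $ l"
  by (simp add: matrix_matrix_mult_def axis_def if_distrib[of "\<lambda>f. f $ _"] if_distrib[of "\<lambda>u. _ * u"]
      if_distrib[of "\<lambda>u. u * _"] cong: if_cong)

lemma transpose_matrix_unit: "transpose (axis i (axis j 1) :: real^'n^'n) = axis j (axis i 1)"
  by (auto simp: transpose_def axis_def vec_eq_iff)

text \<open>The traces of \<open>Z \<mapsto> M Z N\<close> and of \<open>Z \<mapsto> M Z\<^sup>T N\<close> on the space of all matrices.\<close>

lemma trace_sandwich:
  fixes M N :: "real^'n^'n"
  shows "(\<Sum>i\<in>UNIV. \<Sum>j\<in>UNIV. (M ** axis i (axis j 1) ** N) $ i $ j) = trace M * trace N"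
    and "(\<Sum>i\<in>UNIV. \<Sum>j\<in>UNIV. (M ** transpose (axis i (axis j 1)) ** N) $ i $ j) = trace (M ** transpose N)"
  unfolding transpose_matrix_unit matrix_unit_sandwich
  by (simp_all add: trace_def sum_product matrix_matrix_mult_def transpose_def)

text \<open>With the projection \<open>Z \<mapsto> (Z - adj Z) / 2\<close> onto the skew endomorphisms, the trace of \<open>Z \<mapsto> [M,
  [N, Z]]\<close> becomes a sum of traces of the maps \<open>Z \<mapsto> A Z B\<close> and \<open>Z \<mapsto> A (transpose Z) B\<close>. The constant
  is \<open>n - 2\<close> for \<open>n = 5\<close>.\<close>

lemma killing_o23:
  assumes "adj M = - M" "adj N = - N"
  shows "killing o23 M N = 3 * trace (M ** N)"
proof -
  define P where "P Z = (1 / 2) *\<^sub>R (Z - adj Z)" for Z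
  define T where "T Z = lie_bracket M (lie_bracket N Z)" for Z
  have bil: "linear (\<lambda>Z. L ** Z)" "linear (\<lambda>Z. Z ** L)" for L :: "real^5^5"
    by (rule linearI; simp add: matrix_matrix_mult_def vec_eq_iff sum.distrib algebra_simps sum_distrib_left)+
  have linT: "linear T"
    unfolding T_def lie_bracket_def
    by (intro linear_compose_sub linear_compose[OF _ bil(1), unfolded comp_def] linear_compose[OF _ bil(2), unfolded comp_def] bil)
  have linP: "linear P"
    unfolding P_def
    by (intro linear_compose_scale_right linear_compose_sub linear_adj linear_ident)
  have neg: "adj (- Z) = - adj Z" for Z by (rule linear_neg[OF linear_adj])
  have adjl: "adj (lie_bracket L Z) = - lie_bracket L Z" if "adj L = - L" "adj Z = - Z" for L Z
  proof -
    have m: "(- a) ** (- b) = a ** b" for a b :: "real^5^5"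
      by (simp add: matrix_matrix_mult_def vec_eq_iff)
    show ?thesis
      unfolding lie_bracket_def linear_diff[OF linear_adj] adj_mult that m by simp
  qed
  have sub: "subspace {M. adj M = - M}"
    unfolding subspace_def
    by (simp add: linear_add[OF linear_adj] linear_cmul[OF linear_adj] linear_0[OF linear_adj])
  have "killing o23 M N = (\<Sum>e\<in>Basis. T (P e) \<bullet> e)"
    unfolding killing_def o23_eq T_def[symmetric]
  proof (rule trace_on_projection[OF sub linP _ _ linT])
    show "P x \<in> {M. adj M = - M}" for x
      by (simp add: P_def linear_diff[OF linear_adj] linear_cmul[OF linear_adj] adj_adj
          scaleR_right_diff_distrib)
    show "P x = x" if "x \<in> {M. adj M = - M}" for x
      using that by (simp add: P_def scaleR_2[symmetric])
    show "T x \<in> {M. adj M = - M}" if "x \<in> {M. adj M = - M}" for x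
      using that assms adjl by (simp add: T_def)
  qed
  also have "\<dots> = (\<Sum>i\<in>UNIV. \<Sum>j\<in>UNIV. T (P (axis i (axis j 1))) $ i $ j)"
    unfolding sum_Basis_matrix by (simp add: inner_axis)
  also have "\<dots> = (\<Sum>i\<in>UNIV. \<Sum>j\<in>UNIV. (1 / 2) *
      ((M ** N ** axis i (axis j 1) ** mat 1) $ i $ j - (M ** axis i (axis j 1) ** N) $ i $ j
     - (N ** axis i (axis j 1) ** M) $ i $ j + (mat 1 ** axis i (axis j 1) ** (N ** M)) $ i $ j
     - (M ** N ** Jm ** transpose (axis i (axis j 1)) ** Jm) $ i $ j
     + (M ** Jm ** transpose (axis i (axis j 1)) ** (Jm ** N)) $ i $ j
     + (N ** Jm ** transpose (axis i (axis j 1)) ** (Jm ** M)) $ i $ j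
     - (Jm ** transpose (axis i (axis j 1)) ** (Jm ** N ** M)) $ i $ j))"
  proof (intro sum.cong refl)
    fix i j :: 5
    define E where "E = (axis i (axis j 1) :: real^5^5)"
    have "T (P E) = (1 / 2) *\<^sub>R (T E - T (adj E))"
      unfolding P_def using linT by (simp add: linear_cmul linear_diff)
    moreover have "T Z = M ** N ** Z ** mat 1 - M ** Z ** N - N ** Z ** M + mat 1 ** Z ** (N ** M)" for Z
      unfolding T_def lie_bracket_def
      by (simp add: linear_diff[OF bil(1)] linear_diff[OF bil(2)] matrix_mul_assoc)
    ultimately show "T (P (axis i (axis j 1))) $ i $ j = (1 / 2) *
      ((M ** N ** axis i (axis j 1) ** mat 1) $ i $ j - (M ** axis i (axis j 1) ** N) $ i $ j
     - (N ** axis i (axis j 1) ** M) $ i $ j + (mat 1 ** axis i (axis j 1) ** (N ** M)) $ i $ j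
     - (M ** N ** Jm ** transpose (axis i (axis j 1)) ** Jm) $ i $ j
     + (M ** Jm ** transpose (axis i (axis j 1)) ** (Jm ** N)) $ i $ j
     + (N ** Jm ** transpose (axis i (axis j 1)) ** (Jm ** M)) $ i $ j
     - (Jm ** transpose (axis i (axis j 1)) ** (Jm ** N ** M)) $ i $ j)"
      unfolding E_def[symmetric] by (simp add: adj_def matrix_mul_assoc)
  qed
  also have "\<dots> = (1 / 2) * (trace (M ** N) * 5 - trace M * trace N - trace N * trace M + 5 * trace (N ** M)
      - trace (M ** N ** Jm ** transpose Jm) + trace (M ** Jm ** transpose (Jm ** N))
      + trace (N ** Jm ** transpose (Jm ** M)) - trace (Jm ** transpose (Jm ** N ** M)))"
    unfolding sum_distrib_left[symmetric] sum.distrib sum_subtractf trace_sandwich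
    by (simp add: trace_I)
  also have "\<dots> = 3 * trace (M ** N)"
  proof -
    have t0: "trace L = 0" if "adj L = - L" for L
    proof -
      have "trace (adj L) = trace (transpose L ** Jm ** Jm)"
        unfolding adj_def using trace_mul_sym[of Jm "transpose L ** Jm"] by (simp add: matrix_mul_assoc)
      also have "\<dots> = trace L"
        by (simp add: matrix_mul_assoc[symmetric] Jm_square) (simp add: trace_def transpose_def)
      finally show ?thesis using that by (simp add: trace_def sum_negf)
    qed
    have a: "M ** Jm ** transpose (Jm ** N) = M ** adj N" "N ** Jm ** transpose (Jm ** M) = N ** adj M"
      by (simp_all add: adj_def matrix_transpose_mul transpose_Jm matrix_mul_assoc)
    have neg: "trace (L ** (- K)) = - trace (L ** K)" for L K :: "real^5^5"
      by (simp add: trace_def matrix_matrix_mult_def sum_negf)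
    have b: "trace (M ** N ** Jm ** transpose Jm) = trace (M ** N)"
      by (simp add: transpose_Jm matrix_mul_assoc[symmetric] Jm_square)
    have "trace (Jm ** transpose (Jm ** N ** M)) = trace (transpose (Jm ** N ** M) ** Jm)"
      by (rule trace_mul_sym)
    also have "\<dots> = trace (transpose (N ** M))"
      by (simp add: matrix_transpose_mul transpose_Jm matrix_mul_assoc[symmetric] Jm_square)
    also have "\<dots> = trace (M ** N)"
      using trace_mul_sym[of N M] by (simp add: trace_def transpose_def)
    finally have c: "trace (Jm ** transpose (Jm ** N ** M)) = trace (M ** N)" .
    show ?thesis
      unfolding a b c assms neg using t0[OF assms(1)] trace_mul_sym[of N M] by simp
  qed
  finally show ?thesis .
qed

text \<open>The skew endomorphism \<open>X \<mapsto> \<langle>v, X\<rangle> w - \<langle>w, X\<rangle> v\<close>.\<close>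

definition wedge_endo :: "real^5 \<Rightarrow> real^5 \<Rightarrow> real^5^5" where
  "wedge_endo v w = (\<chi> i j. w $ i * flip v $ j - v $ i * flip w $ j)"

lemma wedge_endo_mult: "wedge_endo v w *v X = scal v X *\<^sub>R w - scal w X *\<^sub>R v"
proof -
  have "(\<Sum>j\<in>UNIV. (a * flip v $ j - b * flip w $ j) * X $ j) = (flip v \<bullet> X) * a - (flip w \<bullet> X) * b" for a b
    by (simp add: inner_vec_def left_diff_distrib sum_subtractf sum_distrib_left mult.assoc mult.commute[of _ a]
        mult.commute[of _ b])
  then show ?thesis by (simp add: vec_eq_iff wedge_endo_def matrix_vector_mult_def scal_flip)
qed

lemma scal_wedge_endo: "scal (wedge_endo v w *v X) Y = scal v X * scal w Y - scal w X * scal v Y"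
  by (simp add: wedge_endo_mult scal_simps)

lemma adj_wedge_endo: "adj (wedge_endo v w) = - wedge_endo v w"
  by (rule adj_unique[symmetric])
     (simp add: matrix_vector_mult_minus scal_wedge_endo scal_simps wedge_endo_mult,
      simp add: scal_commute mult.commute)

lemma bounded_bilinear_wedge_endo: "bounded_bilinear wedge_endo"
proof -
  have "bilinear wedge_endo"
    unfolding bilinear_def wedge_endo_def
    by (auto intro!: linearI simp: vec_eq_iff linear_add[OF linear_flip] linear_cmul[OF linear_flip] algebra_simps)
  then show ?thesis using bilinear_conv_bounded_bilinear by blast
qed

interpretation wedge_endo: bounded_bilinear wedge_endo
  by (rule bounded_bilinear_wedge_endo)

lemma wedge_endo_self [simp]: "wedge_endo v v = 0"
  by (simp add: wedge_endo_def vec_eq_iff)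

lemma trace_wedge_endo: "trace (M ** wedge_endo v w) = scal v (M *v w) - scal w (M *v v)"
proof -
  have "trace (M ** wedge_endo v w) = (\<Sum>i\<in>UNIV. \<Sum>k\<in>UNIV. M$i$k * (w $ k * flip v $ i) - M$i$k * (v $ k * flip w $ i))"
    by (simp add: trace_def matrix_matrix_mult_def wedge_endo_def algebra_simps)
  also have "\<dots> = scal v (M *v w) - scal w (M *v v)"
    by (simp add: scal_flip inner_vec_def matrix_vector_mult_def sum_subtractf sum_distrib_left algebra_simps)
  finally show ?thesis .
qed

text \<open>The nilradical of the stabilizer of the null line through \<open>y\<close>. An element \<open>M\<close> of the polar
  space is tested against \<open>wedge_endo a b\<close> with \<open>a\<close>, \<open>b\<close> orthogonal to \<open>y\<close> and with \<open>a = y\<close>.\<close>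

lemma polar_stabilizer:
  assumes y: "y \<noteq> 0" "scal y y = 0"
  shows "polar o23 (lie_algebra (stabilizer (ray y))) = {wedge_endo y w | w. scal y w = 0}"
proof (intro equalityI subsetI)
  fix M assume "M \<in> {wedge_endo y w | w. scal y w = 0}"
  then obtain w where w: "M = wedge_endo y w" "scal y w = 0" by blast
  have "killing o23 M N = 0" if N: "N \<in> lie_algebra (stabilizer (ray y))" for N
  proof -
    note d = stabilizer_algebra_dest[OF N]
    have "trace (M ** N) = trace (N ** M)" by (rule trace_mul_sym)
    also have "\<dots> = scal y (N *v w) - scal w (N *v y)" unfolding w(1) by (rule trace_wedge_endo)
    also have "scal y (N *v w) = - scal (N *v y) w"
      by (simp add: scal_adj d(1) matrix_vector_mult_minus scal_simps)
    also have "scal (N *v y) w = 0" by (rule d(2)[OF w(2)])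
    finally have "trace (M ** N) = 0" using d(2)[OF w(2)] by (simp add: scal_commute)
    then show ?thesis using killing_o23[OF _ d(1)] w(1) adj_wedge_endo by simp
  qed
  then show "M \<in> polar o23 (lie_algebra (stabilizer (ray y)))"
    unfolding polar_def o23_eq using w(1) adj_wedge_endo by simp
next
  fix M assume M: "M \<in> polar o23 (lie_algebra (stabilizer (ray y)))"
  then have skew: "adj M = - M" by (simp add: polar_def o23_eq)
  have sk: "scal (M *v a) b = - scal a (M *v b)" for a b
    by (simp add: scal_adj skew matrix_vector_mult_minus scal_simps)
  have test: "scal (M *v a) b = 0" if "wedge_endo a b \<in> lie_algebra (stabilizer (ray y))" for a b
  proof -
    have "killing o23 M (wedge_endo a b) = 0" using M that by (simp add: polar_def)
    then have "scal a (M *v b) - scal b (M *v a) = 0"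
      by (simp add: killing_o23[OF skew adj_wedge_endo] trace_wedge_endo)
    then show ?thesis using sk[of a b] scal_commute[of b "M *v a"] by simp
  qed
  have perp: "scal (M *v a) b = 0" if "scal y a = 0" "scal y b = 0" for a b
    by (rule test, rule stabilizer_algebra_intro[OF adj_wedge_endo, of _ _ _ 0])
       (use that in \<open>simp add: wedge_endo_mult scal_commute\<close>)
  have My: "M *v y = 0"
  proof (rule scal_nondegenerate)
    fix Z show "scal (M *v y) Z = 0"
      by (rule test, rule stabilizer_algebra_intro[OF adj_wedge_endo, of _ _ _ "- scal Z y"])
         (use y in \<open>simp add: wedge_endo_mult\<close>)
  qed
  obtain Z where Z: "scal y Z \<noteq> 0" using scal_nondegenerate y(1) by blast
  define w where "w = (1 / scal y Z) *\<^sub>R (M *v Z)"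
  have "scal y (M *v Z) = 0" using sk[of y Z] My by (simp add: scal.zero_left)
  then have yw: "scal y w = 0" by (simp add: w_def scal_simps)
  have wZ: "scal w Z = 0" using sk[of Z Z] scal_commute[of "M *v Z" Z] by (simp add: w_def scal_simps)
  have "M *v X = wedge_endo y w *v X" for X
  proof (rule scal_eqI)
    fix Y
    define X' where "X' = X - (scal y X / scal y Z) *\<^sub>R Z"
    define Y' where "Y' = Y - (scal y Y / scal y Z) *\<^sub>R Z"
    have X: "X = X' + (scal y X / scal y Z) *\<^sub>R Z" and Y: "Y = Y' + (scal y Y / scal y Z) *\<^sub>R Z"
      by (simp_all add: X'_def Y'_def)
    have p: "scal y X' = 0" "scal y Y' = 0" using Z by (simp_all add: X'_def Y'_def scal_simps)
    have MX': "scal (M *v X') Y' = 0" using perp p by blast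
    have MZ: "M *v Z = scal y Z *\<^sub>R w" using Z by (simp add: w_def)
    have "scal (M *v X) Y = scal (M *v X') Y' + (scal y Y / scal y Z) * scal (M *v X') Z
        + (scal y X / scal y Z) * scal (M *v Z) Y' + (scal y X / scal y Z) * (scal y Y / scal y Z) * scal (M *v Z) Z"
      by (subst X, subst Y) (simp add: matrix_vector_right_distrib matrix_vector_mult_scaleR scal_simps algebra_simps)
    also have "scal (M *v X') Z = - scal y Z * scal w X'"
      using sk[of X' Z] MZ by (simp add: scal_simps scal_commute)
    also have "scal (M *v Z) Z = 0" by (simp add: MZ scal_simps wZ)
    also have "scal (M *v Z) Y' = scal y Z * scal w Y'" by (simp add: MZ scal_simps)
    finally have l: "scal (M *v X) Y = scal y X * scal w Y' - scal y Y * scal w X'"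
      using Z MX' by simp
    have "scal w X = scal w X'" "scal w Y = scal w Y'"
      by (simp_all add: X'_def Y'_def scal_simps wZ)
    then show "scal (M *v X) Y = scal (wedge_endo y w *v X) Y"
      unfolding l scal_wedge_endo by simp
  qed
  then have "M = wedge_endo y w" by (simp add: matrix_eq)
  then show "M \<in> {wedge_endo y w | w. scal y w = 0}" using yw by blast
qed

section \<open>Calculus in charts\<close>

lemma smooth_map_subset: "smooth_map A U h \<Longrightarrow> V \<subseteq> U \<Longrightarrow> smooth_map A V h"
  unfolding smooth_map_def by (blast intro: smooth_on_subset)

locale smooth_surface =
  fixes A :: "('x::topological_space, real^2) chart set"
  assumes surface: "connected_oriented_surface A"
begin

lemma atlas: "smooth_atlas euclidean A"
  using surface by (simp add: connected_oriented_surface_def smooth_manifold_def)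

lemma chart_exists: obtains c where "c \<in> A" "x \<in> fst c"
proof -
  have "(\<Union>c\<in>A. fst c) = UNIV" using atlas by (simp add: smooth_atlas_def)
  then show ?thesis using that by blast
qed

lemma chart_open: "c \<in> A \<Longrightarrow> open (fst c)" and chart_image_open: "c \<in> A \<Longrightarrow> open (chart_image c)"
  using atlas by (auto simp: smooth_atlas_def is_chart_def)

lemma chart_homeomorphic:
  "c \<in> A \<Longrightarrow> homeomorphic_map (top_of_set (fst c)) (top_of_set (chart_image c)) (snd c)"
  using atlas by (auto simp: smooth_atlas_def is_chart_def)

lemma chart_inj: "c \<in> A \<Longrightarrow> inj_on (snd c) (fst c)"
  using homeomorphic_imp_injective_map[OF chart_homeomorphic] by simp

lemma chart_continuous: "c \<in> A \<Longrightarrow> continuous_on (fst c) (snd c)"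
  using homeomorphic_imp_continuous_map[OF chart_homeomorphic] by (simp add: continuous_map_in_subtopology)

lemma chart_inv_left: "c \<in> A \<Longrightarrow> x \<in> fst c \<Longrightarrow> chart_inv c (snd c x) = x"
  unfolding chart_inv_def using chart_inj by (rule inv_into_f_f)

lemma chart_inv_right: "p \<in> chart_image c \<Longrightarrow> snd c (chart_inv c p) = p"
  and chart_inv_domain: "p \<in> chart_image c \<Longrightarrow> chart_inv c p \<in> fst c"
  unfolding chart_inv_def chart_image_def by (rule f_inv_into_f inv_into_into; simp)+

lemma chart_value: "x \<in> fst c \<Longrightarrow> snd c x \<in> chart_image c"
  by (simp add: chart_image_def)

lemma chart_image_restrict:
  "c \<in> A \<Longrightarrow> snd c ` (fst c \<inter> U) = {p \<in> chart_image c. chart_inv c p \<in> U}"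
  by (auto simp: chart_inv_left chart_value) (metis IntI chart_inv_domain chart_inv_right image_eqI)

lemma chart_restrict_open:
  assumes "c \<in> A" "open U" shows "open (snd c ` (fst c \<inter> U))"
proof -
  have "openin (top_of_set (chart_image c)) (snd c ` (fst c \<inter> U))"
    using homeomorphic_imp_open_map[OF chart_homeomorphic[OF assms(1)]] assms(2)
    by (auto simp: open_map_def openin_open)
  then show ?thesis using chart_image_open[OF assms(1)] openin_open_trans by blast
qed

lemma chart_inv_image_open:
  assumes "c \<in> A" "open S" "S \<subseteq> chart_image c" shows "open (chart_inv c ` S)"
proof -
  have "chart_inv c ` S = fst c \<inter> snd c -` S"
    using assms by (auto simp: chart_inv_left chart_inv_right chart_inv_domain subset_iff)
      (metis chart_inv_left image_eqI)
  then show ?thesis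
    using continuous_open_preimage[OF chart_continuous chart_open] assms by metis
qed

lemma chart_inv_continuous: assumes "c \<in> A" shows "continuous_on (chart_image c) (chart_inv c)"
  unfolding continuous_on_open_invariant
proof (intro allI impI)
  fix B :: "'x set" assume "open B"
  then show "\<exists>S. open S \<and> S \<inter> chart_image c = chart_inv c -` B \<inter> chart_image c"
    using chart_restrict_open[OF assms, of B] unfolding chart_image_restrict[OF assms]
    by (intro exI[of _ "{p \<in> chart_image c. chart_inv c p \<in> B}"]) auto
qed

lemma smooth_mapD: "smooth_map A UNIV h \<Longrightarrow> c \<in> A \<Longrightarrow> smooth_on (chart_image c) (h \<circ> chart_inv c)"
  by (auto simp: smooth_map_def chart_image_def)

lemma smooth_map_restrictD:
  "smooth_map A U h \<Longrightarrow> c \<in> A \<Longrightarrow> smooth_on (snd c ` (fst c \<inter> U)) (h \<circ> chart_inv c)"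
  by (simp add: smooth_map_def)

lemma smooth_map_differentiable:
  "smooth_map A U h \<Longrightarrow> c \<in> A \<Longrightarrow> x \<in> fst c \<inter> U \<Longrightarrow> (h \<circ> chart_inv c) differentiable (at (snd c x))"
  by (rule smooth_on_differentiable[OF smooth_map_restrictD]) auto

lemma smooth_map_local:
  assumes "\<And>x. x \<in> U \<Longrightarrow> \<exists>V. open V \<and> x \<in> V \<and> smooth_map A V h"
  shows "smooth_map A U h"
  unfolding smooth_map_def
proof
  fix c assume c: "c \<in> A"
  show "smooth_on (snd c ` (fst c \<inter> U)) (h \<circ> chart_inv c)"
  proof (rule smooth_on_local)
    fix p assume "p \<in> snd c ` (fst c \<inter> U)"
    then obtain x where x: "x \<in> fst c" "x \<in> U" "p = snd c x" by blast
    then obtain V where "open V" "x \<in> V" "smooth_map A V h" using assms by blast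
    then show "\<exists>T. open T \<and> p \<in> T \<and> smooth_on T (h \<circ> chart_inv c)"
      using x c chart_restrict_open[of c V] smooth_map_restrictD[of V h c]
      by (intro exI[of _ "snd c ` (fst c \<inter> V)"]) simp
  qed
qed

lemma transition_eq: "transition c c' = (\<lambda>p. snd c' (chart_inv c p))"
  by (simp add: transition_def comp_def)

lemma transition_smooth:
  "c \<in> A \<Longrightarrow> c' \<in> A \<Longrightarrow> smooth_on (snd c ` (fst c \<inter> fst c')) (transition c c')"
  using atlas by (simp add: smooth_atlas_def)

abbreviation dtrans :: "('x, real^2) chart \<Rightarrow> ('x, real^2) chart \<Rightarrow> 'x \<Rightarrow> real^2 \<Rightarrow> real^2" where
  "dtrans c c' x \<equiv> frechet_derivative (transition c c') (at (snd c x))"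

lemma transition_derivative:
  assumes "c \<in> A" "c' \<in> A" "x \<in> fst c" "x \<in> fst c'"
  shows "(transition c c' has_derivative dtrans c c' x) (at (snd c x))"
  by (rule smooth_on_has_derivative[OF transition_smooth[OF assms(1,2)]]) (use assms in auto)

lemma dtrans_linear:
  assumes "c \<in> A" "c' \<in> A" "x \<in> fst c" "x \<in> fst c'"
  shows "linear (dtrans c c' x)"
  using transition_derivative[OF assms] by (rule has_derivative_linear)

lemma dtrans_det:
  assumes "c \<in> A" "c' \<in> A" "x \<in> fst c" "x \<in> fst c'"
  shows "det (matrix (dtrans c c' x)) > 0"
  using surface assms by (auto simp: connected_oriented_surface_def)

lemma dtrans_surj:
  assumes "c \<in> A" "c' \<in> A" "x \<in> fst c" "x \<in> fst c'"
  shows "surj (dtrans c c' x)"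
  using det_nz_iff_inj[OF dtrans_linear[OF assms]] dtrans_det[OF assms]
    linear_injective_imp_surjective[OF dtrans_linear[OF assms]] by auto

lemma differential_change:
  assumes c: "c \<in> A" "c' \<in> A" "x \<in> fst c" "x \<in> fst c'"
    and h: "(h \<circ> chart_inv c') differentiable (at (snd c' x))"
  shows "differential c h x v = differential c' h x (dtrans c c' x v)"
    and "(h \<circ> chart_inv c) differentiable (at (snd c x))"
proof -
  have eq: "transition c c' (snd c x) = snd c' x"
    using c by (simp add: transition_eq chart_inv_left)
  have "((h \<circ> chart_inv c') has_derivative differential c' h x) (at (transition c c' (snd c x)))"
    unfolding eq differential_def using h frechet_derivative_works by blast
  from has_derivative_compose[OF transition_derivative[OF c] this]
  have "((h \<circ> chart_inv c) has_derivative (\<lambda>v. differential c' h x (dtrans c c' x v))) (at (snd c x))"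
  proof (rule has_derivative_transform_within_open)
    show "open (snd c ` (fst c \<inter> fst c'))" by (rule chart_restrict_open) (use c chart_open in auto)
    fix p assume "p \<in> snd c ` (fst c \<inter> fst c')"
    then show "(h \<circ> chart_inv c') (transition c c' p) = (h \<circ> chart_inv c) p"
      using c by (auto simp: transition_eq chart_inv_left)
  qed (use c in auto)
  then show "differential c h x v = differential c' h x (dtrans c c' x v)"
      "(h \<circ> chart_inv c) differentiable (at (snd c x))"
    unfolding differential_def[of c] using frechet_derivative_at by (metis, blast intro: differentiableI)
qed

lemma smooth_map_from_chart:
  assumes "c \<in> A" "U \<subseteq> fst c" "open U" "smooth_on (snd c ` U) (h \<circ> chart_inv c)"
  shows "smooth_map A U h"
  unfolding smooth_map_def
proof
  fix c' assume c': "c' \<in> A"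
  have op: "open (snd c' ` (fst c' \<inter> U))" by (rule chart_restrict_open[OF c' assms(3)])
  have "smooth_on (snd c' ` (fst c' \<inter> U)) (\<lambda>p. (h \<circ> chart_inv c) (transition c' c p))"
    by (rule smooth_on_compose[OF op assms(4) smooth_on_subset[OF transition_smooth[OF c' assms(1)]]])
       (use assms c' in \<open>auto simp: transition_eq chart_inv_left\<close>)
  then show "smooth_on (snd c' ` (fst c' \<inter> U)) (h \<circ> chart_inv c')"
    by (rule smooth_on_cong[OF op]) (use assms c' in \<open>auto simp: transition_eq chart_inv_left\<close>)
qed

end

lemma differential_linear:
  "(h \<circ> chart_inv c) differentiable (at (snd c x)) \<Longrightarrow> linear (differential c h x)"
  unfolding differential_def by (rule linear_frechet_derivative)


section \<open>Null rays and their lifts\<close>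

lemma P_scal: "scal X P0 = - (X$0 + X$4) / sqrt 2" "scal X P1 = - X$1" "scal X P2 = X$2" "scal X P3 = X$3"
    "scal X P4 = (X$4 - X$0) / sqrt 2"
proof -
  show "scal X P0 = - (X$0 + X$4) / sqrt 2" "scal X P1 = - X$1" "scal X P2 = X$2" "scal X P3 = X$3"
    "scal X P4 = (X$4 - X$0) / sqrt 2"
    by (simp_all add: scal_def P0_def P1_def P2_def P3_def P4_def axis_def diff_divide_distrib add_divide_distrib)
qed

lemma P_gram: "scal P0 P0 = -1" "scal P1 P1 = -1" "scal P0 P1 = 0" "scal P1 P0 = 0"
  "scal P2 P2 = 1" "scal P3 P3 = 1" "scal P4 P4 = 1" "scal P2 P3 = 0" "scal P3 P2 = 0"
  "scal P2 P4 = 0" "scal P4 P2 = 0" "scal P3 P4 = 0" "scal P4 P3 = 0"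
  "scal P2 P0 = 0" "scal P3 P0 = 0" "scal P4 P0 = 0" "scal P2 P1 = 0" "scal P3 P1 = 0" "scal P4 P1 = 0"
  "scal P0 P2 = 0" "scal P0 P3 = 0" "scal P0 P4 = 0" "scal P1 P2 = 0" "scal P1 P3 = 0" "scal P1 P4 = 0"
  unfolding P_scal
  by (simp_all add: P0_def P1_def P2_def P3_def P4_def axis_def field_simps)

text \<open>The orthogonal projections to the negative definite plane spanned by \<open>P0\<close>, \<open>P1\<close> and to the
  positive definite space spanned by \<open>P2\<close>, \<open>P3\<close>, \<open>P4\<close>.\<close>

definition neg_part :: "real^5 \<Rightarrow> real^5" where
  "neg_part X = - scal X P0 *\<^sub>R P0 - scal X P1 *\<^sub>R P1"

definition pos_part :: "real^5 \<Rightarrow> real^5" where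
  "pos_part X = scal X P2 *\<^sub>R P2 + scal X P3 *\<^sub>R P3 + scal X P4 *\<^sub>R P4"

lemma parts_sum: "neg_part X + pos_part X = X"
proof -
  have "(x + y) / sqrt 2 / sqrt 2 = (x + y) / 2" for x y :: real
    by (simp add: divide_divide_eq_left)
  then show ?thesis
    unfolding neg_part_def pos_part_def P_scal
    by (simp add: vec_eq_iff forall_5 P0_def P1_def P2_def P3_def P4_def axis_def field_simps)
qed

definition neg_square :: "real^5 \<Rightarrow> real" where
  "neg_square X = (scal X P0)\<^sup>2 + (scal X P1)\<^sup>2"

lemma part_squares: "scal (neg_part X) (neg_part X) = - neg_square X"
  "scal (pos_part X) (pos_part X) = scal X X + neg_square X"
proof -
  show n: "scal (neg_part X) (neg_part X) = - neg_square X"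
    by (simp add: neg_part_def neg_square_def scal_simps P_gram power2_eq_square)
  have np: "scal (neg_part X) (pos_part X) = 0" "scal (pos_part X) (neg_part X) = 0"
    by (simp_all add: neg_part_def pos_part_def scal_simps P_gram)
  have "scal X X = scal (neg_part X + pos_part X) (neg_part X + pos_part X)" by (simp only: parts_sum)
  then show "scal (pos_part X) (pos_part X) = scal X X + neg_square X"
    using n np by (simp add: scal.add_left scal.add_right)
qed

lemma pos_square_zero: "scal (pos_part X) (pos_part X) = 0 \<Longrightarrow> pos_part X = 0"
proof -
  assume "scal (pos_part X) (pos_part X) = 0"
  then have "(scal X P2)\<^sup>2 + (scal X P3)\<^sup>2 + (scal X P4)\<^sup>2 = 0"
    by (simp add: pos_part_def scal_simps P_gram power2_eq_square)
  then have "scal X P2 = 0" "scal X P3 = 0" "scal X P4 = 0"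
    by (smt (verit) zero_le_power2 zero_eq_power2)+
  then show ?thesis by (simp add: pos_part_def)
qed

lemma neg_square_pos:
  assumes "X \<noteq> 0" "scal X X = 0" shows "neg_square X > 0"
proof (rule ccontr)
  assume "\<not> neg_square X > 0"
  then have z: "neg_square X = 0" by (simp add: neg_square_def sum_power2_gt_zero_iff)
  then have "pos_part X = 0" using assms part_squares(2)[of X] by (intro pos_square_zero) simp
  moreover have "neg_part X = 0" using z by (simp add: neg_part_def neg_square_def)
  ultimately show False using parts_sum[of X] assms(1) by simp
qed

lemma S1_times_S2_iff:
  "X \<in> S1_times_S2 \<longleftrightarrow> scal X X = 0 \<and> neg_square X = 1"
proof
  assume "X \<in> S1_times_S2"
  then obtain V W where VW: "X = V + W" "V \<in> span {P0, P1}" "scal V V = -1" "W \<in> span {P2, P3, P4}" "scal W W = 1"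
    by (auto simp: S1_times_S2_def)
  obtain a b where V: "V = a *\<^sub>R P0 + b *\<^sub>R P1"
    using VW(2) by (auto simp: span_insert algebra_simps)
  obtain a' b' c' where W: "W = a' *\<^sub>R P2 + b' *\<^sub>R P3 + c' *\<^sub>R P4"
  proof -
    obtain a' where a': "W - a' *\<^sub>R P2 \<in> span {P3, P4}" using VW(4) span_breakdown_eq by blast
    obtain b' where b': "W - a' *\<^sub>R P2 - b' *\<^sub>R P3 \<in> span {P4}" using a' span_breakdown_eq by blast
    obtain c' where "W - a' *\<^sub>R P2 - b' *\<^sub>R P3 - c' *\<^sub>R P4 \<in> span {}" using b' span_breakdown_eq by blast
    then have "W = a' *\<^sub>R P2 + b' *\<^sub>R P3 + c' *\<^sub>R P4" by (simp add: algebra_simps)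
    then show ?thesis using that by blast
  qed
  have ab: "a\<^sup>2 + b\<^sup>2 = 1"
    using VW(3) unfolding V by (simp add: scal_simps P_gram power2_eq_square)
  have "scal X P0 = - a" "scal X P1 = - b" "scal V W = 0" "scal W V = 0"
    unfolding VW(1) V W by (simp_all add: scal_simps P_gram)
  then show "scal X X = 0 \<and> neg_square X = 1"
    using ab VW by (simp add: neg_square_def scal_simps)
next
  assume "scal X X = 0 \<and> neg_square X = 1"
  then have "scal (neg_part X) (neg_part X) = -1" "scal (pos_part X) (pos_part X) = 1"
    using part_squares[of X] by auto
  moreover have "neg_part X \<in> span {P0, P1}" "pos_part X \<in> span {P2, P3, P4}"
    unfolding neg_part_def pos_part_def
    by (intro span_add span_diff span_neg span_scale; simp add: span_base)+
  ultimately show "X \<in> S1_times_S2"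
    unfolding S1_times_S2_def using parts_sum[of X, symmetric] by blast
qed

text \<open>On a null ray \<open>neg_square\<close> is positive and homogeneous of degree two, so that it takes the
  value 1 exactly once.\<close>

lemma normal_rep_ray:
  assumes "X \<noteq> 0" "scal X X = 0"
  shows "\<exists>t>0. normal_rep (ray X) = t *\<^sub>R X"
proof -
  have sc: "neg_square (t *\<^sub>R X) = t\<^sup>2 * neg_square X" "scal (t *\<^sub>R X) (t *\<^sub>R X) = 0" for t
    using assms(2) by (simp_all add: neg_square_def scal_simps power_mult_distrib distrib_left)
  define s where "s = 1 / sqrt (neg_square X)"
  have pos: "neg_square X > 0" by (rule neg_square_pos[OF assms])
  then have s: "s > 0" "s\<^sup>2 * neg_square X = 1" by (simp_all add: s_def power_divide)
  have "normal_rep (ray X) = s *\<^sub>R X"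
    unfolding normal_rep_def
  proof (rule the_equality)
    show "s *\<^sub>R X \<in> ray X \<and> s *\<^sub>R X \<in> S1_times_S2"
      using s sc by (auto simp: ray_def S1_times_S2_iff)
    fix V assume V: "V \<in> ray X \<and> V \<in> S1_times_S2"
    then obtain t where t: "t > 0" "V = t *\<^sub>R X" by (auto simp: ray_def)
    then have "t\<^sup>2 * neg_square X = s\<^sup>2 * neg_square X" using V sc s by (simp add: S1_times_S2_iff)
    then have "t\<^sup>2 = s\<^sup>2" using pos by simp
    then have "t = s" using t s power2_eq_iff_nonneg[of t s] by simp
    then show "V = s *\<^sub>R X" using t by simp
  qed
  then show ?thesis using s by blast
qed

section \<open>Conformal frames and the conformal Gauss map\<close>

subsection \<open>Linear algebra of frames\<close>

lemma frame_expansion: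
  assumes "F \<in> isometries"
  shows "X = - scal (column 4 F) X *\<^sub>R column 0 F - scal (column 1 F) X *\<^sub>R column 1 F
    + scal (column 2 F) X *\<^sub>R column 2 F + scal (column 3 F) X *\<^sub>R column 3 F
    - scal (column 0 F) X *\<^sub>R column 4 F"
proof -
  have "F ** adj F = mat 1"
    using assms matrix_left_right_inverse by (auto simp: isometries_iff)
  then obtain c where c: "X = F *v c" by (metis matrix_vector_mul_assoc matrix_vector_mul_lid)
  have "scal (column j F) X = scal (axis j 1) c" for j
    unfolding c column_eq_mult_axis by (rule isometry_scal[OF assms])
  then have s: "scal (column 4 F) X = - c$0" "scal (column 1 F) X = - c$1" "scal (column 2 F) X = c$2"
      "scal (column 3 F) X = c$3" "scal (column 0 F) X = - c$4"
    by (simp_all add: scal_def axis_def)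
  show ?thesis
    unfolding s using c by (simp add: matrix_mult_sum sum_5 scalar_mult_eq_scaleR)
qed

lemma scal_eq_axisI:
  assumes "\<And>i. scal X (axis i 1) = scal X' (axis i 1)" shows "X = X'"
proof -
  have "flip X = flip X'"
    using assms by (simp add: vec_eq_iff scal_flip inner_axis)
  then show ?thesis by (metis flip_flip)
qed

definition cross5 :: "real^5 \<Rightarrow> real^5 \<Rightarrow> real^5 \<Rightarrow> real^5 \<Rightarrow> real^5" where
  "cross5 a b c e = flip (\<chi> i. vol a b c (axis i 1) e)"

lemma scal_cross5: "scal (cross5 a b c e) X = vol a b c X e"
proof -
  have "X = (\<Sum>i\<in>UNIV. X $ i *\<^sub>R axis i 1)"
    using basis_expansion[of X] by (simp add: scalar_mult_eq_scaleR)
  then have "vol a b c X e = (\<Sum>i\<in>UNIV. vol a b c (X $ i *\<^sub>R axis i 1) e)"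
    using linear_sum[OF linear_vol(4)[where a=a and b=b and c=c and e=e], of "\<lambda>i. X $ i *\<^sub>R axis i 1" UNIV] by metis
  then show ?thesis
    by (simp add: cross5_def scal_flip inner_vec_def vol_linear mult.commute)
qed

definition frame_matrix :: "real^5 \<Rightarrow> real^5 \<Rightarrow> real^5 \<Rightarrow> real^5 \<Rightarrow> real^5 \<Rightarrow> real^5^5" where
  "frame_matrix a b c d e = transpose (rows5 a b c d e)"

lemma column_frame_matrix [simp]:
  "column 0 (frame_matrix a b c d e) = a" "column 1 (frame_matrix a b c d e) = b"
  "column 2 (frame_matrix a b c d e) = c" "column 3 (frame_matrix a b c d e) = d"
  "column 4 (frame_matrix a b c d e) = e"
  by (simp_all add: frame_matrix_def row_def)

lemma det_frame_matrix: "det (frame_matrix a b c d e) = vol a b c d e"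
  by (simp add: frame_matrix_def det_transpose vol_def)

text \<open>Four vectors with the Gram matrix of the columns \<open>0, 1, 2, 4\<close> of an isometry are completed by
  their cross product: its square \<open>s\<close> is the determinant of the completed matrix, whose own square is
  \<open>s\<close> by comparison of Gram determinants.\<close>

lemma frame_completion:
  assumes g: "scal a a = 0" "scal a b = 0" "scal a c = 0" "scal a e = -1" "scal b b = -1"
    "scal b c = 0" "scal b e = 0" "scal c c = 1" "scal c e = 0" "scal e e = 0"
  shows "scal (cross5 a b c e) (cross5 a b c e) = 1" "scal (cross5 a b c e) a = 0"
    "scal (cross5 a b c e) b = 0" "scal (cross5 a b c e) c = 0" "scal (cross5 a b c e) e = 0"
    "vol a b c (cross5 a b c e) e = 1"
proof -
  let ?w = "cross5 a b c e"
  show p: "scal ?w a = 0" "scal ?w b = 0" "scal ?w c = 0" "scal ?w e = 0"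
    unfolding scal_cross5 by simp_all
  have g': "scal b a = 0" "scal c a = 0" "scal e a = -1" "scal c b = 0" "scal e b = 0" "scal e c = 0"
    "scal a ?w = 0" "scal b ?w = 0" "scal c ?w = 0" "scal e ?w = 0"
    using g p by (simp_all add: scal_commute)
  define s where "s = scal ?w ?w"
  have v: "vol a b c ?w e = s" unfolding s_def scal_cross5 ..
  let ?F = "frame_matrix a b c ?w e"
  define D where "D = ((\<chi> i j. if i = j then if i = 3 then s else 1 else 0) :: real^5^5)"
  have "det D = (\<Prod>i\<in>(UNIV :: 5 set). if i = 3 then s else 1)"
    unfolding D_def by (subst det_diagonal) simp_all
  then have detD: "det D = s" by simp
  have "adj ?F ** ?F = D"
  proof -
    have "adj ?F *v (?F *v axis j 1) = D *v axis j 1" for j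
    proof (rule scal_eq_axisI)
      fix i :: 5
      show "scal (adj ?F *v (?F *v axis j 1)) (axis i 1) = scal (D *v axis j 1) (axis i 1)"
      proof -
        have "scal (adj ?F *v (?F *v axis j 1)) (axis i 1) = scal (column j ?F) (column i ?F)"
          unfolding column_eq_mult_axis by (metis adj_adj scal_adj)
        also have "\<dots> = scal (column j D) (axis i 1)"
        proof -
          have "\<forall>i j. scal (column j ?F) (column i ?F) = scal (column j D) (axis i 1)"
            unfolding forall_5
            by (simp add: g g' p s_def[symmetric]) (simp add: scal_def column_def D_def axis_def)
          then show ?thesis by blast
        qed
        finally show ?thesis unfolding column_eq_mult_axis .
      qed
    qed
    then have "column j (adj ?F ** ?F) = column j D" for j
      unfolding column_eq_mult_axis by (simp add: matrix_vector_mul_assoc)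
    then show ?thesis by (simp add: vec_eq_iff column_def)
  qed
  then have "det ?F * det ?F = s"
    using detD det_mul[of "adj ?F" ?F] by (simp add: det_adj)
  then have "s * s = s" unfolding det_frame_matrix v .
  moreover have "s \<noteq> 0"
  proof
    assume s0: "s = 0"
    have "\<exists>X. vol a b c X e \<noteq> 0"
    proof (rule vol_nonzero_exists)
      fix p q r t assume z: "p *\<^sub>R a + q *\<^sub>R b + r *\<^sub>R c + t *\<^sub>R e = 0"
      have "scal (p *\<^sub>R a + q *\<^sub>R b + r *\<^sub>R c + t *\<^sub>R e) y = 0" for y
        unfolding z by (rule scal.zero_left)
      from this[of a] this[of b] this[of c] this[of e]
      show "p = 0 \<and> q = 0 \<and> r = 0 \<and> t = 0" by (simp add: scal_simps g g')
    qed
    then obtain X0 where X0: "vol a b c X0 e \<noteq> 0" by blast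
    \<comment> \<open>The part of \<open>X0\<close> orthogonal to the four vectors is a multiple of the cross product.\<close>
    define X1 where "X1 = X0 + scal X0 e *\<^sub>R a + scal X0 b *\<^sub>R b - scal X0 c *\<^sub>R c + scal X0 a *\<^sub>R e"
    have v1: "vol a b c X1 e = vol a b c X0 e"
      unfolding X1_def by (simp add: vol_linear)
    have p1: "scal X1 a = 0" "scal X1 b = 0" "scal X1 c = 0" "scal X1 e = 0"
      unfolding X1_def by (simp_all add: scal_simps g g')
    have w1: "scal ?w X1 \<noteq> 0" unfolding scal_cross5 v1 by (rule X0)
    have nz: "scal X1 X1 \<noteq> 0"
    proof
      assume "scal X1 X1 = 0"
      then have "X1 = 0"
        using vol_nonzero_orthogonal[of a b c X1 e X1] X0 v1 p1 by simp
      then show False using w1 by (simp add: scal.zero_right)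
    qed
    define k where "k = scal ?w X1 / scal X1 X1"
    have "?w - k *\<^sub>R X1 = 0"
      by (rule vol_nonzero_orthogonal[of a b c X1 e])
         (use X0 v1 p1 p nz in \<open>simp_all add: scal_simps k_def\<close>)
    then have "s = k * scal ?w X1"
      unfolding s_def by (metis eq_iff_diff_eq_0 scal.scaleR_right real_scaleR_def)
    then show False using s0 w1 nz by (simp add: k_def)
  qed
  ultimately have "s = 1" by simp
  then show "scal ?w ?w = 1" "vol a b c ?w e = 1" using v s_def by simp_all
qed

lemma frame_matrix_isometry:
  assumes "scal a a = 0" "scal a b = 0" "scal a c = 0" "scal a d = 0" "scal a e = -1" "scal b b = -1"
    "scal b c = 0" "scal b d = 0" "scal b e = 0" "scal c c = 1" "scal c d = 0" "scal c e = 0"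
    "scal d d = 1" "scal d e = 0" "scal e e = 0"
  shows "frame_matrix a b c d e \<in> isometries"
proof (rule isometryI)
  have sym: "scal b a = 0" "scal c a = 0" "scal d a = 0" "scal e a = -1" "scal c b = 0" "scal d b = 0"
    "scal e b = 0" "scal d c = 0" "scal e c = 0" "scal e d = 0"
    using assms by (simp_all add: scal_commute)
  have "\<forall>i j. scal (column i (frame_matrix a b c d e)) (column j (frame_matrix a b c d e))
      = scal (axis i 1) (axis j 1)"
    unfolding forall_5 scal_axis using assms sym by simp
  then show "scal (column i (frame_matrix a b c d e)) (column j (frame_matrix a b c d e))
      = scal (axis i 1) (axis j 1)" for i j by blast
qed

lemma column_R1_R2:
  "column j (F ** (R1 ** R2)) = (if j = 1 \<or> j = 2 then - column j F else column j F)"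
proof -
  have "\<forall>j. (R1 ** R2) *v axis j 1 = (if j = 1 \<or> j = 2 then - axis j 1 else axis j (1::real))"
    unfolding forall_5
    by (simp add: R1_def R2_def matrix_vector_mul_assoc[symmetric] reflection_mult scal_axis scal_simps)
       (simp add: vec_eq_iff axis_def forall_5)
  then show ?thesis
    unfolding column_eq_mult_axis matrix_vector_mul_assoc[symmetric]
    by (simp add: linear_neg[OF matrix_vector_mul_linear])
qed

text \<open>An isometry is inverted by taking scalar products with its columns. The column with index 1
  has square -1, which accounts for the sign.\<close>

lemma mc_form_scal:
  assumes F: "F x \<in> isometries" and d: "(F \<circ> chart_inv c) differentiable (at (snd c x))"
  shows "mc_form c F x 3 j v = scal (column 3 (F x)) (differential c (\<lambda>x. column j (F x)) x v)"
    "mc_form c F x 1 j v = - scal (column 1 (F x)) (differential c (\<lambda>x. column j (F x)) x v)"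
    "mc_form c F x 2 j v = scal (column 2 (F x)) (differential c (\<lambda>x. column j (F x)) x v)"
proof -
  have bl: "bounded_linear (\<lambda>M :: real^5^5. column j M)"
    by (rule linear_conv_bounded_linear[THEN iffD1], rule linearI) (simp_all add: column_def vec_eq_iff)
  have "((\<lambda>p. column j ((F \<circ> chart_inv c) p)) has_derivative (\<lambda>v. column j (differential c F x v))) (at (snd c x))"
    unfolding differential_def
    by (rule bounded_linear.has_derivative[OF bl]) (use d frechet_derivative_works in blast)
  then have col: "differential c (\<lambda>x. column j (F x)) x v = column j (differential c F x v)"
    unfolding differential_def comp_def using frechet_derivative_at by metis
  define \<Phi> where "\<Phi> = matrix_inv (F x) ** differential c F x v"
  have "det (F x) \<noteq> 0" using isometry_det[OF F] by auto
  then have "F x ** \<Phi> = differential c F x v"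
    unfolding \<Phi>_def by (simp add: matrix_mul_assoc matrix_inv_inverse)
  then have "column j (differential c F x v) = F x *v column j \<Phi>"
    by (simp only: column_mult[symmetric])
  then have "scal (column i (F x)) (differential c (\<lambda>x. column j (F x)) x v) = scal (axis i 1) (column j \<Phi>)" for i
    unfolding col by (simp only: column_eq_mult_axis[of i] isometry_scal[OF F])
  then show "mc_form c F x 3 j v = scal (column 3 (F x)) (differential c (\<lambda>x. column j (F x)) x v)"
    "mc_form c F x 1 j v = - scal (column 1 (F x)) (differential c (\<lambda>x. column j (F x)) x v)"
    "mc_form c F x 2 j v = scal (column 2 (F x)) (differential c (\<lambda>x. column j (F x)) x v)"
    unfolding mc_form_def \<Phi>_def[symmetric] by (simp_all add: scal_def axis_def column_def)
qed

lemma wedge_compose: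
  assumes "linear \<alpha>" "linear \<beta>" "linear L"
  shows "wedge (\<lambda>v. \<alpha> (L v)) (\<lambda>v. \<beta> (L v)) = det (matrix L) * wedge \<alpha> \<beta>"
proof -
  have L: "L v = L v $ 1 *\<^sub>R axis 1 1 + L v $ 2 *\<^sub>R axis 2 1" for v
    by (simp add: vec_eq_iff forall_2 axis_def)
  have e: "\<alpha> (L v) = L v $ 1 * \<alpha> (axis 1 1) + L v $ 2 * \<alpha> (axis 2 1)"
     "\<beta> (L v) = L v $ 1 * \<beta> (axis 1 1) + L v $ 2 * \<beta> (axis 2 1)" for v
    by (subst L, simp add: linear_add[OF assms(1)] linear_cmul[OF assms(1)] linear_add[OF assms(2)] linear_cmul[OF assms(2)])+
  show ?thesis
    unfolding wedge_def e det_2 matrix_def by (simp add: algebra_simps)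
qed

subsection \<open>Existence of second order frames\<close>

abbreviation dd :: "('a::real_normed_vector \<Rightarrow> 'b::real_normed_vector) \<Rightarrow> 'a \<Rightarrow> 'a \<Rightarrow> 'b" where
  "dd h v p \<equiv> frechet_derivative h (at p) v"

lemma dd_scal:
  assumes "a differentiable (at p)" "b differentiable (at p)"
  shows "dd (\<lambda>q. scal (a q) (b q)) v p = scal (dd a v p) (b p) + scal (a p) (dd b v p)"
proof -
  have "((\<lambda>q. scal (a q) (b q)) has_derivative (\<lambda>v. scal (a p) (dd b v p) + scal (dd a v p) (b p))) (at p)"
    by (rule scal.FDERIV) (use assms frechet_derivative_works in blast)+
  from frechet_derivative_at[OF this] show ?thesis by (simp add: fun_eq_iff add.commute)
qed

lemma dd_const_on:
  assumes "open S" "p \<in> S" "\<And>q. q \<in> S \<Longrightarrow> h q = c"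
  shows "dd h v p = 0"
proof -
  have "(h has_derivative (\<lambda>v. 0)) (at p)"
    by (rule has_derivative_transform_within_open[OF has_derivative_const assms(1,2)]) (simp add: assms(3))
  then show ?thesis using frechet_derivative_at by metis
qed

lemma scal_const_dd:
  assumes "open S" "p \<in> S" "\<And>q. q \<in> S \<Longrightarrow> scal (a q) (b q) = c"
    and "smooth_on S a" "smooth_on S b"
  shows "scal (a p) (dd b v p) = - scal (dd a v p) (b p)"
  using dd_const_on[OF assms(1-3), where v=v] dd_scal[of a p b v] assms(2,4,5)
  by (simp add: smooth_on_differentiable)

lemma smooth_on_scal:
  "open S \<Longrightarrow> smooth_on S a \<Longrightarrow> smooth_on S b \<Longrightarrow> smooth_on S (\<lambda>q. scal (a q) (b q))"
  by (rule smooth_on_bilinear[OF bounded_bilinear_scal])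

lemma dd_linear: "smooth_on S h \<Longrightarrow> p \<in> S \<Longrightarrow> linear (\<lambda>v. dd h v p)"
  using has_derivative_linear[OF smooth_on_has_derivative] .

lemma plane_basis:
  fixes v1 v2 :: "real^2"
  assumes "v1$1 * v2$2 - v1$2 * v2$1 \<noteq> 0"
  obtains a b where "v = a *\<^sub>R v1 + b *\<^sub>R v2"
proof -
  let ?d = "v1$1 * v2$2 - v1$2 * v2$1"
  have "v = ((v$1 * v2$2 - v$2 * v2$1) / ?d) *\<^sub>R v1 + ((v1$1 * v$2 - v1$2 * v$1) / ?d) *\<^sub>R v2"
  proof -
    have "(v$1 * v2$2 - v$2 * v2$1) * v1$i + (v1$1 * v$2 - v1$2 * v$1) * v2$i = ?d * v$i" for i
      using exhaust_2[of i] by (auto simp: algebra_simps)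
    then show ?thesis
      using assms by (simp add: vec_eq_iff add_divide_distrib[symmetric])
  qed
  then show ?thesis using that by blast
qed

lemma wedge_basis:
  assumes "linear \<alpha>" "linear \<beta>"
  shows "\<alpha> v1 * \<beta> v2 - \<alpha> v2 * \<beta> v1 = (v1$1 * v2$2 - v1$2 * v2$1) * wedge \<alpha> \<beta>"
proof -
  have e: "v = v$1 *\<^sub>R axis 1 1 + v$2 *\<^sub>R axis 2 1" for v :: "real^2"
    by (simp add: vec_eq_iff forall_2 axis_def)
  have a: "\<alpha> v = v$1 * \<alpha> (axis 1 1) + v$2 * \<alpha> (axis 2 1)" for v
    by (subst e) (simp add: linear_add[OF assms(1)] linear_cmul[OF assms(1)])
  have b: "\<beta> v = v$1 * \<beta> (axis 1 1) + v$2 * \<beta> (axis 2 1)" for v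
    by (subst e) (simp add: linear_add[OF assms(2)] linear_cmul[OF assms(2)])
  show ?thesis unfolding wedge_def a[of v1] a[of v2] b[of v1] b[of v2] by (simp add: algebra_simps)
qed

text \<open>The conditions on a frame with columns \<open>F0 = y\<close>, \<open>F1\<close>, \<open>F2\<close>, \<open>F3 = n\<close>, in coordinates. The
  entries of \<open>F\<^sup>-\<^sup>1 dF\<close> are scalar products, with a minus sign in the row of \<open>F1\<close>, whose square is
  -1.\<close>

definition second_order_at ::
  "(real^2 \<Rightarrow> real^5) \<Rightarrow> (real^2 \<Rightarrow> real^5) \<Rightarrow> (real^2 \<Rightarrow> real^5) \<Rightarrow> (real^2 \<Rightarrow> real^5) \<Rightarrow> real^2 \<Rightarrow> bool" where
  "second_order_at y F1 F2 n p \<longleftrightarrow> (\<forall>v. scal (n p) (dd y v p) = 0) \<and>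
     wedge (\<lambda>v. - scal (F1 p) (dd y v p)) (\<lambda>v. scal (F2 p) (dd y v p)) > 0 \<and>
     wedge (\<lambda>v. scal (n p) (dd F1 v p)) (\<lambda>v. scal (F2 p) (dd y v p)) +
       wedge (\<lambda>v. scal (n p) (dd F2 v p)) (\<lambda>v. - scal (F1 p) (dd y v p)) = 0"

text \<open>The change of sign of two columns moves a frame from one component of the isometries of
  determinant 1 to the other.\<close>

lemma second_order_at_minus:
  assumes "F1 differentiable (at p)" "F2 differentiable (at p)"
  shows "second_order_at y (\<lambda>q. - F1 q) (\<lambda>q. - F2 q) n p = second_order_at y F1 F2 n p"
proof -
  have m: "dd (\<lambda>q. - h q) v p = - dd h v p" if "h differentiable (at p)" for h :: "real^2 \<Rightarrow> real^5" and v
  proof -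
    have "((\<lambda>q. - h q) has_derivative (\<lambda>v. - dd h v p)) (at p)"
      by (rule has_derivative_minus) (use that frechet_derivative_works in blast)
    then show ?thesis using frechet_derivative_at by metis
  qed
  show ?thesis unfolding second_order_at_def by (simp add: m assms scal_simps wedge_def)
qed

text \<open>Gram-Schmidt applied to the derivatives of \<open>y\<close> gives \<open>F1\<close> and \<open>F2\<close>; the null vector \<open>F4\<close>
  comes from a constant vector, and \<open>F3\<close> is the cross product of the others, corrected by the
  multiple of \<open>y\<close> that makes the second order condition hold.\<close>

lemma local_frame:
  assumes O: "open S" "p0 \<in> S" and y: "smooth_on S y" "\<And>p. p \<in> S \<Longrightarrow> scal (y p) (y p) = 0" "y p0 \<noteq> 0"
    and e: "scal (dd y e1 p0) (dd y e1 p0) = -1" "scal (dd y e2 p0) (dd y e2 p0) = 1"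
      "scal (dd y e1 p0) (dd y e2 p0) = 0"
  obtains W F1 F2 n F4 where "open W" "p0 \<in> W" "W \<subseteq> S" "connected W"
    "smooth_on W F1" "smooth_on W F2" "smooth_on W n" "smooth_on W F4"
    "\<And>p. p \<in> W \<Longrightarrow> frame_matrix (y p) (F1 p) (F2 p) (n p) (F4 p) \<in> isometries"
    "\<And>p. p \<in> W \<Longrightarrow> det (frame_matrix (y p) (F1 p) (F2 p) (n p) (F4 p)) = 1"
    "\<And>p. p \<in> W \<Longrightarrow> second_order_at y F1 F2 n p"
proof -
  have e_pos: "\<exists>v2. scal (dd y v2 p0) (dd y v2 p0) = 1 \<and> scal (dd y e1 p0) (dd y v2 p0) = 0 \<and>
      e1$1 * v2$2 - e1$2 * v2$1 > 0"
  proof -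
    have lin: "linear (\<lambda>v. dd y v p0)" by (rule dd_linear[OF y(1) O(2)])
    have "e1$1 * e2$2 - e1$2 * e2$1 \<noteq> 0"
    proof
      assume z: "e1$1 * e2$2 - e1$2 * e2$1 = 0"
      have "e1$i *\<^sub>R e2 = e2$i *\<^sub>R e1" for i
        using z exhaust_2[of i] by (auto simp: vec_eq_iff forall_2 algebra_simps)
      then have "e1$i *\<^sub>R dd y e2 p0 = e2$i *\<^sub>R dd y e1 p0" for i
        using linear_cmul[OF lin] by metis
      then have "scal (dd y e1 p0) (e1$i *\<^sub>R dd y e2 p0) = scal (dd y e1 p0) (e2$i *\<^sub>R dd y e1 p0)" for i
        by simp
      then have "e2 $ i = 0" for i using e by (simp add: scal_simps)
      then have "e2 = 0" by (simp add: vec_eq_iff)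
      then show False using e(2) linear_0[OF lin] by (simp add: scal.zero_left)
    qed
    then consider "e1$1 * e2$2 - e1$2 * e2$1 > 0" | "e1$1 * (-e2)$2 - e1$2 * (-e2)$1 > 0" by fastforce
    then show ?thesis
    proof cases
      case 1
      then show ?thesis using e by blast
    next
      case 2
      then show ?thesis using e linear_neg[OF lin, of e2] by (intro exI[of _ "- e2"]) (simp add: scal_simps)
    qed
  qed
  then obtain e2 where e2: "scal (dd y e2 p0) (dd y e2 p0) = 1" "scal (dd y e1 p0) (dd y e2 p0) = 0"
      "e1$1 * e2$2 - e1$2 * e2$1 > 0" by blast
  obtain Z where Z: "scal Z (y p0) \<noteq> 0" using scal_nondegenerate[OF _] y(3) scal_commute by metis
  define b where "b p = - scal (dd y e1 p) (dd y e1 p)" for p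
  have sy: "smooth_on S (dd y v)" for v by (rule smooth_on_frechet[OF y(1)])
  have sb: "smooth_on S b"
    unfolding b_def by (intro smooth_on_minus smooth_on_scal sy O)
  define S1 where "S1 = {p \<in> S. b p > 0}"
  have oS1: "open S1"
    unfolding S1_def using continuous_open_preimage[OF smooth_on_continuous[OF sb] O(1), of "{0<..}"]
    by (simp add: Int_def vimage_def)
  have S1: "S1 \<subseteq> S" "p0 \<in> S1" using e(1) O(2) by (auto simp: S1_def b_def)
  define F1 where "F1 p = (1 / sqrt (b p)) *\<^sub>R dd y e1 p" for p
  define T where "T p = dd y e2 p + scal (dd y e2 p) (F1 p) *\<^sub>R F1 p" for p
  have sF1: "smooth_on S1 F1"
    unfolding F1_def
    by (intro smooth_on_scaleR smooth_on_divide smooth_on_const smooth_on_sqrt oS1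
        smooth_on_subset[OF sb] smooth_on_subset[OF sy] S1) (auto simp: S1_def)
  have sT: "smooth_on S1 T"
    unfolding T_def by (intro smooth_on_add smooth_on_scaleR smooth_on_scal oS1 sF1 smooth_on_subset[OF sy] S1)
  have sTT: "smooth_on S1 (\<lambda>p. scal (T p) (T p))" by (intro smooth_on_scal oS1 sT)
  have sZ: "smooth_on S1 (\<lambda>p. scal Z (y p))"
    by (intro smooth_on_scal oS1 smooth_on_const smooth_on_subset[OF y(1)] S1)
  define S2 where "S2 = {p \<in> S1. scal (T p) (T p) > 0 \<and> scal Z (y p) \<noteq> 0}"
  have "open {p \<in> S1. scal (T p) (T p) > 0}" "open {p \<in> S1. scal Z (y p) \<noteq> 0}"
    using continuous_open_preimage[OF smooth_on_continuous[OF sTT] oS1, of "{0<..}"]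
      continuous_open_preimage[OF smooth_on_continuous[OF sZ] oS1, of "- {0}"]
    by (simp_all add: Int_def vimage_def open_Compl)
  then have oS2: "open S2"
    using open_Int[of "{p \<in> S1. scal (T p) (T p) > 0}" "{p \<in> S1. scal Z (y p) \<noteq> 0}"]
    by (simp add: S2_def Int_def conj_ac cong: conj_cong)
  have F1p0: "F1 p0 = dd y e1 p0" using e(1) by (simp add: F1_def b_def)
  have "T p0 = dd y e2 p0" using e2(2) by (simp add: T_def F1p0 scal_commute)
  then have p0S2: "p0 \<in> S2" using S1 e2(1) Z by (simp add: S2_def)
  have S2: "S2 \<subseteq> S1" "S2 \<subseteq> S" using S1 by (auto simp: S2_def)
  obtain r0 where r0: "r0 > 0" "ball p0 r0 \<subseteq> S2" using oS2 p0S2 openE by blast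
  define W where "W = ball p0 r0"
  have W: "open W" "p0 \<in> W" "W \<subseteq> S" "connected W" "W \<subseteq> S1" "W \<subseteq> S2"
    using r0 S2 by (auto simp: W_def)
  define F2 where "F2 p = (1 / sqrt (scal (T p) (T p))) *\<^sub>R T p" for p
  have sF2: "smooth_on W F2"
    unfolding F2_def
    by (intro smooth_on_scaleR smooth_on_divide smooth_on_const smooth_on_sqrt
        smooth_on_subset[OF sTT] smooth_on_subset[OF sT] W) (use W(6) in \<open>auto simp: S2_def\<close>)
  have sF1: "smooth_on W F1" by (rule smooth_on_subset[OF sF1 W(5)])
  have syW: "smooth_on W y" "smooth_on W (dd y v)" for v
    by (rule smooth_on_subset[OF y(1) W(3)], rule smooth_on_subset[OF sy W(3)])
  define Q where "Q p = (- 1 / scal Z (y p)) *\<^sub>R (Z + scal Z (F1 p) *\<^sub>R F1 p - scal Z (F2 p) *\<^sub>R F2 p)" for p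
  define F4' where "F4' p = Q p + (scal (Q p) (Q p) / 2) *\<^sub>R y p" for p
  have sQ: "smooth_on W Q"
    unfolding Q_def
    by (intro smooth_on_scaleR smooth_on_divide smooth_on_add smooth_on_diff smooth_on_scal smooth_on_const
        sF1 sF2 syW W) (use W(6) in \<open>auto simp: S2_def\<close>)
  have sF4': "smooth_on W F4'"
    unfolding F4'_def by (intro smooth_on_add smooth_on_scaleR smooth_on_divide smooth_on_scal smooth_on_const sQ syW W) simp
  define m where "m p = cross5 (y p) (F1 p) (F2 p) (F4' p)" for p
  have sm: "smooth_on W m"
    unfolding m_def cross5_def
    by (rule smooth_on_linear_compose[OF linear_conv_bounded_linear[THEN iffD1, OF linear_flip] W(1)])
       (rule smooth_on_vec[OF W(1)], simp, intro smooth_on_vol W syW sF1 sF2 sF4' smooth_on_const)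
  have yy: "scal (y p) (dd y v p) = 0" if "p \<in> W" for p v
    using scal_const_dd[OF W(1) that, of y y 0 v] y(2) W(3) syW by (auto simp: scal_commute)
  have gram: "scal (y p) (y p) = 0 \<and> scal (y p) (F1 p) = 0 \<and> scal (y p) (F2 p) = 0 \<and> scal (y p) (F4' p) = -1 \<and>
     scal (F1 p) (F1 p) = -1 \<and> scal (F1 p) (F2 p) = 0 \<and> scal (F1 p) (F4' p) = 0 \<and> scal (F2 p) (F2 p) = 1 \<and>
     scal (F2 p) (F4' p) = 0 \<and> scal (F4' p) (F4' p) = 0 \<and> sqrt (b p) > 0 \<and> sqrt (scal (T p) (T p)) > 0 \<and>
     dd y e1 p = sqrt (b p) *\<^sub>R F1 p \<and> scal (F2 p) (dd y e2 p) = sqrt (scal (T p) (T p))"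
    if p: "p \<in> W" for p
  proof -
    have pos: "b p > 0" "scal (T p) (T p) > 0" "scal Z (y p) \<noteq> 0"
      using p W by (auto simp: S1_def S2_def)
    have a0: "scal (y p) (y p) = 0" using y(2) W(3) p by blast
    have a1: "scal (y p) (F1 p) = 0" by (simp add: F1_def scal_simps yy[OF p])
    have aT: "scal (y p) (T p) = 0" by (simp add: T_def scal_simps yy[OF p] a1)
    have a2: "scal (y p) (F2 p) = 0" by (simp add: F2_def scal_simps aT)
    have de: "dd y e1 p = sqrt (b p) *\<^sub>R F1 p" using pos by (simp add: F1_def)
    have sb2: "sqrt (b p) * sqrt (b p) = b p" using pos by simp
    have b1: "scal (F1 p) (F1 p) = -1"
      unfolding F1_def using pos sb2 by (simp add: scal_simps b_def[symmetric]) (simp add: b_def field_simps)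
    have bT: "scal (F1 p) (T p) = 0" by (simp add: T_def scal_simps b1 scal_commute)
    have b2: "scal (F1 p) (F2 p) = 0" by (simp add: F2_def scal_simps bT)
    have st: "sqrt (scal (T p) (T p)) * sqrt (scal (T p) (T p)) = scal (T p) (T p)" using pos by simp
    have c2: "scal (F2 p) (F2 p) = 1"
      unfolding F2_def using pos st by (simp add: scal_simps)
    have yQ: "scal (y p) (Q p) = -1"
      unfolding Q_def using pos a1 a2 by (simp add: scal_simps scal_commute[of "y p" Z])
    have F1Q: "scal (F1 p) (Q p) = 0"
      unfolding Q_def by (simp add: scal_simps b1 b2 scal_commute[of "F1 p" Z])
    have F2Q: "scal (F2 p) (Q p) = 0"
      unfolding Q_def by (simp add: scal_simps c2 b2 scal_commute[of "F2 p" Z] scal_commute[of "F2 p" "F1 p"])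
    have "scal (y p) (F4' p) = -1" "scal (F1 p) (F4' p) = 0" "scal (F2 p) (F4' p) = 0"
      unfolding F4'_def by (simp_all add: scal_simps a0 yQ F1Q F2Q a1 a2 scal_commute[of "F1 p" "y p"] scal_commute[of "F2 p" "y p"])
    moreover have "scal (F4' p) (F4' p) = 0"
      unfolding F4'_def by (simp add: scal_simps a0 yQ scal_commute[of "Q p" "y p"])
    moreover have "scal (F2 p) (dd y e2 p) = sqrt (scal (T p) (T p))"
    proof -
      have "scal (F2 p) (T p) = sqrt (scal (T p) (T p))"
        unfolding F2_def using pos st by (simp add: scal_simps real_div_sqrt)
      then show ?thesis unfolding T_def scal_simps using b2 by (simp add: scal_commute[of "F2 p" "F1 p"] scal_simps)
    qed
    ultimately show ?thesis using a0 a1 a2 b1 b2 c2 de pos by simp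
  qed
  have comp: "scal (m p) (m p) = 1" "scal (m p) (y p) = 0" "scal (m p) (F1 p) = 0" "scal (m p) (F2 p) = 0"
      "scal (m p) (F4' p) = 0" "vol (y p) (F1 p) (F2 p) (m p) (F4' p) = 1" if "p \<in> W" for p
    unfolding m_def
    by (rule frame_completion; simp only: gram[OF that])+
  define S0 where "S0 p = wedge (\<lambda>v. scal (m p) (dd F1 v p)) (\<lambda>v. scal (F2 p) (dd y v p)) +
       wedge (\<lambda>v. scal (m p) (dd F2 v p)) (\<lambda>v. - scal (F1 p) (dd y v p))" for p
  define V where "V p = wedge (\<lambda>v. - scal (F1 p) (dd y v p)) (\<lambda>v. scal (F2 p) (dd y v p))" for p
  define r where "r p = - S0 p / (2 * V p)" for p
  define n where "n p = m p + r p *\<^sub>R y p" for p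
  define F4 where "F4 p = F4' p + r p *\<^sub>R m p + ((r p)\<^sup>2 / 2) *\<^sub>R y p" for p
  have Vpos: "V p > 0" if p: "p \<in> W" for p
  proof -
    have l: "linear (\<lambda>v. dd y v p)" by (rule dd_linear[OF syW(1) p])
    have l1: "linear (\<lambda>v. - scal (F1 p) (dd y v p))" "linear (\<lambda>v. scal (F2 p) (dd y v p))"
      by (rule linearI; simp add: linear_add[OF l] linear_cmul[OF l] scal_simps)+
    have "- scal (F1 p) (dd y e1 p) * scal (F2 p) (dd y e2 p) - (- scal (F1 p) (dd y e2 p)) * scal (F2 p) (dd y e1 p)
        = sqrt (b p) * sqrt (scal (T p) (T p))"
      using gram[OF p] by (simp add: scal_simps scal_commute[of "F2 p" "F1 p"])
    then have "(e1$1 * e2$2 - e1$2 * e2$1) * V p = sqrt (b p) * sqrt (scal (T p) (T p))"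
      using wedge_basis[OF l1, of e1 e2] unfolding V_def by linarith
    then have "(e1$1 * e2$2 - e1$2 * e2$1) * V p > 0"
      using gram[OF p] by simp
    then show ?thesis using e2(3) by (simp add: zero_less_mult_iff)
  qed
  have sw: "smooth_on W (\<lambda>p. wedge (\<lambda>v. \<alpha> v p) (\<lambda>v. \<beta> v p))"
    if "\<And>v. smooth_on W (\<alpha> v)" "\<And>v. smooth_on W (\<beta> v)" for \<alpha> \<beta> :: "real^2 \<Rightarrow> real^2 \<Rightarrow> real"
    unfolding wedge_def by (intro smooth_on_diff smooth_on_mult that W)
  have sS0: "smooth_on W S0" and sV: "smooth_on W V"
    unfolding S0_def V_def
    by (intro smooth_on_add sw smooth_on_minus smooth_on_scal smooth_on_frechet syW sF1 sF2 sm W)+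
  have sr: "smooth_on W r"
    unfolding r_def using Vpos
    by (intro smooth_on_divide smooth_on_minus smooth_on_mult smooth_on_const sS0 sV W) (metis less_irrefl mult_eq_0_iff zero_neq_numeral)
  have sn: "smooth_on W n"
    unfolding n_def by (intro smooth_on_add smooth_on_scaleR sm sr syW W)
  have sF4: "smooth_on W F4"
    unfolding F4_def power2_eq_square
    by (intro smooth_on_add smooth_on_scaleR smooth_on_divide smooth_on_mult smooth_on_const sm sr syW sF4' W) simp
  show ?thesis
  proof (rule that[OF W(1-4) sF1 sF2 sn sF4])
    fix p assume p: "p \<in> W"
    note g = gram[OF p] and c = comp[OF p]
    have g': "scal (F1 p) (y p) = 0" "scal (F2 p) (y p) = 0" "scal (F4' p) (y p) = -1" "scal (y p) (m p) = 0"
      "scal (F1 p) (m p) = 0" "scal (F2 p) (m p) = 0" "scal (F4' p) (m p) = 0"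
      using g c by (simp_all add: scal_commute)
    show "frame_matrix (y p) (F1 p) (F2 p) (n p) (F4 p) \<in> isometries"
      unfolding n_def F4_def
      by (rule frame_matrix_isometry) (use g c g' in \<open>simp_all add: scal_simps power2_eq_square\<close>)
    show "det (frame_matrix (y p) (F1 p) (F2 p) (n p) (F4 p)) = 1"
      unfolding det_frame_matrix n_def F4_def using c(6) by (simp add: vol_linear)
    have dF: "scal (y p) (dd F1 v p) = - scal (F1 p) (dd y v p)" "scal (y p) (dd F2 v p) = - scal (F2 p) (dd y v p)" for v
      using scal_const_dd[OF W(1) p, of y F1 0 v] scal_const_dd[OF W(1) p, of y F2 0 v] gram syW sF1 sF2
      by (simp_all add: scal_commute)
    have ny: "scal (n p) (dd y v p) = 0" for v
    proof -
      obtain a1 a2 where v: "v = a1 *\<^sub>R e1 + a2 *\<^sub>R e2"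
        using plane_basis[of e1 e2 v] e2(3) by auto
      have l: "linear (\<lambda>v. dd y v p)" by (rule dd_linear[OF syW(1) p])
      have "dd y e2 p = sqrt (scal (T p) (T p)) *\<^sub>R F2 p - scal (dd y e2 p) (F1 p) *\<^sub>R F1 p"
        using g by (simp add: F2_def T_def)
      then have "scal (n p) (dd y e2 p) = scal (n p) (sqrt (scal (T p) (T p)) *\<^sub>R F2 p - scal (dd y e2 p) (F1 p) *\<^sub>R F1 p)"
        by simp
      moreover have "scal (n p) (F1 p) = 0" "scal (n p) (F2 p) = 0"
        using c g by (simp_all add: n_def scal_simps)
      ultimately show ?thesis
        using g unfolding v linear_add[OF l] linear_cmul[OF l] by (simp add: scal_simps)
    qed
    have "wedge (\<lambda>v. scal (n p) (dd F1 v p)) (\<lambda>v. scal (F2 p) (dd y v p)) +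
       wedge (\<lambda>v. scal (n p) (dd F2 v p)) (\<lambda>v. - scal (F1 p) (dd y v p)) = S0 p + 2 * r p * V p"
      unfolding n_def S0_def V_def wedge_def scal_simps dF by (simp add: algebra_simps)
    also have "\<dots> = 0" using Vpos[OF p] by (simp add: r_def)
    finally show "second_order_at y F1 F2 n p"
      unfolding second_order_at_def using ny Vpos[OF p] V_def by auto
  qed
qed

subsection \<open>The conditions that determine the conformal Gauss map\<close>

lemma dd_cong:
  assumes "open S" "p \<in> S" "\<And>q. q \<in> S \<Longrightarrow> h q = g q"
  shows "dd h v p = dd g v p"
proof -
  have "(h has_derivative D) (at p) \<longleftrightarrow> (g has_derivative D) (at p)" for D
  proof
    assume "(h has_derivative D) (at p)"
    then show "(g has_derivative D) (at p)"
      by (rule has_derivative_transform_within_open[OF _ assms(1,2)]) (simp add: assms(3))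
  next
    assume "(g has_derivative D) (at p)"
    then show "(h has_derivative D) (at p)"
      by (rule has_derivative_transform_within_open[OF _ assms(1,2)]) (simp add: assms(3))
  qed
  then show ?thesis unfolding frechet_derivative_def by presburger
qed

abbreviation e1 :: "real^2" where "e1 \<equiv> axis 1 1"
abbreviation e2 :: "real^2" where "e2 \<equiv> axis 2 1"

text \<open>A unit normal \<open>n\<close> of the lift \<open>y\<close>, with the sign given by the orientation, whose second
  fundamental form is trace free for the induced metric.\<close>

definition gauss_normal :: "(real^2 \<Rightarrow> real^5) \<Rightarrow> real^5 \<Rightarrow> real^2 \<Rightarrow> bool" where
  "gauss_normal y n p \<longleftrightarrow> scal n n = 1 \<and> scal n (y p) = 0 \<and> (\<forall>v. scal n (dd y v p) = 0) \<and>
     scal (dd y e1 p) (dd y e1 p) * scal n (dd (dd y e2) e2 p)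
       - 2 * scal (dd y e1 p) (dd y e2 p) * scal n (dd (dd y e1) e2 p)
       + scal (dd y e2 p) (dd y e2 p) * scal n (dd (dd y e1) e1 p) = 0 \<and>
     (\<forall>Z. scal (y p) Z < 0 \<longrightarrow> vol (y p) (dd y e1 p) (dd y e2 p) n Z > 0)"

text \<open>Expressed by the frame, the second order condition says that the second fundamental form in
  the direction \<open>n\<close> has trace zero with respect to the induced metric. This does not change when
  \<open>F0\<close> is replaced by its multiple \<open>y\<close>.\<close>

lemma second_order_gauss_normal:
  assumes S: "open S" "p \<in> S"
    and sm: "smooth_on S y" "smooth_on S F1" "smooth_on S F2" "smooth_on S n" "smooth_on S F0"
    and F0: "\<And>q. q \<in> S \<Longrightarrow> \<exists>t>0. F0 q = t *\<^sub>R y q"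
    and iso: "\<And>q. q \<in> S \<Longrightarrow> frame_matrix (F0 q) (F1 q) (F2 q) (n q) (F4 q) \<in> isometries"
    and det: "det (frame_matrix (F0 p) (F1 p) (F2 p) (n p) (F4 p)) = 1"
    and so: "\<And>q. q \<in> S \<Longrightarrow> second_order_at F0 F1 F2 n q"
  shows "gauss_normal y (n p) p"
proof -
  have g: "scal (F0 q) (F0 q) = 0" "scal (F0 q) (F1 q) = 0" "scal (F0 q) (F2 q) = 0" "scal (F0 q) (n q) = 0"
      "scal (F0 q) (F4 q) = -1" "scal (F1 q) (F1 q) = -1" "scal (F1 q) (F2 q) = 0" "scal (F1 q) (n q) = 0"
      "scal (F2 q) (F2 q) = 1" "scal (F2 q) (n q) = 0" "scal (n q) (n q) = 1" "scal (n q) (F1 q) = 0" "scal (n q) (F2 q) = 0"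
      "scal (n q) (F0 q) = 0"
    if "q \<in> S" for q
    using isometry_column_scal[OF iso[OF that], of 0 0] isometry_column_scal[OF iso[OF that], of 0 1]
      isometry_column_scal[OF iso[OF that], of 0 2] isometry_column_scal[OF iso[OF that], of 0 3]
      isometry_column_scal[OF iso[OF that], of 0 4] isometry_column_scal[OF iso[OF that], of 1 1]
      isometry_column_scal[OF iso[OF that], of 1 2] isometry_column_scal[OF iso[OF that], of 1 3]
      isometry_column_scal[OF iso[OF that], of 2 2] isometry_column_scal[OF iso[OF that], of 2 3]
      isometry_column_scal[OF iso[OF that], of 3 3] isometry_column_scal[OF iso[OF that], of 3 1]
      isometry_column_scal[OF iso[OF that], of 3 2] isometry_column_scal[OF iso[OF that], of 3 0]
    by simp_all
  have y0: "scal X (F0 q) = 0 \<longleftrightarrow> scal X (y q) = 0" "scal (F0 q) X = 0 \<longleftrightarrow> scal (y q) X = 0" if "q \<in> S" for X q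
    using F0[OF that] by (auto simp: scal_simps)
  have ny: "scal (n q) (y q) = 0" if "q \<in> S" for q using g(14)[OF that] y0(1)[OF that] by simp
  have dny: "scal (dd n v q) (y q) = 0" if "q \<in> S" for v q
  proof -
    have "scal (n q) (dd F0 v q) = 0" using so[OF that] by (simp add: second_order_at_def)
    then have "scal (dd n v q) (F0 q) = 0"
      using scal_const_dd[OF S(1) that, of n F0 0 v] g(14) sm by simp
    then show ?thesis using y0[OF that] by simp
  qed
  have ndy: "scal (n q) (dd y v q) = 0" if "q \<in> S" for v q
    using scal_const_dd[OF S(1) that, of n y 0 v] ny dny[OF that] sm by simp
  have h: "scal (n p) (dd (dd y w) v p) = - scal (dd n v p) (dd y w p)" for v w
    using scal_const_dd[OF S, of n "dd y w" 0 v] ndy sm smooth_on_frechet[OF sm(1)] by simp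
  have yy: "scal (y q) (y q) = 0" if "q \<in> S" for q
    using g(1)[OF that] y0[OF that] by blast
  have ydy: "scal (y p) (dd y v p) = 0" for v
    using scal_const_dd[OF S, of y y 0 v] yy sm by (simp add: scal_commute)
  define a1 where "a1 w = - scal (F1 p) (dd y w p)" for w
  define a2 where "a2 w = scal (F2 p) (dd y w p)" for w
  define B1 where "B1 v = scal (n p) (dd F1 v p)" for v
  define B2 where "B2 v = scal (n p) (dd F2 v p)" for v
  obtain t where t: "t > 0" "F0 p = t *\<^sub>R y p" using F0[OF S(2)] by blast
  obtain \<alpha> where \<alpha>: "dd y w p = \<alpha> w *\<^sub>R y p + a1 w *\<^sub>R F1 p + a2 w *\<^sub>R F2 p" for w
  proof -
    have "dd y w p = (- scal (F4 p) (dd y w p) * t) *\<^sub>R y p + a1 w *\<^sub>R F1 p + a2 w *\<^sub>R F2 p" for w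
    proof -
      have "scal (F0 p) (dd y w p) = 0" using ydy t by (simp add: scal_simps)
      then show ?thesis
        using frame_expansion[OF iso[OF S(2)], of "dd y w p"] ndy[OF S(2), of w] t
        by (simp add: a1_def a2_def)
    qed
    then show ?thesis by (rule that[of "\<lambda>w. - scal (F4 p) (dd y w p) * t"])
  qed
  have y1: "scal (y p) (F1 p) = 0" "scal (y p) (F2 p) = 0" "scal (F1 p) (y p) = 0" "scal (F2 p) (y p) = 0"
    using g(2,3)[OF S(2)] y0[OF S(2)] by (simp_all add: scal_commute)
  have F12: "scal (F2 p) (F1 p) = 0" using g(7)[OF S(2)] by (simp add: scal_commute)
  have gg: "scal (dd y v p) (dd y w p) = - a1 v * a1 w + a2 v * a2 w" for v w
    unfolding \<alpha> by (simp add: scal_simps yy[OF S(2)] y1 g(6,7,9)[OF S(2)] F12)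
  have phi: "- scal (F1 p) (dd F0 v p) = t * a1 v" "scal (F2 p) (dd F0 v p) = t * a2 v" for v
  proof -
    have "scal (F1 p) (dd F0 v p) = - scal (dd F1 v p) (F0 p)" "scal (F2 p) (dd F0 v p) = - scal (dd F2 v p) (F0 p)"
      using scal_const_dd[OF S, of F1 F0 0 v] scal_const_dd[OF S, of F2 F0 0 v] g(2,3) sm by (simp_all add: scal_commute)
    moreover have "scal (F1 p) (dd y v p) = - scal (dd F1 v p) (y p)" "scal (F2 p) (dd y v p) = - scal (dd F2 v p) (y p)"
      using scal_const_dd[OF S, of F1 y 0 v] scal_const_dd[OF S, of F2 y 0 v] g(2,3) y0 sm by (simp_all add: scal_commute)
    ultimately show "- scal (F1 p) (dd F0 v p) = t * a1 v" "scal (F2 p) (dd F0 v p) = t * a2 v"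
      by (simp_all add: a1_def a2_def t scal_simps)
  qed
  have dn: "scal (dd n v p) (F1 p) = - B1 v" "scal (dd n v p) (F2 p) = - B2 v" for v
    using scal_const_dd[OF S, of n F1 0 v] scal_const_dd[OF S, of n F2 0 v] g(12,13) sm by (simp_all add: B1_def B2_def)
  have hh: "scal (n p) (dd (dd y w) v p) = a1 w * B1 v + a2 w * B2 v" for v w
    unfolding h \<alpha> by (simp add: scal_simps dny[OF S(2)] dn)
  have sym: "a1 e1 * B1 e2 + a2 e1 * B2 e2 = a1 e2 * B1 e1 + a2 e2 * B2 e1"
    using symmetric_second_derivative[OF S(1) sm(1) S(2), of e1 e2] by (metis hh)
  have w: "(a1 e1 * a2 e2 - a1 e2 * a2 e1) > 0"
      "B1 e1 * a2 e2 - B1 e2 * a2 e1 + (B2 e1 * a1 e2 - B2 e2 * a1 e1) = 0"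
  proof -
    have so': "wedge (\<lambda>v. t * a1 v) (\<lambda>v. t * a2 v) > 0"
      "wedge B1 (\<lambda>v. t * a2 v) + wedge B2 (\<lambda>v. t * a1 v) = 0"
      using so[OF S(2)] unfolding second_order_at_def phi B1_def[abs_def] B2_def[abs_def] by simp_all
    have "(t * t) * (a1 e1 * a2 e2 - a1 e2 * a2 e1) > 0"
      using so'(1) by (simp add: wedge_def algebra_simps)
    then show "(a1 e1 * a2 e2 - a1 e2 * a2 e1) > 0" using t(1) by (simp add: zero_less_mult_iff)
    have "t * (B1 e1 * a2 e2 - B1 e2 * a2 e1 + (B2 e1 * a1 e2 - B2 e2 * a1 e1)) = 0"
      using so'(2) by (simp add: wedge_def algebra_simps)
    then show "B1 e1 * a2 e2 - B1 e2 * a2 e1 + (B2 e1 * a1 e2 - B2 e2 * a1 e1) = 0" using t(1) by simp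
  qed
  have tr: "scal (dd y e1 p) (dd y e1 p) * scal (n p) (dd (dd y e2) e2 p)
       - 2 * scal (dd y e1 p) (dd y e2 p) * scal (n p) (dd (dd y e1) e2 p)
       + scal (dd y e2 p) (dd y e2 p) * scal (n p) (dd (dd y e1) e1 p) = 0"
  proof -
    have H: "scal (n p) (dd (dd y e1) e2 p) = (a1 e1 * B1 e2 + a2 e1 * B2 e2 + (a1 e2 * B1 e1 + a2 e2 * B2 e1)) / 2"
      unfolding hh using sym by simp
    have "scal (dd y e1 p) (dd y e1 p) * scal (n p) (dd (dd y e2) e2 p)
       - 2 * scal (dd y e1 p) (dd y e2 p) * scal (n p) (dd (dd y e1) e2 p)
       + scal (dd y e2 p) (dd y e2 p) * scal (n p) (dd (dd y e1) e1 p)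
      = (- a1 e1 * a1 e1 + a2 e1 * a2 e1) * (a1 e2 * B1 e2 + a2 e2 * B2 e2)
       - (- a1 e1 * a1 e2 + a2 e1 * a2 e2) * (a1 e1 * B1 e2 + a2 e1 * B2 e2 + (a1 e2 * B1 e1 + a2 e2 * B2 e1))
       + (- a1 e2 * a1 e2 + a2 e2 * a2 e2) * (a1 e1 * B1 e1 + a2 e1 * B2 e1)"
      unfolding gg hh[of e2 e2] hh[of e1 e1] H by (simp add: field_simps)
    also have "\<dots> = (a1 e1 * a2 e2 - a1 e2 * a2 e1) * (B1 e1 * a2 e2 - B1 e2 * a2 e1 + (B2 e1 * a1 e2 - B2 e2 * a1 e1))"
      by (simp add: algebra_simps)
    finally show ?thesis using w(2) by simp
  qed
  have vol: "vol (y p) (dd y e1 p) (dd y e2 p) (n p) Z > 0" if Z: "scal (y p) Z < 0" for Z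
  proof -
    have F0Z: "scal (F0 p) Z < 0" using Z t by (simp add: scal_simps mult_pos_neg)
    have yF: "y p = (1 / t) *\<^sub>R F0 p" using t by simp
    obtain z0 z1 z2 z3 where Z4: "Z = z0 *\<^sub>R F0 p + z1 *\<^sub>R F1 p + z2 *\<^sub>R F2 p + z3 *\<^sub>R n p + (- scal (F0 p) Z) *\<^sub>R F4 p"
    proof -
      have "Z = (- scal (F4 p) Z) *\<^sub>R F0 p + (- scal (F1 p) Z) *\<^sub>R F1 p + scal (F2 p) Z *\<^sub>R F2 p + scal (n p) Z *\<^sub>R n p + (- scal (F0 p) Z) *\<^sub>R F4 p"
        using frame_expansion[OF iso[OF S(2)], of Z] by simp
      then show ?thesis using that by blast
    qed
    have v1: "vol (F0 p) (F1 p) (F2 p) (n p) (F4 p) = 1" using det by (simp add: det_frame_matrix)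
    have v2: "vol (F0 p) (F2 p) (F1 p) (n p) (F4 p) = -1" using v1 vol_swap[of "F0 p" "F2 p" "F1 p" "n p" "F4 p"] by simp
    have d: "dd y w p = (\<alpha> w / t) *\<^sub>R F0 p + a1 w *\<^sub>R F1 p + a2 w *\<^sub>R F2 p" for w
      unfolding \<alpha>[of w] using yF by simp
    define k where "k = - scal (F0 p) Z"
    have k: "k > 0" using F0Z by (simp add: k_def)
    have "vol (y p) (dd y e1 p) (dd y e2 p) (n p) Z
        = vol ((1 / t) *\<^sub>R F0 p) ((\<alpha> e1 / t) *\<^sub>R F0 p + a1 e1 *\<^sub>R F1 p + a2 e1 *\<^sub>R F2 p)
            ((\<alpha> e2 / t) *\<^sub>R F0 p + a1 e2 *\<^sub>R F1 p + a2 e2 *\<^sub>R F2 p) (n p)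
            (z0 *\<^sub>R F0 p + z1 *\<^sub>R F1 p + z2 *\<^sub>R F2 p + z3 *\<^sub>R n p + k *\<^sub>R F4 p)"
      using yF d Z4 k_def by metis
    also have "\<dots> = (1 / t) * (k * (a1 e1 * a2 e2 - a1 e2 * a2 e1))"
      by (simp add: vol_linear v1 v2 algebra_simps)
    finally show ?thesis using t(1) k w(1) by simp
  qed
  show ?thesis
    unfolding gauss_normal_def using g(11)[OF S(2)] ny[OF S(2)] ndy[OF S(2)] tr vol by blast
qed

text \<open>Two such normals differ by a sign and a multiple of \<open>y\<close>, which the orientation and the trace
  condition exclude.\<close>

lemma gauss_normal_unique:
  assumes S: "open S" "p \<in> S" and sm: "smooth_on S y" and y: "\<And>q. q \<in> S \<Longrightarrow> scal (y q) (y q) = 0" "y p \<noteq> 0"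
    and g: "scal (dd y e1 p) (dd y e1 p) * scal (dd y e2 p) (dd y e2 p) - (scal (dd y e1 p) (dd y e2 p))\<^sup>2 \<noteq> 0"
    and n: "gauss_normal y n p" "gauss_normal y n' p"
  shows "n = n'"
proof -
  obtain Z where Z: "scal (y p) Z < 0"
  proof -
    obtain Z where "scal (y p) Z \<noteq> 0" using scal_nondegenerate y(2) by blast
    then have "scal (y p) Z < 0 \<or> scal (y p) (- Z) < 0" by (simp add: scal_simps) linarith
    then show ?thesis using that by blast
  qed
  have v: "vol (y p) (dd y e1 p) (dd y e2 p) n Z > 0" "vol (y p) (dd y e1 p) (dd y e2 p) n' Z > 0"
    using n Z by (auto simp: gauss_normal_def)
  have yy: "scal (y p) (y p) = 0" using y S by blast
  have ydy: "scal (y q) (dd y v q) = 0" if "q \<in> S" for v q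
    using scal_const_dd[OF S(1) that, of y y 0 v] y sm by (simp add: scal_commute)
  have nn: "scal n n = 1" "scal n (y p) = 0" "scal n (dd y v p) = 0" "scal n' n' = 1" "scal n' (y p) = 0"
    "scal n' (dd y v p) = 0" for v
    using n by (auto simp: gauss_normal_def)
  have yn: "scal (y p) n = 0" using nn(2) by (simp add: scal_commute)
  define s where "s = scal n' n"
  define r where "r = (scal n' Z - s * scal n Z) / scal (y p) Z"
  have "n' - s *\<^sub>R n - r *\<^sub>R y p = 0"
    by (rule vol_nonzero_orthogonal[of "y p" "dd y e1 p" "dd y e2 p" n Z])
       (use v Z nn yy ydy[OF S(2)] yn in \<open>simp_all add: scal_simps s_def r_def\<close>)
  then have n': "n' = s *\<^sub>R n + r *\<^sub>R y p" by (simp add: algebra_simps)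
  have "scal n' n' = s * s" unfolding n' by (simp add: scal_simps nn yy yn)
  then have "s * s = 1" using nn(4) by simp
  then have "s = 1 \<or> s = -1" by (metis power2_eq_1_iff power2_eq_square)
  moreover have "vol (y p) (dd y e1 p) (dd y e2 p) n' Z = s * vol (y p) (dd y e1 p) (dd y e2 p) n Z"
    unfolding n' by (simp add: vol_linear)
  ultimately have s: "s = 1" using v by auto
  have yh: "scal (y p) (dd (dd y v) w p) = - scal (dd y v p) (dd y w p)" for v w
    using scal_const_dd[OF S, of y "dd y v" 0 w] ydy sm smooth_on_frechet[OF sm] by (simp add: scal_commute)
  have "r * (-2 * (scal (dd y e1 p) (dd y e1 p) * scal (dd y e2 p) (dd y e2 p) - (scal (dd y e1 p) (dd y e2 p))\<^sup>2)) = 0"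
  proof -
    have tr: "scal (dd y e1 p) (dd y e1 p) * scal m (dd (dd y e2) e2 p)
       - 2 * scal (dd y e1 p) (dd y e2 p) * scal m (dd (dd y e1) e2 p)
       + scal (dd y e2 p) (dd y e2 p) * scal m (dd (dd y e1) e1 p) = 0" if "m = n \<or> m = n'" for m
      using n that unfolding gauss_normal_def by blast
    have n1: "scal n' X = scal n X + r * scal (y p) X" for X
      unfolding n' s by (simp add: scal_simps)
    have "scal (dd y e1 p) (dd y e1 p) * (scal n (dd (dd y e2) e2 p) - r * scal (dd y e2 p) (dd y e2 p))
       - 2 * scal (dd y e1 p) (dd y e2 p) * (scal n (dd (dd y e1) e2 p) - r * scal (dd y e1 p) (dd y e2 p))
       + scal (dd y e2 p) (dd y e2 p) * (scal n (dd (dd y e1) e1 p) - r * scal (dd y e1 p) (dd y e1 p)) = 0"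
      using tr[of n'] by (simp add: n1 yh)
    then show ?thesis using tr[of n] by algebra
  qed
  then have "r = 0" using g by simp
  then show ?thesis using n' s by simp
qed

subsection \<open>The conformal Gauss map of a timelike surface\<close>

locale timelike_surface = smooth_surface A
  for A :: "('x::topological_space, real^2) chart set" +
  fixes f :: "'x \<Rightarrow> (real^5) set"
  assumes timelike: "timelike_immersion A f"
begin

abbreviation Y :: "'x \<Rightarrow> real^5" where "Y \<equiv> lift f"

lemma Y_null: "Y x \<noteq> 0" "scal (Y x) (Y x) = 0" "f x = ray (Y x)"
proof -
  obtain X where X: "f x = ray X" "X \<noteq> 0" "scal X X = 0"
  proof -
    have "f x \<in> einstein_universe" using timelike by (simp add: timelike_immersion_def)
    then show ?thesis unfolding einstein_universe_def using that by blast
  qed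
  obtain t where "t > 0" "Y x = t *\<^sub>R X"
    using normal_rep_ray[OF X(2,3)] X(1) by (auto simp: lift_def)
  then show "Y x \<noteq> 0" "scal (Y x) (Y x) = 0" "f x = ray (Y x)"
    using X ray_scaleR[of t X] by (simp_all add: scal_simps)
qed

lemma Y_smooth: "smooth_map A UNIV Y"
  using timelike by (simp add: timelike_immersion_def)

lemma Y_coord: "c \<in> A \<Longrightarrow> smooth_on (chart_image c) (\<lambda>p. Y (chart_inv c p))"
  using smooth_mapD[OF Y_smooth] by (simp add: comp_def)

lemma induced_metric_coord:
  "induced_metric f c x v w = scal (dd (\<lambda>p. Y (chart_inv c p)) v (snd c x)) (dd (\<lambda>p. Y (chart_inv c p)) w (snd c x))"
  by (simp add: induced_metric_def differential_def comp_def)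

lemma orthonormal_basis:
  assumes "c \<in> A" "x \<in> fst c"
  obtains v w where "scal (dd (\<lambda>p. Y (chart_inv c p)) v (snd c x)) (dd (\<lambda>p. Y (chart_inv c p)) v (snd c x)) = -1"
    "scal (dd (\<lambda>p. Y (chart_inv c p)) w (snd c x)) (dd (\<lambda>p. Y (chart_inv c p)) w (snd c x)) = 1"
    "scal (dd (\<lambda>p. Y (chart_inv c p)) v (snd c x)) (dd (\<lambda>p. Y (chart_inv c p)) w (snd c x)) = 0"
proof -
  have "lorentzian (induced_metric f c x)"
    using timelike assms by (simp add: timelike_immersion_def)
  then show ?thesis unfolding lorentzian_def induced_metric_coord using that by blast
qed

lemma plane_expansion: "v = v$1 *\<^sub>R e1 + v$2 *\<^sub>R e2" for v :: "real^2"
  by (simp add: vec_eq_iff forall_2 axis_def)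

lemma metric_det_negative:
  assumes "c \<in> A" "p \<in> chart_image c"
  defines "y \<equiv> \<lambda>p. Y (chart_inv c p)"
  shows "scal (dd y e1 p) (dd y e1 p) * scal (dd y e2 p) (dd y e2 p) - (scal (dd y e1 p) (dd y e2 p))\<^sup>2 < 0"
proof -
  have "snd c (chart_inv c p) = p" "chart_inv c p \<in> fst c"
    using chart_inv_right[OF assms(2)] chart_inv_domain[OF assms(2)] by simp_all
  then obtain v w where vw: "scal (dd y v p) (dd y v p) = -1" "scal (dd y w p) (dd y w p) = 1" "scal (dd y v p) (dd y w p) = 0"
    using orthonormal_basis[OF assms(1), of "chart_inv c p"] unfolding y_def by metis
  have l: "linear (\<lambda>v. dd y v p)" using dd_linear[OF Y_coord[OF assms(1)] assms(2)] unfolding y_def .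
  define a where "a = scal (dd y e1 p) (dd y e1 p)"
  define b where "b = scal (dd y e1 p) (dd y e2 p)"
  define c' where "c' = scal (dd y e2 p) (dd y e2 p)"
  have g: "scal (dd y v p) (dd y w p) = a * v$1 * w$1 + b * (v$1 * w$2 + v$2 * w$1) + c' * v$2 * w$2" for v w
  proof -
    have d: "dd y v p = v$1 *\<^sub>R dd y e1 p + v$2 *\<^sub>R dd y e2 p" for v
      using linear_add[OF l, of "v$1 *\<^sub>R e1" "v$2 *\<^sub>R e2"] linear_cmul[OF l] plane_expansion[of v] by metis
    show ?thesis
      unfolding d[of v] d[of w] by (simp add: scal_simps a_def b_def c'_def scal_commute[of "dd y e2 p" "dd y e1 p"] algebra_simps)
  qed
  have "(a * c' - b\<^sup>2) * (v$1 * w$2 - v$2 * w$1)\<^sup>2 = -1"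
  proof -
    have "(a * c' - b\<^sup>2) * (v$1 * w$2 - v$2 * w$1)\<^sup>2
        = scal (dd y v p) (dd y v p) * scal (dd y w p) (dd y w p) - (scal (dd y v p) (dd y w p))\<^sup>2"
      unfolding g by (simp add: power2_eq_square algebra_simps)
    then show ?thesis by (simp add: vw)
  qed
  then show ?thesis
    unfolding a_def[symmetric] b_def[symmetric] c'_def[symmetric]
    by (metis zero_le_power2 mult_nonneg_nonneg not_less neg_0_le_iff_le not_one_le_zero)
qed

text \<open>The frame conditions, once they hold in one chart, hold in all of them, because both sides of
  each condition are multiplied by the Jacobian determinant of the transition map.\<close>

lemma second_order_frame_in_chart:
  assumes F: "conformal_frame A f U F" and U: "U \<subseteq> fst c" "c \<in> A"
    and so: "\<And>p. p \<in> snd c ` U \<Longrightarrow> second_order_at (\<lambda>p. column 0 (F (chart_inv c p))) (\<lambda>p. column 1 (F (chart_inv c p)))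
       (\<lambda>p. column 2 (F (chart_inv c p))) (\<lambda>p. column 3 (F (chart_inv c p))) p"
  shows "second_order_frame A f U F"
proof -
  have iso: "F x \<in> isometries" if "x \<in> U" for x
    using F that G_group_isometries by (auto simp: conformal_frame_def)
  have sF: "smooth_map A U F" using F by (simp add: conformal_frame_def)
  have bl: "bounded_linear (\<lambda>M :: real^5^5. column j M)" for j
    by (rule linear_conv_bounded_linear[THEN iffD1], rule linearI) (simp_all add: column_def vec_eq_iff)
  have main: "(\<forall>v. mc_form c' F x 3 0 v = 0) \<and> wedge (mc_form c' F x 1 0) (mc_form c' F x 2 0) > 0 \<and>
      wedge (mc_form c' F x 3 1) (mc_form c' F x 2 0) + wedge (mc_form c' F x 3 2) (mc_form c' F x 1 0) = 0"
    if c': "c' \<in> A" "x \<in> U" "x \<in> fst c'" for c' x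
  proof -
    have xc: "x \<in> fst c" using U c' by blast
    let ?L = "dtrans c' c x" and ?p = "snd c x"
    have d: "(F \<circ> chart_inv c') differentiable (at (snd c' x))" "(F \<circ> chart_inv c) differentiable (at (snd c x))"
      using smooth_map_differentiable[OF sF] c' U xc by auto
    have dc: "((\<lambda>x. column j (F x)) \<circ> chart_inv c) differentiable (at ?p)" for j
      using differentiableI[OF bounded_linear.has_derivative[OF bl d(2)[unfolded frechet_derivative_works]]]
      by (simp add: comp_def)
    have l: "linear (\<lambda>v. dd (\<lambda>p. column j (F (chart_inv c p))) v ?p)" for j
      using linear_frechet_derivative[OF dc] by (simp add: comp_def)
    have ch: "differential c' (\<lambda>x. column j (F x)) x v = dd (\<lambda>p. column j (F (chart_inv c p))) (?L v) ?p" for j v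
      using differential_change(1)[OF c'(1) U(2) c'(3) xc dc] by (simp add: differential_def comp_def)
    note mc = mc_form_scal[OF iso[OF c'(2)] d(1), unfolded ch]
    have Fx: "F (chart_inv c ?p) = F x" using chart_inv_left[OF U(2) xc] by simp
    note s = so[of ?p, unfolded second_order_at_def Fx]
    have pU: "?p \<in> snd c ` U" using c' by blast
    have lin: "linear (\<lambda>v. scal X (dd (\<lambda>p. column j (F (chart_inv c p))) v ?p))"
      "linear (\<lambda>v. - scal X (dd (\<lambda>p. column j (F (chart_inv c p))) v ?p))" for X j
      by (rule linearI; simp add: linear_add[OF l] linear_cmul[OF l] scal_simps)+
    note L = dtrans_linear[OF c'(1) U(2) c'(3) xc] and det = dtrans_det[OF c'(1) U(2) c'(3) xc]
    show ?thesis
      unfolding mc[abs_def] wedge_compose[OF lin(1) lin(1) L] wedge_compose[OF lin(2) lin(1) L] wedge_compose[OF lin(1) lin(2) L]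
      using s[OF pU] det by (simp add: distrib_left[symmetric] del: distrib_left_numeral)
  qed
  show ?thesis
    unfolding second_order_frame_def first_order_frame_def using F main by blast
qed

text \<open>A local frame of isometries of determinant 1 is brought to the identity component by a change
  of sign of \<open>F1\<close> and \<open>F2\<close>, if necessary; by connectedness it then remains there.\<close>

lemma second_order_frame_exists: "\<exists>U F. second_order_frame A f U F \<and> x \<in> U"
proof -
  obtain c where c: "c \<in> A" "x \<in> fst c" using chart_exists[of x] by blast
  let ?y = "\<lambda>p. Y (chart_inv c p)" and ?p = "snd c x"
  have pc: "?p \<in> chart_image c" using c by (simp add: chart_value)
  obtain v w where vw: "scal (dd ?y v ?p) (dd ?y v ?p) = -1" "scal (dd ?y w ?p) (dd ?y w ?p) = 1" "scal (dd ?y v ?p) (dd ?y w ?p) = 0"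
    using orthonormal_basis[OF c] by blast
  obtain W F1 F2 n F4 where W: "open W" "?p \<in> W" "W \<subseteq> chart_image c" "connected W"
    and sm: "smooth_on W F1" "smooth_on W F2" "smooth_on W n" "smooth_on W F4"
    and iso: "\<And>p. p \<in> W \<Longrightarrow> frame_matrix (?y p) (F1 p) (F2 p) (n p) (F4 p) \<in> isometries"
    and det: "\<And>p. p \<in> W \<Longrightarrow> det (frame_matrix (?y p) (F1 p) (F2 p) (n p) (F4 p)) = 1"
    and so: "\<And>p. p \<in> W \<Longrightarrow> second_order_at ?y F1 F2 n p"
  proof (rule local_frame[OF chart_image_open[OF c(1)] pc Y_coord[OF c(1)] Y_null(2) Y_null(1) vw], goal_cases)
    case (1 W F1 F2 n F4)
    show ?case by (rule that[of W F1 F2 n F4]) (fact 1)+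
  qed
  have sy: "smooth_on W ?y" using smooth_on_subset[OF Y_coord[OF c(1)] W(3)] .
  have fm: "smooth_on W (\<lambda>p. frame_matrix (?y p) (F1 p) (F2 p) (n p) (F4 p))" if "smooth_on W F1" "smooth_on W F2" for F1 F2
  proof (rule smooth_on_vec[OF W(1)], rule smooth_on_vec[OF W(1)])
    fix i j :: 5
    show "smooth_on W (\<lambda>p. frame_matrix (?y p) (F1 p) (F2 p) (n p) (F4 p) $ i $ j)"
      using exhaust_5[of j] by (elim disjE) (simp_all add: frame_matrix_def transpose_def smooth_on_nth W sy sm that)
  qed
  have "\<exists>F1 F2. smooth_on W F1 \<and> smooth_on W F2 \<and> (\<forall>p\<in>W. frame_matrix (?y p) (F1 p) (F2 p) (n p) (F4 p) \<in> isometries)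
      \<and> (\<forall>p\<in>W. second_order_at ?y F1 F2 n p) \<and> frame_matrix (?y ?p) (F1 ?p) (F2 ?p) (n ?p) (F4 ?p) \<in> G_group"
  proof (cases "frame_matrix (?y ?p) (F1 ?p) (F2 ?p) (n ?p) (F4 ?p) \<in> G_group")
    case True
    then show ?thesis using sm iso so by blast
  next
    case False
    have eq: "frame_matrix a (- b) (- d) m e = frame_matrix a b d m e ** (R1 ** R2)" for a b d m e
    proof -
      have "\<forall>j. column j (frame_matrix a (- b) (- d) m e) = column j (frame_matrix a b d m e ** (R1 ** R2))"
        unfolding column_R1_R2 forall_5 by simp
      then show ?thesis by (simp add: vec_eq_iff column_def)
    qed
    have "frame_matrix (?y ?p) (- F1 ?p) (- F2 ?p) (n ?p) (F4 ?p) \<in> G_group"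
      using det_1_in_G_group[OF iso[OF W(2)] det[OF W(2)]] False unfolding eq by blast
    moreover have "frame_matrix (?y p) (- F1 p) (- F2 p) (n p) (F4 p) \<in> isometries" if "p \<in> W" for p
      unfolding eq using iso[OF that] R1_R2 isometries_mult by blast
    moreover have "second_order_at ?y (\<lambda>q. - F1 q) (\<lambda>q. - F2 q) n p" if "p \<in> W" for p
      using second_order_at_minus[OF smooth_on_differentiable[OF sm(1) that] smooth_on_differentiable[OF sm(2) that]] so[OF that] by blast
    moreover have "smooth_on W (\<lambda>q. - F1 q)" "smooth_on W (\<lambda>q. - F2 q)"
      using sm W by (simp_all add: smooth_on_minus)
    ultimately show ?thesis by (intro exI[of _ "\<lambda>q. - F1 q"] exI[of _ "\<lambda>q. - F2 q"]) simp
  qed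
  then obtain F1 F2 where F: "smooth_on W F1" "smooth_on W F2" "\<And>p. p \<in> W \<Longrightarrow> frame_matrix (?y p) (F1 p) (F2 p) (n p) (F4 p) \<in> isometries"
      "\<And>p. p \<in> W \<Longrightarrow> second_order_at ?y F1 F2 n p" "frame_matrix (?y ?p) (F1 ?p) (F2 ?p) (n ?p) (F4 ?p) \<in> G_group" by blast
  define Fm where "Fm p = frame_matrix (?y p) (F1 p) (F2 p) (n p) (F4 p)" for p
  have sFm: "smooth_on W Fm" unfolding Fm_def by (rule fm[OF F(1,2)])
  have G: "Fm p \<in> G_group" if "p \<in> W" for p
  proof -
    have "connected (Fm ` W)" by (rule connected_continuous_image[OF smooth_on_continuous[OF sFm] W(4)])
    moreover have "Fm ` W \<subseteq> isometries" using F(3) by (auto simp: Fm_def)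
    ultimately have "joined (Fm ?p) (Fm p)" using W(2) that unfolding connected_component_def by blast
    moreover have "joined (mat 1) (Fm ?p)" using F(5) by (simp add: G_group_def Fm_def)
    ultimately show ?thesis unfolding G_group_def mem_Collect_eq using connected_component_trans by blast
  qed
  define U where "U = chart_inv c ` W"
  have "snd c (chart_inv c p) = p" if "p \<in> W" for p
    by (rule chart_inv_right) (use W(3) that in auto)
  then have U3: "snd c ` U = W" unfolding U_def by (simp add: image_image)
  have U1: "open U" unfolding U_def by (rule chart_inv_image_open[OF c(1) W(1,3)])
  have U2: "U \<subseteq> fst c" unfolding U_def using W(3) by (auto intro!: chart_inv_domain)
  have U4: "x \<in> U" unfolding U_def using chart_inv_left[OF c] W(2) by (metis imageI)
  note U = U1 U2 U3 U4
  define FX where "FX z = Fm (snd c z)" for z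
  have FXp: "FX (chart_inv c p) = Fm p" if "p \<in> W" for p
    using chart_inv_right[of p c] W(3) that by (auto simp: FX_def)
  have "smooth_on (snd c ` U) (FX \<circ> chart_inv c)"
    unfolding U(3) by (rule smooth_on_cong[OF W(1) sFm]) (simp add: FXp)
  then have "smooth_map A U FX" by (rule smooth_map_from_chart[OF c(1) U(2,1)])
  moreover have "FX z \<in> G_group \<and> f z = ray (column 0 (FX z))" if "z \<in> U" for z
  proof -
    have "snd c z \<in> W" using U(3) that by blast
    moreover have "chart_inv c (snd c z) = z" using chart_inv_left[OF c(1)] U(2) that by blast
    ultimately show ?thesis using G[of "snd c z"] Y_null(3)[of z] by (simp add: FX_def) (simp add: Fm_def)
  qed
  ultimately have cf: "conformal_frame A f U FX" using U(1) by (simp add: conformal_frame_def)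
  have "second_order_frame A f U FX"
  proof (rule second_order_frame_in_chart[OF cf U(2) c(1)])
    fix p assume "p \<in> snd c ` U"
    then have p: "p \<in> W" using U(3) by simp
    have eq: "column 0 (FX (chart_inv c q)) = ?y q" "column 1 (FX (chart_inv c q)) = F1 q"
      "column 2 (FX (chart_inv c q)) = F2 q" "column 3 (FX (chart_inv c q)) = n q" if "q \<in> W" for q
      using FXp[OF that] by (simp_all add: Fm_def)
    have "dd (\<lambda>p. column 0 (FX (chart_inv c p))) v p = dd ?y v p"
      "dd (\<lambda>p. column 1 (FX (chart_inv c p))) v p = dd F1 v p"
      "dd (\<lambda>p. column 2 (FX (chart_inv c p))) v p = dd F2 v p" for v
      by (rule dd_cong[OF W(1) p], simp only: eq)+
    then show "second_order_at (\<lambda>p. column 0 (FX (chart_inv c p))) (\<lambda>p. column 1 (FX (chart_inv c p)))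
       (\<lambda>p. column 2 (FX (chart_inv c p))) (\<lambda>p. column 3 (FX (chart_inv c p))) p"
      using F(4)[OF p] unfolding second_order_at_def eq[OF p] by simp
  qed
  then show ?thesis using U(4) by blast
qed

lemma second_order_frame_normal:
  assumes F: "second_order_frame A f U F" and c: "c \<in> A" and p: "p \<in> snd c ` (fst c \<inter> U)"
  shows "gauss_normal (\<lambda>p. Y (chart_inv c p)) (column 3 (F (chart_inv c p))) p"
proof -
  let ?S = "snd c ` (fst c \<inter> U)"
  have cf: "conformal_frame A f U F" using F by (simp add: second_order_frame_def first_order_frame_def)
  then have U: "open U" and sF: "smooth_map A U F" and G: "\<And>x. x \<in> U \<Longrightarrow> F x \<in> G_group \<and> f x = ray (column 0 (F x))"
    by (auto simp: conformal_frame_def)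
  have S: "open ?S" by (rule chart_restrict_open[OF c U])
  have bl: "bounded_linear (\<lambda>M :: real^5^5. column j M)" for j
    by (rule linear_conv_bounded_linear[THEN iffD1], rule linearI) (simp_all add: column_def vec_eq_iff)
  have sc: "smooth_on ?S (\<lambda>p. column j (F (chart_inv c p)))" for j
    using smooth_on_linear_compose[OF bl S smooth_map_restrictD[OF sF c]] by (simp add: comp_def)
  have sy: "smooth_on ?S (\<lambda>p. Y (chart_inv c p))"
    by (rule smooth_on_subset[OF Y_coord[OF c]]) (auto simp: chart_image_def)
  have inU: "chart_inv c q \<in> U" "chart_inv c q \<in> fst c" "snd c (chart_inv c q) = q" if "q \<in> ?S" for q
    using that chart_inv_left[OF c] by auto
  have iso: "F x \<in> isometries" if "x \<in> U" for x using G[OF that] G_group_isometries by blast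
  have fm: "frame_matrix (column 0 M) (column 1 M) (column 2 M) (column 3 M) (column 4 M) = M" for M
  proof -
    have "\<forall>j. column j (frame_matrix (column 0 M) (column 1 M) (column 2 M) (column 3 M) (column 4 M)) = column j M"
      unfolding forall_5 by simp
    then show ?thesis by (simp add: vec_eq_iff column_def)
  qed
  show ?thesis
  proof (rule second_order_gauss_normal[OF S p sy sc[of 1] sc[of 2] sc[of 3] sc[of 0],
        where ?F4.0="\<lambda>p. column 4 (F (chart_inv c p))"], unfold fm)
    fix q assume q: "q \<in> ?S"
    have "column 0 (F (chart_inv c q)) \<in> ray (Y (chart_inv c q))"
      using G[OF inU(1)[OF q]] Y_null(3) ray_nonempty by metis
    then show "\<exists>t>0. column 0 (F (chart_inv c q)) = t *\<^sub>R Y (chart_inv c q)" by (auto simp: ray_def)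
    show "F (chart_inv c q) \<in> isometries" by (rule iso[OF inU(1)[OF q]])
    have d: "(F \<circ> chart_inv c) differentiable (at (snd c (chart_inv c q)))"
      using smooth_map_differentiable[OF sF c, of "chart_inv c q"] inU[OF q] by simp
    note mc = mc_form_scal[OF iso[OF inU(1)[OF q]] d]
    have "(\<forall>v. mc_form c F (chart_inv c q) 3 0 v = 0) \<and> wedge (mc_form c F (chart_inv c q) 1 0) (mc_form c F (chart_inv c q) 2 0) > 0 \<and>
      wedge (mc_form c F (chart_inv c q) 3 1) (mc_form c F (chart_inv c q) 2 0)
        + wedge (mc_form c F (chart_inv c q) 3 2) (mc_form c F (chart_inv c q) 1 0) = 0"
      using F c inU[OF q] unfolding second_order_frame_def first_order_frame_def by blast
    then show "second_order_at (\<lambda>p. column 0 (F (chart_inv c p))) (\<lambda>p. column 1 (F (chart_inv c p)))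
       (\<lambda>p. column 2 (F (chart_inv c p))) (\<lambda>p. column 3 (F (chart_inv c p))) q"
      unfolding mc[abs_def] second_order_at_def differential_def comp_def inU(3)[OF q] by simp
  next
    have "joined (mat 1) (F (chart_inv c p))" using G[OF inU(1)[OF p]] by (simp add: G_group_def)
    from joined_det[OF this] show "det (F (chart_inv c p)) = 1" by (simp add: det_I)
  qed
qed

abbreviation N :: "'x \<Rightarrow> real^5" where "N \<equiv> conformal_gauss_map A f"

lemma gauss_normal_unique_coord:
  assumes "c \<in> A" "p \<in> chart_image c" "gauss_normal (\<lambda>p. Y (chart_inv c p)) n p" "gauss_normal (\<lambda>p. Y (chart_inv c p)) n' p"
  shows "n = n'"
  by (rule gauss_normal_unique[OF chart_image_open[OF assms(1)] assms(2) Y_coord[OF assms(1)] Y_null(2) Y_null(1) _ assms(3,4)])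
     (use metric_det_negative[OF assms(1,2)] in simp)

text \<open>The third columns of all second order frames agree because they are Gauss normals of the same
  lift.\<close>

lemma N_frame:
  assumes "second_order_frame A f U F" "x \<in> U" shows "N x = column 3 (F x)"
  unfolding conformal_gauss_map_def
proof (rule the_equality)
  show "\<exists>U F'. second_order_frame A f U F' \<and> x \<in> U \<and> column 3 (F x) = column 3 (F' x)"
    using assms by blast
  fix n assume "\<exists>U F. second_order_frame A f U F \<and> x \<in> U \<and> n = column 3 (F x)"
  then obtain U' F' where F': "second_order_frame A f U' F'" "x \<in> U'" "n = column 3 (F' x)" by blast
  obtain c where c: "c \<in> A" "x \<in> fst c" using chart_exists[of x] by blast
  have "gauss_normal (\<lambda>p. Y (chart_inv c p)) (column 3 (F (chart_inv c (snd c x)))) (snd c x)"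
    "gauss_normal (\<lambda>p. Y (chart_inv c p)) (column 3 (F' (chart_inv c (snd c x)))) (snd c x)"
    using second_order_frame_normal[OF assms(1) c(1), of "snd c x"]
      second_order_frame_normal[OF F'(1) c(1), of "snd c x"] assms(2) F'(2) c by auto
  then have "column 3 (F (chart_inv c (snd c x))) = column 3 (F' (chart_inv c (snd c x)))"
    by (rule gauss_normal_unique_coord[OF c(1) chart_value[OF c(2)]])
  then show "n = column 3 (F x)" using F'(3) chart_inv_left[OF c] by simp
qed

lemma N_smooth: "smooth_map A UNIV N"
proof (rule smooth_map_local)
  fix x
  obtain U F where F: "second_order_frame A f U F" "x \<in> U" using second_order_frame_exists by blast
  then have cf: "open U" "smooth_map A U F"
    by (simp_all add: second_order_frame_def first_order_frame_def conformal_frame_def)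
  have bl: "bounded_linear (\<lambda>M :: real^5^5. column j M)" for j
    by (rule linear_conv_bounded_linear[THEN iffD1], rule linearI) (simp_all add: column_def vec_eq_iff)
  have "smooth_map A U N"
    unfolding smooth_map_def
  proof
    fix c assume c: "c \<in> A"
    have op: "open (snd c ` (fst c \<inter> U))" by (rule chart_restrict_open[OF c cf(1)])
    show "smooth_on (snd c ` (fst c \<inter> U)) (N \<circ> chart_inv c)"
      by (rule smooth_on_cong[OF op smooth_on_linear_compose[OF bl[of 3] op smooth_map_restrictD[OF cf(2) c]]])
         (auto simp: chart_inv_left[OF c] N_frame[OF F(1)])
  qed
  then show "\<exists>V. open V \<and> x \<in> V \<and> smooth_map A V N" using cf(1) F(2) by blast
qed

lemma N_coord: "c \<in> A \<Longrightarrow> smooth_on (chart_image c) (\<lambda>p. N (chart_inv c p))"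
  using smooth_mapD[OF N_smooth] by (simp add: comp_def)

lemma N_gauss_normal:
  assumes "c \<in> A" "p \<in> chart_image c"
  shows "gauss_normal (\<lambda>p. Y (chart_inv c p)) (N (chart_inv c p)) p"
proof -
  obtain U F where F: "second_order_frame A f U F" "chart_inv c p \<in> U" using second_order_frame_exists by blast
  have "p \<in> snd c ` (fst c \<inter> U)"
    using F(2) chart_inv_right[OF assms(2)] chart_inv_domain[OF assms(2)] by (metis IntI image_eqI)
  then show ?thesis using second_order_frame_normal[OF F(1) assms(1)] N_frame[OF F] by simp
qed

end

section \<open>The rank of the Gauss map of a quasi-umbilical surface\<close>

lemma dd_eqI: "(h has_derivative D) (at p) \<Longrightarrow> dd h v p = D v"
  by (drule frechet_derivative_at) simp

lemma e_nth [simp]: "e1 $ 1 = 1" "e1 $ 2 = 0" "e2 $ 1 = 0" "e2 $ 2 = 1"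
  by (simp_all add: axis_def)

text \<open>The lift \<open>y\<close> and the Gauss map \<open>n\<close> of a timelike surface in coordinates.\<close>

locale gauss_patch =
  fixes S :: "(real^2) set" and y n :: "real^2 \<Rightarrow> real^5"
  assumes open_S: "open S" and smooth_y: "smooth_on S y" and smooth_n: "smooth_on S n"
    and yy: "\<And>p. p \<in> S \<Longrightarrow> scal (y p) (y p) = 0" and y_nz: "\<And>p. p \<in> S \<Longrightarrow> y p \<noteq> 0"
    and normal: "\<And>p. p \<in> S \<Longrightarrow> gauss_normal y (n p) p"
    and metric_det: "\<And>p. p \<in> S \<Longrightarrow>
      scal (dd y e1 p) (dd y e1 p) * scal (dd y e2 p) (dd y e2 p) - (scal (dd y e1 p) (dd y e2 p))\<^sup>2 \<noteq> 0"
begin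

lemma lin_y: "p \<in> S \<Longrightarrow> linear (\<lambda>v. dd y v p)" and lin_n: "p \<in> S \<Longrightarrow> linear (\<lambda>v. dd n v p)"
  by (rule dd_linear[OF smooth_y], assumption, rule dd_linear[OF smooth_n], assumption)

lemma nn: "p \<in> S \<Longrightarrow> scal (n p) (n p) = 1" and ny: "p \<in> S \<Longrightarrow> scal (n p) (y p) = 0"
  and ndy: "p \<in> S \<Longrightarrow> scal (n p) (dd y v p) = 0"
  using normal[of p] by (simp_all add: gauss_normal_def)

lemma yn: "p \<in> S \<Longrightarrow> scal (y p) (n p) = 0" and dyn: "p \<in> S \<Longrightarrow> scal (dd y v p) (n p) = 0"
  using ny[of p] ndy[of p v] by (simp_all add: scal_commute)

lemma ydy: "p \<in> S \<Longrightarrow> scal (y p) (dd y v p) = 0"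
  using scal_const_dd[OF open_S, of p y y 0 v] yy smooth_y by (simp add: scal_commute)

lemma dyy: "p \<in> S \<Longrightarrow> scal (dd y v p) (y p) = 0"
  using ydy scal_commute by metis

lemma ndn: "p \<in> S \<Longrightarrow> scal (n p) (dd n v p) = 0"
  using scal_const_dd[OF open_S, of p n n 1 v] nn smooth_n by (simp add: scal_commute)

lemma dny: "p \<in> S \<Longrightarrow> scal (dd n v p) (y p) = 0"
  using scal_const_dd[OF open_S, of p n y 0 v] ny ndy smooth_n smooth_y by simp

lemma hessian: "p \<in> S \<Longrightarrow> scal (n p) (dd (dd y w) v p) = - scal (dd n v p) (dd y w p)"
  using scal_const_dd[OF open_S, of p n "dd y w" 0 v] ndy smooth_n smooth_on_frechet[OF smooth_y] by simp

lemma hessian_symmetric: "p \<in> S \<Longrightarrow> scal (dd n v p) (dd y w p) = scal (dd n w p) (dd y v p)"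
  using hessian[of p w v] hessian[of p v w] symmetric_second_derivative[OF open_S smooth_y, of p w v] by simp

lemma dy_expand: "p \<in> S \<Longrightarrow> dd y v p = v$1 *\<^sub>R dd y e1 p + v$2 *\<^sub>R dd y e2 p"
proof -
  assume p: "p \<in> S"
  have "v = v$1 *\<^sub>R e1 + v$2 *\<^sub>R e2" by (simp add: vec_eq_iff forall_2 axis_def)
  then show ?thesis using linear_add[OF lin_y[OF p]] linear_cmul[OF lin_y[OF p]] by metis
qed

lemma metric_coords:
  assumes "p \<in> S"
  shows "scal (dd y v p) (dd y w p) = scal (dd y e1 p) (dd y e1 p) * (v$1 * w$1)
    + scal (dd y e1 p) (dd y e2 p) * (v$1 * w$2 + v$2 * w$1) + scal (dd y e2 p) (dd y e2 p) * (v$2 * w$2)"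
  unfolding dy_expand[OF assms, of v] dy_expand[OF assms, of w]
  by (simp add: scal_simps scal_commute[of "dd y e2 p" "dd y e1 p"] algebra_simps)

lemma metric_nondegenerate:
  assumes "p \<in> S" "\<And>w. scal (dd y v p) (dd y w p) = 0" shows "v = 0"
proof -
  let ?a = "scal (dd y e1 p) (dd y e1 p)" and ?b = "scal (dd y e1 p) (dd y e2 p)" and ?c = "scal (dd y e2 p) (dd y e2 p)"
  have l: "?a * v$1 + ?b * v$2 = 0" "?b * v$1 + ?c * v$2 = 0"
    using assms(2)[of e1] assms(2)[of e2] unfolding metric_coords[OF assms(1), of v] by (simp_all add: axis_def)
  have "(?a * ?c - ?b\<^sup>2) * v$1 = 0" "(?a * ?c - ?b\<^sup>2) * v$2 = 0"
    using l by (algebra, algebra)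
  then show ?thesis using metric_det[OF assms(1)] by (simp add: vec_eq_iff forall_2)
qed

text \<open>If a vector orthogonal to \<open>s\<close> were independent of \<open>s\<close>, the null vector \<open>s\<close> would be orthogonal
  to the whole tangent plane.\<close>

lemma null_orthogonal:
  assumes p: "p \<in> S" and s: "s \<noteq> 0" "scal (dd y s p) (dd y s p) = 0" and z: "scal (dd y s p) (dd y z p) = 0"
  obtains c where "z = c *\<^sub>R s"
proof -
  have "s$1 * z$2 - s$2 * z$1 = 0"
  proof (rule ccontr)
    assume "s$1 * z$2 - s$2 * z$1 \<noteq> 0"
    then have "scal (dd y s p) (dd y w p) = 0" for w
    proof -
      obtain a b where w: "w = a *\<^sub>R s + b *\<^sub>R z"
        using plane_basis[of s z w] \<open>s$1 * z$2 - s$2 * z$1 \<noteq> 0\<close> by blast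
      show ?thesis unfolding w linear_add[OF lin_y[OF p]] linear_cmul[OF lin_y[OF p]] using s z by (simp add: scal_simps)
    qed
    then show False using metric_nondegenerate[OF p] s by blast
  qed
  moreover have "s$1 \<noteq> 0 \<or> s$2 \<noteq> 0" using s(1) by (auto simp: vec_eq_iff forall_2)
  ultimately have "z = (if s$1 \<noteq> 0 then z$1 / s$1 else z$2 / s$2) *\<^sub>R s"
    by (auto simp: vec_eq_iff forall_2 field_simps)
  then show ?thesis using that by blast
qed

text \<open>The vectors orthogonal to \<open>y\<close> and \<open>n\<close> form a space of dimension three, which \<open>y\<close> and its
  derivatives span.\<close>

lemma tangent_expansion:
  assumes p: "p \<in> S" and X: "scal X (y p) = 0" "scal X (n p) = 0"
  obtains a w where "X = a *\<^sub>R y p + dd y w p"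
proof -
  let ?a = "scal (dd y e1 p) (dd y e1 p)" and ?b = "scal (dd y e1 p) (dd y e2 p)" and ?c = "scal (dd y e2 p) (dd y e2 p)"
  define D where "D = ?a * ?c - ?b\<^sup>2"
  have D: "D \<noteq> 0" using metric_det[OF p] by (simp add: D_def)
  define w :: "real^2" where "w = ((?c * scal X (dd y e1 p) - ?b * scal X (dd y e2 p)) / D) *\<^sub>R e1
      + ((?a * scal X (dd y e2 p) - ?b * scal X (dd y e1 p)) / D) *\<^sub>R e2"
  have w: "w$1 * D = ?c * scal X (dd y e1 p) - ?b * scal X (dd y e2 p)"
    "w$2 * D = ?a * scal X (dd y e2 p) - ?b * scal X (dd y e1 p)"
    using D by (simp_all add: w_def axis_def)
  have "D * (?a * w$1 + ?b * w$2) = D * scal X (dd y e1 p)" "D * (?b * w$1 + ?c * w$2) = D * scal X (dd y e2 p)"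
    using w D_def by (algebra, algebra)
  then have Xe: "scal X (dd y e1 p) = ?a * w$1 + ?b * w$2" "scal X (dd y e2 p) = ?b * w$1 + ?c * w$2"
    using D by simp_all
  obtain Z where Z: "scal (y p) Z < 0"
  proof -
    obtain Z where "scal (y p) Z \<noteq> 0" using scal_nondegenerate y_nz[OF p] by blast
    then have "scal (y p) Z < 0 \<or> scal (y p) (- Z) < 0" by (simp add: scal_simps) linarith
    then show ?thesis using that by blast
  qed
  then have vol: "vol (y p) (dd y e1 p) (dd y e2 p) (n p) Z \<noteq> 0"
    using normal[OF p] unfolding gauss_normal_def by force
  define a where "a = (scal X Z - scal (dd y w p) Z) / scal (y p) Z"
  have "X - (a *\<^sub>R y p + dd y w p) = 0"
  proof (rule vol_nonzero_orthogonal[OF vol])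
    show "scal (X - (a *\<^sub>R y p + dd y w p)) (dd y e1 p) = 0" "scal (X - (a *\<^sub>R y p + dd y w p)) (dd y e2 p) = 0"
      using metric_coords[OF p, of w e1] metric_coords[OF p, of w e2]
      by (simp_all add: scal_simps Xe ydy[OF p] algebra_simps)
  qed (use X Z p in \<open>simp_all add: scal_simps yy dyy yn dyn a_def\<close>)
  then show ?thesis using that by simp
qed

text \<open>Modulo \<open>y\<close>, the differential of \<open>n\<close> is a symmetric endomorphism of the tangent plane with
  trace zero; by the theorem of Cayley and Hamilton its square is a multiple of the identity.\<close>

lemma second_fundamental_factor:
  assumes p: "p \<in> S"
  obtains \<rho> where "\<And>v w. scal (dd n v p) (dd n w p) = \<rho> * scal (dd y v p) (dd y w p)"
proof -
  obtain a1 s where s: "dd n e1 p = a1 *\<^sub>R y p + dd y s p"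
    using tangent_expansion[OF p] dny[OF p] ndn[OF p] scal_commute by metis
  obtain a2 t where t: "dd n e2 p = a2 *\<^sub>R y p + dd y t p"
    using tangent_expansion[OF p] dny[OF p] ndn[OF p] scal_commute by metis
  define a where "a = scal (dd y e1 p) (dd y e1 p)"
  define b where "b = scal (dd y e1 p) (dd y e2 p)"
  define c where "c = scal (dd y e2 p) (dd y e2 p)"
  note mc = metric_coords[OF p, folded a_def b_def c_def]
  have n1: "scal (dd n e1 p) (dd y w p) = scal (dd y s p) (dd y w p)"
    "scal (dd n e2 p) (dd y w p) = scal (dd y t p) (dd y w p)" for w
    unfolding s t by (simp_all add: scal_simps ydy[OF p])
  have sym: "s$1 * b + s$2 * c = t$1 * a + t$2 * b"
    using hessian_symmetric[OF p, of e1 e2] unfolding n1 mc by (simp add: axis_def algebra_simps)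
  have "a * scal (n p) (dd (dd y e2) e2 p) - 2 * b * scal (n p) (dd (dd y e1) e2 p) + c * scal (n p) (dd (dd y e1) e1 p) = 0"
    using normal[OF p] unfolding gauss_normal_def a_def b_def c_def by blast
  then have "a * (t$1 * b + t$2 * c) - 2 * b * (t$1 * a + t$2 * b) + c * (s$1 * a + s$2 * b) = 0"
    unfolding hessian[OF p] n1 mc by (simp add: axis_def algebra_simps)
  then have "(a * c - b\<^sup>2) * (s$1 + t$2) = 0"
    using sym by algebra
  then have tr: "t$2 = - s$1" using metric_det[OF p] by (simp add: a_def b_def c_def)
  define \<rho> where "\<rho> = s$1 * s$1 + s$2 * t$1"
  have q: "scal (dd n e1 p) (dd n e1 p) = \<rho> * a" "scal (dd n e1 p) (dd n e2 p) = \<rho> * b" "scal (dd n e2 p) (dd n e2 p) = \<rho> * c"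
    "scal (dd n e2 p) (dd n e1 p) = \<rho> * b"
  proof -
    have st: "scal (dd n e1 p) (dd n e1 p) = scal (dd y s p) (dd y s p)" "scal (dd n e1 p) (dd n e2 p) = scal (dd y s p) (dd y t p)"
      "scal (dd n e2 p) (dd n e2 p) = scal (dd y t p) (dd y t p)"
      unfolding s t by (simp_all add: scal_simps ydy[OF p] dyy[OF p] yy[OF p])
    show "scal (dd n e1 p) (dd n e1 p) = \<rho> * a" unfolding st mc \<rho>_def using sym tr by algebra
    show 12: "scal (dd n e1 p) (dd n e2 p) = \<rho> * b" unfolding st mc \<rho>_def using sym tr by algebra
    show "scal (dd n e2 p) (dd n e2 p) = \<rho> * c" unfolding st mc \<rho>_def using sym tr by algebra
    show "scal (dd n e2 p) (dd n e1 p) = \<rho> * b" using 12 by (simp add: scal_commute)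
  qed
  have "scal (dd n v p) (dd n w p) = \<rho> * scal (dd y v p) (dd y w p)" for v w
  proof -
    have e: "dd n v p = v$1 *\<^sub>R dd n e1 p + v$2 *\<^sub>R dd n e2 p" for v
    proof -
      have "v = v$1 *\<^sub>R e1 + v$2 *\<^sub>R e2" by (simp add: vec_eq_iff forall_2 axis_def)
      then show ?thesis using linear_add[OF lin_n[OF p]] linear_cmul[OF lin_n[OF p]] by metis
    qed
    show ?thesis unfolding e[of v] e[of w] mc by (simp add: scal_simps q algebra_simps)
  qed
  then show ?thesis using that by blast
qed

end

text \<open>The functions \<open>q \<mapsto> dd y (\<zeta> q) q\<close> arise when the differential of \<open>y\<close> is applied to a direction
  field; they are combinations of the two partial derivatives with smooth coefficients.\<close>

lemma smooth_on_dd_field: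
  assumes "open S" "smooth_on S y" "smooth_on S \<zeta>"
  shows "smooth_on S (\<lambda>q. dd y (\<zeta> q :: real^2) q)"
proof -
  have ex: "\<zeta> q $ 1 *\<^sub>R dd y e1 q + \<zeta> q $ 2 *\<^sub>R dd y e2 q = dd y (\<zeta> q) q" if "q \<in> S" for q
  proof -
    note l = dd_linear[OF assms(2) that]
    have "\<zeta> q = \<zeta> q $ 1 *\<^sub>R e1 + \<zeta> q $ 2 *\<^sub>R e2" by (simp add: vec_eq_iff forall_2 axis_def)
    then show ?thesis using linear_add[OF l] linear_cmul[OF l] by metis
  qed
  have "smooth_on S (\<lambda>q. \<zeta> q $ 1 *\<^sub>R dd y e1 q + \<zeta> q $ 2 *\<^sub>R dd y e2 q)"
    by (intro smooth_on_add smooth_on_scaleR smooth_on_nth smooth_on_frechet assms)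
  from smooth_on_cong[OF assms(1) this ex] show ?thesis .
qed

lemma dd_dd_field:
  assumes S: "open S" "p \<in> S" and sm: "smooth_on S y" "smooth_on S \<zeta>"
  shows "dd (\<lambda>q. dd y (\<zeta> q :: real^2) q) v p = dd (dd y (\<zeta> p)) v p + dd y (dd \<zeta> v p) p"
proof -
  have e: "w = w$1 *\<^sub>R e1 + w$2 *\<^sub>R e2" for w :: "real^2" by (simp add: vec_eq_iff forall_2 axis_def)
  have ex: "dd y w q = w$1 *\<^sub>R dd y e1 q + w$2 *\<^sub>R dd y e2 q" if "q \<in> S" for q w
    using linear_add[OF dd_linear[OF sm(1) that]] linear_cmul[OF dd_linear[OF sm(1) that]] e[of w] by metis
  have d: "(dd y w has_derivative (\<lambda>v. dd (dd y w) v p)) (at p)" for w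
    using smooth_on_has_derivative[OF smooth_on_frechet[OF sm(1)] S(2)] .
  have z: "((\<lambda>q. \<zeta> q $ i) has_derivative (\<lambda>v. dd \<zeta> v p $ i)) (at p)" for i
    by (rule bounded_linear.has_derivative[OF bounded_linear_vec_nth smooth_on_has_derivative[OF sm(2) S(2)]])
  have "((\<lambda>q. \<zeta> q $ 1 *\<^sub>R dd y e1 q + \<zeta> q $ 2 *\<^sub>R dd y e2 q) has_derivative
      (\<lambda>v. (\<zeta> p $ 1 *\<^sub>R dd (dd y e1) v p + dd \<zeta> v p $ 1 *\<^sub>R dd y e1 p)
         + (\<zeta> p $ 2 *\<^sub>R dd (dd y e2) v p + dd \<zeta> v p $ 2 *\<^sub>R dd y e2 p))) (at p)"
    by (intro has_derivative_add has_derivative_scaleR z d)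
  then have "dd (\<lambda>q. \<zeta> q $ 1 *\<^sub>R dd y e1 q + \<zeta> q $ 2 *\<^sub>R dd y e2 q) v p
      = (\<zeta> p $ 1 *\<^sub>R dd (dd y e1) v p + dd \<zeta> v p $ 1 *\<^sub>R dd y e1 p)
         + (\<zeta> p $ 2 *\<^sub>R dd (dd y e2) v p + dd \<zeta> v p $ 2 *\<^sub>R dd y e2 p)"
    by (rule dd_eqI)
  moreover have "dd (dd y (\<zeta> p)) v p = \<zeta> p $ 1 *\<^sub>R dd (dd y e1) v p + \<zeta> p $ 2 *\<^sub>R dd (dd y e2) v p"
  proof -
    have "dd (dd y (\<zeta> p)) v p = dd (\<lambda>q. \<zeta> p $ 1 *\<^sub>R dd y e1 q + \<zeta> p $ 2 *\<^sub>R dd y e2 q) v p"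
      by (rule dd_cong[OF S]) (rule ex)
    also have "((\<lambda>q. \<zeta> p $ 1 *\<^sub>R dd y e1 q + \<zeta> p $ 2 *\<^sub>R dd y e2 q) has_derivative
        (\<lambda>v. \<zeta> p $ 1 *\<^sub>R dd (dd y e1) v p + \<zeta> p $ 2 *\<^sub>R dd (dd y e2) v p)) (at p)"
      by (intro has_derivative_add has_derivative_scaleR_right d)
    then have "dd (\<lambda>q. \<zeta> p $ 1 *\<^sub>R dd y e1 q + \<zeta> p $ 2 *\<^sub>R dd y e2 q) v p
        = \<zeta> p $ 1 *\<^sub>R dd (dd y e1) v p + \<zeta> p $ 2 *\<^sub>R dd (dd y e2) v p"
      by (rule dd_eqI)
    finally show ?thesis .
  qed
  moreover have "dd (\<lambda>q. dd y (\<zeta> q) q) v p = dd (\<lambda>q. \<zeta> q $ 1 *\<^sub>R dd y e1 q + \<zeta> q $ 2 *\<^sub>R dd y e2 q) v p"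
    by (rule dd_cong[OF S]) (rule ex)
  ultimately show ?thesis by (simp add: ex[OF S(2), of "dd \<zeta> v p"])
qed

context gauss_patch
begin

text \<open>If \<open>\<zeta>\<close> spans the kernel of the second fundamental form, \<open>dn(\<zeta>)\<close> is a priori a multiple of \<open>y\<close>.
  Differentiating \<open>\<langle>dn(v), dy(\<zeta>)\<rangle> = 0\<close> and using the symmetry of the second derivative of \<open>n\<close> shows that
  the multiple is zero.\<close>

lemma kernel_field:
  assumes T: "open T" "T \<subseteq> S" "smooth_on T \<zeta>" "\<And>q. q \<in> T \<Longrightarrow> \<zeta> q \<noteq> 0"
    and null: "\<And>q v w. q \<in> T \<Longrightarrow> scal (dd n v q) (dd n w q) = 0"
    and nz: "\<And>q. q \<in> T \<Longrightarrow> \<exists>v. \<forall>c. dd n v q \<noteq> c *\<^sub>R y q"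
    and ker: "\<And>q v. q \<in> T \<Longrightarrow> scal (dd n v q) (dd y (\<zeta> q) q) = 0"
    and p: "p \<in> T"
  shows "dd n (\<zeta> p) p = 0" and "scal (dd y (\<zeta> p) p) (dd y (\<zeta> p) p) = 0"
    and "\<exists>a b. dd (\<lambda>q. dd y (\<zeta> q) q) (\<zeta> p) p = a *\<^sub>R y p + b *\<^sub>R dd y (\<zeta> p) p"
proof -
  define W where "W q = dd y (\<zeta> q) q" for q
  have sy: "smooth_on T y" "smooth_on T n" by (rule smooth_on_subset[OF smooth_y T(2)], rule smooth_on_subset[OF smooth_n T(2)])
  have sW: "smooth_on T W" unfolding W_def by (rule smooth_on_dd_field[OF T(1) sy(1) T(3)])
  have WW: "scal (W q) (W q) = 0" if q: "q \<in> T" for q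
  proof -
    have qS: "q \<in> S" using q T(2) by blast
    obtain v where v: "\<forall>c. dd n v q \<noteq> c *\<^sub>R y q" using nz[OF q] by blast
    obtain a s where s: "dd n v q = a *\<^sub>R y q + dd y s q"
      using tangent_expansion[OF qS] dny[OF qS] ndn[OF qS] scal_commute by metis
    have "s \<noteq> 0"
    proof
      assume "s = 0"
      then have "dd n v q = a *\<^sub>R y q" using s linear_0[OF lin_y[OF qS]] by simp
      then show False using v by blast
    qed
    moreover have "scal (dd y s q) (dd y s q) = 0"
      using null[OF q, of v v] unfolding s by (simp add: scal_simps ydy[OF qS] dyy[OF qS] yy[OF qS])
    moreover have "scal (dd y s q) (dd y (\<zeta> q) q) = 0"
      using ker[OF q, of v] unfolding s by (simp add: scal_simps ydy[OF qS])
    ultimately obtain c where c: "\<zeta> q = c *\<^sub>R s" using null_orthogonal[OF qS] by metis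
    show ?thesis
      unfolding W_def c linear_cmul[OF lin_y[OF qS]] using \<open>scal (dd y s q) (dd y s q) = 0\<close> by (simp add: scal_simps)
  qed
  then show "scal (dd y (\<zeta> p) p) (dd y (\<zeta> p) p) = 0" using p by (simp add: W_def)
  have pS: "p \<in> S" using p T(2) by blast
  have yW: "scal (y q) (W q) = 0" "scal (W q) (n q) = 0" if "q \<in> T" for q
    using ydy[of q] dyn[of q] T(2) that unfolding W_def by (simp_all add: subset_iff)
  obtain k s where ks: "dd n (\<zeta> p) p = k *\<^sub>R y p + dd y s p"
    using tangent_expansion[OF pS] dny[OF pS] ndn[OF pS] scal_commute by metis
  have "scal (dd y s p) (dd y w p) = 0" for w
    using ker[OF p, of w] hessian_symmetric[OF pS, of "\<zeta> p" w] unfolding ks by (simp add: scal_simps ydy[OF pS])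
  then have "s = 0" by (rule metric_nondegenerate[OF pS])
  then have k: "dd n (\<zeta> p) p = k *\<^sub>R y p" using ks linear_0[OF lin_y[OF pS]] by simp
  have d: "scal (dd n v p) (dd W w p) = - scal (dd (dd n v) w p) (W p)" for v w
    using scal_const_dd[OF T(1) p, of "dd n v" W 0 w] ker smooth_on_frechet[OF sy(2)] sW by (simp add: W_def)
  have sym: "scal (dd n v p) (dd W w p) = scal (dd n w p) (dd W v p)" for v w
    unfolding d symmetric_second_derivative[OF T(1) sy(2) p, of v w] ..
  define X where "X = dd W (\<zeta> p) p"
  have dW: "scal (y p) (dd W w p) = - scal (dd y w p) (W p)" "scal (W p) (dd W w p) = 0"
      "scal (n p) (dd W w p) = - scal (dd n w p) (W p)" for w
    using scal_const_dd[OF T(1) p, of y W 0 w] scal_const_dd[OF T(1) p, of W W 0 w] scal_const_dd[OF T(1) p, of n W 0 w]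
      yW WW sy sW by (simp_all add: scal_commute)
  have Wp: "W p = dd y (\<zeta> p) p" by (simp add: W_def)
  have "scal X (y p) = 0" using dW(1)[of "\<zeta> p"] WW[OF p] Wp by (simp add: X_def scal_commute)
  moreover have "scal X (n p) = 0" using dW(3)[of "\<zeta> p"] ker[OF p] Wp by (simp add: X_def scal_commute)
  ultimately obtain a w where X: "X = a *\<^sub>R y p + dd y w p" using tangent_expansion[OF pS, of X] by blast
  have "scal (dd y (\<zeta> p) p) (dd y w p) = 0"
    using dW(2)[of "\<zeta> p"] unfolding X_def[symmetric] X Wp by (simp add: scal_simps dyy[OF pS])
  then obtain c where c: "w = c *\<^sub>R \<zeta> p"
    using null_orthogonal[OF pS T(4)[OF p]] WW[OF p] Wp by metis
  have X': "X = a *\<^sub>R y p + c *\<^sub>R W p" unfolding X c linear_cmul[OF lin_y[OF pS]] Wp ..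
  then show "\<exists>a b. dd (\<lambda>q. dd y (\<zeta> q) q) (\<zeta> p) p = a *\<^sub>R y p + b *\<^sub>R dd y (\<zeta> p) p"
    unfolding X_def W_def by blast
  have "k * scal (dd y w p) (W p) = 0" for w
  proof -
    have "scal (dd n w p) X = 0" unfolding X' using ker[OF p] Wp by (simp add: scal_simps dny[OF pS])
    then have "scal (k *\<^sub>R y p) (dd W w p) = 0" using sym[of "\<zeta> p" w] k by (simp add: X_def)
    then show ?thesis by (simp add: scal_simps dW(1))
  qed
  then have "k = 0 \<or> (\<forall>w. scal (dd y (\<zeta> p) p) (dd y w p) = 0)" unfolding Wp by (auto simp: scal_commute)
  then have "k = 0" using metric_nondegenerate[OF pS] T(4)[OF p] by blast
  then show "dd n (\<zeta> p) p = 0" using k by simp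
qed

text \<open>The second fundamental form \<open>\<langle>dn(v), dy(w)\<rangle>\<close> is degenerate, because the tangential part of
  \<open>dn(v)\<close> is null and orthogonal to that of every \<open>dn(w)\<close>, but it does not vanish. Hence its kernel
  is spanned, near \<open>p\<close>, by a direction field that is polynomial in its coefficients, and
  \<open>kernel_field\<close> applies to this field.\<close>

lemma rank_one:
  assumes null: "\<And>q v w. q \<in> S \<Longrightarrow> scal (dd n v q) (dd n w q) = 0"
    and nz: "\<And>q. q \<in> S \<Longrightarrow> \<exists>v. \<forall>c. dd n v q \<noteq> c *\<^sub>R y q"
    and p: "p \<in> S"
  shows "\<exists>z. z \<noteq> 0 \<and> dd n z p = 0"
proof -
  define h where "h v w q = scal (dd n v q) (dd y w q)" for v w q
  have sh: "smooth_on S (h v w)" for v w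
    unfolding h_def by (intro smooth_on_scal smooth_on_frechet smooth_y smooth_n open_S)
  have sym: "h v w q = h w v q" if "q \<in> S" for v w q
    unfolding h_def by (rule hessian_symmetric[OF that])
  have lin: "h v w q = v$1 * h e1 w q + v$2 * h e2 w q" if "q \<in> S" for v w q
  proof -
    have "v = v$1 *\<^sub>R e1 + v$2 *\<^sub>R e2" by (simp add: vec_eq_iff forall_2 axis_def)
    then have "dd n v q = v$1 *\<^sub>R dd n e1 q + v$2 *\<^sub>R dd n e2 q"
      using linear_add[OF lin_n[OF that]] linear_cmul[OF lin_n[OF that]] by metis
    then show ?thesis by (simp add: h_def scal_simps)
  qed
  have deg: "h e1 e1 q * h e2 e2 q - h e1 e2 q * h e1 e2 q = 0" if q: "q \<in> S" for q
  proof -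
    obtain v where v: "\<forall>c. dd n v q \<noteq> c *\<^sub>R y q" using nz[OF q] by blast
    obtain a s where s: "dd n v q = a *\<^sub>R y q + dd y s q"
      using tangent_expansion[OF q] dny[OF q] ndn[OF q] scal_commute by metis
    have "s \<noteq> 0"
    proof
      assume "s = 0"
      then have "dd n v q = a *\<^sub>R y q" using s linear_0[OF lin_y[OF q]] by simp
      then show False using v by blast
    qed
    have "h w s q = 0" for w
      using null[OF q, of w v] unfolding s by (simp add: h_def scal_simps dny[OF q])
    then have "h s w q = 0" for w using sym[OF q, of s w] by simp
    then have "s$1 * h e1 e1 q + s$2 * h e2 e1 q = 0" "s$1 * h e1 e2 q + s$2 * h e2 e2 q = 0"
      using lin[OF q, of s e1] lin[OF q, of s e2] by simp_all
    then have "s$1 * (h e1 e1 q * h e2 e2 q - h e1 e2 q * h e1 e2 q) = 0" "s$2 * (h e1 e1 q * h e2 e2 q - h e1 e2 q * h e1 e2 q) = 0"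
      unfolding sym[OF q, of e2 e1] by (algebra, algebra)
    then show ?thesis using \<open>s \<noteq> 0\<close> by (auto simp: vec_eq_iff forall_2)
  qed
  have nzh: "h e1 e1 p \<noteq> 0 \<or> h e2 e2 p \<noteq> 0"
  proof (rule ccontr)
    assume "\<not> (h e1 e1 p \<noteq> 0 \<or> h e2 e2 p \<noteq> 0)"
    then have z: "h e1 e1 p = 0" "h e2 e2 p = 0" "h e1 e2 p = 0" "h e2 e1 p = 0"
      using deg[OF p] sym[OF p, of e1 e2] by auto
    have h0: "h v w p = 0" for v w
    proof -
      have "h v w p = v$1 * h w e1 p + v$2 * h w e2 p"
        using lin[OF p, of v w] sym[OF p, of w e1] sym[OF p, of w e2] by simp
      then show ?thesis using lin[OF p, of w e1] lin[OF p, of w e2] z by simp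
    qed
    obtain v where v: "\<forall>c. dd n v p \<noteq> c *\<^sub>R y p" using nz[OF p] by blast
    obtain a s where s: "dd n v p = a *\<^sub>R y p + dd y s p"
      using tangent_expansion[OF p] dny[OF p] ndn[OF p] scal_commute by metis
    have "scal (dd y s p) (dd y w p) = 0" for w
      using h0[of v w] unfolding h_def s by (simp add: scal_simps ydy[OF p])
    then have "s = 0" by (rule metric_nondegenerate[OF p])
    then have "dd n v p = a *\<^sub>R y p" using s linear_0[OF lin_y[OF p]] by simp
    then show False using v by blast
  qed
  have main: "dd n (\<zeta> p) p = 0 \<and> \<zeta> p \<noteq> 0"
    if sz: "smooth_on S \<zeta>" and a: "smooth_on S a" "a p \<noteq> (0::real)" "\<And>q. q \<in> S \<Longrightarrow> a q \<noteq> 0 \<Longrightarrow> \<zeta> q \<noteq> 0"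
      and ker: "\<And>q v. q \<in> S \<Longrightarrow> h v (\<zeta> q) q = 0" for \<zeta> a
  proof -
    define T where "T = {q \<in> S. a q \<noteq> 0}"
    have T: "open T"
      using continuous_open_preimage[OF smooth_on_continuous[OF a(1)] open_S, of "- {0}"]
      by (simp add: T_def Int_def vimage_def open_Compl)
    have TS: "T \<subseteq> S" and pT: "p \<in> T" using p a(2) by (auto simp: T_def)
    have "dd n (\<zeta> p) p = 0"
    proof (rule kernel_field(1)[OF T TS smooth_on_subset[OF sz TS] _ _ _ _ pT])
      show "scal (dd n v q) (dd y (\<zeta> q) q) = 0" if "q \<in> T" for q v
        using ker[of q v] that TS by (auto simp: h_def)
      show "\<zeta> q \<noteq> 0" if "q \<in> T" for q using a(3) that by (simp add: T_def)
      show "\<exists>v. \<forall>c. dd n v q \<noteq> c *\<^sub>R y q" if "q \<in> T" for q using nz that TS by blast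
      show "scal (dd n v q) (dd n w q) = 0" if "q \<in> T" for q v w using null that TS by blast
    qed
    then show ?thesis using a(3)[OF p a(2)] by blast
  qed
  have hv: "h v \<zeta> q = \<zeta>$1 * h e1 v q + \<zeta>$2 * h e2 v q" if "q \<in> S" for v \<zeta> q
    using lin[OF that, of \<zeta> v] sym[OF that, of v \<zeta>] by simp
  show ?thesis
  proof (cases "h e1 e1 p = 0")
    case False
    define \<zeta> where "\<zeta> q = (- h e1 e2 q) *\<^sub>R e1 + h e1 e1 q *\<^sub>R e2" for q
    have c: "\<zeta> q $ 1 = - h e1 e2 q" "\<zeta> q $ 2 = h e1 e1 q" for q by (simp_all add: \<zeta>_def axis_def)
    have "h v (\<zeta> q) q = 0" if q: "q \<in> S" for q v
    proof -
      have "h v (\<zeta> q) q = - h e1 e2 q * h v e1 q + h e1 e1 q * h v e2 q"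
        unfolding hv[OF q, of v "\<zeta> q"] c using sym[OF q, of v e1] sym[OF q, of v e2] by simp
      also have "\<dots> = 0"
        using lin[OF q, of v e1] lin[OF q, of v e2] sym[OF q, of e2 e1] deg[OF q] by algebra
      finally show ?thesis .
    qed
    moreover have "smooth_on S \<zeta>"
      unfolding \<zeta>_def by (intro smooth_on_add smooth_on_scaleR smooth_on_minus sh smooth_on_const open_S)
    moreover have "\<zeta> q \<noteq> 0" if "h e1 e1 q \<noteq> 0" for q using c(2)[of q] that by auto
    ultimately show ?thesis using main[of \<zeta> "h e1 e1"] sh False by blast
  next
    case True
    define \<zeta> where "\<zeta> q = h e2 e2 q *\<^sub>R e1 + (- h e1 e2 q) *\<^sub>R e2" for q
    have c: "\<zeta> q $ 1 = h e2 e2 q" "\<zeta> q $ 2 = - h e1 e2 q" for q by (simp_all add: \<zeta>_def axis_def)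
    have "h v (\<zeta> q) q = 0" if q: "q \<in> S" for q v
    proof -
      have "h v (\<zeta> q) q = h e2 e2 q * h v e1 q - h e1 e2 q * h v e2 q"
        unfolding hv[OF q, of v "\<zeta> q"] c using sym[OF q, of v e1] sym[OF q, of v e2] by simp
      also have "\<dots> = 0"
        using lin[OF q, of v e1] lin[OF q, of v e2] sym[OF q, of e2 e1] deg[OF q] by algebra
      finally show ?thesis .
    qed
    moreover have "smooth_on S \<zeta>"
      unfolding \<zeta>_def by (intro smooth_on_add smooth_on_scaleR smooth_on_minus sh smooth_on_const open_S)
    moreover have "\<zeta> q \<noteq> 0" if "h e2 e2 q \<noteq> 0" for q using c(1)[of q] that by auto
    ultimately show ?thesis using main[of \<zeta> "h e2 e2"] sh True nzh by blast
  qed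
qed

end

section \<open>Surfaces whose Gauss map has rank one\<close>

text \<open>A function \<open>u\<close> with null gradient, on a plane with a metric \<open>g\<close>, has vanishing Laplacian:
  differentiation of \<open>|grad u|\<^sup>2 = 0\<close> shows that the Hessian annihilates the null vector \<open>grad u\<close>,
  and a symmetric form that annihilates a null vector of a nondegenerate plane has trace zero. The
  statement is the resulting identity between the derivatives at a point: \<open>u1\<close>, \<open>u11\<close> etc. are
  derivatives of \<open>u\<close>, and \<open>a1\<close>, \<open>a2\<close>, \<open>b1\<close>, \<open>b2\<close>, \<open>c1\<close>, \<open>c2\<close> those of the coefficients \<open>a\<close>, \<open>b\<close>, \<open>c\<close>
  of \<open>g\<close>, while \<open>H11\<close>, \<open>H12\<close>, \<open>H22\<close> are the entries of the Hessian, multiplied by \<open>2 det g\<close>.\<close>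

lemma null_gradient_laplacian:
  fixes a b c :: real
  assumes D: "a * c - b\<^sup>2 \<noteq> 0" and u: "u1 \<noteq> 0 \<or> u2 \<noteq> 0"
    and F: "c * u1\<^sup>2 - 2 * b * u1 * u2 + a * u2\<^sup>2 = 0"
    and F1: "c1 * u1\<^sup>2 + 2 * c * u1 * u11 - 2 * b1 * u1 * u2 - 2 * b * u11 * u2 - 2 * b * u1 * u12 + a1 * u2\<^sup>2 + 2 * a * u2 * u12 = 0"
    and F2: "c2 * u1\<^sup>2 + 2 * c * u1 * u12 - 2 * b2 * u1 * u2 - 2 * b * u12 * u2 - 2 * b * u1 * u22 + a2 * u2\<^sup>2 + 2 * a * u2 * u22 = 0"
    and H11: "H11 = 2 * (a * c - b\<^sup>2) * u11 - (c * u1 - b * u2) * a1 - (a * u2 - b * u1) * (2 * b1 - a2)"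
    and H12: "H12 = 2 * (a * c - b\<^sup>2) * u12 - (c * u1 - b * u2) * a2 - (a * u2 - b * u1) * c1"
    and H22: "H22 = 2 * (a * c - b\<^sup>2) * u22 - (c * u1 - b * u2) * (2 * b2 - c1) - (a * u2 - b * u1) * c2"
  shows "c * H11 - 2 * b * H12 + a * H22 = 0"
proof -
  define x where "x = c * u1 - b * u2"
  define z where "z = a * u2 - b * u1"
  have "x * u1 + z * u2 = 0" using F unfolding x_def z_def by algebra
  have "\<exists>s. x = - s * u2 \<and> z = s * u1"
  proof (cases "u1 = 0")
    case True
    then have "z = 0" using \<open>x * u1 + z * u2 = 0\<close> u by simp
    then show ?thesis using True u by (intro exI[of _ "- x / u2"]) simp
  next
    case False
    then have "x = - (z / u1) * u2" using \<open>x * u1 + z * u2 = 0\<close> by (simp add: field_simps)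
    then show ?thesis using False by (intro exI[of _ "z / u1"]) simp
  qed
  then obtain s where s: "x = - s * u2" "z = s * u1" by blast
  have Du: "(a * c - b\<^sup>2) * u1 = s * (b * u1 - a * u2)" "(a * c - b\<^sup>2) * u2 = s * (c * u1 - b * u2)"
    using s unfolding x_def z_def by (algebra, algebra)
  have k: "- u2 * H11 + u1 * H12 = 0" "- u2 * H12 + u1 * H22 = 0"
  proof -
    have h: "H11 = 2 * (a * c - b\<^sup>2) * u11 + s * u2 * a1 - s * u1 * (2 * b1 - a2)"
      "H12 = 2 * (a * c - b\<^sup>2) * u12 + s * u2 * a2 - s * u1 * c1"
      "H22 = 2 * (a * c - b\<^sup>2) * u22 + s * u2 * (2 * b2 - c1) - s * u1 * c2"
      unfolding H11 H12 H22 x_def[symmetric] z_def[symmetric] s by simp_all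
    show "- u2 * H11 + u1 * H12 = 0" "- u2 * H12 + u1 * H22 = 0"
      unfolding h using Du F1 F2 by (algebra, algebra)
  qed
  have "u1\<^sup>2 * (c * H11 - 2 * b * H12 + a * H22) = 0" "u2\<^sup>2 * (c * H11 - 2 * b * H12 + a * H22) = 0"
    using k F by (algebra, algebra)
  then show ?thesis using u by auto
qed

text \<open>A patch of a quasi-umbilical surface with a function \<open>u\<close> whose differential has the same
  kernel as that of \<open>n\<close>.\<close>

locale rank_one_patch = gauss_patch S y n
  for S :: "(real^2) set" and y n :: "real^2 \<Rightarrow> real^5" +
  fixes u :: "real^2 \<Rightarrow> real"
  assumes smooth_u: "smooth_on S u" and du_nz: "\<And>p. p \<in> S \<Longrightarrow> dd u e1 p \<noteq> 0 \<or> dd u e2 p \<noteq> 0"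
    and null: "\<And>p v w. p \<in> S \<Longrightarrow> scal (dd n v p) (dd n w p) = 0"
    and nz: "\<And>p. p \<in> S \<Longrightarrow> \<exists>v. \<forall>c. dd n v p \<noteq> c *\<^sub>R y p"
    and rank: "\<And>p v. p \<in> S \<Longrightarrow> dd u v p = 0 \<Longrightarrow> dd n v p = 0"
begin

lemma lin_u: "p \<in> S \<Longrightarrow> linear (\<lambda>v. dd u v p)"
  by (rule dd_linear[OF smooth_u])

text \<open>The field \<open>\<zeta>\<close> spans the kernel of \<open>du\<close>, and \<open>grad\<close>, the gradient for the flat metric of the
  coordinates divided by its square, is a transversal field with \<open>du(grad) = 1\<close>. Thus \<open>M\<close> is the
  derivative of \<open>n\<close> with respect to \<open>u\<close>, and \<open>W\<close> spans the image of the kernel under \<open>dy\<close>. The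
  factor \<open>1 / m\<close> makes \<open>\<Phi>\<close> constant along the kernel direction, and the factor \<open>M \<bullet> M\<close> makes the
  form \<open>\<Psi> du\<close> independent of the choice of \<open>u\<close> and of the coordinates.\<close>

definition \<zeta> :: "real^2 \<Rightarrow> real^2" where
  "\<zeta> q = (- dd u e2 q) *\<^sub>R e1 + dd u e1 q *\<^sub>R e2"

definition grad :: "real^2 \<Rightarrow> real^2" where
  "grad q = (1 / ((dd u e1 q)\<^sup>2 + (dd u e2 q)\<^sup>2)) *\<^sub>R (dd u e1 q *\<^sub>R e1 + dd u e2 q *\<^sub>R e2)"

definition W :: "real^2 \<Rightarrow> real^5" where "W q = dd y (\<zeta> q) q"
definition M :: "real^2 \<Rightarrow> real^5" where "M q = dd n (grad q) q"
definition m :: "real^2 \<Rightarrow> real" where "m q = scal (dd y (grad q) q) (W q)"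
definition \<Phi> :: "real^2 \<Rightarrow> real^5^5" where "\<Phi> q = (1 / m q) *\<^sub>R wedge_endo (y q) (W q)"
definition \<Psi> :: "real^2 \<Rightarrow> real^5^5" where "\<Psi> q = (M q \<bullet> M q) *\<^sub>R \<Phi> q"

lemma du_coords: "p \<in> S \<Longrightarrow> dd u v p = v$1 * dd u e1 p + v$2 * dd u e2 p"
proof -
  assume p: "p \<in> S"
  have "v = v$1 *\<^sub>R e1 + v$2 *\<^sub>R e2" by (simp add: vec_eq_iff forall_2 axis_def)
  then show ?thesis using linear_add[OF lin_u[OF p]] linear_cmul[OF lin_u[OF p]] by (metis real_scaleR_def)
qed

lemma grad_sq: "p \<in> S \<Longrightarrow> (dd u e1 p)\<^sup>2 + (dd u e2 p)\<^sup>2 > 0"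
  using du_nz[of p] by (auto simp: sum_power2_gt_zero_iff)

lemma smooth_\<zeta>: "smooth_on S \<zeta>"
  unfolding \<zeta>_def by (intro smooth_on_add smooth_on_scaleR smooth_on_minus smooth_on_frechet smooth_on_const smooth_u open_S)

lemma smooth_grad: "smooth_on S grad"
  unfolding grad_def power2_eq_square
proof (intro smooth_on_scaleR smooth_on_divide smooth_on_add smooth_on_mult smooth_on_frechet smooth_on_const smooth_u open_S)
  fix q assume "q \<in> S"
  then show "dd u e1 q * dd u e1 q + dd u e2 q * dd u e2 q \<noteq> 0"
    using grad_sq[of q] unfolding power2_eq_square by linarith
qed

lemma du_\<zeta>: "p \<in> S \<Longrightarrow> dd u (\<zeta> p) p = 0"
  by (simp add: du_coords[of p "\<zeta> p"]) (simp add: \<zeta>_def axis_def)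

lemma du_grad: "p \<in> S \<Longrightarrow> dd u (grad p) p = 1"
proof -
  assume p: "p \<in> S"
  define s where "s = (dd u e1 p)\<^sup>2 + (dd u e2 p)\<^sup>2"
  have "grad p $ 1 = dd u e1 p / s" "grad p $ 2 = dd u e2 p / s" by (simp_all add: grad_def s_def)
  moreover have "dd u e1 p * dd u e1 p + dd u e2 p * dd u e2 p = s" by (simp add: s_def power2_eq_square)
  ultimately have "dd u (grad p) p = s / s"
    using du_coords[OF p, of "grad p"] by (simp add: add_divide_distrib[symmetric])
  moreover have "s > 0" using grad_sq[OF p] unfolding s_def .
  ultimately show ?thesis by simp
qed

lemma \<zeta>_nz: "p \<in> S \<Longrightarrow> \<zeta> p \<noteq> 0"
  using du_nz[of p] by (auto simp: \<zeta>_def vec_eq_iff forall_2 axis_def)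

lemma dn_\<zeta>: "p \<in> S \<Longrightarrow> dd n (\<zeta> p) p = 0"
  by (rule rank) (simp_all add: du_\<zeta>)

lemma kernel_multiple:
  assumes p: "p \<in> S" and w: "dd u w p = 0"
  obtains c where "w = c *\<^sub>R \<zeta> p"
proof -
  define s where "s = (dd u e1 p)\<^sup>2 + (dd u e2 p)\<^sup>2"
  have s: "s > 0" using grad_sq[OF p] by (simp add: s_def)
  have e: "w$1 * dd u e1 p + w$2 * dd u e2 p = 0" using w du_coords[OF p, of w] by simp
  have "s *\<^sub>R w = (w$2 * dd u e1 p - w$1 * dd u e2 p) *\<^sub>R \<zeta> p"
  proof -
    have "s * w$1 = (w$2 * dd u e1 p - w$1 * dd u e2 p) * (- dd u e2 p)"
      "s * w$2 = (w$2 * dd u e1 p - w$1 * dd u e2 p) * dd u e1 p"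
      unfolding s_def using e by (algebra, algebra)
    then show ?thesis by (simp add: vec_eq_iff forall_2 \<zeta>_def)
  qed
  then have "(1 / s) *\<^sub>R s *\<^sub>R w = ((w$2 * dd u e1 p - w$1 * dd u e2 p) / s) *\<^sub>R \<zeta> p" by simp
  then have "w = ((w$2 * dd u e1 p - w$1 * dd u e2 p) / s) *\<^sub>R \<zeta> p" using s by simp
  then show ?thesis by (rule that)
qed

lemma split_vector:
  assumes p: "p \<in> S"
  obtains c where "v = c *\<^sub>R \<zeta> p + dd u v p *\<^sub>R grad p"
proof -
  have "dd u (v - dd u v p *\<^sub>R grad p) p = 0"
    using linear_diff[OF lin_u[OF p], of v "dd u v p *\<^sub>R grad p"] linear_cmul[OF lin_u[OF p], of "dd u v p" "grad p"] du_grad[OF p] by simp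
  then obtain c where "v - dd u v p *\<^sub>R grad p = c *\<^sub>R \<zeta> p" using kernel_multiple[OF p] by blast
  then have "v = c *\<^sub>R \<zeta> p + dd u v p *\<^sub>R grad p" by (simp add: algebra_simps)
  then show ?thesis by (rule that)
qed

lemma dn_eq: assumes p: "p \<in> S" shows "dd n v p = dd u v p *\<^sub>R M p"
proof -
  obtain c where c: "v = c *\<^sub>R \<zeta> p + dd u v p *\<^sub>R grad p" using split_vector[OF p, of v] by blast
  have "dd n v p = dd n (c *\<^sub>R \<zeta> p + dd u v p *\<^sub>R grad p) p" using c by simp
  also have "\<dots> = c *\<^sub>R dd n (\<zeta> p) p + dd u v p *\<^sub>R M p"
    by (simp only: linear_add[OF lin_n[OF p]] linear_cmul[OF lin_n[OF p]] M_def)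
  finally show ?thesis using dn_\<zeta>[OF p] by simp
qed

lemma ker_W: "q \<in> S \<Longrightarrow> scal (dd n v q) (dd y (\<zeta> q) q) = 0"
  using hessian_symmetric[of q v "\<zeta> q"] dn_\<zeta>[of q] by (simp add: scal.zero_left)

lemma WW: "p \<in> S \<Longrightarrow> scal (W p) (W p) = 0"
  unfolding W_def by (rule kernel_field(2)[OF open_S order_refl smooth_\<zeta> \<zeta>_nz null nz ker_W])

lemma dW_\<zeta>: "p \<in> S \<Longrightarrow> \<exists>a b. dd W (\<zeta> p) p = a *\<^sub>R y p + b *\<^sub>R W p"
  unfolding W_def by (rule kernel_field(3)[OF open_S order_refl smooth_\<zeta> \<zeta>_nz null nz ker_W])

lemma smooth_W: "smooth_on S W"
  unfolding W_def by (rule smooth_on_dd_field[OF open_S smooth_y smooth_\<zeta>])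

lemma smooth_M: "smooth_on S M"
  unfolding M_def by (rule smooth_on_dd_field[OF open_S smooth_n smooth_grad])

lemma smooth_m: "smooth_on S m"
  unfolding m_def by (rule smooth_on_scal[OF open_S smooth_on_dd_field[OF open_S smooth_y smooth_grad] smooth_W])

lemma dy_W: assumes p: "p \<in> S" shows "scal (dd y v p) (W p) = dd u v p * m p"
proof -
  obtain c where c: "v = c *\<^sub>R \<zeta> p + dd u v p *\<^sub>R grad p" using split_vector[OF p, of v] by blast
  have "dd y v p = dd y (c *\<^sub>R \<zeta> p + dd u v p *\<^sub>R grad p) p" using c by simp
  also have "\<dots> = c *\<^sub>R W p + dd u v p *\<^sub>R dd y (grad p) p"
    by (simp only: linear_add[OF lin_y[OF p]] linear_cmul[OF lin_y[OF p]] W_def)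
  finally have "scal (dd y v p) (W p) = scal (c *\<^sub>R W p + dd u v p *\<^sub>R dd y (grad p) p) (W p)" by simp
  then show ?thesis using WW[OF p] by (simp add: scal_simps m_def)
qed

lemma m_nz: assumes p: "p \<in> S" shows "m p \<noteq> 0"
proof
  assume "m p = 0"
  then have "scal (dd y (\<zeta> p) p) (dd y w p) = 0" for w
    using dy_W[OF p, of w] by (simp add: W_def scal_commute)
  then show False using metric_nondegenerate[OF p] \<zeta>_nz[OF p] by blast
qed

lemma yW: "p \<in> S \<Longrightarrow> scal (y p) (W p) = 0"
  unfolding W_def by (rule ydy)

lemma smooth_\<Phi>: "smooth_on S \<Phi>"
  unfolding \<Phi>_def
  by (intro smooth_on_scaleR smooth_on_divide smooth_on_const smooth_m open_S m_nz
      smooth_on_bilinear[OF bounded_bilinear_wedge_endo] smooth_y smooth_W)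

lemma smooth_\<Psi>: "smooth_on S \<Psi>"
  unfolding \<Psi>_def by (intro smooth_on_scaleR smooth_on_inner smooth_M smooth_\<Phi> open_S)

text \<open>\<open>W\<close> is parallel up to scaling and multiples of \<open>y\<close> along the kernel direction, and the scaling
  factor of \<open>m\<close> is the same; hence \<open>\<Phi>\<close> is constant along the kernel.\<close>

lemma d\<Phi>_\<zeta>: assumes p: "p \<in> S" shows "dd \<Phi> (\<zeta> p) p = 0"
proof -
  obtain a b where ab: "dd W (\<zeta> p) p = a *\<^sub>R y p + b *\<^sub>R W p" using dW_\<zeta>[OF p] by blast
  let ?z = "\<zeta> p" and ?t = "grad p"
  have dW: "scal (W p) (dd W v p) = 0" for v
    using scal_const_dd[OF open_S p, of W W 0 v] WW smooth_W by (simp add: scal_commute)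
  have "dd (\<lambda>q. scal (dd y ?t q) (W q)) ?z p = dd (\<lambda>q. dd u ?t q * m q) ?z p"
    by (rule dd_cong[OF open_S p]) (rule dy_W)
  moreover have "dd (\<lambda>q. scal (dd y ?t q) (W q)) ?z p = scal (dd (dd y ?t) ?z p) (W p) + scal (dd y ?t p) (dd W ?z p)"
    by (rule dd_scal) (use smooth_on_differentiable[OF smooth_on_frechet[OF smooth_y] p] smooth_on_differentiable[OF smooth_W p] in auto)
  moreover have "dd (\<lambda>q. dd u ?t q * m q) ?z p = dd u ?t p * dd m ?z p + dd (dd u ?t) ?z p * m p"
  proof -
    have "((\<lambda>q. dd u ?t q * m q) has_derivative (\<lambda>v. dd u ?t p * dd m v p + dd (dd u ?t) v p * m p)) (at p)"
      by (rule has_derivative_mult[OF smooth_on_has_derivative[OF smooth_on_frechet[OF smooth_u] p] smooth_on_has_derivative[OF smooth_m p]])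
    then show ?thesis by (rule dd_eqI)
  qed
  moreover have "scal (dd (dd y ?t) ?z p) (W p) = - dd u (dd \<zeta> ?t p) p * m p"
  proof -
    have "dd W ?t p = dd (dd y ?z) ?t p + dd y (dd \<zeta> ?t p) p"
      unfolding W_def by (rule dd_dd_field[OF open_S p smooth_y smooth_\<zeta>])
    then have "dd (dd y ?t) ?z p = dd W ?t p - dd y (dd \<zeta> ?t p) p"
      using symmetric_second_derivative[OF open_S smooth_y p, of ?t ?z] by simp
    then show ?thesis using dW[of ?t] dy_W[OF p] by (simp add: scal_simps scal_commute)
  qed
  moreover have "dd (dd u ?t) ?z p = - dd u (dd \<zeta> ?t p) p"
  proof -
    have "dd (\<lambda>q. dd u (\<zeta> q) q) ?t p = 0" by (rule dd_const_on[OF open_S p du_\<zeta>])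
    then show ?thesis
      using dd_dd_field[OF open_S p smooth_u smooth_\<zeta>, of ?t] symmetric_second_derivative[OF open_S smooth_u p, of ?t ?z] by simp
  qed
  moreover have "scal (dd y ?t p) (dd W ?z p) = b * m p"
    unfolding ab using dy_W[OF p, of ?t] du_grad[OF p] by (simp add: scal_simps dyy[OF p])
  ultimately have dm: "dd m ?z p = b * m p" using du_grad[OF p] by simp
  have dB: "((\<lambda>q. wedge_endo (y q) (W q)) has_derivative (\<lambda>v. wedge_endo (y p) (dd W v p) + wedge_endo (dd y v p) (W p))) (at p)"
    by (rule wedge_endo.FDERIV[OF smooth_on_has_derivative[OF smooth_y p] smooth_on_has_derivative[OF smooth_W p]])
  have di: "((\<lambda>q. inverse (m q)) has_derivative (\<lambda>v. - (inverse (m p) * dd m v p * inverse (m p)))) (at p)"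
    by (rule Deriv.has_derivative_inverse[OF m_nz[OF p] smooth_on_has_derivative[OF smooth_m p]])
  have "(\<Phi> has_derivative (\<lambda>v. inverse (m p) *\<^sub>R (wedge_endo (y p) (dd W v p) + wedge_endo (dd y v p) (W p))
      + (- (inverse (m p) * dd m v p * inverse (m p))) *\<^sub>R wedge_endo (y p) (W p))) (at p)"
    unfolding \<Phi>_def[abs_def] divide_inverse mult_1 by (rule has_derivative_scaleR[OF di dB])
  then have "dd \<Phi> ?z p = inverse (m p) *\<^sub>R (wedge_endo (y p) (dd W ?z p) + wedge_endo (dd y ?z p) (W p))
      + (- (inverse (m p) * dd m ?z p * inverse (m p))) *\<^sub>R wedge_endo (y p) (W p)"
    by (rule dd_eqI)
  also have "wedge_endo (dd y ?z p) (W p) = 0" by (simp add: W_def)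
  also have "wedge_endo (y p) (dd W ?z p) = b *\<^sub>R wedge_endo (y p) (W p)"
    unfolding ab by (simp add: wedge_endo.add_right wedge_endo.scaleR_right)
  finally show ?thesis using m_nz[OF p] by (simp add: dm)
qed

lemma ddn:
  assumes p: "p \<in> S"
  shows "dd (dd n v) w p = dd u v p *\<^sub>R dd M w p + dd (dd u v) w p *\<^sub>R M p"
proof -
  have "dd (dd n v) w p = dd (\<lambda>q. dd u v q *\<^sub>R M q) w p"
    by (rule dd_cong[OF open_S p]) (rule dn_eq)
  moreover have 2: "((\<lambda>q. dd u v q *\<^sub>R M q) has_derivative (\<lambda>w. dd u v p *\<^sub>R dd M w p + dd (dd u v) w p *\<^sub>R M p)) (at p)"
    by (rule has_derivative_scaleR[OF smooth_on_has_derivative[OF smooth_on_frechet[OF smooth_u] p] smooth_on_has_derivative[OF smooth_M p]])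
  ultimately show ?thesis using dd_eqI[OF 2, of w] by simp
qed

text \<open>As \<open>dn = M du\<close> is closed, \<open>dM\<close> is a multiple of \<open>du\<close>.\<close>

lemma dM_\<zeta>: assumes p: "p \<in> S" shows "dd M v p = dd u v p *\<^sub>R dd M (grad p) p" "dd M (\<zeta> p) p = 0"
proof -
  note d = ddn[OF p]
  have "dd u v p *\<^sub>R dd M w p = dd u w p *\<^sub>R dd M v p" for v w
    using d[of v w] d[of w v] symmetric_second_derivative[OF open_S smooth_n p, of v w]
      symmetric_second_derivative[OF open_S smooth_u p, of v w] by simp
  then show *: "dd M v p = dd u v p *\<^sub>R dd M (grad p) p" for v
    using du_grad[OF p] by (metis scaleR_one)
  show "dd M (\<zeta> p) p = 0" using *[of "\<zeta> p"] du_\<zeta>[OF p] by simp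
qed

lemma d\<Psi>_\<zeta>: assumes p: "p \<in> S" shows "dd \<Psi> (\<zeta> p) p = 0"
proof -
  have "(\<Psi> has_derivative (\<lambda>v. (M p \<bullet> M p) *\<^sub>R dd \<Phi> v p + (M p \<bullet> dd M v p + dd M v p \<bullet> M p) *\<^sub>R \<Phi> p)) (at p)"
    unfolding \<Psi>_def[abs_def]
    by (intro has_derivative_scaleR has_derivative_inner smooth_on_has_derivative[OF smooth_M p] smooth_on_has_derivative[OF smooth_\<Phi> p])
  then have "dd \<Psi> (\<zeta> p) p = (M p \<bullet> M p) *\<^sub>R dd \<Phi> (\<zeta> p) p + (M p \<bullet> dd M (\<zeta> p) p + dd M (\<zeta> p) p \<bullet> M p) *\<^sub>R \<Phi> p"
    by (rule dd_eqI)
  then show ?thesis using d\<Phi>_\<zeta>[OF p] dM_\<zeta>(2)[OF p] by simp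
qed

lemma M_nz: assumes p: "p \<in> S" shows "M p \<noteq> 0"
proof
  assume "M p = 0"
  then have "dd n v p = 0 *\<^sub>R y p" for v using dn_eq[OF p, of v] by simp
  then show False using nz[OF p] by blast
qed

lemma \<Psi>_nz: assumes p: "p \<in> S" shows "\<Psi> p \<noteq> 0"
proof
  assume "\<Psi> p = 0"
  then have "wedge_endo (y p) (W p) = 0" using M_nz[OF p] m_nz[OF p] by (simp add: \<Psi>_def \<Phi>_def)
  then have "scal (wedge_endo (y p) (W p) *v dd y (grad p) p) Z = 0" for Z by (simp add: scal.zero_left)
  then have "m p * scal (y p) Z = 0" for Z
    using ydy[OF p, of "grad p"] dy_W[OF p, of "grad p"] du_grad[OF p]
    unfolding scal_wedge_endo by (simp add: scal_commute[of "W p"])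
  then have "y p = 0" using m_nz[OF p] scal_nondegenerate by auto
  then show False using y_nz[OF p] by blast
qed

text \<open>As \<open>d\<Psi>\<close> is a multiple of \<open>du\<close>, only the term \<open>dh \<and> du\<close> contributes to the differential of \<open>h \<Psi>
  du\<close>. Hence this form is closed if and only if \<open>h\<close> is constant along the kernel of \<open>du\<close>.\<close>

lemma curl_multiple:
  assumes T: "open T" "T \<subseteq> S" "smooth_on T h" and p: "p \<in> T"
  shows "dd (\<lambda>q. (h q :: real) *\<^sub>R dd u e2 q *\<^sub>R \<Psi> q) e1 p - dd (\<lambda>q. h q *\<^sub>R dd u e1 q *\<^sub>R \<Psi> q) e2 p = - dd h (\<zeta> p) p *\<^sub>R \<Psi> p"
proof -
  have pS: "p \<in> S" using T p by blast
  have curl: "dd (\<lambda>q. h q *\<^sub>R dd u v q *\<^sub>R \<Psi> q) w p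
      = h p *\<^sub>R (dd u v p *\<^sub>R dd \<Psi> w p + dd (dd u v) w p *\<^sub>R \<Psi> p) + dd h w p *\<^sub>R dd u v p *\<^sub>R \<Psi> p" for v w
  proof -
    have "((\<lambda>q. h q *\<^sub>R dd u v q *\<^sub>R \<Psi> q) has_derivative (\<lambda>w. h p *\<^sub>R (dd u v p *\<^sub>R dd \<Psi> w p + dd (dd u v) w p *\<^sub>R \<Psi> p)
        + dd h w p *\<^sub>R dd u v p *\<^sub>R \<Psi> p)) (at p)"
      by (intro has_derivative_scaleR smooth_on_has_derivative[OF smooth_\<Psi> pS] smooth_on_has_derivative[OF smooth_on_frechet[OF smooth_u] pS]
          smooth_on_has_derivative[OF T(3) p])
    then show ?thesis by (rule dd_eqI)
  qed
  have lin: "dd g (\<zeta> p) p = (- dd u e2 p) *\<^sub>R dd g e1 p + dd u e1 p *\<^sub>R dd g e2 p"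
    if "linear (\<lambda>v. dd g v p)" for g :: "real^2 \<Rightarrow> 'z::real_normed_vector"
    unfolding \<zeta>_def using linear_add[OF that] linear_cmul[OF that] by metis
  have "dd u e1 p *\<^sub>R dd \<Psi> e2 p = dd u e2 p *\<^sub>R dd \<Psi> e1 p"
    using lin[OF dd_linear[OF smooth_\<Psi> pS]] d\<Psi>_\<zeta>[OF pS] by simp
  from arg_cong[OF this, of "\<lambda>X. h p *\<^sub>R X"]
  have k1: "(h p * dd u e1 p) *\<^sub>R dd \<Psi> e2 p = (h p * dd u e2 p) *\<^sub>R dd \<Psi> e1 p" by simp
  have k2: "dd h (\<zeta> p) p = - dd u e2 p * dd h e1 p + dd u e1 p * dd h e2 p"
    using lin[OF dd_linear[OF T(3) p]] by simp
  show ?thesis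
    unfolding curl k2 symmetric_second_derivative[OF open_S smooth_u pS, of e1 e2]
    using k1 by (simp add: algebra_simps)
qed

end

context rank_one_patch
begin

text \<open>A closed form with values in the spaces \<open>{y \<and> w. w orthogonal to y}\<close> is \<open>y \<and> a\<close> for some
  vectors \<open>a\<^sub>1\<close>, \<open>a\<^sub>2\<close>, unique up to multiples of \<open>y\<close>. Tested against pairs of vectors, the equation
  \<open>\<partial>\<^sub>1 (y \<and> a\<^sub>2) = \<partial>\<^sub>2 (y \<and> a\<^sub>1)\<close> shows that their components along \<open>n\<close> vanish, then that they are
  orthogonal to \<open>W\<close>, and thus multiples of \<open>W\<close> modulo \<open>y\<close>, and finally that the two multiples are
  proportional to the components of \<open>du\<close>.\<close>

lemma closed_form_multiple:
  fixes d :: "real^2 \<Rightarrow> real^2 \<Rightarrow> real^5^5"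
  assumes T: "open T" "T \<subseteq> S" and sd: "\<And>v. smooth_on T (d v)"
    and lin: "\<And>q. q \<in> T \<Longrightarrow> linear (\<lambda>v. d v q)"
    and val: "\<And>q v. q \<in> T \<Longrightarrow> \<exists>w. scal (y q) w = 0 \<and> d v q = wedge_endo (y q) w"
    and closed: "\<And>q. q \<in> T \<Longrightarrow> dd (d e2) e1 q = dd (d e1) e2 q"
    and p0: "p0 \<in> T"
  shows "\<exists>h. \<forall>v. d v p0 = h *\<^sub>R dd u v p0 *\<^sub>R \<Psi> p0"
proof -
  have TS: "q \<in> S" if "q \<in> T" for q using T that by blast
  obtain Z where Z: "scal (y p0) Z \<noteq> 0" using scal_nondegenerate y_nz[OF TS[OF p0]] by blast
  have syT: "smooth_on T y" by (rule smooth_on_subset[OF smooth_y T(2)])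
  have snT: "smooth_on T n" by (rule smooth_on_subset[OF smooth_n T(2)])
  have sZ: "smooth_on T (\<lambda>q. scal (y q) Z)" by (intro smooth_on_scal smooth_on_const syT T)
  \<comment> \<open>Applied to a vector \<open>Z\<close> that is not orthogonal to \<open>y\<close>, the form gives back the factor \<open>a\<close>, up
    to a multiple of \<open>y\<close>.\<close>
  define R where "R = {q \<in> T. scal (y q) Z \<noteq> 0}"
  have R: "open R" "R \<subseteq> T" "p0 \<in> R"
    using continuous_open_preimage[OF smooth_on_continuous[OF sZ] T(1), of "- {0}"] p0 Z
    by (auto simp: R_def Int_def vimage_def open_Compl)
  have RS: "q \<in> S" "q \<in> T" "scal (y q) Z \<noteq> 0" if "q \<in> R" for q using that TS by (auto simp: R_def)
  define a where "a v q = (1 / scal (y q) Z) *\<^sub>R (d v q *v Z)" for v q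
  have bl: "bounded_linear (\<lambda>D :: real^5^5. D *v Z)"
    by (rule linear_conv_bounded_linear[THEN iffD1], rule linearI)
       (simp_all add: matrix_vector_mult_add_rdistrib matrix_mult_scaleR)
  have sa: "smooth_on R (a v)" for v
    unfolding a_def
    by (intro smooth_on_scaleR smooth_on_divide smooth_on_const smooth_on_subset[OF sZ R(2)] R(1)
        smooth_on_linear_compose[OF bl] smooth_on_subset[OF sd R(2)]) (rule RS(3))
  have ad: "d v q = wedge_endo (y q) (a v q)" "scal (a v q) (y q) = 0" if q: "q \<in> R" for v q
  proof -
    obtain w where w: "scal (y q) w = 0" "d v q = wedge_endo (y q) w" using val RS(2)[OF q] by blast
    have "a v q = w - (scal w Z / scal (y q) Z) *\<^sub>R y q"
      using RS(3)[OF q] by (simp add: a_def w wedge_endo_mult scaleR_diff_right)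
    then show "d v q = wedge_endo (y q) (a v q)" "scal (a v q) (y q) = 0"
      using w yy[OF RS(1)[OF q]]
      by (simp_all add: wedge_endo.diff_right wedge_endo.scaleR_right scal_simps scal_commute[of w])
  qed
  have ya: "scal (y q) (a v q) = 0" if "q \<in> R" for q v using ad(2)[OF that] by (simp add: scal_commute)
  have syR: "smooth_on R y" "smooth_on R n" by (rule smooth_on_subset[OF syT R(2)], rule smooth_on_subset[OF snT R(2)])
  have curl: "scal (dd y e1 q) X * scal (a e2 q) V - scal (a e2 q) X * scal (dd y e1 q) V
        + scal (y q) X * scal (dd (a e2) e1 q) V - scal (dd (a e2) e1 q) X * scal (y q) V
      = scal (dd y e2 q) X * scal (a e1 q) V - scal (a e1 q) X * scal (dd y e2 q) V
        + scal (y q) X * scal (dd (a e1) e2 q) V - scal (dd (a e1) e2 q) X * scal (y q) V"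
    if q: "q \<in> R" for q X V
  proof -
    have dda: "dd (d v) w q = wedge_endo (y q) (dd (a v) w q) + wedge_endo (dd y w q) (a v q)" for v w
    proof -
      have "dd (d v) w q = dd (\<lambda>q. wedge_endo (y q) (a v q)) w q"
        by (rule dd_cong[OF R(1) q]) (rule ad(1))
      also have "\<dots> = wedge_endo (y q) (dd (a v) w q) + wedge_endo (dd y w q) (a v q)"
        by (rule dd_eqI, rule wedge_endo.FDERIV[OF smooth_on_has_derivative[OF syR(1) q] smooth_on_has_derivative[OF sa q]])
      finally show ?thesis .
    qed
    have "scal (dd (d e2) e1 q *v X) V = scal (dd (d e1) e2 q *v X) V"
      using closed[OF RS(2)[OF q]] by simp
    then show ?thesis
      unfolding dda matrix_vector_mult_add_rdistrib scal.add_left scal_wedge_endo by simp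
  qed
  \<comment> \<open>The pairs of \<open>n\<close> and a tangent vector.\<close>
  have an: "scal (a v q) (n q) = 0" if q: "q \<in> R" and v: "v = e1 \<or> v = e2" for q v
  proof -
    note qS = RS(1)[OF q]
    define w where "w = scal (a e2 q) (n q) *\<^sub>R e1 - scal (a e1 q) (n q) *\<^sub>R e2"
    have "scal (dd y w q) (dd y e1 q) = 0" "scal (dd y w q) (dd y e2 q) = 0"
      using curl[OF q, of "n q" "dd y e1 q"] curl[OF q, of "n q" "dd y e2 q"]
      unfolding w_def linear_diff[OF lin_y[OF qS]] linear_cmul[OF lin_y[OF qS]]
      by (simp_all add: scal_simps dyn[OF qS] ydy[OF qS] yn[OF qS])
    then have "scal (dd y w q) (dd y z q) = 0" for z
      using dy_expand[OF qS, of z] by (simp add: scal_simps)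
    then have "w = 0" by (rule metric_nondegenerate[OF qS])
    then have "w $ 1 = 0" "w $ 2 = 0" by simp_all
    then show ?thesis using v by (auto simp: w_def)
  qed
  note pR = R(3) and pS = TS[OF p0]
  let ?p = p0
  have nM: "dd n v ?p = dd u v ?p *\<^sub>R M ?p" for v by (rule dn_eq[OF pS])
  \<comment> \<open>The components along \<open>n\<close> vanish in a neighbourhood, so that their derivatives vanish as well.\<close>
  have "scal (dd (a e2) e1 ?p) (n ?p) = scal (dd (a e1) e2 ?p) (n ?p)"
    using curl[OF pR, of "n ?p" Z] an[OF pR] Z by (simp add: dyn[OF pS] yn[OF pS])
  moreover have "scal (dd (a v) w ?p) (n ?p) = - scal (a v ?p) (dd n w ?p)" if "v = e1 \<or> v = e2" for v w
    using scal_const_dd[OF R(1) pR, of "a v" n 0 w] an[OF _ that] sa syR by simp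
  ultimately have aM: "dd u e1 ?p * scal (a e2 ?p) (M ?p) = dd u e2 ?p * scal (a e1 ?p) (M ?p)"
    by (simp add: nM scal_simps)
  \<comment> \<open>Modulo \<open>y\<close>, the vector \<open>M\<close> is a nonzero multiple of \<open>W\<close>.\<close>
  obtain \<alpha> \<beta> where MW: "M ?p = \<alpha> *\<^sub>R y ?p + \<beta> *\<^sub>R W ?p" "\<beta> \<noteq> 0"
  proof -
    have "scal (M ?p) (y ?p) = 0" "scal (M ?p) (n ?p) = 0"
      unfolding M_def using dny[OF pS] ndn[OF pS] by (simp_all add: scal_commute)
    then obtain \<alpha> s where s: "M ?p = \<alpha> *\<^sub>R y ?p + dd y s ?p" using tangent_expansion[OF pS, of "M ?p"] by blast
    have "scal (M ?p) (W ?p) = 0"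
      unfolding M_def W_def by (rule ker_W[OF pS])
    then have "scal (dd y (\<zeta> ?p) ?p) (dd y s ?p) = 0"
      unfolding s W_def by (simp add: scal_simps ydy[OF pS] scal_commute)
    then obtain \<beta> where \<beta>: "s = \<beta> *\<^sub>R \<zeta> ?p"
      using null_orthogonal[OF pS \<zeta>_nz[OF pS]] WW[OF pS] unfolding W_def by metis
    have M: "M ?p = \<alpha> *\<^sub>R y ?p + \<beta> *\<^sub>R W ?p"
      unfolding s \<beta> linear_cmul[OF lin_y[OF pS]] W_def ..
    have "\<beta> \<noteq> 0"
    proof
      assume "\<beta> = 0"
      then have "dd n v ?p = (dd u v ?p * \<alpha>) *\<^sub>R y ?p" for v using nM[of v] M by simp
      then show False using nz[OF pS] by blast
    qed
    then show ?thesis using M that by blast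
  qed
  have aW: "dd u e1 ?p * scal (a e2 ?p) (W ?p) = dd u e2 ?p * scal (a e1 ?p) (W ?p)"
    using aM MW(2) unfolding MW(1) by (simp add: scal_simps ad(2)[OF pR])
  define s where "s v w = scal (a v ?p) (dd y w ?p)" for v w
  have "scal (dd (a e2) e1 ?p) (y ?p) = scal (dd (a e1) e2 ?p) (y ?p)"
    using curl[OF pR, of "y ?p" Z] Z ad(2)[OF pR] by (simp add: dyy[OF pS] yy[OF pS])
  moreover have "scal (dd (a v) w ?p) (y ?p) = - s v w" for v w
    using scal_const_dd[OF R(1) pR, of "a v" y 0 w] ad(2) sa syR by (simp add: s_def)
  ultimately have sym: "s e2 e1 = s e1 e2" by simp
  define g11 where "g11 = scal (dd y e1 ?p) (dd y e1 ?p)"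
  define g12 where "g12 = scal (dd y e1 ?p) (dd y e2 ?p)"
  define g22 where "g22 = scal (dd y e2 ?p) (dd y e2 ?p)"
  define u1 where "u1 = dd u e1 ?p"
  define u2 where "u2 = dd u e2 ?p"
  have g21: "scal (dd y e2 ?p) (dd y e1 ?p) = g12" by (simp add: g12_def scal_commute)
  \<comment> \<open>The pair of the two coordinate vectors gives a trace condition on the tangential components,
    which excludes a component transversal to the kernel.\<close>
  have tr: "g11 * s e2 e2 - 2 * g12 * s e1 e2 + g22 * s e1 e1 = 0"
    using curl[OF pR, of "dd y e1 ?p" "dd y e2 ?p"] sym
    unfolding g21 s_def[symmetric] g11_def[symmetric] g12_def[symmetric] g22_def[symmetric]
    by (simp add: ydy[OF pS] algebra_simps)
  have sW: "scal (a v ?p) (W ?p) = - u2 * s v e1 + u1 * s v e2" for v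
    unfolding W_def \<zeta>_def linear_add[OF lin_y[OF pS]] linear_cmul[OF lin_y[OF pS]] s_def u1_def u2_def
    by (simp add: scal_simps)
  have gW: "scal (dd y v ?p) (W ?p) = - u2 * scal (dd y v ?p) (dd y e1 ?p) + u1 * scal (dd y v ?p) (dd y e2 ?p)" for v
    unfolding W_def \<zeta>_def linear_add[OF lin_y[OF pS]] linear_cmul[OF lin_y[OF pS]] u1_def u2_def
    by (simp add: scal_simps)
  have m1: "u1 * m ?p = - u2 * g11 + u1 * g12" "u2 * m ?p = - u2 * g12 + u1 * g22"
    using dy_W[OF pS, of e1] dy_W[OF pS, of e2] unfolding gW g21 by (simp_all add: u1_def u2_def g11_def g12_def g22_def)
  have aWe: "u1 * (- u2 * s e1 e2 + u1 * s e2 e2) = u2 * (- u2 * s e1 e1 + u1 * s e1 e2)"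
    using aW unfolding sW u1_def[symmetric] u2_def[symmetric] sym .
  have uz: "u1 \<noteq> 0 \<or> u2 \<noteq> 0" using du_nz[OF pS] by (simp add: u1_def u2_def)
  obtain l where l: "- u2 * s e1 e1 + u1 * s e1 e2 = l * u1" "- u2 * s e1 e2 + u1 * s e2 e2 = l * u2"
  proof (cases "u1 = 0")
    case False
    show ?thesis
      by (rule that[of "(- u2 * s e1 e1 + u1 * s e1 e2) / u1"]) (use False aWe in \<open>simp_all add: field_simps\<close>)
  next
    case True
    then have "u2 \<noteq> 0" using uz by simp
    then show ?thesis using True aWe
      by (intro that[of "(- u2 * s e1 e2 + u1 * s e2 e2) / u2"]) simp_all
  qed
  have "l * m ?p * u1\<^sup>2 = 0" "l * m ?p * u2\<^sup>2 = 0"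
    using tr l m1 by (algebra, algebra)
  then have "l = 0" using m_nz[OF pS] uz by auto
  then have aW0: "scal (a e1 ?p) (W ?p) = 0" "scal (a e2 ?p) (W ?p) = 0"
    unfolding sW sym using l by simp_all
  have ex: "\<exists>\<gamma> \<tau>. a v ?p = \<gamma> *\<^sub>R y ?p + \<tau> *\<^sub>R W ?p" if v: "v = e1 \<or> v = e2" for v
  proof -
    obtain \<gamma> w where w: "a v ?p = \<gamma> *\<^sub>R y ?p + dd y w ?p"
      using tangent_expansion[OF pS ad(2)[OF pR] an[OF pR v]] by blast
    have "scal (a v ?p) (W ?p) = 0" using aW0 v by blast
    then have "scal (dd y (\<zeta> ?p) ?p) (dd y w ?p) = 0"
      unfolding w W_def by (simp add: scal_simps ydy[OF pS] scal_commute)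
    then obtain c where c: "w = c *\<^sub>R \<zeta> ?p"
      using null_orthogonal[OF pS \<zeta>_nz[OF pS]] WW[OF pS] unfolding W_def by metis
    show ?thesis unfolding w c linear_cmul[OF lin_y[OF pS]] W_def by blast
  qed
  obtain c1 t1 where t1: "a e1 ?p = c1 *\<^sub>R y ?p + t1 *\<^sub>R W ?p" using ex by blast
  obtain c2 t2 where t2: "a e2 ?p = c2 *\<^sub>R y ?p + t2 *\<^sub>R W ?p" using ex by blast
  have Wd: "scal (W ?p) (dd y v ?p) = dd u v ?p * m ?p" for v using dy_W[OF pS] by (simp add: scal_commute)
  have "t2 * u1 = t1 * u2"
    using sym m_nz[OF pS] unfolding s_def t1 t2 by (simp add: scal_simps ydy[OF pS] Wd u1_def u2_def)
  then obtain t where t: "t1 = t * u1" "t2 = t * u2"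
  proof (cases "u1 = 0")
    case False
    then show ?thesis using \<open>t2 * u1 = t1 * u2\<close> by (intro that[of "t1 / u1"]) (simp_all add: field_simps)
  next
    case True
    then have "u2 \<noteq> 0" using uz by simp
    then show ?thesis using True \<open>t2 * u1 = t1 * u2\<close> by (intro that[of "t2 / u2"]) simp_all
  qed
  have \<Psi>B: "wedge_endo (y ?p) (W ?p) = (m ?p / (M ?p \<bullet> M ?p)) *\<^sub>R \<Psi> ?p"
    using m_nz[OF pS] M_nz[OF pS] by (simp add: \<Psi>_def \<Phi>_def)
  have de: "d e1 ?p = (t * u1) *\<^sub>R wedge_endo (y ?p) (W ?p)" "d e2 ?p = (t * u2) *\<^sub>R wedge_endo (y ?p) (W ?p)"
    unfolding ad(1)[OF pR] t1 t2 t by (simp_all add: wedge_endo.add_right wedge_endo.scaleR_right)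
  have "d v ?p = (t * (m ?p / (M ?p \<bullet> M ?p))) *\<^sub>R dd u v ?p *\<^sub>R \<Psi> ?p" for v
  proof -
    have "v = v$1 *\<^sub>R e1 + v$2 *\<^sub>R e2" by (simp add: vec_eq_iff forall_2)
    then have "d v ?p = v$1 *\<^sub>R d e1 ?p + v$2 *\<^sub>R d e2 ?p"
      using linear_add[OF lin[OF p0]] linear_cmul[OF lin[OF p0]] by metis
    also have "\<dots> = (t * dd u v ?p) *\<^sub>R wedge_endo (y ?p) (W ?p)"
      unfolding de du_coords[OF pS, of v] u1_def u2_def by (simp add: distrib_left scaleR_add_left mult.left_commute)
    finally show ?thesis unfolding \<Psi>B by (simp add: algebra_simps)
  qed
  then show ?thesis by blast
qed

end

context rank_one_patch
begin

text \<open>The Hessian of \<open>n\<close> is a combination of \<open>M\<close> and of the derivative of \<open>M\<close>. In the tension field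
  the coefficients are the Laplacian of \<open>u\<close> and the square of its gradient, and both vanish because
  the kernel of \<open>du\<close> is a null line, that is, because \<open>u\<close> has null gradient.\<close>

lemma tension_zero:
  assumes p: "p \<in> S"
  defines "G \<equiv> \<lambda>q. \<chi> i j. scal (dd y (axis i 1) q) (dd y (axis j 1) q)"
  shows "tension G n p = 0"
proof -
  define a where "a q = scal (dd y e1 q) (dd y e1 q)" for q
  define b where "b q = scal (dd y e1 q) (dd y e2 q)" for q
  define c where "c q = scal (dd y e2 q) (dd y e2 q)" for q
  define u1 where "u1 q = dd u e1 q" for q
  define u2 where "u2 q = dd u e2 q" for q
  have G: "G q $ 1 $ 1 = a q" "G q $ 1 $ 2 = b q" "G q $ 2 $ 1 = b q" "G q $ 2 $ 2 = c q" for q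
    by (simp_all add: G_def a_def b_def c_def scal_commute)
  define D where "D = a p * c p - (b p)\<^sup>2"
  have D: "D \<noteq> 0" using metric_det[OF p] by (simp add: D_def a_def b_def c_def)
  define I where "I = matrix_inv (G p)"
  have "det (G p) \<noteq> 0" using D by (simp add: det_2 G D_def power2_eq_square)
  then have IG: "I ** G p = mat 1" unfolding I_def by (rule matrix_inv_inverse)
  have "(I ** G p) $ i $ j = (if i = j then 1 else 0)" for i j unfolding IG by (simp add: mat_def)
  from this[of 1 1] this[of 1 2] this[of 2 1] this[of 2 2]
  have i: "I$1$1 * a p + I$1$2 * b p = 1" "I$1$1 * b p + I$1$2 * c p = 0"
    "I$2$1 * a p + I$2$2 * b p = 0" "I$2$1 * b p + I$2$2 * c p = 1"
    by (simp_all add: matrix_matrix_mult_def sum_2 G)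
  have "D * I$1$1 = c p" "D * I$1$2 = - b p" "D * I$2$1 = - b p" "D * I$2$2 = a p"
    using i unfolding D_def by (algebra, algebra, algebra, algebra)
  then have I: "I$1$1 = c p / D" "I$1$2 = - b p / D" "I$2$1 = - b p / D" "I$2$2 = a p / D"
    using D by (simp_all add: field_simps)
  have sm: "smooth_on S a" "smooth_on S b" "smooth_on S c" "smooth_on S u1" "smooth_on S u2"
    unfolding a_def b_def c_def u1_def u2_def
    by (intro smooth_on_scal smooth_on_frechet smooth_y smooth_u open_S)+
  note hd = smooth_on_has_derivative[OF sm(1) p] smooth_on_has_derivative[OF sm(2) p] smooth_on_has_derivative[OF sm(3) p]
    smooth_on_has_derivative[OF sm(4) p] smooth_on_has_derivative[OF sm(5) p]
  have F: "c q * u1 q * u1 q - 2 * b q * u1 q * u2 q + a q * u2 q * u2 q = 0" if "q \<in> S" for q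
    using WW[OF that] unfolding W_def metric_coords[OF that, of "\<zeta> q" "\<zeta> q"] by (simp add: \<zeta>_def a_def b_def c_def u1_def u2_def algebra_simps)
  have dF: "dd c v p * u1 p * u1 p + 2 * c p * u1 p * dd u1 v p - 2 * dd b v p * u1 p * u2 p - 2 * b p * dd u1 v p * u2 p
      - 2 * b p * u1 p * dd u2 v p + dd a v p * u2 p * u2 p + 2 * a p * u2 p * dd u2 v p = 0" for v
  proof -
    have "((\<lambda>q. c q * u1 q * u1 q - 2 * b q * u1 q * u2 q + a q * u2 q * u2 q) has_derivative
       (\<lambda>v. dd c v p * u1 p * u1 p + 2 * c p * u1 p * dd u1 v p - 2 * dd b v p * u1 p * u2 p - 2 * b p * dd u1 v p * u2 p
      - 2 * b p * u1 p * dd u2 v p + dd a v p * u2 p * u2 p + 2 * a p * u2 p * dd u2 v p)) (at p)"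
      by (rule derivative_eq_intros hd refl)+ (simp add: fun_eq_iff algebra_simps)
    from dd_eqI[OF this, where v=v] dd_const_on[OF open_S p F, where v=v] show ?thesis by simp
  qed
  have u21: "dd u1 e2 p = dd u2 e1 p"
    using symmetric_second_derivative[OF open_S smooth_u p, of e1 e2] by (simp add: u1_def[abs_def] u2_def[abs_def])
  define H where "H k i j = dd u (axis k 1) p * christoffel G k i j p" for k i j
  have pdG: "pd k (\<lambda>q. G q $ 1 $ 1) p = dd a (axis k 1) p" "pd k (\<lambda>q. G q $ 1 $ 2) p = dd b (axis k 1) p"
    "pd k (\<lambda>q. G q $ 2 $ 1) p = dd b (axis k 1) p" "pd k (\<lambda>q. G q $ 2 $ 2) p = dd c (axis k 1) p" for k
    unfolding G pd_def by simp_all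
  note ch = christoffel_def[of G _ _ _ p, folded I_def, unfolded sum_2]
  define H11 where "H11 = 2 * D * dd u1 e1 p - (c p * u1 p - b p * u2 p) * dd a e1 p - (a p * u2 p - b p * u1 p) * (2 * dd b e1 p - dd a e2 p)"
  define H12 where "H12 = 2 * D * dd u2 e1 p - (c p * u1 p - b p * u2 p) * dd a e2 p - (a p * u2 p - b p * u1 p) * dd c e1 p"
  define H22 where "H22 = 2 * D * dd u2 e2 p - (c p * u1 p - b p * u2 p) * (2 * dd b e2 p - dd c e1 p) - (a p * u2 p - b p * u1 p) * dd c e2 p"
  have lap: "c p * H11 - 2 * b p * H12 + a p * H22 = 0"
  proof (rule null_gradient_laplacian[where ?u1.0="u1 p" and ?u2.0="u2 p"])
    show "a p * c p - (b p)\<^sup>2 \<noteq> 0" using D by (simp add: D_def)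
    show "u1 p \<noteq> 0 \<or> u2 p \<noteq> 0" using du_nz[OF p] by (simp add: u1_def u2_def)
    show "c p * (u1 p)\<^sup>2 - 2 * b p * u1 p * u2 p + a p * (u2 p)\<^sup>2 = 0" using F[OF p] by (simp add: power2_eq_square)
    show "dd c e1 p * (u1 p)\<^sup>2 + 2 * c p * u1 p * dd u1 e1 p - 2 * dd b e1 p * u1 p * u2 p - 2 * b p * dd u1 e1 p * u2 p
      - 2 * b p * u1 p * dd u2 e1 p + dd a e1 p * (u2 p)\<^sup>2 + 2 * a p * u2 p * dd u2 e1 p = 0"
      using dF[of e1] by (simp add: power2_eq_square)
    show "dd c e2 p * (u1 p)\<^sup>2 + 2 * c p * u1 p * dd u2 e1 p - 2 * dd b e2 p * u1 p * u2 p - 2 * b p * dd u2 e1 p * u2 p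
      - 2 * b p * u1 p * dd u2 e2 p + dd a e2 p * (u2 p)\<^sup>2 + 2 * a p * u2 p * dd u2 e2 p = 0"
      using dF[of e2] unfolding u21 by (simp add: power2_eq_square)
  qed (simp_all add: H11_def H12_def H22_def D_def)
  have K: "dd u1 e1 p - (u1 p * christoffel G 1 1 1 p + u2 p * christoffel G 2 1 1 p) = H11 / (2 * D)"
    "dd u2 e1 p - (u1 p * christoffel G 1 1 2 p + u2 p * christoffel G 2 1 2 p) = H12 / (2 * D)"
    "dd u2 e1 p - (u1 p * christoffel G 1 2 1 p + u2 p * christoffel G 2 2 1 p) = H12 / (2 * D)"
    "dd u2 e2 p - (u1 p * christoffel G 1 2 2 p + u2 p * christoffel G 2 2 2 p) = H22 / (2 * D)"
    unfolding ch pdG I H11_def H12_def H22_def using D by (simp_all add: divide_simps) (simp_all add: algebra_simps)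
  define M' where "M' = dd M (grad p) p"
  have tg: "tangential_part (n p) (dd (dd n v) w p) = dd (dd u v) w p *\<^sub>R M p + (dd u v p * dd u w p) *\<^sub>R M'" for v w
  proof -
    have "scal (n p) (dd (dd n v) w p) = - scal (dd n w p) (dd n v p)"
      using scal_const_dd[OF open_S p, of n "dd n v" 0 w] ndn smooth_n smooth_on_frechet[OF smooth_n] by simp
    then have "tangential_part (n p) (dd (dd n v) w p) = dd (dd n v) w p"
      using null[OF p] by (simp add: tangential_part_def scal_commute)
    then show ?thesis unfolding ddn[OF p] dM_\<zeta>(1)[OF p, of w] M'_def by simp
  qed
  have pdn: "pd i n p = dd u (axis i 1) p *\<^sub>R M p" "pd i (pd j n) p = dd (dd n (axis j 1)) (axis i 1) p" for i j
    unfolding pd_def[abs_def] using dn_eq[OF p] by simp_all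
  have "tension G n p = (\<Sum>i\<in>UNIV. \<Sum>j\<in>UNIV. I$i$j *\<^sub>R
      ((dd (dd u (axis j 1)) (axis i 1) p - (\<Sum>k\<in>UNIV. dd u (axis k 1) p * christoffel G k i j p)) *\<^sub>R M p
        + (dd u (axis j 1) p * dd u (axis i 1) p) *\<^sub>R M'))"
    unfolding tension_def I_def[symmetric] pdn tg
    by (simp add: scaleR_sum_left algebra_simps)
  also have "\<dots> = (I$1$1 * (dd u1 e1 p - (u1 p * christoffel G 1 1 1 p + u2 p * christoffel G 2 1 1 p))
        + I$1$2 * (dd u2 e1 p - (u1 p * christoffel G 1 1 2 p + u2 p * christoffel G 2 1 2 p))
        + I$2$1 * (dd u2 e1 p - (u1 p * christoffel G 1 2 1 p + u2 p * christoffel G 2 2 1 p))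
        + I$2$2 * (dd u2 e2 p - (u1 p * christoffel G 1 2 2 p + u2 p * christoffel G 2 2 2 p))) *\<^sub>R M p
      + (I$1$1 * (u1 p * u1 p) + I$1$2 * (u2 p * u1 p) + I$2$1 * (u1 p * u2 p) + I$2$2 * (u2 p * u2 p)) *\<^sub>R M'"
    unfolding sum_2 u1_def[symmetric] u2_def[symmetric] u1_def[abs_def, symmetric] u2_def[abs_def, symmetric] u21
    by (simp add: algebra_simps)
  also have "\<dots> = ((c p * H11 - 2 * b p * H12 + a p * H22) / (2 * D * D)) *\<^sub>R M p
      + ((c p * u1 p * u1 p - 2 * b p * u1 p * u2 p + a p * u2 p * u2 p) / D) *\<^sub>R M'"
  proof -
    have "I$1$1 * (H11 / (2 * D)) + I$1$2 * (H12 / (2 * D)) + I$2$1 * (H12 / (2 * D)) + I$2$2 * (H22 / (2 * D))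
        = (c p * H11 - 2 * b p * H12 + a p * H22) / (2 * D * D)"
      unfolding I using D by (simp add: field_simps)
    moreover have "I$1$1 * (u1 p * u1 p) + I$1$2 * (u2 p * u1 p) + I$2$1 * (u1 p * u2 p) + I$2$2 * (u2 p * u2 p)
        = (c p * u1 p * u1 p - 2 * b p * u1 p * u2 p + a p * u2 p * u2 p) / D"
      unfolding I using D by (simp add: field_simps)
    ultimately show ?thesis unfolding K by simp
  qed
  also have "\<dots> = 0" using lap F[OF p] by simp
  finally show ?thesis .
qed

end

section \<open>Harmonicity\<close>

lemma gauss_patch_subset: "gauss_patch S y n \<Longrightarrow> open T \<Longrightarrow> T \<subseteq> S \<Longrightarrow> gauss_patch T y n"
  unfolding gauss_patch_def by (auto intro: smooth_on_subset)

lemma open_nonzero: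
  fixes g :: "'a::topological_space \<Rightarrow> real"
  assumes "open S" "continuous_on S g" shows "open {q \<in> S. g q \<noteq> 0}"
proof -
  have "open (S \<inter> g -` (- {0}))" by (rule continuous_open_preimage[OF assms(2,1)]) (simp add: open_Compl)
  then show ?thesis by (simp add: Int_def vimage_def)
qed

lemma dd_nth: "h differentiable (at p) \<Longrightarrow> dd (\<lambda>q. h q $ k) v p = dd h v p $ k"
  by (rule dd_eqI, rule bounded_linear.has_derivative[OF bounded_linear_vec_nth]) (simp add: frechet_derivative_works)

lemma tension_cong:
  assumes "open S" "p \<in> S" "\<And>q. q \<in> S \<Longrightarrow> m q = m' q"
  shows "tension m h p = tension m' h p"
proof -
  have "pd i (\<lambda>q. m q $ j $ l) p = pd i (\<lambda>q. m' q $ j $ l) p" for i j l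
    unfolding pd_def by (rule dd_cong[OF assms(1,2)]) (simp add: assms(3))
  then show ?thesis unfolding tension_def christoffel_def assms(3)[OF assms(2)] by simp
qed

lemma differential_coord: "differential c h x v = dd (\<lambda>p. h (chart_inv c p)) v (snd c x)"
  by (simp add: differential_def comp_def)

locale quasi_umbilical_surface = timelike_surface A f
  for A :: "('x::topological_space, real^2) chart set" and f :: "'x \<Rightarrow> (real^5) set" +
  assumes quasi_umbilical: "quasi_umbilical A f"
begin

abbreviation yc :: "('x, real^2) chart \<Rightarrow> real^2 \<Rightarrow> real^5" where "yc c \<equiv> \<lambda>p. Y (chart_inv c p)"
abbreviation nc :: "('x, real^2) chart \<Rightarrow> real^2 \<Rightarrow> real^5" where "nc c \<equiv> \<lambda>p. N (chart_inv c p)"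

lemma gauss_patch_chart:
  assumes "c \<in> A" shows "gauss_patch (chart_image c) (yc c) (nc c)"
proof
  fix p assume p: "p \<in> chart_image c"
  show "gauss_normal (yc c) (nc c p) p" by (rule N_gauss_normal[OF assms p])
  show "scal (dd (yc c) e1 p) (dd (yc c) e1 p) * scal (dd (yc c) e2 p) (dd (yc c) e2 p) - (scal (dd (yc c) e1 p) (dd (yc c) e2 p))\<^sup>2 \<noteq> 0"
    using metric_det_negative[OF assms p] by simp
qed (use assms in \<open>simp_all add: chart_image_open Y_coord N_coord Y_null\<close>)

lemma smooth_map_change:
  assumes "smooth_map A UNIV h" "c \<in> A" "c' \<in> A" "x \<in> fst c" "x \<in> fst c'"
  shows "differential c h x v = differential c' h x (dtrans c c' x v)"
  by (rule differential_change(1)[OF assms(2-5)]) (use smooth_map_differentiable[OF assms(1,3)] assms(5) in simp)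

lemma conformal_factor:
  "\<exists>\<rho>. \<forall>c\<in>A. x \<in> fst c \<longrightarrow> (\<forall>v w. scal (differential c N x v) (differential c N x w) = \<rho> * induced_metric f c x v w)"
proof -
  obtain c where c: "c \<in> A" "x \<in> fst c" using chart_exists[of x] by blast
  interpret gauss_patch "chart_image c" "yc c" "nc c" by (rule gauss_patch_chart[OF c(1)])
  obtain \<rho> where \<rho>: "\<And>v w. scal (dd (nc c) v (snd c x)) (dd (nc c) w (snd c x)) = \<rho> * scal (dd (yc c) v (snd c x)) (dd (yc c) w (snd c x))"
    using second_fundamental_factor[OF chart_value[OF c(2)]] by blast
  have "scal (differential c' N x v) (differential c' N x w) = \<rho> * induced_metric f c' x v w"
    if c': "c' \<in> A" "x \<in> fst c'" for c' v w
    unfolding induced_metric_def smooth_map_change[OF N_smooth c'(1) c(1) c'(2) c(2)] smooth_map_change[OF Y_smooth c'(1) c(1) c'(2) c(2)]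
      differential_coord[of c] by (rule \<rho>)
  then show ?thesis by blast
qed

text \<open>The conformal factor is unique because the metric takes the value -1 on some vector, so that
  it is the function which vanishes by assumption.\<close>

lemma N_null:
  assumes c: "c \<in> A" "p \<in> chart_image c"
  shows "scal (dd (nc c) v p) (dd (nc c) w p) = 0"
proof -
  let ?x = "chart_inv c p"
  have x: "?x \<in> fst c" "snd c ?x = p" using chart_inv_domain[OF c(2)] chart_inv_right[OF c(2)] .
  let ?P = "\<lambda>\<rho>. \<forall>c\<in>A. ?x \<in> fst c \<longrightarrow> (\<forall>v w. scal (differential c N ?x v) (differential c N ?x w) = \<rho> * induced_metric f c ?x v w)"
  obtain \<rho> where \<rho>: "?P \<rho>" using conformal_factor by blast
  have uniq: "\<rho>' = \<rho>" if "?P \<rho>'" for \<rho>'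
  proof -
    obtain v where v: "induced_metric f c ?x v v = -1"
      using orthonormal_basis[OF c(1) x(1)] unfolding induced_metric_coord by blast
    have "scal (differential c N ?x v) (differential c N ?x v) = \<rho>' * induced_metric f c ?x v v"
      "scal (differential c N ?x v) (differential c N ?x v) = \<rho> * induced_metric f c ?x v v"
      using \<rho> that c(1) x(1) by (blast, blast)
    then have "\<rho>' * induced_metric f c ?x v v = \<rho> * induced_metric f c ?x v v" by linarith
    then show ?thesis unfolding v by simp
  qed
  have "gauss_factor A f ?x = \<rho>" unfolding gauss_factor_def by (rule the_equality[where P="?P", OF \<rho> uniq])
  then have "\<rho> = 0" using quasi_umbilical by (simp add: quasi_umbilical_def)
  then have "scal (differential c N ?x v) (differential c N ?x w) = 0" using \<rho> c(1) x(1) by simp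
  then show ?thesis unfolding differential_coord x(2) .
qed

lemma N_not_proportional:
  assumes c: "c \<in> A" "p \<in> chart_image c"
  shows "\<exists>v. \<forall>k. dd (nc c) v p \<noteq> k *\<^sub>R yc c p"
proof -
  let ?x = "chart_inv c p"
  have x: "?x \<in> fst c" "snd c ?x = p" using chart_inv_domain[OF c(2)] chart_inv_right[OF c(2)] .
  obtain v where v: "bivector (Y ?x) (differential c N ?x v) \<noteq> 0"
    using quasi_umbilical c(1) x(1) unfolding quasi_umbilical_def by blast
  have "bivector (Y ?x) (k *\<^sub>R Y ?x) = 0" for k by (simp add: bivector_def vec_eq_iff)
  then have "\<forall>k. dd (nc c) v p \<noteq> k *\<^sub>R yc c p" using v unfolding differential_coord x(2) by metis
  then show ?thesis by blast
qed

text \<open>Each component of the Gauss map which is not critical serves as \<open>u\<close>: its differential vanishes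
  on the kernel of the differential of the Gauss map, and both kernels are lines.\<close>

lemma coordinate_patch:
  assumes c: "c \<in> A" and p0: "p0 \<in> chart_image c"
  obtains Q i where "open Q" "p0 \<in> Q" "Q \<subseteq> chart_image c" "rank_one_patch Q (yc c) (nc c) (\<lambda>q. nc c q $ i)"
proof -
  interpret gauss_patch "chart_image c" "yc c" "nc c" by (rule gauss_patch_chart[OF c])
  obtain v where v: "dd (nc c) v p0 \<noteq> 0 *\<^sub>R yc c p0" using N_not_proportional[OF c p0] by blast
  then obtain i where i: "dd (nc c) v p0 $ i \<noteq> 0" by (auto simp: vec_eq_iff)
  let ?u = "\<lambda>q. nc c q $ i"
  have su: "smooth_on (chart_image c) ?u" by (rule smooth_on_nth[OF open_S smooth_n])
  have du: "dd ?u w q = dd (nc c) w q $ i" if "q \<in> chart_image c" for w q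
    by (rule dd_nth[OF smooth_on_differentiable[OF smooth_n that]])
  have coords: "dd ?u w q = w$1 * dd ?u e1 q + w$2 * dd ?u e2 q" if q: "q \<in> chart_image c" for w q
  proof -
    note l = dd_linear[OF su q]
    show ?thesis using linear_add[OF l, of "w$1 *\<^sub>R e1" "w$2 *\<^sub>R e2"] linear_cmul[OF l] plane_expansion[of w]
      by (metis real_scaleR_def)
  qed
  define Q where "Q = {q \<in> chart_image c. dd ?u e1 q \<noteq> 0} \<union> {q \<in> chart_image c. dd ?u e2 q \<noteq> 0}"
  have Q: "open Q" "Q \<subseteq> chart_image c"
    unfolding Q_def by (intro open_Un open_nonzero open_S smooth_on_continuous smooth_on_frechet su) blast
  have "p0 \<in> Q" using i coords[OF p0, of v] p0 unfolding Q_def du[OF p0, of v] by auto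
  moreover have "rank_one_patch Q (yc c) (nc c) ?u"
  proof (rule rank_one_patch.intro[OF gauss_patch_subset[OF gauss_patch_chart[OF c] Q]], unfold_locales)
    show "smooth_on Q ?u" using su Q(2) by (rule smooth_on_subset)
    fix p assume pQ: "p \<in> Q"
    then have p: "p \<in> chart_image c" using Q by blast
    show nzp: "dd ?u e1 p \<noteq> 0 \<or> dd ?u e2 p \<noteq> 0" using pQ unfolding Q_def by blast
    show "scal (dd (nc c) v p) (dd (nc c) w p) = 0" for v w by (rule N_null[OF c p])
    show "\<exists>v. \<forall>k. dd (nc c) v p \<noteq> k *\<^sub>R yc c p" by (rule N_not_proportional[OF c p])
    fix v assume v: "dd ?u v p = 0"
    obtain z where z: "z \<noteq> 0" "dd (nc c) z p = 0"
      using rank_one[OF N_null[OF c] N_not_proportional[OF c] p] by blast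
    have uz: "z$1 * dd ?u e1 p + z$2 * dd ?u e2 p = 0" using du[OF p, of z] z(2) coords[OF p, of z] by simp
    have uv: "v$1 * dd ?u e1 p + v$2 * dd ?u e2 p = 0" using v coords[OF p, of v] by simp
    have "(v$1 * z$2 - v$2 * z$1) * dd ?u e1 p = 0" "(v$1 * z$2 - v$2 * z$1) * dd ?u e2 p = 0"
      using uz uv by (algebra, algebra)
    then have "v$1 * z$2 = v$2 * z$1" using nzp by auto
    moreover have "z$1 \<noteq> 0 \<or> z$2 \<noteq> 0" using z(1) by (auto simp: vec_eq_iff forall_2)
    ultimately have "v = (if z$1 \<noteq> 0 then v$1 / z$1 else v$2 / z$2) *\<^sub>R z"
      by (auto simp: vec_eq_iff forall_2 field_simps)
    then obtain k where "v = k *\<^sub>R z" by blast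
    then show "dd (nc c) v p = 0" using linear_cmul[OF lin_n[OF p]] z(2) by simp
  qed
  ultimately show ?thesis using that Q by blast
qed

theorem N_harmonic: "harmonic_wrt A f N"
  unfolding harmonic_wrt_def
proof (intro conjI allI ballI)
  fix x
  obtain c where c: "c \<in> A" "x \<in> fst c" using chart_exists[of x] by blast
  interpret gauss_patch "chart_image c" "yc c" "nc c" by (rule gauss_patch_chart[OF c(1)])
  show "N x \<in> S22" using nn[OF chart_value[OF c(2)]] chart_inv_left[OF c] by (simp add: S22_def)
next
  show "smooth_map A UNIV N" by (rule N_smooth)
next
  fix c p assume c: "c \<in> A" and p: "p \<in> chart_image c"
  obtain Q i where Q: "open Q" "p \<in> Q" "Q \<subseteq> chart_image c" and r: "rank_one_patch Q (yc c) (nc c) (\<lambda>q. nc c q $ i)"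
    using coordinate_patch[OF c p] by blast
  interpret rank_one_patch Q "yc c" "nc c" "\<lambda>q. nc c q $ i" by (rule r)
  have "tension (\<lambda>q. \<chi> i j. induced_metric f c (chart_inv c q) (axis i 1) (axis j 1)) (nc c) p
      = tension (\<lambda>q. \<chi> i j. scal (dd (yc c) (axis i 1) q) (dd (yc c) (axis j 1) q)) (nc c) p"
    by (rule tension_cong[OF Q(1,2)]) (use Q(3) in \<open>simp add: induced_metric_coord chart_inv_right subset_iff\<close>)
  then show "tension (\<lambda>q. \<chi> i j. induced_metric f c (chart_inv c q) (axis i 1) (axis j 1)) (N \<circ> chart_inv c) p = 0"
    using tension_zero[OF Q(2)] by (simp add: comp_def)
qed

end

section \<open>The leaves of the kernel distribution\<close>

context quasi_umbilical_surface
begin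

lemma velocity:
  assumes J: "open J" "continuous_on J \<gamma>" and t: "t \<in> J" and c: "c \<in> A" "\<gamma> t \<in> fst c"
    and sm: "smooth_on (J \<inter> \<gamma> -` fst c) (snd c \<circ> \<gamma>)" and h: "smooth_map A UNIV h"
  shows "((\<lambda>s. h (\<gamma> s)) has_vector_derivative differential c h (\<gamma> t) (vector_derivative (snd c \<circ> \<gamma>) (at t))) (at t)"
proof -
  let ?J = "J \<inter> \<gamma> -` fst c"
  have op: "open ?J" by (rule continuous_open_preimage[OF J(2,1) chart_open[OF c(1)]])
  have "(snd c \<circ> \<gamma>) differentiable (at t)" by (rule smooth_on_differentiable[OF sm]) (use t c in simp)
  then have d: "((snd c \<circ> \<gamma>) has_derivative (\<lambda>r. r *\<^sub>R vector_derivative (snd c \<circ> \<gamma>) (at t))) (at t)"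
    using vector_derivative_works has_vector_derivative_def by blast
  have df: "(h \<circ> chart_inv c) differentiable (at (snd c (\<gamma> t)))"
    using smooth_map_differentiable[OF h c(1)] c(2) by simp
  then have dh: "((h \<circ> chart_inv c) has_derivative differential c h (\<gamma> t)) (at ((snd c \<circ> \<gamma>) t))"
    by (simp add: differential_def frechet_derivative_works)
  note l = differential_linear[OF df]
  have "((\<lambda>s. (h \<circ> chart_inv c) ((snd c \<circ> \<gamma>) s)) has_derivative
      (\<lambda>r. r *\<^sub>R differential c h (\<gamma> t) (vector_derivative (snd c \<circ> \<gamma>) (at t)))) (at t)"
    using has_derivative_compose[OF d dh] unfolding linear_cmul[OF l] .
  then have "((\<lambda>s. h (\<gamma> s)) has_derivative
      (\<lambda>r. r *\<^sub>R differential c h (\<gamma> t) (vector_derivative (snd c \<circ> \<gamma>) (at t)))) (at t)"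
    by (rule has_derivative_transform_within_open[OF _ op]) (use t c in \<open>simp_all add: chart_inv_left\<close>)
  then show ?thesis unfolding has_vector_derivative_def .
qed

lemma constant_on_tangent_curve:
  assumes g: "tangent_curve A N {a<..<b} \<gamma>" and h: "smooth_map A UNIV h"
    and ker: "\<And>c x v. c \<in> A \<Longrightarrow> x \<in> fst c \<Longrightarrow> differential c N x v = 0 \<Longrightarrow> differential c h x v = 0"
    and st: "s \<in> {a<..<b}" "t \<in> {a<..<b}"
  shows "h (\<gamma> s) = h (\<gamma> t)"
proof (rule has_derivative_zero_unique[of "{a<..<b}" "\<lambda>s. h (\<gamma> s)", OF _ _ st])
  fix r assume r: "r \<in> {a<..<b}"
  obtain c where c: "c \<in> A" "\<gamma> r \<in> fst c" using chart_exists[of "\<gamma> r"] by blast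
  have "differential c N (\<gamma> r) (vector_derivative (snd c \<circ> \<gamma>) (at r)) = 0"
    using g r c unfolding tangent_curve_def by blast
  from ker[OF c this]
  have "differential c h (\<gamma> r) (vector_derivative (snd c \<circ> \<gamma>) (at r)) = 0" .
  moreover have "((\<lambda>s. h (\<gamma> s)) has_vector_derivative differential c h (\<gamma> r) (vector_derivative (snd c \<circ> \<gamma>) (at r))) (at r)"
    by (rule velocity[where J="{a<..<b}"]) (use g c r h in \<open>auto simp: tangent_curve_def\<close>)
  ultimately show "((\<lambda>s. h (\<gamma> s)) has_derivative (\<lambda>h. 0)) (at r within {a<..<b})"
    by (simp add: has_vector_derivative_def has_derivative_at_withinI)
qed simp

lemma constant_on_leaf:
  assumes xy: "(x, y) \<in> leaf_rel A N" and h: "smooth_map A UNIV h"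
    and ker: "\<And>c x v. c \<in> A \<Longrightarrow> x \<in> fst c \<Longrightarrow> differential c N x v = 0 \<Longrightarrow> differential c h x v = 0"
  shows "h x = h y"
  using xy unfolding leaf_rel_def
proof (induction rule: rtrancl_induct)
  case (step y z)
  then obtain \<gamma> a b where g: "a < 0" "1 < b" "tangent_curve A N {a<..<b} \<gamma>" "\<gamma> 0 = y" "\<gamma> 1 = z" by blast
  have "h (\<gamma> 0) = h (\<gamma> 1)" by (rule constant_on_tangent_curve[OF g(3) h ker]) (use g in auto)
  then show ?case using step.IH g by simp
qed simp

lemma N_leaf: "(x, y) \<in> leaf_rel A N \<Longrightarrow> N x = N y"
  by (rule constant_on_leaf[OF _ N_smooth])

text \<open>Tangency to the kernel of \<open>dN\<close> means that \<open>N\<close> is stationary along the curve. In this form the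
  condition does not refer to charts.\<close>

lemma tangent_curveI:
  assumes J: "open J" "continuous_on J \<gamma>"
    and sm: "\<And>c. c \<in> A \<Longrightarrow> smooth_on (J \<inter> \<gamma> -` fst c) (snd c \<circ> \<gamma>)"
    and N: "\<And>t. t \<in> J \<Longrightarrow> ((\<lambda>s. N (\<gamma> s)) has_vector_derivative 0) (at t)"
  shows "tangent_curve A N J \<gamma>"
  unfolding tangent_curve_def
proof (intro conjI ballI)
  fix c t assume c: "c \<in> A" and t: "t \<in> J \<inter> \<gamma> -` fst c"
  show "differential c N (\<gamma> t) (vector_derivative (snd c \<circ> \<gamma>) (at t)) = 0"
    using velocity[where J=J and \<gamma>=\<gamma> and c=c and t=t and h=N, OF J _ c _ sm[OF c] N_smooth] N[of t] t vector_derivative_unique_at by blast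
qed (use J sm in auto)

definition smooth_curve :: "real set \<Rightarrow> (real \<Rightarrow> 'x) \<Rightarrow> bool" where
  "smooth_curve J \<gamma> \<longleftrightarrow> open J \<and> continuous_on J \<gamma> \<and> (\<forall>c\<in>A. smooth_on (J \<inter> \<gamma> -` fst c) (snd c \<circ> \<gamma>))"

lemma smooth_curve_in_chart:
  assumes c: "c \<in> A" and J: "open J" and \<sigma>: "smooth_on J \<sigma>" "\<And>t. t \<in> J \<Longrightarrow> \<sigma> t \<in> chart_image c"
  shows "smooth_curve J (\<lambda>t. chart_inv c (\<sigma> t))"
  unfolding smooth_curve_def
proof (intro conjI ballI J)
  show cont: "continuous_on J (\<lambda>t. chart_inv c (\<sigma> t))"
    by (rule continuous_on_compose2[OF chart_inv_continuous[OF c] smooth_on_continuous[OF \<sigma>(1)]]) (use \<sigma> in auto)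
  fix c' assume c': "c' \<in> A"
  let ?J = "J \<inter> (\<lambda>t. chart_inv c (\<sigma> t)) -` fst c'"
  have op: "open ?J" by (rule continuous_open_preimage[OF cont J chart_open[OF c']])
  have "smooth_on ?J (\<lambda>t. transition c c' (\<sigma> t))"
  proof (rule smooth_on_compose[OF op transition_smooth[OF c c'] smooth_on_subset[OF \<sigma>(1)]])
    fix t assume "t \<in> ?J"
    then show "\<sigma> t \<in> snd c ` (fst c \<inter> fst c')" unfolding chart_image_restrict[OF c] using \<sigma>(2) by simp
  qed simp
  then show "smooth_on ?J (snd c' \<circ> (\<lambda>t. chart_inv c (\<sigma> t)))"
    by (simp add: transition_eq comp_def)
qed

lemma smooth_curve_open: "smooth_curve J \<gamma> \<Longrightarrow> open W \<Longrightarrow> open (J \<inter> \<gamma> -` W)"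
  unfolding smooth_curve_def by (blast intro: continuous_open_preimage)

lemma smooth_along_curve:
  assumes g: "smooth_curve J \<gamma>" and W: "open W" "smooth_map A W h"
  shows "smooth_on (J \<inter> \<gamma> -` W) (\<lambda>s. h (\<gamma> s))"
proof (rule smooth_on_local)
  fix t assume t: "t \<in> J \<inter> \<gamma> -` W"
  obtain c where c: "c \<in> A" "\<gamma> t \<in> fst c" using chart_exists[of "\<gamma> t"] by blast
  let ?T = "J \<inter> \<gamma> -` (fst c \<inter> W)"
  have op: "open ?T" by (rule smooth_curve_open[OF g open_Int[OF chart_open[OF c(1)] W(1)]])
  have "smooth_on (J \<inter> \<gamma> -` fst c) (snd c \<circ> \<gamma>)" using g c by (simp add: smooth_curve_def)
  then have "smooth_on ?T (snd c \<circ> \<gamma>)" by (rule smooth_on_subset) auto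
  then have "smooth_on ?T (\<lambda>s. (h \<circ> chart_inv c) ((snd c \<circ> \<gamma>) s))"
    by (rule smooth_on_compose[OF op smooth_map_restrictD[OF W(2) c(1)]]) auto
  then have "smooth_on ?T (\<lambda>s. h (\<gamma> s))"
    by (rule smooth_on_cong[OF op]) (simp add: chart_inv_left[OF c(1)])
  then show "\<exists>T. open T \<and> t \<in> T \<and> smooth_on T (\<lambda>s. h (\<gamma> s))" using op t c by blast
qed

lemma tangent_curve_in_chart:
  assumes c: "c \<in> A" and J: "open J" and \<sigma>: "smooth_on J \<sigma>" "\<And>t. t \<in> J \<Longrightarrow> \<sigma> t \<in> chart_image c"
    and N: "\<And>t. t \<in> J \<Longrightarrow> ((\<lambda>s. nc c (\<sigma> s)) has_vector_derivative 0) (at t)"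
  shows "tangent_curve A N J (\<lambda>t. chart_inv c (\<sigma> t))"
  by (rule tangent_curveI[OF J _ _ N]) (use smooth_curve_in_chart[OF c J \<sigma>] in \<open>simp_all add: smooth_curve_def\<close>)

lemma tangent_curve_reverse:
  assumes g: "tangent_curve A N {a<..<b} \<gamma>"
  shows "tangent_curve A N {1-b<..<1-a} (\<lambda>t. \<gamma> (1 - t))"
proof (rule tangent_curveI)
  let ?J = "{1-b<..<1-a}"
  have gc: "continuous_on {a<..<b} \<gamma>" using g by (simp add: tangent_curve_def)
  show cont: "continuous_on ?J (\<lambda>t. \<gamma> (1 - t))"
    by (rule continuous_on_compose2[OF gc]) (auto intro!: continuous_intros)
  fix c assume c: "c \<in> A"
  have op: "open (?J \<inter> (\<lambda>t. \<gamma> (1 - t)) -` fst c)"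
    by (rule continuous_open_preimage[OF cont _ chart_open[OF c]]) simp
  have sm: "smooth_on ({a<..<b} \<inter> \<gamma> -` fst c) (snd c \<circ> \<gamma>)" using g c by (simp add: tangent_curve_def)
  have "smooth_on (?J \<inter> (\<lambda>t. \<gamma> (1 - t)) -` fst c) (\<lambda>t. (snd c \<circ> \<gamma>) (1 - t))"
    by (rule smooth_on_compose[OF op sm smooth_on_diff[OF op smooth_on_const smooth_on_ident]]) auto
  then show "smooth_on (?J \<inter> (\<lambda>t. \<gamma> (1 - t)) -` fst c) (snd c \<circ> (\<lambda>t. \<gamma> (1 - t)))" by (simp add: comp_def)
next
  fix t assume t: "t \<in> {1-b<..<1-a}"
  have "((\<lambda>s. N (\<gamma> (1 - s))) has_derivative (\<lambda>r. 0)) (at t)"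
  proof (rule has_derivative_transform_within_open[OF has_derivative_const[of "N (\<gamma> (1 - t))"] _ t])
    fix s assume "s \<in> {1-b<..<1-a}"
    then show "N (\<gamma> (1 - t)) = N (\<gamma> (1 - s))"
      using t by (intro constant_on_tangent_curve[OF g N_smooth]) auto
  qed simp
  then show "((\<lambda>s. N (\<gamma> (1 - s))) has_vector_derivative 0) (at t)" by (simp add: has_vector_derivative_def)
qed simp

lemma leaf_rel_refl: "(x, x) \<in> leaf_rel A N" and leaf_rel_trans: "(x, y) \<in> leaf_rel A N \<Longrightarrow> (y, z) \<in> leaf_rel A N \<Longrightarrow> (x, z) \<in> leaf_rel A N"
  unfolding leaf_rel_def by (rule rtrancl.rtrancl_refl, rule rtrancl_trans)

lemma leaf_rel_sym: "(x, y) \<in> leaf_rel A N \<Longrightarrow> (y, x) \<in> leaf_rel A N"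
proof -
  have "sym {(x, y). \<exists>\<gamma> a b. a < 0 \<and> 1 < b \<and> tangent_curve A N {a<..<b} \<gamma> \<and> \<gamma> 0 = x \<and> \<gamma> 1 = y}"
  proof (rule symI, clarify)
    fix \<gamma> a b assume "a < 0" "1 < (b :: real)" "tangent_curve A N {a<..<b} \<gamma>"
    then show "\<exists>\<gamma>' a' b'. a' < 0 \<and> 1 < b' \<and> tangent_curve A N {a'<..<b'} \<gamma>' \<and> \<gamma>' 0 = \<gamma> 1 \<and> \<gamma>' 1 = \<gamma> 0"
      by (intro exI[of _ "\<lambda>t. \<gamma> (1 - t)"] exI[of _ "1 - b"] exI[of _ "1 - a"]) (simp add: tangent_curve_reverse)
  qed
  then have "sym (leaf_rel A N)" unfolding leaf_rel_def by (rule sym_rtrancl)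
  then show "(x, y) \<in> leaf_rel A N \<Longrightarrow> (y, x) \<in> leaf_rel A N" by (rule symD)
qed

lemma leaf_of_eq: "leaf_of A N x = leaf_of A N y \<longleftrightarrow> (x, y) \<in> leaf_rel A N"
proof
  assume "leaf_of A N x = leaf_of A N y"
  then have "y \<in> leaf_of A N x" using leaf_rel_refl by (simp add: leaf_of_def)
  then show "(x, y) \<in> leaf_rel A N" by (simp add: leaf_of_def)
next
  assume "(x, y) \<in> leaf_rel A N"
  then show "leaf_of A N x = leaf_of A N y"
    unfolding leaf_of_def using leaf_rel_trans leaf_rel_sym by blast
qed

text \<open>In flow box coordinates \<open>(s, z)\<close> the leaves are the segments \<open>s = const\<close>, and \<open>s\<close> is the
  component \<open>k\<close> of the Gauss map. Hence points on which this component agrees are joined by a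
  tangent curve. The transversals \<open>z = const\<close> are the curves \<open>\<tau> z\<close>, one through each point \<open>z\<close> of
  the box, parametrised by the value of the component.\<close>

definition flow_box :: "'x set \<Rightarrow> 5 \<Rightarrow> real set \<Rightarrow> ('x \<Rightarrow> real \<Rightarrow> 'x) \<Rightarrow> bool" where
  "flow_box U k V \<tau> \<longleftrightarrow> open U \<and> open V \<and> (\<forall>x\<in>U. N x $ k \<in> V) \<and>
     (\<forall>x\<in>U. \<forall>y\<in>U. N x $ k = N y $ k \<longrightarrow> (x, y) \<in> leaf_rel A N) \<and>
     (\<forall>z\<in>U. \<forall>s\<in>V. \<tau> z s \<in> U \<and> N (\<tau> z s) $ k = s) \<and>
     (\<forall>z\<in>U. \<tau> z (N z $ k) = z) \<and> (\<forall>z\<in>U. smooth_curve V (\<tau> z))"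

lemma flow_boxD:
  assumes "flow_box U k V \<tau>"
  shows "open U" "open V" "x \<in> U \<Longrightarrow> N x $ k \<in> V"
    "x \<in> U \<Longrightarrow> y \<in> U \<Longrightarrow> N x $ k = N y $ k \<Longrightarrow> (x, y) \<in> leaf_rel A N"
    "z \<in> U \<Longrightarrow> s \<in> V \<Longrightarrow> \<tau> z s \<in> U" "z \<in> U \<Longrightarrow> s \<in> V \<Longrightarrow> N (\<tau> z s) $ k = s"
    "z \<in> U \<Longrightarrow> \<tau> z (N z $ k) = z" "z \<in> U \<Longrightarrow> smooth_curve V (\<tau> z)"
  using assms by (simp_all add: flow_box_def)

text \<open>The first coordinate is a component \<open>u\<close> of the Gauss map, the second one is the linear
  function of the chart coordinates that grows along the kernel of \<open>du\<close> at the given point; hence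
  they are independent there.\<close>

lemma flow_box_exists: "\<exists>U k V \<tau>. flow_box U k V \<tau> \<and> x0 \<in> U"
proof -
  obtain c where c: "c \<in> A" "x0 \<in> fst c" using chart_exists[of x0] by blast
  let ?p = "snd c x0"
  have p0: "?p \<in> chart_image c" using chart_value[OF c(2)] .
  obtain Q k where Q: "open Q" "?p \<in> Q" "Q \<subseteq> chart_image c" and r: "rank_one_patch Q (yc c) (nc c) (\<lambda>q. nc c q $ k)"
    using coordinate_patch[OF c(1) p0] by blast
  let ?u = "\<lambda>q. nc c q $ k"
  interpret rank_one_patch Q "yc c" "nc c" ?u by (rule r)
  define e where "e = \<zeta> ?p"
  define F :: "real^2 \<Rightarrow> real^2" where "F q = (\<chi> i. if i = 1 then ?u q else q \<bullet> e)" for q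
  have F12: "F q $ 1 = ?u q" "F q $ 2 = q \<bullet> e" for q by (simp_all add: F_def)
  have sF: "smooth_on Q F"
  proof (rule smooth_on_vec[OF Q(1)])
    fix i :: 2
    have "smooth_on Q (\<lambda>q. q \<bullet> e)" by (rule smooth_on_inner[OF Q(1) smooth_on_ident smooth_on_const])
    then show "smooth_on Q (\<lambda>q. F q $ i)" using smooth_u by (cases "i = 1") (simp_all add: F_def)
  qed
  have dF: "dd F v ?p $ 1 = dd ?u v ?p" "dd F v ?p $ 2 = v \<bullet> e" for v
  proof -
    note d = dd_nth[OF smooth_on_differentiable[OF sF Q(2)], symmetric]
    show "dd F v ?p $ 1 = dd ?u v ?p" unfolding d F12 ..
    have "((\<lambda>q. q \<bullet> e) has_derivative (\<lambda>v. v \<bullet> e)) (at ?p)"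
      by (rule bounded_linear.has_derivative[OF bounded_linear_inner_left has_derivative_ident])
    then show "dd F v ?p $ 2 = v \<bullet> e" unfolding d F12 by (rule dd_eqI)
  qed
  have "det (matrix (frechet_derivative F (at ?p))) = (dd ?u e1 ?p)\<^sup>2 + (dd ?u e2 ?p)\<^sup>2"
    unfolding det_2 matrix_def by (simp add: dF e_def \<zeta>_def inner_vec_def sum_2 power2_eq_square)
  then have "det (matrix (frechet_derivative F (at ?p))) \<noteq> 0" using grad_sq[OF Q(2)] by linarith
  then obtain U' V' g where G: "open U'" "?p \<in> U'" "U' \<subseteq> Q" "open V'" "homeomorphism U' V' F g" "smooth_on V' g"
    using smooth_local_inverse_plane[OF Q(1) sF Q(2)] by blast
  have FV: "F ?p \<in> V'" using G(2,5) by (auto simp: homeomorphism_def)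
  obtain \<epsilon>0 where e0: "\<epsilon>0 > 0" "ball (F ?p) \<epsilon>0 \<subseteq> V'" using G(4) FV openE by blast
  define \<epsilon> where "\<epsilon> = \<epsilon>0 / 2"
  define a where "a = F ?p $ 1"
  define b where "b = F ?p $ 2"
  define K where "K = {z :: real^2. \<bar>z$1 - a\<bar> < \<epsilon> \<and> \<bar>z$2 - b\<bar> < \<epsilon>}"
  have eps: "\<epsilon> > 0" using e0 by (simp add: \<epsilon>_def)
  have KV: "K \<subseteq> V'"
  proof
    fix z assume "z \<in> K"
    then have "\<bar>(z - F ?p)$1\<bar> + \<bar>(z - F ?p)$2\<bar> < \<epsilon>0" by (simp add: K_def a_def b_def \<epsilon>_def)
    moreover have "norm (z - F ?p) \<le> \<bar>(z - F ?p)$1\<bar> + \<bar>(z - F ?p)$2\<bar>"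
      using norm_le_l1_cart[of "z - F ?p"] by (simp add: sum_2)
    ultimately have "z \<in> ball (F ?p) \<epsilon>0" by (simp add: dist_norm norm_minus_commute)
    then show "z \<in> V'" using e0 by blast
  qed
  have opK: "open K"
  proof -
    have "K = (\<lambda>z. \<bar>z$1 - a\<bar>) -` {..<\<epsilon>} \<inter> (\<lambda>z. \<bar>z$2 - b\<bar>) -` {..<\<epsilon>}" by (auto simp: K_def)
    then show ?thesis by (auto intro!: open_Int open_vimage continuous_intros)
  qed
  have gF: "g (F q) = q" if "q \<in> U'" for q using G(5) that by (simp add: homeomorphism_def)
  have Fg: "F (g z) = z" "g z \<in> U'" if "z \<in> V'" for z using G(5) that by (auto simp: homeomorphism_def)
  have sg: "smooth_on K g" by (rule smooth_on_subset[OF G(6) KV])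
  have chart: "g z \<in> chart_image c" "g z \<in> Q" "F (g z) = z" if "z \<in> K" for z
    using Fg[of z] that KV G(3) Q(3) by auto
  define vec2 :: "real \<Rightarrow> real \<Rightarrow> real^2" where "vec2 s t = (\<chi> i. if i = 1 then s else t)" for s t
  have v2 [simp]: "vec2 s t $ 1 = s" "vec2 s t $ 2 = t" for s t by (simp_all add: vec2_def)
  have v2eq: "vec2 (z$1) (z$2) = z" for z by (simp add: vec_eq_iff forall_2)
  define U where "U = chart_inv c ` (g ` K)"
  have gK: "g ` K = U' \<inter> F -` K"
  proof (intro equalityI subsetI)
    fix q assume "q \<in> g ` K" then show "q \<in> U' \<inter> F -` K" using Fg KV by auto
  next
    fix q assume "q \<in> U' \<inter> F -` K" then show "q \<in> g ` K" using gF by (metis IntD1 IntD2 image_eqI vimageD)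
  qed
  have opU: "open U"
    unfolding U_def
  proof (rule chart_inv_image_open[OF c(1)])
    show "open (g ` K)" unfolding gK
      by (rule continuous_open_preimage[OF _ G(1) opK]) (use G(5) in \<open>simp add: homeomorphism_def\<close>)
    show "g ` K \<subseteq> chart_image c" using chart by blast
  qed
  have inU: "x \<in> fst c" "F (snd c x) \<in> K" "g (F (snd c x)) = snd c x" "x = chart_inv c (g (F (snd c x)))"
    "F (snd c x) $ 1 = N x $ k" if xU: "x \<in> U" for x
  proof -
    obtain z where z: "z \<in> K" "x = chart_inv c (g z)" using xU by (auto simp: U_def)
    then have s: "snd c x = g z" using chart_inv_right[OF chart(1)] by simp
    note ci = chart_inv_domain[OF chart(1)[OF z(1)]]
    show "x \<in> fst c" "F (snd c x) \<in> K" "g (F (snd c x)) = snd c x" "x = chart_inv c (g (F (snd c x)))"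
      unfolding s using z(1) ci by (simp_all add: z(2) chart(3))
    show "F (snd c x) $ 1 = N x $ k" unfolding F12 s unfolding z(2) ..
  qed
  have Uin: "chart_inv c (g z) \<in> U" "N (chart_inv c (g z)) $ k = z $ 1" "F (snd c (chart_inv c (g z))) = z" if "z \<in> K" for z
  proof -
    show "chart_inv c (g z) \<in> U" using that by (auto simp: U_def)
    show "N (chart_inv c (g z)) $ k = z $ 1" using F12(1)[of "g z"] chart(3)[OF that] by simp
    show "F (snd c (chart_inv c (g z))) = z" using chart[OF that] by (simp add: chart_inv_right[OF chart(1)[OF that]])
  qed
  define V where "V = {a-\<epsilon><..<a+\<epsilon>}"
  define \<tau> where "\<tau> z s = chart_inv c (g (vec2 s (F (snd c z) $ 2)))" for z s
  have vK: "vec2 s (F (snd c z) $ 2) \<in> K" if "z \<in> U" "s \<in> V" for z s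
    using inU(2)[OF that(1)] that(2) by (auto simp: K_def V_def)
  have sv: "smooth_on J (\<lambda>s. vec2 (l s) (m s))" if "open J" "smooth_on J l" "smooth_on J m" for l m :: "real \<Rightarrow> real" and J
  proof (rule smooth_on_vec[OF that(1)])
    fix i :: 2 show "smooth_on J (\<lambda>s. vec2 (l s) (m s) $ i)" using that by (cases "i = 1") (simp_all add: vec2_def)
  qed
  have opV: "open V" by (simp add: V_def)
  have sgv: "smooth_on V (\<lambda>s. g (vec2 s (F (snd c z) $ 2)))" if "z \<in> U" for z
    by (rule smooth_on_compose[OF opV sg sv[OF opV smooth_on_ident smooth_on_const] vK[OF that]])
  have x0: "x0 = chart_inv c (g (F ?p))" using gF[OF G(2)] chart_inv_left[OF c] by simp
  have "x0 \<in> U" by (subst x0, rule Uin(1)) (use eps in \<open>simp add: K_def a_def b_def\<close>)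
  moreover have "flow_box U k V \<tau>"
    unfolding flow_box_def
  proof (intro conjI ballI impI)
    show "open U" "open V" by (fact opU, fact opV)
    show "N x $ k \<in> V" if "x \<in> U" for x using inU(2,5)[OF that] by (auto simp: K_def V_def)
    show "\<tau> z s \<in> U" "N (\<tau> z s) $ k = s" if "z \<in> U" "s \<in> V" for z s
      using Uin[OF vK[OF that]] by (simp_all add: \<tau>_def)
    show "\<tau> z (N z $ k) = z" if "z \<in> U" for z
      unfolding \<tau>_def inU(5)[OF that, symmetric] v2eq by (rule inU(4)[OF that, symmetric])
    show "smooth_curve V (\<tau> z)" if "z \<in> U" for z
      unfolding \<tau>_def by (rule smooth_curve_in_chart[OF c(1) opV sgv[OF that] chart(1)[OF vK[OF that]]])
    fix x y assume x: "x \<in> U" and y: "y \<in> U" and eq: "N x $ k = N y $ k"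
    define s0 where "s0 = N x $ k"
    define b1 where "b1 = F (snd c x) $ 2"
    define b2 where "b2 = F (snd c y) $ 2"
    define \<eta> where "\<eta> = (\<epsilon> - max \<bar>b1 - b\<bar> \<bar>b2 - b\<bar>) / (\<bar>b2 - b1\<bar> + 1)"
    have b12: "\<bar>b1 - b\<bar> < \<epsilon>" "\<bar>b2 - b\<bar> < \<epsilon>" "\<bar>s0 - a\<bar> < \<epsilon>"
      using inU(2)[OF x] inU(2)[OF y] inU(5)[OF x] by (auto simp: K_def b1_def b2_def s0_def)
    have \<eta>: "\<eta> > 0" unfolding \<eta>_def using b12 by simp
    have \<eta>': "\<eta> * \<bar>b2 - b1\<bar> \<le> \<epsilon> - max \<bar>b1 - b\<bar> \<bar>b2 - b\<bar>"
      unfolding \<eta>_def using b12 by (simp add: field_simps)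
    define \<sigma> where "\<sigma> t = g (vec2 s0 (b1 + t * (b2 - b1)))" for t
    let ?J = "{-\<eta><..<1+\<eta>}"
    have inK: "vec2 s0 (b1 + t * (b2 - b1)) \<in> K" if t: "t \<in> ?J" for t
    proof -
      have "\<bar>b1 + t * (b2 - b1) - b\<bar> < \<epsilon>"
      proof (cases "b2 = b1")
        case True then show ?thesis using b12 by simp
      next
        case False
        have lo: "(-\<eta>) * \<bar>b2 - b1\<bar> < t * \<bar>b2 - b1\<bar>" and hi: "t * \<bar>b2 - b1\<bar> < (1 + \<eta>) * \<bar>b2 - b1\<bar>"
          using t False by (intro mult_strict_right_mono; simp)+
        show ?thesis
        proof (cases "b2 \<ge> b1")
          case True
          then have "- (\<eta> * \<bar>b2 - b1\<bar>) < t * (b2 - b1)" "t * (b2 - b1) < b2 - b1 + \<eta> * \<bar>b2 - b1\<bar>"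
            using lo hi by (simp_all add: distrib_right)
          then show ?thesis using \<eta>' max.cobounded1[of "\<bar>b1 - b\<bar>" "\<bar>b2 - b\<bar>"] max.cobounded2[of "\<bar>b2 - b\<bar>" "\<bar>b1 - b\<bar>"] by linarith
        next
          case False
          then have "t * \<bar>b2 - b1\<bar> = - (t * (b2 - b1))" by (simp add: abs_of_neg algebra_simps)
          then have "t * (b2 - b1) < \<eta> * \<bar>b2 - b1\<bar>" "b2 - b1 - \<eta> * \<bar>b2 - b1\<bar> < t * (b2 - b1)"
            using lo hi False by (simp_all add: distrib_right)
          then show ?thesis using \<eta>' max.cobounded1[of "\<bar>b1 - b\<bar>" "\<bar>b2 - b\<bar>"] max.cobounded2[of "\<bar>b2 - b\<bar>" "\<bar>b1 - b\<bar>"] by linarith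
        qed
      qed
      then show ?thesis using b12 by (simp add: K_def)
    qed
    have s\<sigma>: "smooth_on ?J \<sigma>"
      unfolding \<sigma>_def by (rule smooth_on_compose[OF _ sg sv inK])
        (intro open_greaterThanLessThan smooth_on_const smooth_on_add smooth_on_mult smooth_on_diff smooth_on_ident | assumption)+
    have "tangent_curve A N ?J (\<lambda>t. chart_inv c (\<sigma> t))"
    proof (rule tangent_curve_in_chart[OF c(1) _ s\<sigma>])
      fix t assume t: "t \<in> ?J"
      then show "\<sigma> t \<in> chart_image c" using chart(1)[OF inK] by (simp add: \<sigma>_def)
      have \<sigma>Q: "\<sigma> t \<in> Q" using chart(2)[OF inK[OF t]] by (simp add: \<sigma>_def)
      have d\<sigma>: "(\<sigma> has_derivative (\<lambda>r. dd \<sigma> r t)) (at t)" by (rule smooth_on_has_derivative[OF s\<sigma> t])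
      have "((\<lambda>s. ?u (\<sigma> s)) has_derivative (\<lambda>r. 0)) (at t)"
      proof (rule has_derivative_transform_within_open[OF has_derivative_const[of s0] _ t])
        fix s assume "s \<in> ?J"
        then show "s0 = ?u (\<sigma> s)" using Uin(2)[OF inK] by (simp add: \<sigma>_def)
      qed simp
      moreover have "((\<lambda>s. ?u (\<sigma> s)) has_derivative (\<lambda>r. dd ?u (dd \<sigma> r t) (\<sigma> t))) (at t)"
        by (rule has_derivative_compose[OF d\<sigma> smooth_on_has_derivative[OF smooth_u \<sigma>Q]])
      ultimately have "(\<lambda>r. dd ?u (dd \<sigma> r t) (\<sigma> t)) = (\<lambda>r. 0)" using has_derivative_unique by blast
      then have z: "dd (nc c) (dd \<sigma> r t) (\<sigma> t) = 0" for r using rank[OF \<sigma>Q] by metis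
      have "((\<lambda>s. nc c (\<sigma> s)) has_derivative (\<lambda>r. dd (nc c) (dd \<sigma> r t) (\<sigma> t))) (at t)"
        by (rule has_derivative_compose[OF d\<sigma> smooth_on_has_derivative[OF smooth_n \<sigma>Q]])
      then show "((\<lambda>s. nc c (\<sigma> s)) has_vector_derivative 0) (at t)"
        unfolding z by (simp add: has_vector_derivative_def)
    qed simp
    moreover have "chart_inv c (\<sigma> 0) = x"
      using inU(4)[OF x] v2eq[of "F (snd c x)"] inU(5)[OF x] by (simp add: \<sigma>_def s0_def b1_def)
    moreover have "chart_inv c (\<sigma> 1) = y"
      using inU(4)[OF y] v2eq[of "F (snd c y)"] inU(5)[OF y] eq by (simp add: \<sigma>_def s0_def b2_def)
    moreover have "-\<eta> < 0" "1 < 1 + \<eta>" using \<eta> by simp_all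
    ultimately show "(x, y) \<in> leaf_rel A N" unfolding leaf_rel_def
      by (intro r_into_rtrancl CollectI case_prodI exI[of _ "\<lambda>t. chart_inv c (\<sigma> t)"] exI[of _ "-\<eta>"] exI[of _ "1+\<eta>"] conjI)
  qed
  ultimately show ?thesis by blast
qed

end

section \<open>The leaf space\<close>

context quasi_umbilical_surface
begin

abbreviation \<pi> :: "'x \<Rightarrow> 'x set" where "\<pi> \<equiv> leaf_of A N"
abbreviation leaves :: "'x set topology" where "leaves \<equiv> leaf_topology A N"

definition saturation :: "'x set \<Rightarrow> 'x set" where "saturation B = leaf_rel A N `` B"

lemma saturation_vimage: "\<pi> -` (\<pi> ` B) = saturation B"
proof (rule set_eqI)
  fix y
  have "y \<in> \<pi> -` \<pi> ` B \<longleftrightarrow> (\<exists>x\<in>B. \<pi> x = \<pi> y)" by (auto simp: image_iff)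
  also have "\<dots> \<longleftrightarrow> y \<in> saturation B" unfolding leaf_of_eq saturation_def by blast
  finally show "y \<in> \<pi> -` \<pi> ` B \<longleftrightarrow> y \<in> saturation B" .
qed

lemma saturation_subset: "B \<subseteq> saturation B"
  unfolding saturation_def using leaf_rel_refl by blast

lemma smooth_map_continuous: "smooth_map A UNIV h \<Longrightarrow> continuous_on UNIV h"
proof -
  assume h: "smooth_map A UNIV h"
  have "continuous_on (\<Union>c\<in>A. fst c) h"
  proof (rule continuous_on_open_UN[OF chart_open])
    fix c assume c: "c \<in> A"
    have "continuous_on (fst c) (\<lambda>x. (h \<circ> chart_inv c) (snd c x))"
      by (rule continuous_on_compose2[OF smooth_on_continuous[OF smooth_mapD[OF h c]] chart_continuous[OF c]])
         (auto simp: chart_image_def)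
    then show "continuous_on (fst c) h"
      by (rule continuous_on_eq) (simp add: chart_inv_left[OF c])
  qed
  moreover have "(\<Union>c\<in>A. fst c) = UNIV" using chart_exists by blast
  ultimately show ?thesis by simp
qed

lemma N_component_vimage: "open B \<Longrightarrow> open {x. N x $ k \<in> B}"
proof -
  assume "open B"
  have "continuous_on UNIV (\<lambda>x. N x $ k)"
    by (intro continuous_intros smooth_map_continuous[OF N_smooth])
  from open_vimage[OF \<open>open B\<close> this] show ?thesis by (simp add: vimage_def)
qed

lemma flow_box_image_open:
  assumes F: "flow_box U k V \<tau>" and B: "open B"
  shows "open ((\<lambda>x. N x $ k) ` (B \<inter> U))"
  unfolding open_subopen[of "(\<lambda>x. N x $ k) ` (B \<inter> U)"]
proof
  fix s assume "s \<in> (\<lambda>x. N x $ k) ` (B \<inter> U)"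
  then obtain z where z: "z \<in> B" "z \<in> U" "s = N z $ k" by blast
  have "open (V \<inter> \<tau> z -` B)" by (rule smooth_curve_open[OF flow_boxD(8)[OF F z(2)] B])
  moreover have "s \<in> V \<inter> \<tau> z -` B" using z flow_boxD(3,7)[OF F, of z] by simp
  moreover have "V \<inter> \<tau> z -` B \<subseteq> (\<lambda>x. N x $ k) ` (B \<inter> U)"
  proof
    fix t assume "t \<in> V \<inter> \<tau> z -` B"
    then have "\<tau> z t \<in> B \<inter> U" "t = N (\<tau> z t) $ k" using flow_boxD(5,6)[OF F z(2)] by auto
    then show "t \<in> (\<lambda>x. N x $ k) ` (B \<inter> U)" by (rule image_eqI[rotated])
  qed
  ultimately show "\<exists>T. open T \<and> s \<in> T \<and> T \<subseteq> (\<lambda>x. N x $ k) ` (B \<inter> U)" by blast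
qed

lemma flow_box_saturation:
  assumes F: "flow_box U k V \<tau>" and z: "z \<in> U" and y: "y \<in> saturation U"
  shows "N y $ k \<in> V" "(y, \<tau> z (N y $ k)) \<in> leaf_rel A N"
proof -
  obtain x where x: "x \<in> U" "(x, y) \<in> leaf_rel A N" using y by (auto simp: saturation_def)
  then have eq: "N y = N x" using N_leaf by simp
  then show v: "N y $ k \<in> V" using flow_boxD(3)[OF F x(1)] by simp
  have "(x, \<tau> z (N y $ k)) \<in> leaf_rel A N"
    by (rule flow_boxD(4)[OF F x(1) flow_boxD(5)[OF F z v]]) (simp only: flow_boxD(6)[OF F z v], simp only: eq)
  then show "(y, \<tau> z (N y $ k)) \<in> leaf_rel A N" using x leaf_rel_sym leaf_rel_trans by blast
qed

text \<open>Along a tangent curve, whether a point is interior to a given saturated set is locally constant: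
  in a flow box, a component of \<open>N\<close> is an open map which is constant along the curve, and the points of
  the box with a common value of it are in the same leaf.\<close>

lemma tangent_curve_interior:
  assumes S: "\<And>x y. x \<in> S \<Longrightarrow> (x, y) \<in> leaf_rel A N \<Longrightarrow> y \<in> S"
    and g: "tangent_curve A N {a<..<b} \<gamma>" and t: "t0 \<in> {a<..<b}" "t1 \<in> {a<..<b}" and i: "\<gamma> t0 \<in> interior S"
  shows "\<gamma> t1 \<in> interior S"
proof -
  have cont: "continuous_on {a<..<b} \<gamma>" using g by (simp add: tangent_curve_def)
  have "(\<gamma> t0 \<in> interior S) = (\<gamma> t1 \<in> interior S)"
  proof (rule connected_local_const[of "{a<..<b}" t0 t1 "\<lambda>t. \<gamma> t \<in> interior S"])
    show "\<forall>t\<in>{a<..<b}. eventually (\<lambda>r. (\<gamma> t \<in> interior S) = (\<gamma> r \<in> interior S)) (at t within {a<..<b})"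
    proof
      fix t assume t: "t \<in> {a<..<b}"
      obtain U k V \<tau> where F: "flow_box U k V \<tau>" "\<gamma> t \<in> U" using flow_box_exists by blast
      have mono: "\<gamma> r' \<in> interior S"
        if "r \<in> {a<..<b}" "\<gamma> r \<in> U" "r' \<in> {a<..<b}" "\<gamma> r' \<in> U" "\<gamma> r \<in> interior S" for r r'
      proof (rule interiorI)
        let ?B = "(\<lambda>x. N x $ k) ` (interior S \<inter> U)"
        show "open (U \<inter> {x. N x $ k \<in> ?B})"
          by (intro open_Int flow_boxD(1)[OF F(1)] N_component_vimage flow_box_image_open[OF F(1)] open_interior)
        have "N (\<gamma> r') = N (\<gamma> r)" by (rule constant_on_tangent_curve[OF g N_smooth _ that(3,1)])
        then show "\<gamma> r' \<in> U \<inter> {x. N x $ k \<in> ?B}" using that by auto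
        show "U \<inter> {x. N x $ k \<in> ?B} \<subseteq> S"
        proof
          fix y assume y: "y \<in> U \<inter> {x. N x $ k \<in> ?B}"
          then obtain x where x: "x \<in> interior S" "x \<in> U" "N x $ k = N y $ k" by auto
          then have "(x, y) \<in> leaf_rel A N" using y by (intro flow_boxD(4)[OF F(1)]) auto
          then show "y \<in> S" using S x(1) interior_subset by blast
        qed
      qed
      have op: "open ({a<..<b} \<inter> \<gamma> -` U)"
        by (rule continuous_open_preimage[OF cont _ flow_boxD(1)[OF F(1)]]) simp
      have iff: "(\<gamma> t \<in> interior S) = (\<gamma> r \<in> interior S)" if "r \<in> {a<..<b} \<inter> \<gamma> -` U" for r
        using mono[of t r] mono[of r t] t F(2) that by blast
      have "t \<in> {a<..<b} \<inter> \<gamma> -` U" using t F(2) by simp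
      then show "eventually (\<lambda>r. (\<gamma> t \<in> interior S) = (\<gamma> r \<in> interior S)) (at t within {a<..<b})"
        unfolding eventually_at_topological using op iff by blast
    qed
  qed (use t in auto)
  then show ?thesis using i by simp
qed

lemma saturation_open:
  assumes B: "open B" shows "open (saturation B)"
proof -
  have S: "y \<in> saturation B" if "x \<in> saturation B" "(x, y) \<in> leaf_rel A N" for x y
    using that leaf_rel_trans unfolding saturation_def by blast
  have "y \<in> interior (saturation B)" if x: "x \<in> B" and xy: "(x, y) \<in> leaf_rel A N" for x y
    using xy unfolding leaf_rel_def
  proof (induction rule: rtrancl_induct)
    case base
    show ?case using interior_maximal[OF saturation_subset B] x by blast
  next
    case (step y z)
    then obtain \<gamma> a b where g: "a < 0" "1 < b" "tangent_curve A N {a<..<b} \<gamma>" "\<gamma> 0 = y" "\<gamma> 1 = z" by blast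
    have "\<gamma> 1 \<in> interior (saturation B)"
      by (rule tangent_curve_interior[OF S g(3), where ?t0.0=0]) (use g step.IH in auto)
    then show ?case using g by simp
  qed
  then have "saturation B \<subseteq> interior (saturation B)" unfolding saturation_def by blast
  then show ?thesis using interior_subset open_interior by (metis subset_antisym)
qed

lemma openin_leaves_image: "open B \<Longrightarrow> openin leaves (\<pi> ` B)"
  unfolding openin_leaf_topology saturation_vimage by (auto simp: leaf_space_def saturation_open)

lemma topspace_leaves: "topspace leaves = leaf_space A N"
  using quotient_imp_surjective_map[OF quotient_map_leaf_of[of A N]] by (simp add: leaf_space_def)

text \<open>A function that is constant on the leaves factors through a component of \<open>N\<close> near each leaf.\<close>

lemma leafwise_derivative:
  fixes h :: "'x \<Rightarrow> 'b::real_normed_vector"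
  assumes F: "flow_box U k V \<tau>" and z: "z \<in> U" and W: "open W" "smooth_map A W h"
    and sat: "\<And>y y'. y \<in> W \<Longrightarrow> (y, y') \<in> leaf_rel A N \<Longrightarrow> y' \<in> W \<and> h y' = h y"
    and x: "x \<in> W" "x \<in> saturation U" and c: "c \<in> A" "x \<in> fst c"
  shows "differential c h x v = dd (\<lambda>s. h (\<tau> z s)) (differential c N x v $ k) (N x $ k)"
proof -
  let ?p = "snd c x" and ?g = "\<lambda>s. h (\<tau> z s)" and ?J = "V \<inter> \<tau> z -` W"
  have p: "?p \<in> chart_image c" "chart_inv c ?p = x" using chart_value[OF c(2)] chart_inv_left[OF c] .
  have fact: "N y $ k \<in> ?J \<and> h y = ?g (N y $ k)" if "y \<in> W \<inter> saturation U" for y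
    using flow_box_saturation[OF F z, of y] sat[of y "\<tau> z (N y $ k)"] that by auto
  have sg: "smooth_on ?J ?g" by (rule smooth_along_curve[OF flow_boxD(8)[OF F z] W])
  have "((\<lambda>q. nc c q $ k) has_derivative (\<lambda>v. dd (nc c) v ?p $ k)) (at ?p)"
    by (rule bounded_linear.has_derivative[OF bounded_linear_vec_nth smooth_on_has_derivative[OF N_coord[OF c(1)] p(1)]])
  moreover have "(?g has_derivative (\<lambda>r. dd ?g r (N x $ k))) (at (nc c ?p $ k))"
    unfolding p(2) by (rule smooth_on_has_derivative[OF sg]) (use fact x in blast)
  ultimately have d: "((\<lambda>q. ?g (nc c q $ k)) has_derivative (\<lambda>v. dd ?g (dd (nc c) v ?p $ k) (N x $ k))) (at ?p)"
    by (rule has_derivative_compose)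
  have "((h \<circ> chart_inv c) has_derivative (\<lambda>v. dd ?g (dd (nc c) v ?p $ k) (N x $ k))) (at ?p)"
  proof (rule has_derivative_transform_within_open[OF d])
    show "open (snd c ` (fst c \<inter> (W \<inter> saturation U)))"
      by (intro chart_restrict_open c(1) open_Int W saturation_open flow_boxD(1)[OF F])
    show "?p \<in> snd c ` (fst c \<inter> (W \<inter> saturation U))" using x c by blast
    fix q assume "q \<in> snd c ` (fst c \<inter> (W \<inter> saturation U))"
    then have "chart_inv c q \<in> W \<inter> saturation U" unfolding chart_image_restrict[OF c(1)] by simp
    from fact[OF this] show "?g (nc c q $ k) = (h \<circ> chart_inv c) q" by simp
  qed
  then show ?thesis unfolding differential_coord[of c N] unfolding differential_def by (rule dd_eqI)
qed

lemma leafwise_derivative_linear: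
  assumes F: "flow_box U k V \<tau>" and z: "z \<in> U" and W: "open W" "smooth_map A W h"
    and sat: "\<And>y y'. y \<in> W \<Longrightarrow> (y, y') \<in> leaf_rel A N \<Longrightarrow> y' \<in> W \<and> h y' = h y"
    and x: "x \<in> W" "x \<in> saturation U"
  shows "linear (\<lambda>r. dd (\<lambda>s. h (\<tau> z s)) r (N x $ k))"
proof (rule dd_linear[OF smooth_along_curve[OF flow_boxD(8)[OF F z] W]])
  show "N x $ k \<in> V \<inter> \<tau> z -` W"
    using flow_box_saturation[OF F z x(2)] sat[OF x(1)] by auto
qed

lemma leafwise_kernel:
  assumes h: "smooth_map A UNIV h" and sat: "\<And>y y'. (y, y') \<in> leaf_rel A N \<Longrightarrow> h y' = h y"
    and c: "c \<in> A" "x \<in> fst c" and v: "differential c N x v = 0"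
  shows "differential c h x v = 0"
proof -
  obtain U k V \<tau> where F: "flow_box U k V \<tau>" "x \<in> U" using flow_box_exists by blast
  have x: "x \<in> saturation U" using F(2) saturation_subset by blast
  have "differential c h x v = dd (\<lambda>s. h (\<tau> x s)) (differential c N x v $ k) (N x $ k)"
    by (rule leafwise_derivative[OF F open_UNIV h _ UNIV_I x c]) (use sat in simp)
  moreover have "linear (\<lambda>r. dd (\<lambda>s. h (\<tau> x s)) r (N x $ k))"
    by (rule leafwise_derivative_linear[OF F open_UNIV h _ UNIV_I x]) (use sat in simp)
  ultimately show ?thesis using v linear_0 by fastforce
qed

text \<open>\<open>N\<close> factors through the component near the leaf of \<open>x\<close>, so that \<open>dN\<close> would vanish at \<open>x\<close>
  together with the differential of the component.\<close>

lemma component_submersion: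
  assumes F: "flow_box U k V \<tau>" and x: "x \<in> saturation U" and c: "c \<in> A" "x \<in> fst c"
  shows "\<exists>v. differential c N x v $ k \<noteq> 0"
proof (rule ccontr)
  assume "\<not> ?thesis"
  then have k: "differential c N x v $ k = 0" for v by blast
  obtain z where z: "z \<in> U" using x by (auto simp: saturation_def)
  have d: "differential c N x v = dd (\<lambda>s. N (\<tau> z s)) (differential c N x v $ k) (N x $ k)" for v
    by (rule leafwise_derivative[OF F z open_UNIV N_smooth _ UNIV_I x c]) (simp add: N_leaf)
  have "linear (\<lambda>r. dd (\<lambda>s. N (\<tau> z s)) r (N x $ k))"
    by (rule leafwise_derivative_linear[OF F z open_UNIV N_smooth _ UNIV_I x]) (simp add: N_leaf)
  then have "differential c N x v = 0" for v using d[of v] k[of v] linear_0 by fastforce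
  then have "dd (nc c) v (snd c x) = 0 *\<^sub>R yc c (snd c x)" for v unfolding differential_coord by simp
  then show False using N_not_proportional[OF c(1) chart_value[OF c(2)]] by blast
qed

text \<open>As \<open>N\<close> is constant on each leaf, it does not matter at which point of the leaf it is
  evaluated.\<close>

definition leaf_chart :: "'x set \<Rightarrow> 5 \<Rightarrow> ('x set, real) chart" where
  "leaf_chart U k = (\<pi> ` U, \<lambda>L. N (SOME x. x \<in> L) $ k)"

lemma N_some: "N (SOME y. y \<in> \<pi> x) = N x"
proof -
  have "x \<in> \<pi> x" using leaf_rel_refl by (simp add: leaf_of_def)
  then have "(SOME y. y \<in> \<pi> x) \<in> \<pi> x" by (rule someI)
  then show ?thesis using N_leaf by (simp add: leaf_of_def)
qed

lemma leaf_chart: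
  assumes F: "flow_box U k V \<tau>" shows "leaf_chart U k \<in> leaf_charts A N"
proof -
  let ?\<psi> = "\<lambda>L. N (SOME x. x \<in> L) $ k"
  have comp: "?\<psi> \<circ> \<pi> = (\<lambda>x. N x $ k)" by (simp add: fun_eq_iff N_some)
  have img: "?\<psi> ` \<pi> ` B = (\<lambda>x. N x $ k) ` B" for B by (simp add: image_image N_some)
  have sub: "\<pi> ` U \<subseteq> topspace leaves" by (auto simp: topspace_leaves leaf_space_def)
  have "is_chart leaves (\<pi> ` U, ?\<psi>)"
    unfolding is_chart_def chart_image_def fst_conv snd_conv
  proof (intro conjI)
    show "openin leaves (\<pi> ` U)" by (rule openin_leaves_image[OF flow_boxD(1)[OF F]])
    show op: "open (?\<psi> ` \<pi> ` U)" unfolding img using flow_box_image_open[OF F open_UNIV] by simp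
    show "homeomorphic_map (subtopology leaves (\<pi> ` U)) (top_of_set (?\<psi> ` \<pi> ` U)) ?\<psi>"
    proof (rule bijective_open_imp_homeomorphic_map)
      have ts: "topspace (subtopology leaves (\<pi> ` U)) = \<pi> ` U" using sub by auto
      show "?\<psi> ` topspace (subtopology leaves (\<pi> ` U)) = topspace (top_of_set (?\<psi> ` \<pi> ` U))"
        unfolding ts by simp
      show "inj_on ?\<psi> (topspace (subtopology leaves (\<pi> ` U)))"
        unfolding ts by (auto simp: inj_on_def N_some leaf_of_eq flow_boxD(4)[OF F])
      have "openin leaves {L \<in> \<pi> ` U. ?\<psi> L \<in> B}" if B: "open B" for B
      proof -
        have "\<pi> -` {L \<in> \<pi> ` U. ?\<psi> L \<in> B} = saturation U \<inter> {x. N x $ k \<in> B}"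
          unfolding saturation_vimage[symmetric] by (auto simp: N_some)
        then show ?thesis
          unfolding openin_leaf_topology using open_Int[OF saturation_open[OF flow_boxD(1)[OF F]] N_component_vimage[OF B]]
          by (auto simp: leaf_space_def)
      qed
      then have pre: "openin (subtopology leaves (\<pi> ` U)) {L \<in> \<pi> ` U. ?\<psi> L \<in> B}" if "open B" for B
        unfolding openin_subtopology using that by blast
      show "continuous_map (subtopology leaves (\<pi> ` U)) (top_of_set (?\<psi> ` \<pi> ` U)) ?\<psi>"
        unfolding continuous_map_in_subtopology unfolding continuous_map_def ts using pre by simp
      show "open_map (subtopology leaves (\<pi> ` U)) (top_of_set (?\<psi> ` \<pi> ` U)) ?\<psi>"
        unfolding open_map_def
      proof (intro allI impI)
        fix D assume "openin (subtopology leaves (\<pi> ` U)) D"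
        then obtain D' where D: "openin leaves D'" "D = D' \<inter> \<pi> ` U" unfolding openin_subtopology by blast
        have "D = \<pi> ` (\<pi> -` D' \<inter> U)" unfolding D(2) by blast
        moreover have "open ((\<lambda>x. N x $ k) ` (\<pi> -` D' \<inter> U))"
          by (rule flow_box_image_open[OF F]) (use D(1) in \<open>simp add: openin_leaf_topology\<close>)
        ultimately have "open (?\<psi> ` D)" by (simp add: img)
        moreover have "?\<psi> ` D \<subseteq> ?\<psi> ` \<pi> ` U" using D(2) by blast
        ultimately show "openin (top_of_set (?\<psi> ` \<pi> ` U)) (?\<psi> ` D)"
          using op by (simp add: openin_open_eq)
      qed
    qed
  qed
  moreover have "smooth_map A (\<pi> -` \<pi> ` U) (?\<psi> \<circ> \<pi>)"
  proof -
    have "smooth_map A UNIV (\<lambda>x. N x $ k)"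
      unfolding smooth_map_def
    proof
      fix c assume c: "c \<in> A"
      show "smooth_on (snd c ` (fst c \<inter> UNIV)) ((\<lambda>x. N x $ k) \<circ> chart_inv c)"
        using smooth_on_nth[OF chart_image_open[OF c] N_coord[OF c]] by (simp add: comp_def chart_image_def)
    qed
    then show ?thesis unfolding comp by (rule smooth_map_subset) simp
  qed
  moreover have "\<exists>v. differential c (?\<psi> \<circ> \<pi>) x v \<noteq> 0" if c: "c \<in> A" and x: "x \<in> fst c \<inter> \<pi> -` \<pi> ` U" for c x
  proof -
    have xc: "x \<in> fst c" "x \<in> saturation U" using x by (auto simp: saturation_vimage)
    have "differential c (\<lambda>x. N x $ k) x v = differential c N x v $ k" for v
      unfolding differential_coord by (rule dd_nth[OF smooth_on_differentiable[OF N_coord[OF c] chart_value[OF xc(1)]]])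
    then show ?thesis unfolding comp using component_submersion[OF F xc(2) c xc(1)] by simp
  qed
  ultimately show ?thesis unfolding leaf_charts_def leaf_chart_def by blast
qed

text \<open>Composed with a transversal of a flow box, the leaf chart becomes a function of one variable
  whose derivative does not vanish, because the leaf chart is a submersion on the surface and
  factors through the parameter of the transversal. The inverse of this function lifts the leaf
  chart to the transversal, where the assumption on \<open>H\<close> applies.\<close>

lemma leaf_function_smooth:
  assumes ch: "(V', \<psi>) \<in> leaf_charts A N" and W: "openin leaves W" "W \<subseteq> V'"
    and sF: "smooth_map A (\<pi> -` W) (\<lambda>x. H (\<pi> x))"
  shows "smooth_on (\<psi> ` W) (\<lambda>s. H (chart_inv (V', \<psi>) s))"
proof (rule smooth_on_local)
  have ic: "is_chart leaves (V', \<psi>)" and s\<psi>: "smooth_map A (\<pi> -` V') (\<psi> \<circ> \<pi>)"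
    and sub: "\<And>c x. c \<in> A \<Longrightarrow> x \<in> fst c \<inter> \<pi> -` V' \<Longrightarrow> \<exists>v. differential c (\<psi> \<circ> \<pi>) x v \<noteq> 0"
    using ch by (auto simp: leaf_charts_def)
  have inj: "inj_on \<psi> V'"
  proof -
    have "homeomorphic_map (subtopology leaves V') (top_of_set (chart_image (V', \<psi>))) \<psi>" "openin leaves V'"
      using ic by (simp_all add: is_chart_def)
    from homeomorphic_imp_injective_map[OF this(1)] openin_subset[OF this(2)] show ?thesis by (simp add: inf_absorb2)
  qed
  have opW: "open (\<pi> -` W)" using W(1) by (simp add: openin_leaf_topology)
  fix s1 assume "s1 \<in> \<psi> ` W"
  then obtain L where L: "L \<in> W" "s1 = \<psi> L" by blast
  moreover have "L \<in> range \<pi>" using W(1) L(1) by (auto simp: openin_leaf_topology leaf_space_def)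
  ultimately obtain x0 where x0: "\<pi> x0 \<in> W" "s1 = \<psi> (\<pi> x0)" by auto
  obtain U k V \<tau> where F: "flow_box U k V \<tau>" "x0 \<in> U" using flow_box_exists by blast
  have xs: "x0 \<in> saturation U" using F(2) saturation_subset by blast
  let ?J = "V \<inter> \<tau> x0 -` (\<pi> -` W)" and ?s0 = "N x0 $ k"
  note crv = flow_boxD(8)[OF F]
  have J: "open ?J" by (rule smooth_curve_open[OF crv opW])
  have s0: "?s0 \<in> ?J" using flow_boxD(3,7)[OF F] x0 by simp
  define \<theta> where "\<theta> s = (\<psi> \<circ> \<pi>) (\<tau> x0 s)" for s
  have s\<psi>W: "smooth_map A (\<pi> -` W) (\<psi> \<circ> \<pi>)" by (rule smooth_map_subset[OF s\<psi>]) (use W(2) in blast)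
  have s\<theta>: "smooth_on ?J \<theta>" unfolding \<theta>_def by (rule smooth_along_curve[OF crv opW s\<psi>W])
  have satc: "y' \<in> \<pi> -` W \<and> (\<psi> \<circ> \<pi>) y' = (\<psi> \<circ> \<pi>) y" if "y \<in> \<pi> -` W" "(y, y') \<in> leaf_rel A N" for y y'
    using that leaf_of_eq[of y y'] by simp
  have "dd \<theta> 1 ?s0 \<noteq> 0"
  proof
    assume z: "dd \<theta> 1 ?s0 = 0"
    have l: "linear (\<lambda>r. dd \<theta> r ?s0)" by (rule dd_linear[OF s\<theta> s0])
    have z': "dd \<theta> r ?s0 = 0" for r using linear_cmul[OF l, of r 1] z by simp
    obtain c where c: "c \<in> A" "x0 \<in> fst c" using chart_exists[of x0] by blast
    have "differential c (\<psi> \<circ> \<pi>) x0 v = dd \<theta> (differential c N x0 v $ k) ?s0" for v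
      unfolding \<theta>_def by (rule leafwise_derivative[OF F opW s\<psi>W satc _ xs c]) (use x0 in auto)
    then show False using sub[OF c(1), of x0] c(2) x0(1) W(2) z' by auto
  qed
  then obtain U1 V1 g where G: "open U1" "?s0 \<in> U1" "U1 \<subseteq> ?J" "open V1" "homeomorphism U1 V1 \<theta> g" "smooth_on V1 g"
    using smooth_local_inverse_real[OF J s\<theta> s0] by blast
  have gV: "g s \<in> ?J" "\<theta> (g s) = s" if "s \<in> V1" for s using G(3,5) that by (auto simp: homeomorphism_def)
  have "smooth_on V1 (\<lambda>s. (\<lambda>x. H (\<pi> x)) (\<tau> x0 (g s)))"
    by (rule smooth_on_compose[OF G(4) smooth_along_curve[OF crv opW sF] G(6) gV(1)])
  then have "smooth_on V1 (\<lambda>s. H (chart_inv (V', \<psi>) s))"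
  proof (rule smooth_on_cong[OF G(4)])
    fix s assume s: "s \<in> V1"
    have "\<pi> (\<tau> x0 (g s)) \<in> V'" using gV(1)[OF s] W(2) by auto
    from inv_into_f_f[OF inj this] have "chart_inv (V', \<psi>) s = \<pi> (\<tau> x0 (g s))"
      using gV(2)[OF s] by (simp add: chart_inv_def \<theta>_def)
    then show "H (\<pi> (\<tau> x0 (g s))) = H (chart_inv (V', \<psi>) s)" by simp
  qed
  moreover have "s1 \<in> V1"
  proof -
    have "\<theta> ?s0 \<in> V1" using G(2,5) by (auto simp: homeomorphism_def)
    then show ?thesis using flow_boxD(7)[OF F] x0 by (simp add: \<theta>_def)
  qed
  ultimately show "\<exists>T. open T \<and> s1 \<in> T \<and> smooth_on T (\<lambda>s. H (chart_inv (V', \<psi>) s))" using G(4) by blast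
qed

text \<open>The projection to the leaf space is open, which gives the second axiom of countability.\<close>

lemma leaf_manifold:
  assumes "regular A f" shows "smooth_manifold leaves (leaf_charts A N)"
  unfolding smooth_manifold_def
proof (intro conjI)
  show "Hausdorff_space leaves" using assms by (simp add: regular_def)
  show "second_countable leaves"
  proof (rule second_countable_open_map_image[OF quotient_imp_continuous_map[OF quotient_map_leaf_of]])
    show "open_map euclidean leaves \<pi>" by (simp add: open_map_def openin_leaves_image)
    show "\<pi> ` topspace euclidean = topspace leaves" by (simp add: topspace_leaves leaf_space_def)
    show "second_countable (euclidean :: 'x topology)"
      using surface by (simp add: connected_oriented_surface_def smooth_manifold_def)
  qed
  show "smooth_atlas leaves (leaf_charts A N)"
    unfolding smooth_atlas_def
  proof (intro conjI ballI)
    show "is_chart leaves c" if "c \<in> leaf_charts A N" for c using that by (auto simp: leaf_charts_def)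
    then have "fst c \<subseteq> topspace leaves" if "c \<in> leaf_charts A N" for c
      using that openin_subset unfolding is_chart_def by blast
    moreover have "\<exists>c\<in>leaf_charts A N. L \<in> fst c" if L: "L \<in> topspace leaves" for L
    proof -
      obtain x where x: "L = \<pi> x" using L by (auto simp: topspace_leaves leaf_space_def)
      obtain U k V \<tau> where F: "flow_box U k V \<tau>" "x \<in> U" using flow_box_exists by blast
      have "L \<in> fst (leaf_chart U k)" using F(2) x by (simp add: leaf_chart_def)
      then show ?thesis using leaf_chart[OF F(1)] by blast
    qed
    ultimately show "(\<Union>c\<in>leaf_charts A N. fst c) = topspace leaves" by blast
    fix c c' assume c: "c \<in> leaf_charts A N" "c' \<in> leaf_charts A N"
    obtain V1 \<psi>1 where p1: "c = (V1, \<psi>1)" using surj_pair[of c] by blast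
    obtain V2 \<psi>2 where p2: "c' = (V2, \<psi>2)" using surj_pair[of c'] by blast
    note p = p1 p2
    have op: "openin leaves (V1 \<inter> V2)" using c by (auto simp: p leaf_charts_def is_chart_def)
    have "smooth_map A (\<pi> -` V2) (\<psi>2 \<circ> \<pi>)" using c(2) by (simp add: p leaf_charts_def)
    then have "smooth_map A (\<pi> -` (V1 \<inter> V2)) (\<lambda>x. \<psi>2 (\<pi> x))"
      unfolding comp_def by (rule smooth_map_subset) blast
    from leaf_function_smooth[OF c(1)[unfolded p] op _ this]
    show "smooth_on (snd c ` (fst c \<inter> fst c')) (transition c c')"
      by (simp add: p transition_def comp_def)
  qed
qed

lemma leaf_space_connected: "connected_space leaves"
proof -
  have "connected_space (euclidean :: 'x topology)"
    using surface connectedin_topspace[of "euclidean :: 'x topology"] by (simp add: connected_oriented_surface_def)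
  then show ?thesis by (rule connected_space_quotient_map_image[OF quotient_map_leaf_of])
qed

lemma leaf_function_smooth_map:
  assumes "smooth_map A UNIV (\<lambda>x. H (\<pi> x))"
  shows "smooth_map (leaf_charts A N) (leaf_space A N) H"
  unfolding smooth_map_def
proof
  fix c assume c: "c \<in> leaf_charts A N"
  obtain V \<psi> where p: "c = (V, \<psi>)" using surj_pair[of c] by blast
  have op: "openin leaves V" using c by (simp add: p leaf_charts_def is_chart_def)
  then have "V \<inter> leaf_space A N = V" by (auto simp: openin_leaf_topology)
  then show "smooth_on (snd c ` (fst c \<inter> leaf_space A N)) (H \<circ> chart_inv c)"
    using leaf_function_smooth[OF c[unfolded p] op subset_refl smooth_map_subset[OF assms]] by (simp add: p comp_def)
qed

lemma leaf_function_pullback: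
  assumes H: "smooth_map (leaf_charts A N) (leaf_space A N) H"
  shows "smooth_map A UNIV (\<lambda>x. H (\<pi> x))"
proof (rule smooth_map_local)
  fix x
  obtain U k V \<tau> where F: "flow_box U k V \<tau>" "x \<in> U" using flow_box_exists by blast
  let ?c = "leaf_chart U k"
  have sub: "\<pi> ` U \<subseteq> leaf_space A N" by (auto simp: leaf_space_def)
  have inj: "inj_on (snd ?c) (fst ?c)"
    by (auto simp: leaf_chart_def inj_on_def N_some leaf_of_eq flow_boxD(4)[OF F(1)])
  have sH: "smooth_on (snd ?c ` (\<pi> ` U)) (H \<circ> chart_inv ?c)"
  proof -
    have "fst ?c \<inter> leaf_space A N = \<pi> ` U" using sub by (auto simp: leaf_chart_def)
    then show ?thesis using H leaf_chart[OF F(1)] unfolding smooth_map_def by metis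
  qed
  have "smooth_map A U (\<lambda>x. H (\<pi> x))"
    unfolding smooth_map_def
  proof
    fix c assume c: "c \<in> A"
    have op: "open (snd c ` (fst c \<inter> U))" by (rule chart_restrict_open[OF c flow_boxD(1)[OF F(1)]])
    have sub': "snd c ` (fst c \<inter> U) \<subseteq> chart_image c" by (auto simp: chart_image_def)
    have "smooth_on (snd c ` (fst c \<inter> U)) (\<lambda>q. (H \<circ> chart_inv ?c) (nc c q $ k))"
    proof (rule smooth_on_compose[OF op sH smooth_on_nth[OF op smooth_on_subset[OF N_coord[OF c] sub']]])
      fix q assume "q \<in> snd c ` (fst c \<inter> U)"
      then have "chart_inv c q \<in> U" by (auto simp: chart_inv_left[OF c])
      then show "nc c q $ k \<in> snd ?c ` (\<pi> ` U)" by (auto simp: leaf_chart_def N_some image_image)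
    qed
    then show "smooth_on (snd c ` (fst c \<inter> U)) ((\<lambda>x. H (\<pi> x)) \<circ> chart_inv c)"
    proof (rule smooth_on_cong[OF op])
      fix q assume "q \<in> snd c ` (fst c \<inter> U)"
      then have "chart_inv c q \<in> U" by (auto simp: chart_inv_left[OF c])
      then have "chart_inv ?c (snd ?c (\<pi> (chart_inv c q))) = \<pi> (chart_inv c q)"
        unfolding chart_inv_def[of ?c] by (intro inv_into_f_f[OF inj]) (simp add: leaf_chart_def)
      then show "(H \<circ> chart_inv ?c) (nc c q $ k) = ((\<lambda>x. H (\<pi> x)) \<circ> chart_inv c) q"
        by (simp add: leaf_chart_def N_some)
    qed
  qed
  then show "\<exists>V. open V \<and> x \<in> V \<and> smooth_map A V (\<lambda>x. H (\<pi> x))" using F flow_boxD(1) by blast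
qed

end

section \<open>The infinitesimal deformations\<close>

context quasi_umbilical_surface
begin

text \<open>In the coordinates of a patch this is the form \<open>\<Psi> du\<close>. Here it is defined in a way that does
  not depend on \<open>u\<close> and the chart: the vector \<open>q\<close> is dual to the linear form \<open>w \<mapsto> dN(v) \<bullet> dN(w)\<close>
  with respect to the induced metric. The euclidean product is used as an auxiliary positive
  definite one, since \<open>scal (dN v) (dN w)\<close> vanishes; another choice would multiply the form by a
  function on the leaf space.\<close>

definition fundamental_form :: "('x, real^5^5) form" where
  "fundamental_form c x v = (if c \<in> A \<and> x \<in> fst c then THE B. \<exists>q.
     (\<forall>w. induced_metric f c x q w = differential c N x v \<bullet> differential c N x w) \<and>
     B = wedge_endo (Y x) (differential c Y x q) else 0)"

lemma fundamental_form_eq: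
  assumes c: "c \<in> A" "x \<in> fst c"
    and q: "\<And>w. induced_metric f c x q w = differential c N x v \<bullet> differential c N x w"
  shows "fundamental_form c x v = wedge_endo (Y x) (differential c Y x q)"
proof -
  interpret gauss_patch "chart_image c" "yc c" "nc c" by (rule gauss_patch_chart[OF c(1)])
  have p: "snd c x \<in> chart_image c" by (rule chart_value[OF c(2)])
  have "q' = q" if q': "\<And>w. induced_metric f c x q' w = differential c N x v \<bullet> differential c N x w" for q'
  proof -
    have "scal (dd (yc c) (q' - q) (snd c x)) (dd (yc c) w (snd c x)) = 0" for w
      using q[of w] q'[of w] unfolding induced_metric_coord linear_diff[OF lin_y[OF p]] by (simp add: scal_simps)
    then show ?thesis using metric_nondegenerate[OF p] by fastforce
  qed
  note uniq = this
  have "(THE B. \<exists>q. (\<forall>w. induced_metric f c x q w = differential c N x v \<bullet> differential c N x w) \<and>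
     B = wedge_endo (Y x) (differential c Y x q)) = wedge_endo (Y x) (differential c Y x q)"
  proof (rule the_equality)
    fix B assume "\<exists>q. (\<forall>w. induced_metric f c x q w = differential c N x v \<bullet> differential c N x w) \<and>
      B = wedge_endo (Y x) (differential c Y x q)"
    then obtain q' where q': "\<And>w. induced_metric f c x q' w = differential c N x v \<bullet> differential c N x w"
      "B = wedge_endo (Y x) (differential c Y x q')" by blast
    show "B = wedge_endo (Y x) (differential c Y x q)" using uniq[OF q'(1)] q'(2) by simp
  qed (use q in blast)
  then show ?thesis using c by (simp add: fundamental_form_def)
qed

abbreviation \<Psi>c :: "('x, real^2) chart \<Rightarrow> 5 \<Rightarrow> real^2 \<Rightarrow> real^5^5" where
  "\<Psi>c c i \<equiv> rank_one_patch.\<Psi> (yc c) (nc c) (\<lambda>q. nc c q $ i)"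

lemma fundamental_form_patch:
  assumes c: "c \<in> A" and Q: "Q \<subseteq> chart_image c" and r: "rank_one_patch Q (yc c) (nc c) (\<lambda>q. nc c q $ i)" and p: "p \<in> Q"
  shows "fundamental_form c (chart_inv c p) v = dd (\<lambda>q. nc c q $ i) v p *\<^sub>R \<Psi>c c i p"
    and "\<exists>q. \<forall>w. induced_metric f c (chart_inv c p) q w
      = differential c N (chart_inv c p) v \<bullet> differential c N (chart_inv c p) w"
proof -
  interpret rank_one_patch Q "yc c" "nc c" "\<lambda>q. nc c q $ i" by (rule r)
  let ?x = "chart_inv c p" and ?u = "\<lambda>q. nc c q $ i"
  have pc: "p \<in> chart_image c" using Q p by blast
  have x: "?x \<in> fst c" "snd c ?x = p" using chart_inv_domain[OF pc] chart_inv_right[OF pc] .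
  define k where "k = dd ?u v p * (M p \<bullet> M p) / m p"
  have dq: "dd (yc c) (k *\<^sub>R \<zeta> p) p = k *\<^sub>R W p" unfolding W_def by (rule linear_cmul[OF lin_y[OF p]])
  have q: "induced_metric f c ?x (k *\<^sub>R \<zeta> p) w = differential c N ?x v \<bullet> differential c N ?x w" for w
  proof -
    have "scal (dd (yc c) (k *\<^sub>R \<zeta> p) p) (dd (yc c) w p) = k * (dd ?u w p * m p)"
      unfolding dq using dy_W[OF p, of w] by (simp add: scal_simps scal_commute)
    then show ?thesis
      unfolding induced_metric_coord differential_coord x(2) dn_eq[OF p] using m_nz[OF p] by (simp add: k_def)
  qed
  then show "\<exists>q. \<forall>w. induced_metric f c ?x q w = differential c N ?x v \<bullet> differential c N ?x w" by blast
  show "fundamental_form c ?x v = dd ?u v p *\<^sub>R \<Psi> p"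
    unfolding fundamental_form_eq[OF c x(1) q] differential_coord x(2) dq
    by (simp add: \<Psi>_def \<Phi>_def k_def wedge_endo.scaleR_right)
qed

lemma patch_at:
  assumes c: "c \<in> A" "x \<in> fst c"
  obtains Q i where "open Q" "snd c x \<in> Q" "Q \<subseteq> chart_image c" "rank_one_patch Q (yc c) (nc c) (\<lambda>q. nc c q $ i)"
    "\<And>v. fundamental_form c x v = dd (\<lambda>q. nc c q $ i) v (snd c x) *\<^sub>R \<Psi>c c i (snd c x)"
proof -
  obtain Q i where Q: "open Q" "snd c x \<in> Q" "Q \<subseteq> chart_image c" "rank_one_patch Q (yc c) (nc c) (\<lambda>q. nc c q $ i)"
    using coordinate_patch[OF c(1) chart_value[OF c(2)]] by blast
  show ?thesis using that[OF Q] fundamental_form_patch(1)[OF c(1) Q(3,4,2)] chart_inv_left[OF c] by simp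
qed

lemma fundamental_form_linear:
  assumes c: "c \<in> A" "x \<in> fst c" shows "linear (fundamental_form c x)"
proof -
  obtain Q i where Q': "open Q" "snd c x \<in> Q" "Q \<subseteq> chart_image c" "rank_one_patch Q (yc c) (nc c) (\<lambda>q. nc c q $ i)"
    and e: "\<And>v. fundamental_form c x v = dd (\<lambda>q. nc c q $ i) v (snd c x) *\<^sub>R \<Psi>c c i (snd c x)"
    using patch_at[OF c] by blast
  note Q = Q'(2,4)
  interpret rank_one_patch Q "yc c" "nc c" "\<lambda>q. nc c q $ i" by (rule Q(2))
  show ?thesis
    by (rule linearI) (simp_all add: e linear_add[OF lin_u[OF Q(1)]] linear_cmul[OF lin_u[OF Q(1)]] scaleR_left_distrib)
qed

lemma fundamental_form_smooth:
  assumes c: "c \<in> A" shows "smooth_on (chart_image c) (\<lambda>p. fundamental_form c (chart_inv c p) v)"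
proof (rule smooth_on_local)
  fix p assume "p \<in> chart_image c"
  then obtain Q i where Q: "open Q" "p \<in> Q" "Q \<subseteq> chart_image c" "rank_one_patch Q (yc c) (nc c) (\<lambda>q. nc c q $ i)"
    using coordinate_patch[OF c] by blast
  interpret rank_one_patch Q "yc c" "nc c" "\<lambda>q. nc c q $ i" by (rule Q(4))
  have "smooth_on Q (\<lambda>p. dd (\<lambda>q. nc c q $ i) v p *\<^sub>R \<Psi> p)"
    by (intro smooth_on_scaleR smooth_on_frechet smooth_u smooth_\<Psi> Q(1))
  then have "smooth_on Q (\<lambda>p. fundamental_form c (chart_inv c p) v)"
    by (rule smooth_on_cong[OF Q(1)]) (simp add: fundamental_form_patch(1)[OF c Q(3,4)])
  then show "\<exists>T. open T \<and> p \<in> T \<and> smooth_on T (\<lambda>p. fundamental_form c (chart_inv c p) v)" using Q by blast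
qed

lemma metric_dual_exists:
  assumes c: "c \<in> A" "x \<in> fst c"
  obtains q where "\<And>w. induced_metric f c x q w = differential c N x v \<bullet> differential c N x w"
proof -
  obtain Q i where Q: "open Q" "snd c x \<in> Q" "Q \<subseteq> chart_image c" "rank_one_patch Q (yc c) (nc c) (\<lambda>q. nc c q $ i)"
    using coordinate_patch[OF c(1) chart_value[OF c(2)]] by blast
  show ?thesis using that fundamental_form_patch(2)[OF c(1) Q(3,4,2), of v] unfolding chart_inv_left[OF c] by blast
qed

lemma fundamental_form_change:
  assumes c: "c \<in> A" "x \<in> fst c" and c': "c' \<in> A" "x \<in> fst c'"
  shows "fundamental_form c' x (dtrans c c' x v) = fundamental_form c x v"
proof -
  obtain q where q: "\<And>w. induced_metric f c x q w = differential c N x v \<bullet> differential c N x w"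
    using metric_dual_exists[OF c] by blast
  note dN = smooth_map_change[OF N_smooth c(1) c'(1) c(2) c'(2)] and dY = smooth_map_change[OF Y_smooth c(1) c'(1) c(2) c'(2)]
  have q': "induced_metric f c' x (dtrans c c' x q) w' = differential c' N x (dtrans c c' x v) \<bullet> differential c' N x w'" for w'
  proof -
    obtain w where w: "w' = dtrans c c' x w" using dtrans_surj[OF c(1) c'(1) c(2) c'(2)] by (metis surjD)
    show ?thesis using q[of w] unfolding induced_metric_def w dN dY .
  qed
  show ?thesis unfolding fundamental_form_eq[OF c' q'] fundamental_form_eq[OF c q] dY ..
qed

lemma fundamental_form_nonzero:
  assumes c: "c \<in> A" "x \<in> fst c"
  shows "fundamental_form c x e1 \<noteq> 0 \<or> fundamental_form c x e2 \<noteq> 0"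
proof -
  obtain Q i where Q': "open Q" "snd c x \<in> Q" "Q \<subseteq> chart_image c" "rank_one_patch Q (yc c) (nc c) (\<lambda>q. nc c q $ i)"
    and e: "\<And>v. fundamental_form c x v = dd (\<lambda>q. nc c q $ i) v (snd c x) *\<^sub>R \<Psi>c c i (snd c x)"
    using patch_at[OF c] by blast
  note Q = Q'(2,4)
  interpret rank_one_patch Q "yc c" "nc c" "\<lambda>q. nc c q $ i" by (rule Q(2))
  show ?thesis unfolding e using du_nz[OF Q(1)] \<Psi>_nz[OF Q(1)] by simp
qed

lemma fundamental_form_polar:
  assumes c: "c \<in> A" "x \<in> fst c"
  shows "h *\<^sub>R fundamental_form c x v \<in> polar o23 (lie_algebra (stabilizer (f x)))"
proof -
  obtain q where q: "\<And>w. induced_metric f c x q w = differential c N x v \<bullet> differential c N x w"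
    using metric_dual_exists[OF c] by blast
  interpret gauss_patch "chart_image c" "yc c" "nc c" by (rule gauss_patch_chart[OF c(1)])
  have "scal (Y x) (differential c Y x q) = 0"
    using ydy[OF chart_value[OF c(2)], of q] unfolding differential_coord chart_inv_left[OF c] .
  then have "scal (Y x) (h *\<^sub>R differential c Y x q) = 0" by (simp add: scal_simps)
  then show ?thesis
    unfolding Y_null(3)[of x] polar_stabilizer[OF Y_null(1,2)] fundamental_form_eq[OF c q] wedge_endo.scaleR_right[symmetric]
    by blast
qed

lemma curl_fundamental_form:
  assumes c: "c \<in> A" and Q: "open Q" "Q \<subseteq> chart_image c" and r: "rank_one_patch Q (yc c) (nc c) (\<lambda>q. nc c q $ i)" and p: "p \<in> Q"
    and h: "smooth_map A UNIV h"
  shows "pd 1 (\<lambda>q. h (chart_inv c q) *\<^sub>R fundamental_form c (chart_inv c q) e2) p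
      - pd 2 (\<lambda>q. h (chart_inv c q) *\<^sub>R fundamental_form c (chart_inv c q) e1) p
    = - dd (\<lambda>q. h (chart_inv c q)) (rank_one_patch.\<zeta> (\<lambda>q. nc c q $ i) p) p *\<^sub>R \<Psi>c c i p"
proof -
  interpret rank_one_patch Q "yc c" "nc c" "\<lambda>q. nc c q $ i" by (rule r)
  have sh: "smooth_on Q (\<lambda>q. h (chart_inv c q))"
    using smooth_on_subset[OF smooth_mapD[OF h c] Q(2)] by (simp add: comp_def)
  have e: "pd j (\<lambda>q. h (chart_inv c q) *\<^sub>R fundamental_form c (chart_inv c q) v) p
      = dd (\<lambda>q. h (chart_inv c q) *\<^sub>R dd (\<lambda>q. nc c q $ i) v q *\<^sub>R \<Psi> q) (axis j 1) p" for j v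
    unfolding pd_def by (rule dd_cong[OF Q(1) p]) (simp add: fundamental_form_patch(1)[OF c Q(2) r])
  show ?thesis unfolding e by (rule curl_multiple[OF Q(1) subset_refl sh p])
qed

text \<open>A factor that is constant on the leaves does not affect closedness, since its differential
  vanishes on the kernel of \<open>dN\<close>.\<close>

lemma deformation_multiple:
  assumes h: "smooth_map A UNIV h" and leaf: "\<And>y y'. (y, y') \<in> leaf_rel A N \<Longrightarrow> h y' = h y" and nz: "h x0 \<noteq> 0"
  shows "infinitesimal_deformation A f (\<lambda>c x v. h x *\<^sub>R fundamental_form c x v)"
  unfolding infinitesimal_deformation_def smooth_one_form_def closed_one_form_def
proof (intro conjI ballI allI impI)
  fix c x v assume c: "c \<in> A" "x \<in> fst c"
  show "linear (\<lambda>v. h x *\<^sub>R fundamental_form c x v)"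
    by (rule linear_compose_scale_right[OF fundamental_form_linear[OF c]])
  show pol: "h x *\<^sub>R fundamental_form c x v \<in> polar o23 (lie_algebra (stabilizer (f x)))"
    by (rule fundamental_form_polar[OF c])
  then show "h x *\<^sub>R fundamental_form c x v \<in> o23" by (simp add: polar_def)
next
  fix c v assume c: "c \<in> A"
  show "smooth_on (chart_image c) (\<lambda>p. h (chart_inv c p) *\<^sub>R fundamental_form c (chart_inv c p) v)"
    using smooth_on_scaleR[OF chart_image_open[OF c] smooth_mapD[OF h c] fundamental_form_smooth[OF c]] by (simp add: comp_def)
next
  fix c c' x v assume "c \<in> A" "c' \<in> A" "x \<in> fst c \<inter> fst c'"
  then show "h x *\<^sub>R fundamental_form c' x (dtrans c c' x v) = h x *\<^sub>R fundamental_form c x v"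
    using fundamental_form_change[of c x c' v] by simp
next
  fix c x v assume "\<not> (c \<in> A \<and> x \<in> fst c)"
  then have "fundamental_form c x v = 0" unfolding fundamental_form_def by (rule if_not_P)
  then show "h x *\<^sub>R fundamental_form c x v = 0" by simp
next
  fix c p assume c: "c \<in> A" and p: "p \<in> chart_image c"
  obtain Q i where Q: "open Q" "p \<in> Q" "Q \<subseteq> chart_image c" and r: "rank_one_patch Q (yc c) (nc c) (\<lambda>q. nc c q $ i)"
    using coordinate_patch[OF c p] by blast
  interpret rank_one_patch Q "yc c" "nc c" "\<lambda>q. nc c q $ i" by (rule r)
  note x = chart_inv_domain[OF p] chart_inv_right[OF p]
  have N0: "differential c N (chart_inv c p) (\<zeta> p) = 0" unfolding differential_coord x(2) by (rule dn_\<zeta>[OF Q(2)])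
  have "differential c h (chart_inv c p) (\<zeta> p) = 0" by (rule leafwise_kernel[OF h _ c x(1) N0]) (rule leaf)
  then have "dd (\<lambda>q. h (chart_inv c q)) (\<zeta> p) p = 0" unfolding differential_coord x(2) .
  then show "pd 1 (\<lambda>q. h (chart_inv c q) *\<^sub>R fundamental_form c (chart_inv c q) e2) p
      - pd 2 (\<lambda>q. h (chart_inv c q) *\<^sub>R fundamental_form c (chart_inv c q) e1) p = 0"
    unfolding curl_fundamental_form[OF c Q(1,3) r Q(2) h] by simp
next
  obtain c where c: "c \<in> A" "x0 \<in> fst c" using chart_exists[of x0] by blast
  show "\<exists>c x v. h x *\<^sub>R fundamental_form c x v \<noteq> 0" using fundamental_form_nonzero[OF c] nz by (metis scaleR_eq_0_iff)
qed

text \<open>At each point a deformation is a multiple of the fundamental form. The factor is smooth, since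
  it is a quotient with the square of a nonvanishing component of the fundamental form as its
  denominator. Closedness forces its differential to vanish on the kernel of \<open>dN\<close>, so that it is
  constant on the leaves.\<close>

lemma deformation_is_multiple:
  assumes d: "infinitesimal_deformation A f \<delta>"
  obtains h where "smooth_map A UNIV h" "\<And>y y'. (y, y') \<in> leaf_rel A N \<Longrightarrow> h y' = h y"
    "\<delta> = (\<lambda>c x v. h x *\<^sub>R fundamental_form c x v)"
proof -
  have lin: "linear (\<delta> c x)" if "c \<in> A" "x \<in> fst c" for c x
    using d that by (auto simp: infinitesimal_deformation_def smooth_one_form_def)
  have sm: "smooth_on (chart_image c) (\<lambda>p. \<delta> c (chart_inv c p) v)" if "c \<in> A" for c v
    using d that by (auto simp: infinitesimal_deformation_def smooth_one_form_def)
  have change: "\<delta> c' x (dtrans c c' x v) = \<delta> c x v" if "c \<in> A" "c' \<in> A" "x \<in> fst c" "x \<in> fst c'" for c c' x v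
    using d that by (auto simp: infinitesimal_deformation_def smooth_one_form_def)
  have outside: "\<delta> c x v = 0" if "\<not> (c \<in> A \<and> x \<in> fst c)" for c x v
    using d that unfolding infinitesimal_deformation_def smooth_one_form_def by blast
  have closed: "pd 1 (\<lambda>q. \<delta> c (chart_inv c q) e2) p - pd 2 (\<lambda>q. \<delta> c (chart_inv c q) e1) p = 0"
    if "c \<in> A" "p \<in> chart_image c" for c p
    using d that unfolding infinitesimal_deformation_def closed_one_form_def by blast
  have val: "\<exists>w. scal (Y x) w = 0 \<and> \<delta> c x v = wedge_endo (Y x) w" if "c \<in> A" "x \<in> fst c" for c x v
  proof -
    have "\<delta> c x v \<in> polar o23 (lie_algebra (stabilizer (f x)))"
      using d that unfolding infinitesimal_deformation_def by blast
    then show ?thesis unfolding Y_null(3)[of x] polar_stabilizer[OF Y_null(1,2)] by blast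
  qed
  have "\<exists>k. \<forall>c\<in>A. x \<in> fst c \<longrightarrow> (\<forall>v. \<delta> c x v = k *\<^sub>R fundamental_form c x v)" for x
  proof -
    obtain c where c: "c \<in> A" "x \<in> fst c" using chart_exists[of x] by blast
    let ?p = "snd c x"
    obtain Q i where Q: "open Q" "?p \<in> Q" "Q \<subseteq> chart_image c" and r: "rank_one_patch Q (yc c) (nc c) (\<lambda>q. nc c q $ i)"
      and e: "\<And>v. fundamental_form c x v = dd (\<lambda>q. nc c q $ i) v ?p *\<^sub>R \<Psi>c c i ?p"
      using patch_at[OF c] by blast
    interpret rank_one_patch Q "yc c" "nc c" "\<lambda>q. nc c q $ i" by (rule r)
    have "\<exists>k. \<forall>v. \<delta> c (chart_inv c ?p) v = k *\<^sub>R dd (\<lambda>q. nc c q $ i) v ?p *\<^sub>R \<Psi> ?p"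
    proof (rule closed_form_multiple[where d="\<lambda>v q. \<delta> c (chart_inv c q) v", OF Q(1) subset_refl])
      show "smooth_on Q (\<lambda>q. \<delta> c (chart_inv c q) v)" for v by (rule smooth_on_subset[OF sm[OF c(1)] Q(3)])
      fix q assume "q \<in> Q"
      then have q: "q \<in> chart_image c" using Q by blast
      show "linear (\<delta> c (chart_inv c q))" by (rule lin[OF c(1) chart_inv_domain[OF q]])
      show "\<exists>w. scal (yc c q) w = 0 \<and> \<delta> c (chart_inv c q) v = wedge_endo (yc c q) w" for v
        by (rule val[OF c(1) chart_inv_domain[OF q]])
      show "dd (\<lambda>q. \<delta> c (chart_inv c q) e2) e1 q = dd (\<lambda>q. \<delta> c (chart_inv c q) e1) e2 q"
        using closed[OF c(1) q] by (simp add: pd_def)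
    qed (rule Q(2))
    then obtain k where k: "\<And>v. \<delta> c x v = k *\<^sub>R fundamental_form c x v"
      unfolding chart_inv_left[OF c] e by blast
    have "\<delta> c' x v = k *\<^sub>R fundamental_form c' x v" if c': "c' \<in> A" "x \<in> fst c'" for c' v
      using change[OF c'(1) c(1) c'(2) c(2), of v] fundamental_form_change[OF c' c, of v] k by simp
    then show ?thesis by blast
  qed
  then obtain h where "\<forall>x. \<forall>c\<in>A. x \<in> fst c \<longrightarrow> (\<forall>v. \<delta> c x v = h x *\<^sub>R fundamental_form c x v)"
    using choice[of "\<lambda>x k. \<forall>c\<in>A. x \<in> fst c \<longrightarrow> (\<forall>v. \<delta> c x v = k *\<^sub>R fundamental_form c x v)"] by blast
  then have h: "\<delta> c x v = h x *\<^sub>R fundamental_form c x v" if "c \<in> A" "x \<in> fst c" for c x v using that by blast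
  have eq: "\<delta> = (\<lambda>c x v. h x *\<^sub>R fundamental_form c x v)"
  proof (intro ext)
    fix c x v show "\<delta> c x v = h x *\<^sub>R fundamental_form c x v"
    proof (cases "c \<in> A \<and> x \<in> fst c")
      case False
      then have "fundamental_form c x v = 0" unfolding fundamental_form_def by (rule if_not_P)
      then show ?thesis using outside[OF False] by simp
    qed (use h in blast)
  qed
  have sh: "smooth_map A UNIV h"
  proof (rule smooth_map_local)
    fix x
    obtain c where c: "c \<in> A" "x \<in> fst c" using chart_exists[of x] by blast
    obtain e where e: "fundamental_form c x e \<noteq> 0" using fundamental_form_nonzero[OF c] by blast
    define g where "g p = fundamental_form c (chart_inv c p) e \<bullet> fundamental_form c (chart_inv c p) e" for p
    have sg: "smooth_on (chart_image c) g" unfolding g_def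
      by (intro smooth_on_inner chart_image_open c(1) fundamental_form_smooth)
    define T where "T = {p \<in> chart_image c. g p \<noteq> 0}"
    have T: "open T" "T \<subseteq> chart_image c"
      unfolding T_def by (rule open_nonzero[OF chart_image_open[OF c(1)] smooth_on_continuous[OF sg]], blast)
    have xT: "snd c x \<in> T" using e chart_value[OF c(2)] by (simp add: T_def g_def chart_inv_left[OF c])
    have "smooth_on T (\<lambda>p. (\<delta> c (chart_inv c p) e \<bullet> fundamental_form c (chart_inv c p) e) / g p)"
      by (intro smooth_on_divide smooth_on_inner T(1) smooth_on_subset[OF sm[OF c(1)] T(2)] smooth_on_subset[OF sg T(2)]
          smooth_on_subset[OF fundamental_form_smooth[OF c(1)] T(2)]) (simp add: T_def)
    then have sT: "smooth_on T (h \<circ> chart_inv c)"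
    proof (rule smooth_on_cong[OF T(1)])
      fix p assume "p \<in> T"
      then have "chart_inv c p \<in> fst c" "g p \<noteq> 0" using T(2) chart_inv_domain[of p c] by (auto simp: T_def)
      then show "(\<delta> c (chart_inv c p) e \<bullet> fundamental_form c (chart_inv c p) e) / g p = (h \<circ> chart_inv c) p"
        using h[OF c(1)] by (simp add: g_def)
    qed
    have im: "snd c ` (chart_inv c ` T) = T"
    proof -
      have "snd c (chart_inv c p) = p" if "p \<in> T" for p using that T(2) chart_inv_right[of p c] by blast
      then show ?thesis by (simp add: image_image)
    qed
    have op: "open (chart_inv c ` T)" by (rule chart_inv_image_open[OF c(1) T])
    have "smooth_map A (chart_inv c ` T) h"
      by (rule smooth_map_from_chart[OF c(1) _ op]) (use sT T(2) in \<open>auto simp: im intro: chart_inv_domain\<close>)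
    moreover have "x \<in> chart_inv c ` T" using xT chart_inv_left[OF c] by (metis imageI)
    ultimately show "\<exists>V. open V \<and> x \<in> V \<and> smooth_map A V h" using op by blast
  qed
  have ker: "differential c h x v = 0" if c: "c \<in> A" "x \<in> fst c" and v: "differential c N x v = 0" for c x v
  proof -
    let ?p = "snd c x"
    obtain Q i where Q: "open Q" "?p \<in> Q" "Q \<subseteq> chart_image c" and r: "rank_one_patch Q (yc c) (nc c) (\<lambda>q. nc c q $ i)"
      using coordinate_patch[OF c(1) chart_value[OF c(2)]] by blast
    interpret rank_one_patch Q "yc c" "nc c" "\<lambda>q. nc c q $ i" by (rule r)
    have "dd (\<lambda>q. nc c q $ i) v ?p = 0"
      using dd_nth[OF smooth_on_differentiable[OF smooth_n Q(2)], of i v] v unfolding differential_coord by simp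
    then obtain k where k: "v = k *\<^sub>R \<zeta> ?p" using kernel_multiple[OF Q(2)] by blast
    have "dd (\<lambda>q. h (chart_inv c q)) (\<zeta> ?p) ?p *\<^sub>R \<Psi> ?p = 0"
      using closed[OF c(1) chart_value[OF c(2)], unfolded eq, unfolded curl_fundamental_form[OF c(1) Q(1,3) r Q(2) sh]] by simp
    then have z: "differential c h x (\<zeta> ?p) = 0" unfolding differential_coord using \<Psi>_nz[OF Q(2)] by simp
    have "linear (differential c h x)"
      by (rule differential_linear[OF smooth_map_differentiable[OF sh c(1)]]) (use c in simp)
    from linear_cmul[OF this, of k "\<zeta> ?p"] show ?thesis unfolding k z by simp
  qed
  show ?thesis by (rule that[OF sh _ eq]) (rule constant_on_leaf[OF _ sh ker, symmetric])
qed

lemma isothermic: "isothermic A f"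
proof -
  have "smooth_map A UNIV (\<lambda>x. 1 :: real)" by (simp add: smooth_map_def comp_def smooth_on_const)
  then have "infinitesimal_deformation A f (\<lambda>c x v. 1 *\<^sub>R fundamental_form c x v)"
    by (rule deformation_multiple[where h="\<lambda>x. 1"]) simp_all
  then show ?thesis unfolding isothermic_def by blast
qed

text \<open>The leaf function belonging to a deformation takes the value of the factor at an arbitrary
  point of the leaf. It is determined by the deformation because the fundamental form vanishes
  nowhere.\<close>

lemma deformations_bij:
  "bij_betw (\<lambda>r c x v. r (\<pi> x) *\<^sub>R fundamental_form c x v) (nonzero_leaf_functions A N)
    {\<delta>. infinitesimal_deformation A f \<delta>}"
  unfolding bij_betw_def
proof (intro conjI subset_antisym subsetI)
  show "inj_on (\<lambda>r c x v. r (\<pi> x) *\<^sub>R fundamental_form c x v) (nonzero_leaf_functions A N)"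
  proof (rule inj_onI)
    fix r r' assume r: "r \<in> nonzero_leaf_functions A N" "r' \<in> nonzero_leaf_functions A N"
      and eq: "(\<lambda>c x v. r (\<pi> x) *\<^sub>R fundamental_form c x v) = (\<lambda>c x v. r' (\<pi> x) *\<^sub>R fundamental_form c x v)"
    have pt: "r (\<pi> x) = r' (\<pi> x)" for x
    proof -
      obtain c where c: "c \<in> A" "x \<in> fst c" using chart_exists[of x] by blast
      obtain v where "fundamental_form c x v \<noteq> 0" using fundamental_form_nonzero[OF c] by blast
      moreover have "r (\<pi> x) *\<^sub>R fundamental_form c x v = r' (\<pi> x) *\<^sub>R fundamental_form c x v"
        using fun_cong[OF fun_cong[OF fun_cong[OF eq, of c], of x], of v] by simp
      ultimately show ?thesis by simp
    qed
    show "r = r'"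
    proof (rule extensionalityI[of _ "leaf_space A N"])
      show "r \<in> extensional (leaf_space A N)" "r' \<in> extensional (leaf_space A N)"
        using r by (simp_all add: nonzero_leaf_functions_def)
    qed (use pt in \<open>auto simp: leaf_space_def\<close>)
  qed
next
  fix \<delta> assume "\<delta> \<in> (\<lambda>r c x v. r (\<pi> x) *\<^sub>R fundamental_form c x v) ` nonzero_leaf_functions A N"
  then obtain r where r: "r \<in> nonzero_leaf_functions A N" and \<delta>: "\<delta> = (\<lambda>c x v. r (\<pi> x) *\<^sub>R fundamental_form c x v)" by blast
  obtain x0 where x0: "r (\<pi> x0) \<noteq> 0" using r by (auto simp: nonzero_leaf_functions_def leaf_space_def)
  have "infinitesimal_deformation A f \<delta>"
    unfolding \<delta>
  proof (rule deformation_multiple[where h="\<lambda>x. r (\<pi> x)", OF _ _ x0])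
    show "smooth_map A UNIV (\<lambda>x. r (\<pi> x))"
      by (rule leaf_function_pullback) (use r in \<open>simp add: nonzero_leaf_functions_def\<close>)
    show "r (\<pi> y') = r (\<pi> y)" if "(y, y') \<in> leaf_rel A N" for y y' using that leaf_of_eq[of y y'] by simp
  qed
  then show "\<delta> \<in> {\<delta>. infinitesimal_deformation A f \<delta>}" by simp
next
  fix \<delta> assume "\<delta> \<in> {\<delta>. infinitesimal_deformation A f \<delta>}"
  then have d: "infinitesimal_deformation A f \<delta>" by simp
  obtain h where h: "smooth_map A UNIV h" "\<And>y y'. (y, y') \<in> leaf_rel A N \<Longrightarrow> h y' = h y"
    "\<delta> = (\<lambda>c x v. h x *\<^sub>R fundamental_form c x v)" using deformation_is_multiple[OF d] by blast
  define r where "r = restrict (\<lambda>L. h (SOME x. x \<in> L)) (leaf_space A N)"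
  have r: "r (\<pi> x) = h x" for x
  proof -
    have "x \<in> \<pi> x" using leaf_rel_refl by (simp add: leaf_of_def)
    then have "(SOME y. y \<in> \<pi> x) \<in> \<pi> x" by (rule someI)
    then have "h (SOME y. y \<in> \<pi> x) = h x" using h(2) by (simp add: leaf_of_def)
    then show ?thesis by (simp add: r_def leaf_space_def)
  qed
  obtain x0 where x0: "h x0 \<noteq> 0"
  proof -
    obtain c x v where "\<delta> c x v \<noteq> 0" using d unfolding infinitesimal_deformation_def by blast
    then show ?thesis using that[of x] unfolding h(3) by simp
  qed
  have "r \<in> nonzero_leaf_functions A N"
    unfolding nonzero_leaf_functions_def
  proof (intro CollectI conjI)
    show "r \<in> extensional (leaf_space A N)" by (simp add: r_def)
    show "smooth_map (leaf_charts A N) (leaf_space A N) r"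
      by (rule leaf_function_smooth_map) (simp add: r h(1))
    show "\<exists>L\<in>leaf_space A N. r L \<noteq> 0" by (rule bexI[of _ "\<pi> x0"]) (simp_all add: r leaf_space_def x0)
  qed
  then show "\<delta> \<in> (\<lambda>r c x v. r (\<pi> x) *\<^sub>R fundamental_form c x v) ` nonzero_leaf_functions A N"
    by (rule image_eqI[rotated]) (simp add: h(3) r)
qed

end

theorem theoremA:
  fixes A :: "('x::topological_space, real^2) chart set"
    and f :: "'x \<Rightarrow> (real^5) set"
  assumes "connected_oriented_surface A"
    and "timelike_immersion A f"
    and "quasi_umbilical A f"
  shows "harmonic_wrt A f (conformal_gauss_map A f) \<and>
    (regular A f \<longrightarrow> isothermic A f \<and> deformations_depend_on_one_function A f)"
proof -
  interpret quasi_umbilical_surface A f by unfold_locales (fact assms)+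
  have "deformations_depend_on_one_function A f" if "regular A f"
    unfolding deformations_depend_on_one_function_def Let_def
    using leaf_manifold[OF that] leaf_space_connected deformations_bij by blast
  then show ?thesis using N_harmonic isothermic by blast
qed

end
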